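(* Let $k$ be a field. For all integers $m,n\ge2$ the graded algebra $A_{m,n}$ is intrinsically formal.
   Context: Conventions. Let $R=k^m$ be the semisimple $k$-algebra with generators $e_1,\dots,e_m$ and relations $e_i^2=e_i$, $e_ie_j=0$ for $i\ne j$ (so $1=e_1+\dots+e_m$). A graded algebra means a $\mathbb Z$-graded unital associative $k$-algebra $A$ together with a unital algebra homomorphism $\iota_A:R\to A^0$; homomorphisms of graded algebras commute with the maps $\iota$. A differential graded algebra (dga) $\mathcal A=(A,d_A)$ is a graded algebra with a derivation $d_A$ of degree one satisfying $d_A^2=0$ and $d_A\circ\iota_A=0$. Its cohomology $H(\mathcal A)$ is a graded algebra. A dga homomorphism is a quasi-isomorphism if it induces an isomorphism on cohomology; two dgas are quasi-isomorphic if they are connected by a finite zig-zag of dga quasi-isomorphisms. A dga is formal if it is quasi-isomorphic to its cohomology algebra with zero differential. A graded algebra $A$ is intrinsically formal if any two dgas with cohomology (isomorphic to) $A$ are quasi-isomorphic; equivalently, if any dga $\mathcal B$ with $H(\mathcal B)\cong A$ is formal. The algebra $A_{m,n}$. Put $d_i=\frac12 n$ if $n$ is even and $d_i=\frac12(n+(-1)^i)$ if $n$ is odd. Let $\Gamma_{m,n}$ be the quiver with vertices $1,\dots,m$ and, for each $i=1,\dots,m-1$, one edge from $i$ to $i+1$ of degree $d_i$ and one edge from $i+1$ to $i$ of degree $n-d_i$. Its path algebra $k[\Gamma_{m,n}]$ has as basis the paths, written $(i_0|\dots|i_l)$ with $i_\nu\in\{1,\dots,m\}$, $|i_{\nu+1}-i_\nu|=1$,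 $l\ge0$; the product is $(i_0|\dots|i_l)(i'_0|\dots|i'_{l'})=(i_0|\dots|i_l|i'_1|\dots|i'_{l'})$ if $i_l=i'_0$ and zero otherwise; the degree of a path is the sum of the degrees of its edges; $\iota$ sends $e_i$ to the length-zero path $(i)$. Let $J_{m,n}$ be the two-sided ideal generated, if $m\ge3$, by $(i|i-1|i)-(i|i+1|i)$, $(i-1|i|i+1)$ and $(i+1|i|i-1)$ for $i=2,\dots,m-1$, and, if $m=2$, by $(1|2|1|2)$ and $(2|1|2|1)$. Then $A_{m,n}=k[\Gamma_{m,n}]/J_{m,n}$. *)

theory Defs
  imports "HOL-Algebra.Module" "HOL-Algebra.QuotRing"
begin

section \<open>The semisimple algebra \<open>R = k\<^sup>m\<close>\<close>

definition power_algebra :: "('k, 'e) ring_scheme \<Rightarrow> nat \<Rightarrow> ('k, nat \<Rightarrow> 'k) module" where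
  "power_algebra K m =
    \<lparr> carrier = {1..m} \<rightarrow>\<^sub>E carrier K,
      monoid.mult = (\<lambda>r s. \<lambda>i\<in>{1..m}. r i \<otimes>\<^bsub>K\<^esub> s i),
      monoid.one = (\<lambda>i\<in>{1..m}. \<one>\<^bsub>K\<^esub>),
      ring.zero = (\<lambda>i\<in>{1..m}. \<zero>\<^bsub>K\<^esub>),
      ring.add = (\<lambda>r s. \<lambda>i\<in>{1..m}. r i \<oplus>\<^bsub>K\<^esub> s i),
      smult = (\<lambda>c r. \<lambda>i\<in>{1..m}. c \<otimes>\<^bsub>K\<^esub> r i) \<rparr>"

section \<open>Graded algebras over \<open>R\<close>\<close>

definition alg_hom ::
  "('k, 'e) ring_scheme \<Rightarrow> ('k, 'a, 'y) module_scheme \<Rightarrow> ('k, 'b, 'z) module_scheme \<Rightarrow> ('a \<Rightarrow> 'b) set"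
where
  "alg_hom K A B = {f \<in> ring_hom A B.
     \<forall>c \<in> carrier K. \<forall>x \<in> carrier A. f (c \<odot>\<^bsub>A\<^esub> x) = c \<odot>\<^bsub>B\<^esub> f x}"

record ('k, 'a) galg = "('k, 'a) module" +
  grade :: "int \<Rightarrow> 'a set"
  iota :: "(nat \<Rightarrow> 'k) \<Rightarrow> 'a"

text \<open>
  The library locale \<^locale>\<open>algebra\<close> is restricted to commutative algebras; here a ring that is
  also a vector space over \<open>K\<close> with bilinear multiplication is required.  The assumption
  \<open>grade_decomp\<close> says that the carrier is the internal direct sum of the subspaces \<open>grade A p\<close>.
\<close>

locale graded_algebra = K?: field K + A?: ring A + module K A
  for K :: "('k, 'e) ring_scheme" and m :: nat and A :: "('k, 'a, 'z) galg_scheme" +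
  assumes smult_mult_left:
      "\<lbrakk>c \<in> carrier K; x \<in> carrier A; y \<in> carrier A\<rbrakk> \<Longrightarrow>
        (c \<odot>\<^bsub>A\<^esub> x) \<otimes>\<^bsub>A\<^esub> y = c \<odot>\<^bsub>A\<^esub> (x \<otimes>\<^bsub>A\<^esub> y)"
    and smult_mult_right:
      "\<lbrakk>c \<in> carrier K; x \<in> carrier A; y \<in> carrier A\<rbrakk> \<Longrightarrow>
        x \<otimes>\<^bsub>A\<^esub> (c \<odot>\<^bsub>A\<^esub> y) = c \<odot>\<^bsub>A\<^esub> (x \<otimes>\<^bsub>A\<^esub> y)"
    and grade_submodule: "submodule (grade A p) K A"
    and grade_decomp:
      "x \<in> carrier A \<Longrightarrow>
        \<exists>!c :: int \<Rightarrow> 'a. (\<forall>p. c p \<in> grade A p) \<and> finite {p. c p \<noteq> \<zero>\<^bsub>A\<^esub>} \<and>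
          x = (\<Oplus>\<^bsub>A\<^esub> p \<in> {p. c p \<noteq> \<zero>\<^bsub>A\<^esub>}. c p)"
    and grade_mult:
      "\<lbrakk>x \<in> grade A p; y \<in> grade A q\<rbrakk> \<Longrightarrow> x \<otimes>\<^bsub>A\<^esub> y \<in> grade A (p + q)"
    and iota_hom: "iota A \<in> alg_hom K (power_algebra K m) A"
    and iota_grade: "r \<in> carrier (power_algebra K m) \<Longrightarrow> iota A r \<in> grade A 0"

definition galg_hom ::
  "('k, 'e) ring_scheme \<Rightarrow> nat \<Rightarrow> ('k, 'a, 'y) galg_scheme \<Rightarrow> ('k, 'b, 'z) galg_scheme
    \<Rightarrow> ('a \<Rightarrow> 'b) set"
where
  "galg_hom K m A B = {f \<in> alg_hom K A B.
     (\<forall>p. f ` grade A p \<subseteq> grade B p) \<and>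
     (\<forall>r \<in> carrier (power_algebra K m). f (iota A r) = iota B r)}"

definition galg_iso ::
  "('k, 'e) ring_scheme \<Rightarrow> nat \<Rightarrow> ('k, 'a, 'y) galg_scheme \<Rightarrow> ('k, 'b, 'z) galg_scheme
    \<Rightarrow> ('a \<Rightarrow> 'b) set"
where
  "galg_iso K m A B = {f \<in> galg_hom K m A B. bij_betw f (carrier A) (carrier B)}"

text \<open>
  The quotient by a homogeneous two-sided ideal \<open>I\<close>.  The ring structure is that of the library
  quotient \<open>A Quot I\<close>, whose elements are the cosets \<open>I + x\<close>; adding \<open>I\<close> in \<open>smult\<close> makes the
  result a full coset also for the scalar 0.
\<close>

definition galg_quot :: "('k, 'a, 'z) galg_scheme \<Rightarrow> 'a set \<Rightarrow> ('k, 'a set) galg" where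
  "galg_quot A I =
    \<lparr> carrier = carrier (A Quot I),
      monoid.mult = monoid.mult (A Quot I),
      monoid.one = monoid.one (A Quot I),
      ring.zero = ring.zero (A Quot I),
      ring.add = ring.add (A Quot I),
      smult = (\<lambda>c X. I <+>\<^bsub>A\<^esub> ((\<lambda>x. c \<odot>\<^bsub>A\<^esub> x) ` X)),
      grade = (\<lambda>p. (\<lambda>x. I +>\<^bsub>A\<^esub> x) ` grade A p),
      iota = (\<lambda>r. I +>\<^bsub>A\<^esub> iota A r) \<rparr>"

section \<open>Differential graded algebras\<close>

record ('k, 'a) dga = "('k, 'a) galg" +
  diff :: "'a \<Rightarrow> 'a"

locale diff_graded_algebra = graded_algebra K m A
  for K :: "('k, 'e) ring_scheme" and m :: nat and A :: "('k, 'a, 'z) dga_scheme" +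
  assumes diff_closed: "x \<in> carrier A \<Longrightarrow> diff A x \<in> carrier A"
    and diff_add:
      "\<lbrakk>x \<in> carrier A; y \<in> carrier A\<rbrakk> \<Longrightarrow> diff A (x \<oplus>\<^bsub>A\<^esub> y) = diff A x \<oplus>\<^bsub>A\<^esub> diff A y"
    and diff_smult:
      "\<lbrakk>c \<in> carrier K; x \<in> carrier A\<rbrakk> \<Longrightarrow> diff A (c \<odot>\<^bsub>A\<^esub> x) = c \<odot>\<^bsub>A\<^esub> diff A x"
    and diff_grade: "x \<in> grade A p \<Longrightarrow> diff A x \<in> grade A (p + 1)"
    and diff_mult:
      "\<lbrakk>x \<in> grade A p; y \<in> carrier A\<rbrakk> \<Longrightarrow>
        diff A (x \<otimes>\<^bsub>A\<^esub> y) =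
          (if even p then (diff A x \<otimes>\<^bsub>A\<^esub> y) \<oplus>\<^bsub>A\<^esub> (x \<otimes>\<^bsub>A\<^esub> diff A y)
           else (diff A x \<otimes>\<^bsub>A\<^esub> y) \<ominus>\<^bsub>A\<^esub> (x \<otimes>\<^bsub>A\<^esub> diff A y))"
    and diff_diff: "x \<in> carrier A \<Longrightarrow> diff A (diff A x) = \<zero>\<^bsub>A\<^esub>"
    and diff_iota: "r \<in> carrier (power_algebra K m) \<Longrightarrow> diff A (iota A r) = \<zero>\<^bsub>A\<^esub>"

definition cocycles :: "('k, 'a, 'z) dga_scheme \<Rightarrow> 'a set" where
  "cocycles A = {x \<in> carrier A. diff A x = \<zero>\<^bsub>A\<^esub>}"

definition coboundaries :: "('k, 'a, 'z) dga_scheme \<Rightarrow> 'a set" where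
  "coboundaries A = diff A ` carrier A"

definition cohomology :: "('k, 'a, 'z) dga_scheme \<Rightarrow> ('k, 'a set) galg" where
  "cohomology A =
    galg_quot (A\<lparr>carrier := cocycles A, grade := (\<lambda>p. grade A p \<inter> cocycles A)\<rparr>) (coboundaries A)"

definition dga_hom ::
  "('k, 'e) ring_scheme \<Rightarrow> nat \<Rightarrow> ('k, 'a, 'y) dga_scheme \<Rightarrow> ('k, 'b, 'z) dga_scheme
    \<Rightarrow> ('a \<Rightarrow> 'b) set"
where
  "dga_hom K m A B = {f \<in> galg_hom K m A B. \<forall>x \<in> carrier A. f (diff A x) = diff B (f x)}"

text \<open>The map \<open>[x] \<mapsto> [f x]\<close> on cohomology classes, written on cosets without choosing
  representatives.\<close>

definition cohomology_map :: "('k, 'b, 'z) dga_scheme \<Rightarrow> ('a \<Rightarrow> 'b) \<Rightarrow> 'a set \<Rightarrow> 'b set" where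
  "cohomology_map B f X = coboundaries B <+>\<^bsub>B\<^esub> (f ` X)"

definition quasi_isos ::
  "('k, 'e) ring_scheme \<Rightarrow> nat \<Rightarrow> ('k, 'a, 'y) dga_scheme \<Rightarrow> ('k, 'b, 'z) dga_scheme
    \<Rightarrow> ('a \<Rightarrow> 'b) set"
where
  "quasi_isos K m A B =
    {f \<in> dga_hom K m A B. cohomology_map B f \<in> galg_iso K m (cohomology A) (cohomology B)}"

section \<open>Zig-zags and intrinsic formality\<close>

definition qis_step ::
  "('k, 'e) ring_scheme \<Rightarrow> nat \<Rightarrow> ('k, 'a, 'y) dga_scheme \<Rightarrow> ('k, 'b, 'z) dga_scheme \<Rightarrow> bool"
where
  "qis_step K m A B \<longleftrightarrow>
    diff_graded_algebra K m A \<and> diff_graded_algebra K m B \<and>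
    (quasi_isos K m A B \<noteq> {} \<or> quasi_isos K m B A \<noteq> {})"

text \<open>
  HOL cannot quantify existentially over the carrier types of the intermediate dgas of a zig-zag,
  so these are taken with carriers in the type of functions from words in the letters
  \<open>'a + 'b + nat\<close> to \<open>'k\<close>.  This is no restriction: every dga \<open>A\<close> with carrier in \<open>'a\<close> has an
  isomorphic copy there, and it also has a semifree resolution \<open>Q \<rightarrow> A\<close> whose generators can be
  indexed by a set of cardinality at most that of \<open>'a + nat\<close>, so that (a copy of)
  \<open>Q\<close>, made of finite linear combinations of words in the generators, fits into this type.
  Two dgas on \<open>'a\<close> and \<open>'b\<close> that are connected by a zig-zag of any size are connected by
  \<open>A \<leftarrow> Q \<rightarrow> B\<close>.  The end points are related to such copies, hence the zig-zag always has at
  least one intermediate dga, which may be a copy of an end point.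
\<close>

definition quasi_isomorphic ::
  "('k, 'e) ring_scheme \<Rightarrow> nat \<Rightarrow> ('k, 'a) dga \<Rightarrow> ('k, 'b) dga \<Rightarrow> bool"
where
  "quasi_isomorphic K m A B \<longleftrightarrow>
    (\<exists>D E :: ('k, ('a + 'b + nat) list \<Rightarrow> 'k) dga.
       qis_step K m A D \<and> (qis_step K m)\<^sup>*\<^sup>* D E \<and> qis_step K m E B)"

text \<open>
  The type arguments are the carrier types of the two dgas compared.  A statement in which they are
  type variables not occurring elsewhere ranges over all pairs of dgas.
\<close>

definition intrinsically_formal ::
  "'b itself \<Rightarrow> 'c itself \<Rightarrow> ('k, 'e) ring_scheme \<Rightarrow> nat \<Rightarrow> ('k, 'a, 'z) galg_scheme \<Rightarrow> bool"
where
  "intrinsically_formal _ _ K m A \<longleftrightarrow>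
    (\<forall>(B :: ('k, 'b) dga) (C :: ('k, 'c) dga).
       diff_graded_algebra K m B \<longrightarrow> diff_graded_algebra K m C \<longrightarrow>
       galg_iso K m (cohomology B) A \<noteq> {} \<longrightarrow> galg_iso K m (cohomology C) A \<noteq> {} \<longrightarrow>
       quasi_isomorphic K m B C)"

section \<open>The quiver \<open>\<Gamma>\<close> and its path algebra\<close>

text \<open>Both divisions below are exact.\<close>

definition quiver_d :: "nat \<Rightarrow> nat \<Rightarrow> int" where
  "quiver_d n i = (if even n then int n div 2 else (int n + (-1) ^ i) div 2)"

definition edge_degree :: "nat \<Rightarrow> nat \<Rightarrow> nat \<Rightarrow> int" where
  "edge_degree n i j = (if j = i + 1 then quiver_d n i else int n - quiver_d n j)"

text \<open>The path \<open>(i\<^sub>0|\<dots>|i\<^sub>l)\<close> is the list of its \<open>l + 1\<close> vertices.\<close>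

definition paths :: "nat \<Rightarrow> nat list set" where
  "paths m = {p. p \<noteq> [] \<and> set p \<subseteq> {1..m} \<and>
     (\<forall>\<nu> < length p - 1. p ! Suc \<nu> = p ! \<nu> + 1 \<or> p ! \<nu> = p ! Suc \<nu> + 1)}"

definition path_degree :: "nat \<Rightarrow> nat list \<Rightarrow> int" where
  "path_degree n p = (\<Sum>\<nu> < length p - 1. edge_degree n (p ! \<nu>) (p ! Suc \<nu>))"

text \<open>
  Elements are the finitely supported coefficient functions on paths, extended by zero to all lists.
  The product is the bilinear extension of \<open>p \<cdot> q = p @ tl q\<close> if \<open>last p = hd q\<close>, and 0 otherwise.
\<close>

definition path_algebra :: "('k, 'e) ring_scheme \<Rightarrow> nat \<Rightarrow> nat \<Rightarrow> ('k, nat list \<Rightarrow> 'k) galg" where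
  "path_algebra K m n =
    (let C = {f. (\<forall>p \<in> paths m. f p \<in> carrier K) \<and> (\<forall>p. p \<notin> paths m \<longrightarrow> f p = \<zero>\<^bsub>K\<^esub>) \<and>
                 finite {p. f p \<noteq> \<zero>\<^bsub>K\<^esub>}}
     in
    \<lparr> carrier = C,
      monoid.mult = (\<lambda>f g r.
        \<Oplus>\<^bsub>K\<^esub> u \<in> {(p, q) \<in> paths m \<times> paths m. last p = hd q \<and> p @ tl q = r}.
          f (fst u) \<otimes>\<^bsub>K\<^esub> g (snd u)),
      monoid.one = (\<lambda>p. if \<exists>i \<in> {1..m}. p = [i] then \<one>\<^bsub>K\<^esub> else \<zero>\<^bsub>K\<^esub>),
      ring.zero = (\<lambda>p. \<zero>\<^bsub>K\<^esub>),
      ring.add = (\<lambda>f g p. f p \<oplus>\<^bsub>K\<^esub> g p),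
      smult = (\<lambda>c f p. c \<otimes>\<^bsub>K\<^esub> f p),
      grade = (\<lambda>t. {f \<in> C. \<forall>p. f p \<noteq> \<zero>\<^bsub>K\<^esub> \<longrightarrow> path_degree n p = t}),
      iota = (\<lambda>r p. if \<exists>i \<in> {1..m}. p = [i] then r (hd p) else \<zero>\<^bsub>K\<^esub>) \<rparr>)"

definition path_elem :: "('k, 'e) ring_scheme \<Rightarrow> nat list \<Rightarrow> (nat list \<Rightarrow> 'k)" where
  "path_elem K p = (\<lambda>q. if q = p then \<one>\<^bsub>K\<^esub> else \<zero>\<^bsub>K\<^esub>)"

section \<open>The algebra \<open>A\<^sub>m\<^sub>,\<^sub>n\<close>\<close>

text \<open>Only \<open>m \<ge> 2\<close> is meaningful; the second case is \<open>m = 2\<close>.\<close>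

definition J_generators :: "('k, 'e) ring_scheme \<Rightarrow> nat \<Rightarrow> nat \<Rightarrow> (nat list \<Rightarrow> 'k) set" where
  "J_generators K m n =
    (if m \<ge> 3 then
       (\<Union>i \<in> {2..m - 1}.
          {path_elem K [i, i - 1, i] \<ominus>\<^bsub>path_algebra K m n\<^esub> path_elem K [i, i + 1, i],
           path_elem K [i - 1, i, i + 1],
           path_elem K [i + 1, i, i - 1]})
     else {path_elem K [1, 2, 1, 2], path_elem K [2, 1, 2, 1]})"

definition A_alg :: "('k, 'e) ring_scheme \<Rightarrow> nat \<Rightarrow> nat \<Rightarrow> ('k, (nat list \<Rightarrow> 'k) set) galg" where
  "A_alg K m n =
    galg_quot (path_algebra K m n) (Idl\<^bsub>path_algebra K m n\<^esub> (J_generators K m n))"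

end

theory Submission
  imports Defs "HOL-Library.Poly_Mapping"
begin

text \<open>
  Let \<open>A\<close> be the zigzag algebra, with basis the idempotents, the arrows and one loop at each vertex.
  The cobar construction \<open>Q\<close> of the bar construction of \<open>A\<close> has as basis the words
  \<open>(i\<^sub>0, \<dots>, i\<^sub>N)\<close> of vertices in which consecutive vertices are adjacent (an arrow) or equal
  (a loop), with each inner vertex marked as a bar or as a product sign.  Turning the first product
  sign into a bar is a homotopy which contracts \<open>Q\<close> to \<open>A\<close>.  A morphism \<open>Q \<rightarrow> B\<close> inducing a given
  isomorphism \<open>A \<cong> H(B)\<close> amounts to elements \<open>f(i\<^sub>0, \<dots>, i\<^sub>N)\<close> of \<open>B\<close> with prescribed
  differentials, found by induction on \<open>N\<close>.  For \<open>N \<ge> 3\<close> the obstructions vanish for degree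
  reasons unless \<open>n = 2\<close>; then they are functions on closed paths of arrows of length \<open>N\<close>.
  Changing \<open>f\<close> on words of length \<open>N - 1\<close> by cocycles changes the obstruction by
  indicator functions of \<open>p\<close> and of \<open>p'\<close> simultaneously, where \<open>p'\<close> is a rotation of \<open>p\<close> or
  arises by reflecting a turning point \<open>h, h + 1, h\<close> of \<open>p\<close> to \<open>h, h - 1, h\<close>; when \<open>h = 1\<close>
  there is no \<open>p'\<close>.  By induction on the sum of the vertices of \<open>p\<close>, every function is reached.
  Hence any two dgas \<open>B\<close>, \<open>C\<close> with this cohomology are connected by \<open>B \<leftarrow> Q \<rightarrow> C\<close>.
\<close>

section \<open>Algebras of words\<close>

text \<open>The values of \<open>f\<close> on blocks are, up to signs, the components of an
  A-infinity morphism from \<open>A\<close> to \<open>B\<close>; \<open>Q\<close> turns such a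
  morphism into an honest dga homomorphism. The obstruction on words of \<open>N\<close> letters is,
  on cohomology, a Hochschild cochain of \<open>A\<close> in bidegree \<open>(N, 2 - N)\<close>, and
  cocycles added on words of \<open>N - 1\<close> letters change it by a Hochschild coboundary
  without spoiling the equations already solved. For \<open>n > 2\<close> and
  \<open>N \<ge> 3\<close> this cochain group is zero: a word whose letters form a path of length
  \<open>p\<close> has degree about \<open>n * p / 2\<close>, which outgrows the drop by one for
  each bar. For \<open>n = 2\<close> arrows have degree one and the two effects balance exactly. In
  that case every cochain turns out to be a coboundary, so the obstruction itself never has to be
  computed. Words are stored as lists of vertices, so the length of a list exceeds the number of
  letters by one. \<open>Q\<close> depends on \<open>K\<close>, \<open>m\<close> and
  \<open>n\<close> alone, and its marked vertices can be coded by numbers, which places it in a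
  carrier type fixed in advance.\<close>

definition word_algebra ::
  "('k, 'e) ring_scheme \<Rightarrow> nat \<Rightarrow> (nat \<Rightarrow> 'x) \<Rightarrow> ('x \<Rightarrow> nat) \<Rightarrow> 'x list set \<Rightarrow> ('x list \<Rightarrow> int)
    \<Rightarrow> ('k, 'x list \<Rightarrow> 'k) galg" where
  "word_algebra K m v u W dg =
    (let C = {f. (\<forall>p \<in> W. f p \<in> carrier K) \<and> (\<forall>p. p \<notin> W \<longrightarrow> f p = \<zero>\<^bsub>K\<^esub>) \<and>
                 finite {p. f p \<noteq> \<zero>\<^bsub>K\<^esub>}}
     in
    \<lparr> carrier = C,
      monoid.mult = (\<lambda>f g r.
        \<Oplus>\<^bsub>K\<^esub> x \<in> {(p, q) \<in> W \<times> W. last p = hd q \<and> p @ tl q = r}. f (fst x) \<otimes>\<^bsub>K\<^esub> g (snd x)),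
      monoid.one = (\<lambda>p. if \<exists>i \<in> {1..m}. p = [v i] then \<one>\<^bsub>K\<^esub> else \<zero>\<^bsub>K\<^esub>),
      ring.zero = (\<lambda>p. \<zero>\<^bsub>K\<^esub>),
      ring.add = (\<lambda>f g p. f p \<oplus>\<^bsub>K\<^esub> g p),
      smult = (\<lambda>c f p. c \<otimes>\<^bsub>K\<^esub> f p),
      grade = (\<lambda>t. {f \<in> C. \<forall>p. f p \<noteq> \<zero>\<^bsub>K\<^esub> \<longrightarrow> dg p = t}),
      iota = (\<lambda>r p. if \<exists>i \<in> {1..m}. p = [v i] then r (u (hd p)) else \<zero>\<^bsub>K\<^esub>) \<rparr>)"

lemma path_algebra_word_algebra:
  "path_algebra K m n = word_algebra K m (\<lambda>i. i) (\<lambda>i. i) (paths m) (path_degree n)"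
  by (simp add: path_algebra_def word_algebra_def)

definition single :: "('k, 'e) ring_scheme \<Rightarrow> 'x \<Rightarrow> 'x \<Rightarrow> 'k" where
  "single K w = (\<lambda>q. if q = w then \<one>\<^bsub>K\<^esub> else \<zero>\<^bsub>K\<^esub>)"

definition klinear :: "('k, 'e) ring_scheme \<Rightarrow> ('k, 'a, 'y) module_scheme \<Rightarrow> ('k, 'b, 'z) module_scheme \<Rightarrow> ('a \<Rightarrow> 'b) \<Rightarrow> bool" where
  "klinear K A B T \<longleftrightarrow> T \<in> carrier A \<rightarrow> carrier B \<and>
    (\<forall>x\<in>carrier A. \<forall>y\<in>carrier A. T (x \<oplus>\<^bsub>A\<^esub> y) = T x \<oplus>\<^bsub>B\<^esub> T y) \<and>
    (\<forall>c\<in>carrier K. \<forall>x\<in>carrier A. T (c \<odot>\<^bsub>A\<^esub> x) = c \<odot>\<^bsub>B\<^esub> T x)"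

lemma klinearD:
  assumes "klinear K A B T"
  shows "x \<in> carrier A \<Longrightarrow> T x \<in> carrier B"
    and "x \<in> carrier A \<Longrightarrow> y \<in> carrier A \<Longrightarrow> T (x \<oplus>\<^bsub>A\<^esub> y) = T x \<oplus>\<^bsub>B\<^esub> T y"
    and "c \<in> carrier K \<Longrightarrow> x \<in> carrier A \<Longrightarrow> T (c \<odot>\<^bsub>A\<^esub> x) = c \<odot>\<^bsub>B\<^esub> T x"
  using assms by (auto simp: klinear_def)

lemma klinearI:
  assumes "\<And>x. x \<in> carrier A \<Longrightarrow> T x \<in> carrier B"
    and "\<And>x y. x \<in> carrier A \<Longrightarrow> y \<in> carrier A \<Longrightarrow> T (x \<oplus>\<^bsub>A\<^esub> y) = T x \<oplus>\<^bsub>B\<^esub> T y"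
    and "\<And>c x. c \<in> carrier K \<Longrightarrow> x \<in> carrier A \<Longrightarrow> T (c \<odot>\<^bsub>A\<^esub> x) = c \<odot>\<^bsub>B\<^esub> T x"
  shows "klinear K A B T"
  using assms by (auto simp: klinear_def)

lemma klinear_comp: "klinear K A B S \<Longrightarrow> klinear K B C T \<Longrightarrow> klinear K A C (\<lambda>x. T (S x))"
  by (auto simp: klinear_def Pi_def)

lemma path_elem_single: "path_elem K = single K"
  by (simp add: fun_eq_iff path_elem_def single_def)

definition lin :: "('k, 'e) ring_scheme \<Rightarrow> ('k, 'b, 'z) module_scheme \<Rightarrow> ('x \<Rightarrow> 'b) \<Rightarrow> ('x \<Rightarrow> 'k) \<Rightarrow> 'b" where
  "lin K M \<phi> f = (\<Oplus>\<^bsub>M\<^esub> w \<in> {w. f w \<noteq> \<zero>\<^bsub>K\<^esub>}. f w \<odot>\<^bsub>M\<^esub> \<phi> w)"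

text \<open>Exchanges the two cut points of a word; this is the index bookkeeping behind
  \<open>mult_assoc\<close>.\<close>

lemma (in abelian_monoid) finsum_triangle:
  assumes "\<And>i j. i \<le> j \<Longrightarrow> j < N \<Longrightarrow> F i j \<in> carrier G"
  shows "(\<Oplus>l\<in>{..<N::nat}. \<Oplus>k\<in>{..<Suc l}. F k l) = (\<Oplus>k\<in>{..<N}. \<Oplus>j\<in>{..<N - k}. F k (k + j))"
  using assms
proof (induction N)
  case (Suc N)
  have c: "F i j \<in> carrier G" if "i \<le> j" "j < Suc N" for i j using Suc.prems that by auto
  have "(\<Oplus>k\<in>{..<Suc N}. \<Oplus>j\<in>{..<Suc N - k}. F k (k + j)) =
     (\<Oplus>j\<in>{..<Suc N - N}. F N (N + j)) \<oplus> (\<Oplus>k\<in>{..<N}. \<Oplus>j\<in>{..<Suc N - k}. F k (k + j))"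
    unfolding lessThan_Suc using c by (subst finsum_insert) (auto intro!: finsum_closed)
  also have "(\<Oplus>k\<in>{..<N}. \<Oplus>j\<in>{..<Suc N - k}. F k (k + j)) =
      (\<Oplus>k\<in>{..<N}. F k N \<oplus> (\<Oplus>j\<in>{..<N - k}. F k (k + j)))"
  proof (rule finsum_cong')
    fix k assume k: "k \<in> {..<N}"
    then have "{..<Suc N - k} = insert (N - k) {..<N - k}" by (auto simp: Suc_diff_le)
    then show "(\<Oplus>j\<in>{..<Suc N - k}. F k (k + j)) = F k N \<oplus> (\<Oplus>j\<in>{..<N - k}. F k (k + j))"
      using k c by (simp add: finsum_insert Pi_def)
  qed (use c in \<open>auto intro!: finsum_closed\<close>)
  also have "\<dots> = (\<Oplus>k\<in>{..<N}. F k N) \<oplus> (\<Oplus>k\<in>{..<N}. \<Oplus>j\<in>{..<N - k}. F k (k + j))"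
    using c by (subst finsum_addf) (auto intro!: finsum_closed)
  also have "(\<Oplus>k\<in>{..<N}. \<Oplus>j\<in>{..<N - k}. F k (k + j)) = (\<Oplus>l\<in>{..<N}. \<Oplus>k\<in>{..<Suc l}. F k l)"
    using Suc c by simp
  finally have *: "(\<Oplus>k\<in>{..<Suc N}. \<Oplus>j\<in>{..<Suc N - k}. F k (k + j)) =
     F N N \<oplus> ((\<Oplus>k\<in>{..<N}. F k N) \<oplus> (\<Oplus>l\<in>{..<N}. \<Oplus>k\<in>{..<Suc l}. F k l))"
    using c by (simp add: lessThan_Suc finsum_insert[of "{}"])
  have cl: "(\<Oplus>l\<in>{..<N}. \<Oplus>k\<in>{..<Suc l}. F k l) \<in> carrier G"
    using c by (auto intro!: finsum_closed)
  have "(\<Oplus>l\<in>{..<Suc N}. \<Oplus>k\<in>{..<Suc l}. F k l) =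
     (\<Oplus>k\<in>{..<Suc N}. F k N) \<oplus> (\<Oplus>l\<in>{..<N}. \<Oplus>k\<in>{..<Suc l}. F k l)"
    using c by (subst lessThan_Suc, subst finsum_insert) (auto intro!: finsum_closed)
  also have "(\<Oplus>k\<in>{..<Suc N}. F k N) = F N N \<oplus> (\<Oplus>k\<in>{..<N}. F k N)"
    using c by (subst lessThan_Suc, subst finsum_insert) auto
  finally show ?case using * c cl by (simp add: a_assoc finsum_closed Pi_def)
qed simp

text \<open>Abstract enough to cover both the path algebra, whose letters are vertices, and the
  cobar construction, whose letters are marked vertices. \<open>v\<close> turns a vertex into the
  letter that forms its unit word, and \<open>u\<close> recovers the vertex.\<close>

locale word_category = field K for K :: "('k, 'e) ring_scheme" (structure) +
  fixes m :: nat and v :: "nat \<Rightarrow> 'x" and u :: "'x \<Rightarrow> nat" and W :: "'x list set" and dg :: "'x list \<Rightarrow> int"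
  assumes W_nonempty: "w \<in> W \<Longrightarrow> w \<noteq> []"
    and W_unit: "i \<in> {1..m} \<Longrightarrow> [v i] \<in> W"
    and u_v: "i \<in> {1..m} \<Longrightarrow> u (v i) = i"
    and W_ends: "w \<in> W \<Longrightarrow> hd w \<in> v ` {1..m} \<and> last w \<in> v ` {1..m}"
    and W_comp: "p \<in> W \<Longrightarrow> q \<in> W \<Longrightarrow> last p = hd q \<Longrightarrow> p @ tl q \<in> W"
    and dg_unit: "i \<in> {1..m} \<Longrightarrow> dg [v i] = 0"
    and dg_comp: "p \<in> W \<Longrightarrow> q \<in> W \<Longrightarrow> last p = hd q \<Longrightarrow> dg (p @ tl q) = dg p + dg q"
begin

abbreviation "A \<equiv> word_algebra K m v u W dg"

lemma word_algebra_simps: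
  "carrier A = {f. (\<forall>p \<in> W. f p \<in> carrier K) \<and> (\<forall>p. p \<notin> W \<longrightarrow> f p = \<zero>) \<and> finite {p. f p \<noteq> \<zero>}}"
  "f \<otimes>\<^bsub>A\<^esub> g = (\<lambda>r. \<Oplus> x \<in> {(p, q) \<in> W \<times> W. last p = hd q \<and> p @ tl q = r}. f (fst x) \<otimes> g (snd x))"
  "\<one>\<^bsub>A\<^esub> = (\<lambda>p. if \<exists>i \<in> {1..m}. p = [v i] then \<one> else \<zero>)"
  "\<zero>\<^bsub>A\<^esub> = (\<lambda>p. \<zero>)"
  "f \<oplus>\<^bsub>A\<^esub> g = (\<lambda>p. f p \<oplus> g p)"
  "c \<odot>\<^bsub>A\<^esub> f = (\<lambda>p. c \<otimes> f p)"
  "grade A t = {f \<in> carrier A. \<forall>p. f p \<noteq> \<zero> \<longrightarrow> dg p = t}"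
  "iota A r = (\<lambda>p. if \<exists>i \<in> {1..m}. p = [v i] then r (u (hd p)) else \<zero>)"
  by (simp_all add: word_algebra_def)

lemma carrier_val [simp, intro]: "f \<in> carrier A \<Longrightarrow> f w \<in> carrier K"
  by (cases "w \<in> W") (auto simp: word_algebra_simps)

lemma carrier_supp: "f \<in> carrier A \<Longrightarrow> finite {w. f w \<noteq> \<zero>}"
  and carrier_out: "f \<in> carrier A \<Longrightarrow> w \<notin> W \<Longrightarrow> f w = \<zero>"
  unfolding word_algebra_simps(1) by simp_all

lemma carrierI:
  "\<lbrakk>\<And>w. f w \<in> carrier K; \<And>w. f w \<noteq> \<zero> \<Longrightarrow> w \<in> W; finite {w. f w \<noteq> \<zero>}\<rbrakk> \<Longrightarrow> f \<in> carrier A"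
  unfolding word_algebra_simps(1) by blast

text \<open>A factorisation of \<open>r\<close> is determined by the position \<open>k\<close> of
  the vertex shared by the two factors. Cuts with a piece outside \<open>W\<close> contribute zero,
  so the sum may run over all positions, which makes it easy to reindex.\<close>

lemma mult_conv:
  assumes f: "f \<in> carrier A" and g: "g \<in> carrier A"
  shows "(f \<otimes>\<^bsub>A\<^esub> g) r = (\<Oplus>k\<in>{..<length r}. f (take (Suc k) r) \<otimes> g (drop k r))"
proof -
  let ?I = "{k \<in> {..<length r}. take (Suc k) r \<in> W \<and> drop k r \<in> W}"
  let ?h = "\<lambda>k. (take (Suc k) r, drop k r)"
  have img: "{(p, q) \<in> W \<times> W. last p = hd q \<and> p @ tl q = r} = ?h ` ?I"
  proof (rule Set.set_eqI, rule iffI)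
    fix x assume "x \<in> {(p, q) \<in> W \<times> W. last p = hd q \<and> p @ tl q = r}"
    then obtain p q where x: "x = (p, q)" "p \<in> W" "q \<in> W" "last p = hd q" "p @ tl q = r" by auto
    obtain y p' where p: "p = p' @ [y]" using W_nonempty[OF x(2)] by (metis append_butlast_last_id)
    obtain q' where q: "q = y # q'" using W_nonempty[OF x(3)] x(4) p by (cases q) auto
    have "x = ?h (length p')" using x p q by auto
    moreover have "length p' \<in> ?I" using x p q by auto
    ultimately show "x \<in> ?h ` ?I" by blast
  next
    fix x assume "x \<in> ?h ` ?I"
    then obtain k where k: "k < length r" "x = ?h k" "take (Suc k) r \<in> W" "drop k r \<in> W" by auto
    have "last (take (Suc k) r) = hd (drop k r)"
      using k(1) by (simp add: take_Suc_conv_app_nth hd_drop_conv_nth)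
    moreover have "take (Suc k) r @ tl (drop k r) = r"
      by (metis append_take_drop_id drop_Suc tl_drop)
    ultimately show "x \<in> {(p, q) \<in> W \<times> W. last p = hd q \<and> p @ tl q = r}" using k by auto
  qed
  have inj: "inj_on ?h ?I" by (auto simp: inj_on_def) (metis diff_diff_cancel length_drop less_imp_le)
  have "(f \<otimes>\<^bsub>A\<^esub> g) r = (\<Oplus>x\<in>?h ` ?I. f (fst x) \<otimes> g (snd x))"
    unfolding word_algebra_simps(2) by (simp only: img)
  also have "\<dots> = (\<Oplus>k\<in>?I. f (take (Suc k) r) \<otimes> g (drop k r))"
    using f g inj by (subst finsum_reindex) auto
  also have "\<dots> = (\<Oplus>k\<in>{..<length r}. f (take (Suc k) r) \<otimes> g (drop k r))"
  proof (rule add.finprod_mono_neutral_cong_left)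
    show "f (take (Suc i) r) \<otimes> g (drop i r) = \<zero>" if "i \<in> {..<length r} - ?I" for i
    proof -
      note that
      then have "take (Suc i) r \<notin> W \<or> drop i r \<notin> W" by blast
      then show "f (take (Suc i) r) \<otimes> g (drop i r) = \<zero>"
        using carrier_out[OF f] carrier_out[OF g] f g by (metis carrier_val l_null r_null)
    qed
  qed (use f g in auto)
  finally show ?thesis .
qed

lemma mult_closed:
  assumes f: "f \<in> carrier A" and g: "g \<in> carrier A"
  shows "f \<otimes>\<^bsub>A\<^esub> g \<in> carrier A"
proof -
  \<comment> \<open>A nonzero coefficient forces a composable pair in the two supports; this gives
    membership in \<open>W\<close> and the finiteness of the support at once.\<close>
  have nz: "\<exists>p q. f p \<noteq> \<zero> \<and> g q \<noteq> \<zero> \<and> p \<in> W \<and> q \<in> W \<and> last p = hd q \<and> p @ tl q = r"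
    if "(f \<otimes>\<^bsub>A\<^esub> g) r \<noteq> \<zero>" for r
  proof (rule ccontr)
    assume "\<not> ?thesis"
    then have 0: "f p = \<zero> \<or> g q = \<zero>" if "p \<in> W" "q \<in> W" "last p = hd q" "p @ tl q = r" for p q
      using that by blast
    have "f (fst x) \<otimes> g (snd x) = \<zero>"
      if "x \<in> {(p, q) \<in> W \<times> W. last p = hd q \<and> p @ tl q = r}" for x
      using that 0[of "fst x" "snd x"] f g by (cases x) auto
    then have "(f \<otimes>\<^bsub>A\<^esub> g) r = \<zero>"
      unfolding word_algebra_simps by (rule add.finprod_one_eqI)
    then show False using that by simp
  qed
  show ?thesis
  proof (rule carrierI)
    show "(f \<otimes>\<^bsub>A\<^esub> g) w \<in> carrier K" for w
      using f g by (simp add: mult_conv finsum_closed Pi_def)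
    show "w \<in> W" if "(f \<otimes>\<^bsub>A\<^esub> g) w \<noteq> \<zero>" for w using nz[OF that] W_comp by auto
    have "{w. (f \<otimes>\<^bsub>A\<^esub> g) w \<noteq> \<zero>} \<subseteq> (\<lambda>(p, q). p @ tl q) ` ({p. f p \<noteq> \<zero>} \<times> {q. g q \<noteq> \<zero>})"
      using nz by (auto simp: image_iff) metis
    then show "finite {w. (f \<otimes>\<^bsub>A\<^esub> g) w \<noteq> \<zero>}"
      using carrier_supp[OF f] carrier_supp[OF g] by (meson finite_SigmaI finite_imageI finite_subset)
  qed
qed

lemma add_closed: "f \<in> carrier A \<Longrightarrow> g \<in> carrier A \<Longrightarrow> f \<oplus>\<^bsub>A\<^esub> g \<in> carrier A"
proof (rule carrierI)
  assume f: "f \<in> carrier A" and g: "g \<in> carrier A"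
  show "(f \<oplus>\<^bsub>A\<^esub> g) w \<in> carrier K" for w using f g by (simp add: word_algebra_simps(5))
  show "w \<in> W" if "(f \<oplus>\<^bsub>A\<^esub> g) w \<noteq> \<zero>" for w
    using that f g by (cases "w \<in> W") (auto simp: word_algebra_simps(5) carrier_out)
  have "{w. (f \<oplus>\<^bsub>A\<^esub> g) w \<noteq> \<zero>} \<subseteq> {w. f w \<noteq> \<zero>} \<union> {w. g w \<noteq> \<zero>}" by (auto simp: word_algebra_simps(5))
  then show "finite {w. (f \<oplus>\<^bsub>A\<^esub> g) w \<noteq> \<zero>}"
    using carrier_supp[OF f] carrier_supp[OF g] by (meson finite_UnI finite_subset)
qed

lemma smult_closed: "c \<in> carrier K \<Longrightarrow> f \<in> carrier A \<Longrightarrow> c \<odot>\<^bsub>A\<^esub> f \<in> carrier A"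
proof (rule carrierI)
  assume c: "c \<in> carrier K" and f: "f \<in> carrier A"
  show "(c \<odot>\<^bsub>A\<^esub> f) w \<in> carrier K" for w using f c by (simp add: word_algebra_simps(6))
  show "w \<in> W" if "(c \<odot>\<^bsub>A\<^esub> f) w \<noteq> \<zero>" for w
    using that f c by (cases "w \<in> W") (auto simp: word_algebra_simps(6) carrier_out)
  have "{w. (c \<odot>\<^bsub>A\<^esub> f) w \<noteq> \<zero>} \<subseteq> {w. f w \<noteq> \<zero>}" using c by (auto simp: word_algebra_simps(6))
  then show "finite {w. (c \<odot>\<^bsub>A\<^esub> f) w \<noteq> \<zero>}"
    using carrier_supp[OF f] by (meson finite_subset)
qed

lemma zero_in: "\<zero>\<^bsub>A\<^esub> \<in> carrier A"
  by (rule carrierI) (auto simp: word_algebra_simps(4))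

lemma iota_in: "r \<in> carrier (power_algebra K m) \<Longrightarrow> iota A r \<in> carrier A"
proof (rule carrierI)
  assume r: "r \<in> carrier (power_algebra K m)"
  show "iota A r w \<in> carrier K" for w using r by (auto simp: word_algebra_simps(8) power_algebra_def u_v PiE_def Pi_def)
  show "w \<in> W" if "iota A r w \<noteq> \<zero>" for w using that W_unit by (auto simp: word_algebra_simps(8) split: if_splits)
  have "{w. iota A r w \<noteq> \<zero>} \<subseteq> (\<lambda>i. [v i]) ` {1..m}" by (auto simp: word_algebra_simps(8))
  then show "finite {w. iota A r w \<noteq> \<zero>}" by (meson finite_atLeastAtMost finite_imageI finite_subset)
qed

lemma iota_length: "length w \<noteq> 1 \<Longrightarrow> iota A r w = \<zero>"
  by (auto simp: word_algebra_simps(8))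

lemma one_iota: "\<one>\<^bsub>A\<^esub> = iota A \<one>\<^bsub>power_algebra K m\<^esub>"
  by (auto simp: fun_eq_iff word_algebra_simps(3,8) power_algebra_def u_v)

lemma power_algebra_one: "\<one>\<^bsub>power_algebra K m\<^esub> \<in> carrier (power_algebra K m)"
  by (auto simp: power_algebra_def)

lemma one_in: "\<one>\<^bsub>A\<^esub> \<in> carrier A"
  using one_iota iota_in power_algebra_one by simp

text \<open>Both sides are sums over two cut points \<open>k\<close> and \<open>l\<close> of
  \<open>r\<close> with \<open>k \<le> l\<close>, ordered differently.\<close>

lemma mult_assoc:
  assumes f: "f \<in> carrier A" and g: "g \<in> carrier A" and h: "h \<in> carrier A"
  shows "f \<otimes>\<^bsub>A\<^esub> g \<otimes>\<^bsub>A\<^esub> h = f \<otimes>\<^bsub>A\<^esub> (g \<otimes>\<^bsub>A\<^esub> h)"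
proof
  fix r :: "'x list"
  let ?N = "length r"
  let ?F = "\<lambda>k l. f (take (Suc k) r) \<otimes> (g (drop k (take (Suc l) r)) \<otimes> h (drop l r))"
  have "(f \<otimes>\<^bsub>A\<^esub> g \<otimes>\<^bsub>A\<^esub> h) r = (\<Oplus>l\<in>{..<?N}. (f \<otimes>\<^bsub>A\<^esub> g) (take (Suc l) r) \<otimes> h (drop l r))"
    using f g h by (simp add: mult_conv mult_closed)
  also have "\<dots> = (\<Oplus>l\<in>{..<?N}. \<Oplus>k\<in>{..<Suc l}. ?F k l)"
  proof (rule finsum_cong')
    fix l assume l: "l \<in> {..<?N}"
    have "(f \<otimes>\<^bsub>A\<^esub> g) (take (Suc l) r) =
       (\<Oplus>k\<in>{..<Suc l}. f (take (Suc k) r) \<otimes> g (drop k (take (Suc l) r)))"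
      using l f g by (auto simp: mult_conv min_def intro!: finsum_cong')
    then show "(f \<otimes>\<^bsub>A\<^esub> g) (take (Suc l) r) \<otimes> h (drop l r) = (\<Oplus>k\<in>{..<Suc l}. ?F k l)"
      using f g h by (simp add: finsum_ldistr Pi_def m_assoc del: lessThan_Suc)
  qed (use f g h in \<open>auto intro!: finsum_closed\<close>)
  also have "\<dots> = (\<Oplus>k\<in>{..<?N}. \<Oplus>j\<in>{..<?N - k}. ?F k (k + j))"
    using f g h by (intro finsum_triangle) auto
  also have "\<dots> = (\<Oplus>k\<in>{..<?N}. f (take (Suc k) r) \<otimes> (g \<otimes>\<^bsub>A\<^esub> h) (drop k r))"
  proof (rule finsum_cong')
    fix k assume k: "k \<in> {..<?N}"
    have "(g \<otimes>\<^bsub>A\<^esub> h) (drop k r) = (\<Oplus>j\<in>{..<?N - k}. g (drop k (take (Suc (k + j)) r)) \<otimes> h (drop (k + j) r))"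
      using k g h by (auto simp: mult_conv drop_take add.commute intro!: finsum_cong')
    then show "(\<Oplus>j\<in>{..<?N - k}. ?F k (k + j)) = f (take (Suc k) r) \<otimes> (g \<otimes>\<^bsub>A\<^esub> h) (drop k r)"
      using f g h by (simp add: finsum_rdistr Pi_def)
  qed (use f g h mult_closed in auto)
  also have "\<dots> = (f \<otimes>\<^bsub>A\<^esub> (g \<otimes>\<^bsub>A\<^esub> h)) r"
    using f g h by (simp add: mult_conv mult_closed)
  finally show "(f \<otimes>\<^bsub>A\<^esub> g \<otimes>\<^bsub>A\<^esub> h) r = (f \<otimes>\<^bsub>A\<^esub> (g \<otimes>\<^bsub>A\<^esub> h)) r" .
qed

text \<open>\<open>iota A r\<close> lives on words of length one, so of all cuts only the one at the
  first vertex survives; in \<open>mult_iota\<close> it is the one at the last vertex.\<close>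

lemma iota_mult:
  assumes r: "r \<in> carrier (power_algebra K m)" and f: "f \<in> carrier A"
  shows "iota A r \<otimes>\<^bsub>A\<^esub> f = (\<lambda>w. if w \<in> W then r (u (hd w)) \<otimes> f w else \<zero>)"
proof
  fix w
  note i = iota_in[OF r]
  show "(iota A r \<otimes>\<^bsub>A\<^esub> f) w = (if w \<in> W then r (u (hd w)) \<otimes> f w else \<zero>)"
  proof (cases "w \<in> W")
    case True
    then have w: "w \<noteq> []" using W_nonempty by simp
    have t: "take (Suc 0) w = [hd w]" using w by (cases w) auto
    have "(iota A r \<otimes>\<^bsub>A\<^esub> f) w = (\<Oplus>k\<in>{..<length w}. iota A r (take (Suc k) w) \<otimes> f (drop k w))"
      using i f by (simp add: mult_conv)
    also have "\<dots> = (\<Oplus>k\<in>{..<length w}. if 0 = k then iota A r [hd w] \<otimes> f w else \<zero>)"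
    proof (rule finsum_cong')
      fix k assume k: "k \<in> {..<length w}"
      show "iota A r (take (Suc k) w) \<otimes> f (drop k w) = (if 0 = k then iota A r [hd w] \<otimes> f w else \<zero>)"
      proof (cases k)
        case (Suc k')
        have "length (take (Suc k) w) \<ge> 2" using k Suc by simp
        then have "iota A r (take (Suc k) w) = \<zero>" by (intro iota_length) linarith
        then show ?thesis using f Suc by simp
      qed (simp add: t)
    qed (use i f in auto)
    also have "\<dots> = iota A r [hd w] \<otimes> f w"
      using add.finprod_singleton[of 0 "{..<length w}" "\<lambda>_. iota A r [hd w] \<otimes> f w"] w i f by simp
    also have "iota A r [hd w] = r (u (hd w))"
      using W_ends[OF True] by (auto simp: word_algebra_simps(8))
    finally show ?thesis using True by simp
  qed (use carrier_out[OF mult_closed[OF i f]] in simp)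
qed

lemma mult_iota:
  assumes r: "r \<in> carrier (power_algebra K m)" and f: "f \<in> carrier A"
  shows "f \<otimes>\<^bsub>A\<^esub> iota A r = (\<lambda>w. if w \<in> W then f w \<otimes> r (u (last w)) else \<zero>)"
proof
  fix w
  note i = iota_in[OF r]
  show "(f \<otimes>\<^bsub>A\<^esub> iota A r) w = (if w \<in> W then f w \<otimes> r (u (last w)) else \<zero>)"
  proof (cases "w \<in> W")
    case True
    then have w: "w \<noteq> []" using W_nonempty by simp
    let ?L = "length w - 1"
    have t: "drop ?L w = [last w]" using w by (cases w rule: rev_cases) auto
    have "(f \<otimes>\<^bsub>A\<^esub> iota A r) w = (\<Oplus>k\<in>{..<length w}. f (take (Suc k) w) \<otimes> iota A r (drop k w))"
      using i f by (simp add: mult_conv)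
    also have "\<dots> = (\<Oplus>k\<in>{..<length w}. if ?L = k then f w \<otimes> iota A r [last w] else \<zero>)"
    proof (rule finsum_cong')
      fix k assume k: "k \<in> {..<length w}"
      show "f (take (Suc k) w) \<otimes> iota A r (drop k w) = (if ?L = k then f w \<otimes> iota A r [last w] else \<zero>)"
      proof (cases "?L = k")
        case False
        have "length (drop k w) \<ge> 2" using k False by auto
        then have "iota A r (drop k w) = \<zero>" by (intro iota_length) simp
        then show ?thesis using f False by simp
      next
        case True
        then show ?thesis using t w by (auto simp del: One_nat_def)
      qed
    qed (use i f in auto)
    also have "\<dots> = f w \<otimes> iota A r [last w]"
      using add.finprod_singleton[of ?L "{..<length w}" "\<lambda>_. f w \<otimes> iota A r [last w]"] w i f by simp
    also have "iota A r [last w] = r (u (last w))"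
      using W_ends[OF True] by (auto simp: word_algebra_simps(8))
    finally show ?thesis using True by simp
  qed (use carrier_out[OF mult_closed[OF f i]] in simp)
qed

lemma one_mult:
  assumes f: "f \<in> carrier A" shows "\<one>\<^bsub>A\<^esub> \<otimes>\<^bsub>A\<^esub> f = f" "f \<otimes>\<^bsub>A\<^esub> \<one>\<^bsub>A\<^esub> = f"
proof -
  have "\<one>\<^bsub>power_algebra K m\<^esub> (u (hd w)) = \<one>" "\<one>\<^bsub>power_algebra K m\<^esub> (u (last w)) = \<one>" if "w \<in> W" for w
    using W_ends[OF that] by (auto simp: power_algebra_def u_v)
  then show "\<one>\<^bsub>A\<^esub> \<otimes>\<^bsub>A\<^esub> f = f" "f \<otimes>\<^bsub>A\<^esub> \<one>\<^bsub>A\<^esub> = f"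
    using f by (auto simp: one_iota iota_mult mult_iota power_algebra_one fun_eq_iff carrier_out)
qed

lemma mult_distribs:
  assumes f: "f \<in> carrier A" and g: "g \<in> carrier A" and h: "h \<in> carrier A"
  shows "(f \<oplus>\<^bsub>A\<^esub> g) \<otimes>\<^bsub>A\<^esub> h = (f \<otimes>\<^bsub>A\<^esub> h) \<oplus>\<^bsub>A\<^esub> (g \<otimes>\<^bsub>A\<^esub> h)"
    and "h \<otimes>\<^bsub>A\<^esub> (f \<oplus>\<^bsub>A\<^esub> g) = (h \<otimes>\<^bsub>A\<^esub> f) \<oplus>\<^bsub>A\<^esub> (h \<otimes>\<^bsub>A\<^esub> g)"
proof -
  show "(f \<oplus>\<^bsub>A\<^esub> g) \<otimes>\<^bsub>A\<^esub> h = (f \<otimes>\<^bsub>A\<^esub> h) \<oplus>\<^bsub>A\<^esub> (g \<otimes>\<^bsub>A\<^esub> h)"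
  proof
    fix r
    show "((f \<oplus>\<^bsub>A\<^esub> g) \<otimes>\<^bsub>A\<^esub> h) r = (f \<otimes>\<^bsub>A\<^esub> h \<oplus>\<^bsub>A\<^esub> g \<otimes>\<^bsub>A\<^esub> h) r"
      using f g h add_closed[OF f g]
      by (simp add: mult_conv word_algebra_simps(5) l_distr finsum_addf Pi_def)
  qed
  show "h \<otimes>\<^bsub>A\<^esub> (f \<oplus>\<^bsub>A\<^esub> g) = (h \<otimes>\<^bsub>A\<^esub> f) \<oplus>\<^bsub>A\<^esub> (h \<otimes>\<^bsub>A\<^esub> g)"
  proof
    fix r
    show "(h \<otimes>\<^bsub>A\<^esub> (f \<oplus>\<^bsub>A\<^esub> g)) r = (h \<otimes>\<^bsub>A\<^esub> f \<oplus>\<^bsub>A\<^esub> h \<otimes>\<^bsub>A\<^esub> g) r"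
      using f g h add_closed[OF f g]
      by (simp add: mult_conv word_algebra_simps(5) r_distr finsum_addf Pi_def)
  qed
qed

lemma abelian_group_A: "abelian_group A"
proof (rule abelian_groupI)
  fix f assume f: "f \<in> carrier A"
  let ?g = "\<lambda>w. \<ominus> f w"
  have "?g \<in> carrier A"
    using f by (intro carrierI) (auto simp: carrier_supp, metis carrier_out add.inv_one)
  moreover have "?g \<oplus>\<^bsub>A\<^esub> f = \<zero>\<^bsub>A\<^esub>" using f by (auto simp: word_algebra_simps(4,5) l_neg)
  ultimately show "\<exists>y\<in>carrier A. y \<oplus>\<^bsub>A\<^esub> f = \<zero>\<^bsub>A\<^esub>" by blast
qed (auto simp: add_closed zero_in, auto simp: word_algebra_simps(4,5) a_ac carrier_val)

lemma ring_A: "ring A"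
  by (rule ringI[OF abelian_group_A]) (auto intro!: monoidI simp: mult_closed one_in mult_assoc one_mult mult_distribs)

lemma module_A: "module K A"
  by (rule moduleI[OF is_cring abelian_group_A])
     (auto simp: smult_closed, auto simp: word_algebra_simps(5,6) l_distr r_distr m_assoc carrier_val)

lemma smult_mult:
  assumes c: "c \<in> carrier K" and f: "f \<in> carrier A" and g: "g \<in> carrier A"
  shows "(c \<odot>\<^bsub>A\<^esub> f) \<otimes>\<^bsub>A\<^esub> g = c \<odot>\<^bsub>A\<^esub> (f \<otimes>\<^bsub>A\<^esub> g)" "f \<otimes>\<^bsub>A\<^esub> (c \<odot>\<^bsub>A\<^esub> g) = c \<odot>\<^bsub>A\<^esub> (f \<otimes>\<^bsub>A\<^esub> g)"
proof -
  show "(c \<odot>\<^bsub>A\<^esub> f) \<otimes>\<^bsub>A\<^esub> g = c \<odot>\<^bsub>A\<^esub> (f \<otimes>\<^bsub>A\<^esub> g)"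
  proof
    fix r show "((c \<odot>\<^bsub>A\<^esub> f) \<otimes>\<^bsub>A\<^esub> g) r = (c \<odot>\<^bsub>A\<^esub> (f \<otimes>\<^bsub>A\<^esub> g)) r"
      using c f g smult_closed[OF c f]
      by (simp add: mult_conv word_algebra_simps(6) finsum_rdistr Pi_def m_assoc)
  qed
  show "f \<otimes>\<^bsub>A\<^esub> (c \<odot>\<^bsub>A\<^esub> g) = c \<odot>\<^bsub>A\<^esub> (f \<otimes>\<^bsub>A\<^esub> g)"
  proof
    fix r show "(f \<otimes>\<^bsub>A\<^esub> (c \<odot>\<^bsub>A\<^esub> g)) r = (c \<odot>\<^bsub>A\<^esub> (f \<otimes>\<^bsub>A\<^esub> g)) r"
      using c f g smult_closed[OF c g]
      by (simp add: mult_conv word_algebra_simps(6) finsum_rdistr Pi_def m_lcomm)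
  qed
qed


sublocale WA: ring A by (rule ring_A)
sublocale WM: module K A by (rule module_A)

lemma finsum_apply:
  assumes "F \<in> S \<rightarrow> carrier A"
  shows "(\<Oplus>\<^bsub>A\<^esub> x\<in>S. F x) r = (\<Oplus>x\<in>S. F x r)"
proof (cases "finite S")
  case True
  then show ?thesis using assms
  proof induction
    case empty
    then show ?case by (simp add: word_algebra_simps(4))
  next
    case (insert x S)
    then show ?case by (simp add: WA.finsum_insert finsum_insert Pi_def word_algebra_simps(5))
  qed
qed (simp add: WA.finsum_infinite finsum_infinite word_algebra_simps(4))

lemma single_in [simp, intro]: "w \<in> W \<Longrightarrow> single K w \<in> carrier A"
  by (intro carrierI) (auto simp: single_def split: if_splits)

lemma expand:
  assumes f: "f \<in> carrier A"
  shows "f = (\<Oplus>\<^bsub>A\<^esub> w\<in>{w. f w \<noteq> \<zero>}. f w \<odot>\<^bsub>A\<^esub> single K w)"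
proof
  fix r
  have W: "{w. f w \<noteq> \<zero>} \<subseteq> W" using f carrier_out by blast
  have "(\<Oplus>\<^bsub>A\<^esub> w\<in>{w. f w \<noteq> \<zero>}. f w \<odot>\<^bsub>A\<^esub> single K w) r = (\<Oplus>w\<in>{w. f w \<noteq> \<zero>}. (f w \<odot>\<^bsub>A\<^esub> single K w) r)"
    using W f by (intro finsum_apply) (auto intro!: smult_closed)
  also have "\<dots> = (\<Oplus>w\<in>{w. f w \<noteq> \<zero>}. if r = w then f w else \<zero>)"
    using f by (auto simp: word_algebra_simps(6) single_def intro!: finsum_cong')
  also have "\<dots> = f r"
  proof (cases "f r = \<zero>")
    case True
    then have "(\<Oplus>w\<in>{w. f w \<noteq> \<zero>}. if r = w then f w else \<zero>) = (\<Oplus>w\<in>{w. f w \<noteq> \<zero>}. \<zero>)"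
      by (intro finsum_cong') auto
    then show ?thesis using True by simp
  next
    case False
    then show ?thesis using add.finprod_singleton[of r "{w. f w \<noteq> \<zero>}" f] carrier_supp[OF f] f by auto
  qed
  finally show "f r = (\<Oplus>\<^bsub>A\<^esub> w\<in>{w. f w \<noteq> \<zero>}. f w \<odot>\<^bsub>A\<^esub> single K w) r" by simp
qed

lemma word_induct [consumes 1, case_names zero single add smult]:
  assumes f: "f \<in> carrier A"
    and P0: "P \<zero>\<^bsub>A\<^esub>" and Ps: "\<And>w. w \<in> W \<Longrightarrow> P (single K w)"
    and Pa: "\<And>f g. f \<in> carrier A \<Longrightarrow> g \<in> carrier A \<Longrightarrow> P f \<Longrightarrow> P g \<Longrightarrow> P (f \<oplus>\<^bsub>A\<^esub> g)"
    and Pm: "\<And>c f. c \<in> carrier K \<Longrightarrow> f \<in> carrier A \<Longrightarrow> P f \<Longrightarrow> P (c \<odot>\<^bsub>A\<^esub> f)"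
  shows "P f"
proof -
  have "S \<subseteq> W \<Longrightarrow> P (\<Oplus>\<^bsub>A\<^esub> w\<in>S. f w \<odot>\<^bsub>A\<^esub> single K w)" if "finite S" for S
    using that
  proof induction
    case (insert x S)
    have "(\<Oplus>\<^bsub>A\<^esub> w\<in>insert x S. f w \<odot>\<^bsub>A\<^esub> single K w) = f x \<odot>\<^bsub>A\<^esub> single K x \<oplus>\<^bsub>A\<^esub> (\<Oplus>\<^bsub>A\<^esub> w\<in>S. f w \<odot>\<^bsub>A\<^esub> single K w)"
      using insert f by (intro WA.finsum_insert) (auto intro!: smult_closed)
    moreover have "(\<Oplus>\<^bsub>A\<^esub> w\<in>S. f w \<odot>\<^bsub>A\<^esub> single K w) \<in> carrier A"
      using insert f by (intro WA.finsum_closed) (auto intro!: smult_closed)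
    ultimately show ?case using insert f by (auto intro!: Pa Pm Ps smult_closed)
  qed (simp add: P0)
  from this[OF carrier_supp[OF f]] show ?thesis using expand[OF f] carrier_out[OF f] by auto
qed

lemma klinear_ext:
  assumes T: "klinear K A B T" and T': "klinear K A B T'" and B: "module K B"
    and eq: "\<And>w. w \<in> W \<Longrightarrow> T (single K w) = T' (single K w)" and f: "f \<in> carrier A"
  shows "T f = T' f"
proof -
  interpret B: module K B by (rule B)
  have z: "T \<zero>\<^bsub>A\<^esub> = \<zero>\<^bsub>B\<^esub>" if "klinear K A B T" for T
    using klinearD(3)[OF that, of \<zero> "\<zero>\<^bsub>A\<^esub>"] klinearD(1)[OF that, of "\<zero>\<^bsub>A\<^esub>"] by simp
  show ?thesis using f
    by (induction rule: word_induct) (simp_all add: z T T' eq klinearD[OF T] klinearD[OF T'])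
qed

context
  fixes M :: "('k, 'b, 'z) module_scheme" and \<phi> :: "'x list \<Rightarrow> 'b"
  assumes M: "module K M" and \<phi>: "\<And>w. w \<in> W \<Longrightarrow> \<phi> w \<in> carrier M"
begin

interpretation M: module K M by (rule M)

lemma lin_superset:
  assumes f: "f \<in> carrier A" and S: "finite S" "{w. f w \<noteq> \<zero>} \<subseteq> S" "S \<subseteq> W"
  shows "lin K M \<phi> f = (\<Oplus>\<^bsub>M\<^esub> w\<in>S. f w \<odot>\<^bsub>M\<^esub> \<phi> w)"
  unfolding lin_def
  using S f \<phi> by (intro M.add.finprod_mono_neutral_cong_left) auto

lemma lin_closed:
  assumes f: "f \<in> carrier A" shows "lin K M \<phi> f \<in> carrier M"
  unfolding lin_def using f \<phi> carrier_out[OF f] by (intro M.finsum_closed) auto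

lemma lin_klinear: "klinear K A M (lin K M \<phi>)"
proof (rule klinearI)
  fix f g assume f: "f \<in> carrier A" and g: "g \<in> carrier A"
  let ?S = "{w. f w \<noteq> \<zero>} \<union> {w. g w \<noteq> \<zero>}"
  have S: "finite ?S" "?S \<subseteq> W" using carrier_supp[OF f] carrier_supp[OF g] carrier_out f g by auto
  have "lin K M \<phi> (f \<oplus>\<^bsub>A\<^esub> g) = (\<Oplus>\<^bsub>M\<^esub> w\<in>?S. (f \<oplus>\<^bsub>A\<^esub> g) w \<odot>\<^bsub>M\<^esub> \<phi> w)"
    by (rule lin_superset[OF add_closed[OF f g] S(1) _ S(2)]) (auto simp: word_algebra_simps(5))
  also have "\<dots> = (\<Oplus>\<^bsub>M\<^esub> w\<in>?S. f w \<odot>\<^bsub>M\<^esub> \<phi> w \<oplus>\<^bsub>M\<^esub> g w \<odot>\<^bsub>M\<^esub> \<phi> w)"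
    using S f g \<phi> by (intro M.finsum_cong') (auto simp: word_algebra_simps(5) M.smult_l_distr)
  also have "\<dots> = lin K M \<phi> f \<oplus>\<^bsub>M\<^esub> lin K M \<phi> g"
    using S f g \<phi> by (subst M.finsum_addf) (auto simp: lin_superset[OF f S(1) _ S(2)] lin_superset[OF g S(1) _ S(2)])
  finally show "lin K M \<phi> (f \<oplus>\<^bsub>A\<^esub> g) = lin K M \<phi> f \<oplus>\<^bsub>M\<^esub> lin K M \<phi> g" .
next
  fix c f assume c: "c \<in> carrier K" and f: "f \<in> carrier A"
  let ?S = "{w. f w \<noteq> \<zero>}"
  have S: "finite ?S" "?S \<subseteq> W" using carrier_supp[OF f] carrier_out f by auto
  have "lin K M \<phi> (c \<odot>\<^bsub>A\<^esub> f) = (\<Oplus>\<^bsub>M\<^esub> w\<in>?S. (c \<odot>\<^bsub>A\<^esub> f) w \<odot>\<^bsub>M\<^esub> \<phi> w)"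
    using c by (intro lin_superset[OF smult_closed[OF c f] S(1) _ S(2)]) (auto simp: word_algebra_simps(6))
  also have "\<dots> = (\<Oplus>\<^bsub>M\<^esub> w\<in>?S. c \<odot>\<^bsub>M\<^esub> (f w \<odot>\<^bsub>M\<^esub> \<phi> w))"
    using S c f \<phi> by (intro M.finsum_cong') (auto simp: word_algebra_simps(6) M.smult_assoc1)
  also have "\<dots> = c \<odot>\<^bsub>M\<^esub> lin K M \<phi> f"
    using S c f \<phi> unfolding lin_def by (subst M.finsum_smult_ldistr) auto
  finally show "lin K M \<phi> (c \<odot>\<^bsub>A\<^esub> f) = c \<odot>\<^bsub>M\<^esub> lin K M \<phi> f" .
qed (rule lin_closed)

lemma lin_single: "w \<in> W \<Longrightarrow> lin K M \<phi> (single K w) = \<phi> w"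
proof -
  assume w: "w \<in> W"
  have "lin K M \<phi> (single K w) = (\<Oplus>\<^bsub>M\<^esub> x\<in>{w}. single K w x \<odot>\<^bsub>M\<^esub> \<phi> x)"
    using w by (intro lin_superset single_in) (auto simp: single_def)
  also have "\<dots> = \<phi> w"
    using w \<phi> M.finsum_insert[of "{}" w "\<lambda>x. single K w x \<odot>\<^bsub>M\<^esub> \<phi> x"] by (simp add: single_def)
  finally show ?thesis .
qed

end

lemma mult_single:
  assumes p: "p \<in> W" and q: "q \<in> W"
  shows "single K p \<otimes>\<^bsub>A\<^esub> single K q = (if last p = hd q then single K (p @ tl q) else \<zero>\<^bsub>A\<^esub>)"
proof
  fix r
  let ?h = "\<lambda>x. single K p (fst x) \<otimes> single K q (snd x)"
  have *: "?h x = (if x = (p, q) then \<one> else \<zero>)" for x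
    by (cases x) (auto simp: single_def)
  let ?X = "{(p, q) \<in> W \<times> W. last p = hd q \<and> p @ tl q = r}"
  have fin: "finite ?X"
  proof (rule finite_subset)
    show "?X \<subseteq> (\<lambda>k. (take k r, drop k r)) ` {..length r} \<union> (\<lambda>(a,b). (a, last a # b)) ` (\<lambda>k. (take k r, drop k r)) ` {..length r}"
    proof
      fix x assume "x \<in> ?X"
      then obtain a b where x: "x = (a, b)" "a \<in> W" "b \<in> W" "last a = hd b" "a @ tl b = r" by auto
      then have "x = (\<lambda>(a,b). (a, last a # b)) ((\<lambda>k. (take k r, drop k r)) (length a))" "length a \<le> length r"
        using W_nonempty[OF x(3)] by (cases b; auto)+
      then show "x \<in> (\<lambda>k. (take k r, drop k r)) ` {..length r} \<union> (\<lambda>(a,b). (a, last a # b)) ` (\<lambda>k. (take k r, drop k r)) ` {..length r}"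
        by blast
    qed
  qed simp
  show "(single K p \<otimes>\<^bsub>A\<^esub> single K q) r = (if last p = hd q then single K (p @ tl q) else \<zero>\<^bsub>A\<^esub>) r"
  proof (cases "(p, q) \<in> ?X")
    case True
    have "(single K p \<otimes>\<^bsub>A\<^esub> single K q) r = (\<Oplus>x\<in>?X. if (p, q) = x then \<one> else \<zero>)"
      unfolding word_algebra_simps(2) by (intro finsum_cong') (auto simp: single_def)
    also have "\<dots> = \<one>" using add.finprod_singleton[OF True fin, of "\<lambda>_. \<one>"] by simp
    finally show ?thesis using True by (auto simp: single_def)
  next
    case False
    have "?h x = \<zero>" if "x \<in> ?X" for x
    proof -
      have "x \<noteq> (p, q)" using False that by blast
      then show ?thesis using *[of x] by simp
    qed
    then have "(\<Oplus>x\<in>?X. ?h x) = \<zero>" by (intro add.finprod_one_eqI) auto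
    then have "(single K p \<otimes>\<^bsub>A\<^esub> single K q) r = \<zero>" unfolding word_algebra_simps(2) .
    then show ?thesis using False p q by (auto simp: single_def word_algebra_simps(4))
  qed
qed

lemma graded: "graded_algebra K m A"
proof -
  have sm: "c \<odot>\<^bsub>A\<^esub> a \<in> grade A p" if c: "c \<in> carrier K" and a: "a \<in> grade A p" for c a p
    unfolding word_algebra_simps(7)
  proof (intro CollectI conjI allI impI)
    show "c \<odot>\<^bsub>A\<^esub> a \<in> carrier A" using a c unfolding word_algebra_simps(7) by (intro smult_closed) auto
    fix w assume "(c \<odot>\<^bsub>A\<^esub> a) w \<noteq> \<zero>"
    then have "a w \<noteq> \<zero>" unfolding word_algebra_simps(6) using c by (metis r_null)
    then show "dg w = p" using a unfolding word_algebra_simps(7) by blast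
  qed
  have sub: "submodule (grade A p) K A" for p
  proof (rule submodule.intro)
    show "subgroup (grade A p) (add_monoid A)"
    proof (rule WA.add.subgroupI)
      show "grade A p \<noteq> {}" using zero_in by (auto simp: word_algebra_simps(4,7))
      fix a assume a: "a \<in> grade A p"
      then have ac: "a \<in> carrier A" by (simp add: word_algebra_simps(7))
      have "\<ominus>\<^bsub>A\<^esub> a = (\<ominus> \<one>) \<odot>\<^bsub>A\<^esub> a"
        using WM.smult_l_minus[of \<one> a] ac by simp
      moreover have "(\<ominus> \<one>) \<odot>\<^bsub>A\<^esub> a \<in> grade A p" using sm a by simp
      ultimately show "\<ominus>\<^bsub>A\<^esub> a \<in> grade A p" by simp
    next
      fix a b assume ab: "a \<in> grade A p" "b \<in> grade A p"
      have "a w \<noteq> \<zero> \<or> b w \<noteq> \<zero>" if "a w \<oplus> b w \<noteq> \<zero>" for w using that by auto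
      then show "a \<oplus>\<^bsub>A\<^esub> b \<in> grade A p"
        using add_closed[of a b] ab unfolding word_algebra_simps(5,7) by blast
    qed (auto simp: word_algebra_simps(7))
  next
    show "submodule_axioms (grade A p) K A"
      by (rule submodule_axioms.intro) (rule sm)
  qed
  have decomp: "\<exists>!c. (\<forall>p. c p \<in> grade A p) \<and> finite {p. c p \<noteq> \<zero>\<^bsub>A\<^esub>} \<and>
          f = (\<Oplus>\<^bsub>A\<^esub> p \<in> {p. c p \<noteq> \<zero>\<^bsub>A\<^esub>}. c p)" if f: "f \<in> carrier A" for f
  proof (rule ex1I)
    \<comment> \<open>The component of degree \<open>p\<close> keeps the coefficients at words of
      degree \<open>p\<close>. Uniqueness follows by evaluation at a word \<open>w\<close>, where
      only the component of degree \<open>dg w\<close> can be nonzero.\<close>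
    let ?c = "\<lambda>p w. if dg w = p then f w else \<zero>"
    have cc: "?c p \<in> carrier A" for p
      using f carrier_out[OF f]
      by (intro carrierI) (auto split: if_splits intro: finite_subset[OF _ carrier_supp[OF f]])
    have fin: "finite {p. ?c p \<noteq> \<zero>\<^bsub>A\<^esub>}"
    proof (rule finite_subset)
      show "{p. ?c p \<noteq> \<zero>\<^bsub>A\<^esub>} \<subseteq> dg ` {w. f w \<noteq> \<zero>}" by (auto simp: word_algebra_simps(4) fun_eq_iff split: if_splits)
    qed (use carrier_supp[OF f] in simp)
    have "f = (\<Oplus>\<^bsub>A\<^esub> p \<in> {p. ?c p \<noteq> \<zero>\<^bsub>A\<^esub>}. ?c p)"
    proof
      fix w
      have "(\<Oplus>\<^bsub>A\<^esub> p \<in> {p. ?c p \<noteq> \<zero>\<^bsub>A\<^esub>}. ?c p) w = (\<Oplus> p \<in> {p. ?c p \<noteq> \<zero>\<^bsub>A\<^esub>}. if dg w = p then f w else \<zero>)"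
        using cc by (subst finsum_apply) auto
      also have "\<dots> = f w"
      proof (cases "f w = \<zero>")
        case True then show ?thesis by (intro trans[OF add.finprod_one_eqI]) auto
      next
        case False
        then have "dg w \<in> {p. ?c p \<noteq> \<zero>\<^bsub>A\<^esub>}" by (auto simp: word_algebra_simps(4) fun_eq_iff)
        from add.finprod_singleton[OF this fin, of "\<lambda>_. f w"] show ?thesis using f by simp
      qed
      finally show "f w = (\<Oplus>\<^bsub>A\<^esub> p \<in> {p. ?c p \<noteq> \<zero>\<^bsub>A\<^esub>}. ?c p) w" by simp
    qed
    then show "(\<forall>p. ?c p \<in> grade A p) \<and> finite {p. ?c p \<noteq> \<zero>\<^bsub>A\<^esub>} \<and> f = (\<Oplus>\<^bsub>A\<^esub> p \<in> {p. ?c p \<noteq> \<zero>\<^bsub>A\<^esub>}. ?c p)"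
      using fin cc by (auto simp: word_algebra_simps(7) split: if_splits)
    fix c assume c: "(\<forall>p. c p \<in> grade A p) \<and> finite {p. c p \<noteq> \<zero>\<^bsub>A\<^esub>} \<and> f = (\<Oplus>\<^bsub>A\<^esub> p \<in> {p. c p \<noteq> \<zero>\<^bsub>A\<^esub>}. c p)"
    then have ccc: "c p \<in> carrier A" for p by (auto simp: word_algebra_simps(7))
    show "c = ?c"
    proof (intro ext)
      fix p w
      have off: "c q w = \<zero>" if "q \<noteq> dg w" for q using c that by (auto simp: word_algebra_simps(7))
      have "f w = (\<Oplus> q \<in> {q. c q \<noteq> \<zero>\<^bsub>A\<^esub>}. c q w)"
        using c ccc finsum_apply[of c "{q. c q \<noteq> \<zero>\<^bsub>A\<^esub>}" w] by auto
      also have "\<dots> = c (dg w) w"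
      proof (cases "c (dg w) = \<zero>\<^bsub>A\<^esub>")
        case True
        then have "c q w = \<zero>" if "q \<in> {q. c q \<noteq> \<zero>\<^bsub>A\<^esub>}" for q
            using off that by (cases "q = dg w") auto
        then have "(\<Oplus> q \<in> {q. c q \<noteq> \<zero>\<^bsub>A\<^esub>}. c q w) = \<zero>" by (intro add.finprod_one_eqI) auto
        then show ?thesis using True by (simp add: word_algebra_simps(4))
      next
        case False
        have "(\<Oplus> q \<in> {q. c q \<noteq> \<zero>\<^bsub>A\<^esub>}. c q w) = (\<Oplus> q \<in> {q. c q \<noteq> \<zero>\<^bsub>A\<^esub>}. if dg w = q then c q w else \<zero>)"
          using off ccc by (intro finsum_cong') auto
        also have "\<dots> = c (dg w) w"
          using add.finprod_singleton[of "dg w" "{q. c q \<noteq> \<zero>\<^bsub>A\<^esub>}" "\<lambda>q. c q w"] False c ccc by auto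
        finally show ?thesis .
      qed
      finally show "c p w = ?c p w" using off by auto
    qed
  qed
  show ?thesis
  proof (intro graded_algebra.intro graded_algebra_axioms.intro)
    show "field K" by (rule field_axioms)
    fix f g p q assume f: "f \<in> grade A p" and g: "g \<in> grade A q"
    then have fc: "f \<in> carrier A" and gc: "g \<in> carrier A" by (auto simp: word_algebra_simps(7))
    have "dg r = p + q" if nz: "(f \<otimes>\<^bsub>A\<^esub> g) r \<noteq> \<zero>" for r
    proof (rule ccontr)
      assume ne: "dg r \<noteq> p + q"
      have "f (fst x) \<otimes> g (snd x) = \<zero>"
        if "x \<in> {(p, q) \<in> W \<times> W. last p = hd q \<and> p @ tl q = r}" for x
      proof -
        obtain a b where x: "x = (a, b)" "a \<in> W" "b \<in> W" "last a = hd b" "a @ tl b = r" using \<open>x \<in> _\<close> by auto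
        then have "dg a \<noteq> p \<or> dg b \<noteq> q" using dg_comp[of a b] ne by auto
        then have "f a = \<zero> \<or> g b = \<zero>" using f g by (auto simp: word_algebra_simps(7))
        then show ?thesis using x fc gc by auto
      qed
      then have "(f \<otimes>\<^bsub>A\<^esub> g) r = \<zero>" unfolding word_algebra_simps(2) by (rule add.finprod_one_eqI)
      then show False using nz by simp
    qed
    then show "f \<otimes>\<^bsub>A\<^esub> g \<in> grade A (p + q)" using mult_closed[OF fc gc] by (simp add: word_algebra_simps(7))
  next
    show "iota A \<in> alg_hom K (power_algebra K m) A"
      unfolding alg_hom_def ring_hom_def
    proof (safe)
      fix r s assume r: "r \<in> carrier (power_algebra K m)" and s: "s \<in> carrier (power_algebra K m)"
      have rs: "r i \<in> carrier K" "s i \<in> carrier K" if "i \<in> {1..m}" for i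
        using r s that by (auto simp: power_algebra_def)
      show "iota A (r \<otimes>\<^bsub>power_algebra K m\<^esub> s) = iota A r \<otimes>\<^bsub>A\<^esub> iota A s"
        unfolding iota_mult[OF r iota_in[OF s]]
      proof
        fix w
        show "iota A (r \<otimes>\<^bsub>power_algebra K m\<^esub> s) w = (if w \<in> W then r (u (hd w)) \<otimes> iota A s w else \<zero>)"
        proof (cases "\<exists>i\<in>{1..m}. w = [v i]")
          case True
          then show ?thesis using W_unit u_v by (auto simp: word_algebra_simps(8) power_algebra_def)
        next
          case False
          have "r (u (hd w)) \<in> carrier K" if "w \<in> W" using W_ends[OF that] rs(1) by (auto simp: u_v)
          then show ?thesis using False by (simp add: word_algebra_simps(8))
        qed
      qed
      show "iota A (r \<oplus>\<^bsub>power_algebra K m\<^esub> s) = iota A r \<oplus>\<^bsub>A\<^esub> iota A s"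
        using u_v by (auto simp: fun_eq_iff word_algebra_simps(5,8) power_algebra_def)
    next
      fix c r assume "c \<in> carrier K" "r \<in> carrier (power_algebra K m)"
      then show "iota A (c \<odot>\<^bsub>power_algebra K m\<^esub> r) = c \<odot>\<^bsub>A\<^esub> iota A r"
        using u_v by (auto simp: fun_eq_iff word_algebra_simps(6,8) power_algebra_def)
    qed (simp_all add: iota_in one_iota)
  next
    fix r assume r: "r \<in> carrier (power_algebra K m)"
    show "iota A r \<in> grade A 0"
      unfolding word_algebra_simps(7) using iota_in[OF r] by (auto simp: word_algebra_simps(8) dg_unit split: if_splits)
  qed (auto simp: ring_A module_A smult_mult sub decomp)
qed

end

section \<open>Homogeneous components and cohomology\<close>

text \<open>Adding a differential changes the record, so \<open>graded\<close> does not literally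
  apply to the result. Inverses and finite sums are defined through the whole record and must be
  seen to depend on the shared fields only.\<close>

lemma graded_algebra_cong:
  assumes A: "graded_algebra K m A"
    and eq: "carrier B = carrier A" "monoid.mult B = monoid.mult A" "monoid.one B = monoid.one A"
      "ring.zero B = ring.zero A" "ring.add B = ring.add A" "smult B = smult A" "grade B = grade A"
      "iota B = iota A"
  shows "graded_algebra K m B"
proof -
  interpret A: graded_algebra K m A by (rule A)
  have gr: "abelian_group B"
  proof (rule abelian_groupI)
    fix x assume "x \<in> carrier B"
    then have "\<ominus>\<^bsub>A\<^esub> x \<in> carrier B \<and> \<ominus>\<^bsub>A\<^esub> x \<oplus>\<^bsub>B\<^esub> x = \<zero>\<^bsub>B\<^esub>" by (simp add: eq A.A.l_neg)
    then show "\<exists>y\<in>carrier B. y \<oplus>\<^bsub>B\<^esub> x = \<zero>\<^bsub>B\<^esub>" by blast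
  qed (simp_all add: eq A.A.a_ac)
  have rB: "ring B"
    by (rule ringI[OF gr]) (auto intro!: monoidI simp: eq A.A.m_assoc A.A.l_distr A.A.r_distr)
  have mB: "module K B"
    by (rule moduleI[OF A.is_cring gr])
      (simp_all add: eq A.smult_l_distr A.smult_r_distr A.smult_assoc1)
  interpret B: ring B by (rule rB)
  have inv: "\<ominus>\<^bsub>B\<^esub> x = \<ominus>\<^bsub>A\<^esub> x" if "x \<in> carrier A" for x
    using B.minus_equality[of "\<ominus>\<^bsub>A\<^esub> x" x] that by (simp add: eq A.A.l_neg)
  have am: "carrier (add_monoid B) = carrier (add_monoid A)" "monoid.mult (add_monoid B) = monoid.mult (add_monoid A)"
    "monoid.one (add_monoid B) = monoid.one (add_monoid A)" by (simp_all add: eq)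
  have fs: "finsum B = finsum A"
    unfolding finsum_def finprod_def am ..
  have sm: "submodule (grade B p) K B" for p
  proof -
    interpret S: submodule "grade A p" K A by (rule A.grade_submodule)
    have g: "grade A p \<subseteq> carrier A" using S.subset by simp
    show ?thesis
    proof (rule submodule.intro)
      show "subgroup (grade B p) (add_monoid B)"
      proof (rule B.add.subgroupI)
        show "grade B p \<subseteq> carrier B" using g eq by simp
        show "grade B p \<noteq> {}" using S.one_closed eq by auto
        show "\<ominus>\<^bsub>B\<^esub> a \<in> grade B p" if "a \<in> grade B p" for a
          using S.m_inv_closed[of a] that g inv[of a] eq by (auto simp: a_inv_def)
        show "a \<oplus>\<^bsub>B\<^esub> b \<in> grade B p" if "a \<in> grade B p" "b \<in> grade B p" for a b
          using S.m_closed[of a b] that eq by simp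
      qed
      show "submodule_axioms (grade B p) K B"
        by (rule submodule_axioms.intro) (simp add: eq S.smult_closed)
    qed
  qed
  show ?thesis
  proof (intro graded_algebra.intro graded_algebra_axioms.intro)
    show "\<exists>!c. (\<forall>p. c p \<in> grade B p) \<and> finite {p. c p \<noteq> \<zero>\<^bsub>B\<^esub>} \<and> x = (\<Oplus>\<^bsub>B\<^esub>p\<in>{p. c p \<noteq> \<zero>\<^bsub>B\<^esub>}. c p)"
      if "x \<in> carrier B" for x
      using A.grade_decomp[of x] that unfolding eq fs by simp
    show "iota B \<in> alg_hom K (power_algebra K m) B"
      using A.iota_hom by (simp add: alg_hom_def ring_hom_def eq)
  qed (use A.field_axioms rB mB sm A.smult_mult_left A.smult_mult_right A.grade_mult A.iota_grade in
      \<open>simp_all add: eq\<close>)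
qed

context graded_algebra
begin

lemma grade_carrier [simp, intro]: "x \<in> grade A p \<Longrightarrow> x \<in> carrier A"
proof -
  interpret S: submodule "grade A p" K A by (rule grade_submodule)
  show "x \<in> grade A p \<Longrightarrow> x \<in> carrier A" using S.subset by auto
qed

lemma grade_closed:
  "\<zero>\<^bsub>A\<^esub> \<in> grade A p" "x \<in> grade A p \<Longrightarrow> y \<in> grade A p \<Longrightarrow> x \<oplus>\<^bsub>A\<^esub> y \<in> grade A p"
  "c \<in> carrier K \<Longrightarrow> x \<in> grade A p \<Longrightarrow> c \<odot>\<^bsub>A\<^esub> x \<in> grade A p"
proof -
  interpret S: submodule "grade A p" K A by (rule grade_submodule)
  show "\<zero>\<^bsub>A\<^esub> \<in> grade A p" "x \<in> grade A p \<Longrightarrow> y \<in> grade A p \<Longrightarrow> x \<oplus>\<^bsub>A\<^esub> y \<in> grade A p"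
    "c \<in> carrier K \<Longrightarrow> x \<in> grade A p \<Longrightarrow> c \<odot>\<^bsub>A\<^esub> x \<in> grade A p"
    using S.one_closed S.m_closed S.smult_closed by simp_all
qed

definition hcomp :: "'a \<Rightarrow> int \<Rightarrow> 'a" where
  "hcomp x = (THE c. (\<forall>p. c p \<in> grade A p) \<and> finite {p. c p \<noteq> \<zero>\<^bsub>A\<^esub>} \<and> x = (\<Oplus>\<^bsub>A\<^esub> p \<in> {p. c p \<noteq> \<zero>\<^bsub>A\<^esub>}. c p))"

lemma hcomp:
  assumes "x \<in> carrier A"
  shows "hcomp x p \<in> grade A p" "finite {p. hcomp x p \<noteq> \<zero>\<^bsub>A\<^esub>}" "x = (\<Oplus>\<^bsub>A\<^esub> p \<in> {p. hcomp x p \<noteq> \<zero>\<^bsub>A\<^esub>}. hcomp x p)"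
  using theI'[OF grade_decomp[OF assms]] unfolding hcomp_def[symmetric] by auto

lemma hcomp_unique:
  assumes c: "\<And>p. c p \<in> grade A p" and F: "finite F" "\<And>p. p \<notin> F \<Longrightarrow> c p = \<zero>\<^bsub>A\<^esub>"
    and x: "x = (\<Oplus>\<^bsub>A\<^esub> p \<in> F. c p)"
  shows "hcomp x = c"
proof -
  have xc: "x \<in> carrier A" using c x by (auto intro!: A.finsum_closed)
  have sub: "{p. c p \<noteq> \<zero>\<^bsub>A\<^esub>} \<subseteq> F" using F by auto
  have "x = (\<Oplus>\<^bsub>A\<^esub> p \<in> {p. c p \<noteq> \<zero>\<^bsub>A\<^esub>}. c p)"
    unfolding x using F sub c by (intro A.add.finprod_mono_neutral_cong_right) auto
  moreover have "finite {p. c p \<noteq> \<zero>\<^bsub>A\<^esub>}" using F sub finite_subset by blast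
  ultimately show ?thesis
    unfolding hcomp_def using c by (intro the1_equality[OF grade_decomp[OF xc]]) auto
qed

lemma hcomp_homogeneous: "x \<in> grade A t \<Longrightarrow> hcomp x = (\<lambda>p. if p = t then x else \<zero>\<^bsub>A\<^esub>)"
  using A.finsum_insert[of "{}" t "\<lambda>p. if p = t then x else \<zero>\<^bsub>A\<^esub>"]
  by (intro hcomp_unique[of _ "{t}"]) (auto simp: grade_closed)

definition base_unit :: "nat \<Rightarrow> nat \<Rightarrow> 'k" where
  "base_unit i = (\<lambda>j\<in>{1..m}. if j = i then \<one>\<^bsub>K\<^esub> else \<zero>\<^bsub>K\<^esub>)"

definition idem :: "nat \<Rightarrow> 'a" where
  "idem i = iota A (base_unit i)"

lemma base_unit_in [simp]: "base_unit i \<in> carrier (power_algebra K m)"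
  by (auto simp: base_unit_def power_algebra_def)

lemma iota_props:
  assumes "r \<in> carrier (power_algebra K m)"
  shows "iota A r \<in> carrier A"
    and "s \<in> carrier (power_algebra K m) \<Longrightarrow> iota A (r \<otimes>\<^bsub>power_algebra K m\<^esub> s) = iota A r \<otimes>\<^bsub>A\<^esub> iota A s"
    and "s \<in> carrier (power_algebra K m) \<Longrightarrow> iota A (r \<oplus>\<^bsub>power_algebra K m\<^esub> s) = iota A r \<oplus>\<^bsub>A\<^esub> iota A s"
    and "c \<in> carrier K \<Longrightarrow> iota A (c \<odot>\<^bsub>power_algebra K m\<^esub> r) = c \<odot>\<^bsub>A\<^esub> iota A r"
    and "iota A \<one>\<^bsub>power_algebra K m\<^esub> = \<one>\<^bsub>A\<^esub>"
  using iota_hom assms by (auto simp: alg_hom_def ring_hom_def)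

lemma idem_closed [simp, intro]: "idem i \<in> carrier A"
  unfolding idem_def by (simp add: iota_props)

lemma idem_grade: "idem i \<in> grade A 0"
  unfolding idem_def by (simp add: iota_grade)

lemma iota_zero: "iota A (\<lambda>j\<in>{Suc 0..m}. \<zero>\<^bsub>K\<^esub>) = \<zero>\<^bsub>A\<^esub>"
proof -
  have "(\<lambda>j\<in>{Suc 0..m}. \<zero>\<^bsub>K\<^esub>) = \<zero>\<^bsub>K\<^esub> \<odot>\<^bsub>power_algebra K m\<^esub> base_unit 1"
    by (auto simp: power_algebra_def base_unit_def)
  then show ?thesis using iota_props(1)[of "base_unit 1"] iota_props(4)[of "base_unit 1" "\<zero>\<^bsub>K\<^esub>"] by simp
qed

lemma idem_mult: "idem i \<otimes>\<^bsub>A\<^esub> idem j = (if i = j then idem i else \<zero>\<^bsub>A\<^esub>)"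
proof -
  have "base_unit i \<otimes>\<^bsub>power_algebra K m\<^esub> base_unit j = (if i = j then base_unit i else (\<lambda>j\<in>{1..m}. \<zero>\<^bsub>K\<^esub>))"
    by (auto simp: power_algebra_def base_unit_def)
  then show ?thesis
    using iota_props(2)[of "base_unit i" "base_unit j"] by (auto simp: idem_def iota_zero)
qed

text \<open>Reduces compatibility with \<open>iota\<close> to the idempotents. The induction on
  \<open>l\<close> truncates \<open>r\<close> to its first \<open>l\<close> coordinates.\<close>

lemma iota_expand:
  assumes r: "r \<in> carrier (power_algebra K m)"
  shows "iota A r = (\<Oplus>\<^bsub>A\<^esub> i\<in>{1..m}. r i \<odot>\<^bsub>A\<^esub> idem i)"
proof -
  let ?r = "\<lambda>l. \<lambda>i\<in>{1..m}. if i \<le> l then r i else \<zero>\<^bsub>K\<^esub>"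
  have rK: "r i \<in> carrier K" if "i \<in> {1..m}" for i using r that by (auto simp: power_algebra_def)
  have "iota A (?r l) = (\<Oplus>\<^bsub>A\<^esub> i\<in>{1..l}. r i \<odot>\<^bsub>A\<^esub> idem i)" if "l \<le> m" for l
    using that
  proof (induction l)
    case 0
    have "?r 0 = (\<lambda>j\<in>{1..m}. \<zero>\<^bsub>K\<^esub>)" by auto
    then show ?case by (simp add: iota_zero del: restrict_apply)
  next
    case (Suc l)
    have rl: "r (Suc l) \<in> carrier K" using rK Suc.prems by simp
    then have rl': "r (Suc l) \<otimes>\<^bsub>K\<^esub> \<zero>\<^bsub>K\<^esub> \<oplus>\<^bsub>K\<^esub> \<zero>\<^bsub>K\<^esub> = \<zero>\<^bsub>K\<^esub>" "r (Suc l) \<otimes>\<^bsub>K\<^esub> \<one>\<^bsub>K\<^esub> \<oplus>\<^bsub>K\<^esub> \<zero>\<^bsub>K\<^esub> = r (Suc l)" by simp_all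
    have eq: "?r (Suc l) = (r (Suc l) \<odot>\<^bsub>power_algebra K m\<^esub> base_unit (Suc l)) \<oplus>\<^bsub>power_algebra K m\<^esub> ?r l"
      using rK rl by (auto simp: power_algebra_def base_unit_def fun_eq_iff restrict_def le_Suc_eq rl')
    have in1: "r (Suc l) \<odot>\<^bsub>power_algebra K m\<^esub> base_unit (Suc l) \<in> carrier (power_algebra K m)"
      and in2: "?r l \<in> carrier (power_algebra K m)"
      using rK Suc.prems by (auto simp: power_algebra_def base_unit_def)
    have "{1..Suc l} = insert (Suc l) {1..l}" by auto
    moreover have "(\<Oplus>\<^bsub>A\<^esub> i\<in>insert (Suc l) {1..l}. r i \<odot>\<^bsub>A\<^esub> idem i) = r (Suc l) \<odot>\<^bsub>A\<^esub> idem (Suc l) \<oplus>\<^bsub>A\<^esub> (\<Oplus>\<^bsub>A\<^esub> i\<in>{1..l}. r i \<odot>\<^bsub>A\<^esub> idem i)"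
      using rK Suc.prems by (intro A.finsum_insert) auto
    ultimately show ?case
      unfolding eq iota_props(3)[OF in1 in2] using Suc rK
      by (simp add: iota_props(4) idem_def del: restrict_apply)
  qed
  from this[of m] have "iota A (?r m) = (\<Oplus>\<^bsub>A\<^esub> i\<in>{1..m}. r i \<odot>\<^bsub>A\<^esub> idem i)" by simp
  moreover have "?r m = r" using r by (auto simp: power_algebra_def PiE_def extensional_def fun_eq_iff)
  ultimately show ?thesis by simp
qed

end

section \<open>Cocycles, coboundaries and the cohomology algebra on representatives\<close>

context diff_graded_algebra
begin

lemma minus_zero_zero: "\<zero>\<^bsub>A\<^esub> \<ominus>\<^bsub>A\<^esub> \<zero>\<^bsub>A\<^esub> = \<zero>\<^bsub>A\<^esub>"
  by (simp add: a_minus_def)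

lemma diff_klinear: "klinear K A A (diff A)"
  by (intro klinearI) (auto simp: diff_closed diff_add diff_smult)

lemma diff_zero [simp]: "diff A \<zero>\<^bsub>A\<^esub> = \<zero>\<^bsub>A\<^esub>"
  using diff_smult[of "\<zero>\<^bsub>K\<^esub>" "\<zero>\<^bsub>A\<^esub>"] diff_closed[of "\<zero>\<^bsub>A\<^esub>"] by simp

lemma diff_minus: "x \<in> carrier A \<Longrightarrow> y \<in> carrier A \<Longrightarrow> diff A (x \<ominus>\<^bsub>A\<^esub> y) = diff A x \<ominus>\<^bsub>A\<^esub> diff A y"
proof -
  assume x: "x \<in> carrier A" and y: "y \<in> carrier A"
  have "diff A (\<ominus>\<^bsub>A\<^esub> y) = \<ominus>\<^bsub>A\<^esub> diff A y"
    using y diff_add[of y "\<ominus>\<^bsub>A\<^esub> y"] by (metis A.add.inv_closed A.minus_equality A.r_neg A.a_comm diff_closed diff_zero)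
  then show ?thesis using x y by (simp add: a_minus_def diff_add)
qed

lemma diff_finsum:
  assumes "F \<in> S \<rightarrow> carrier A"
  shows "diff A (\<Oplus>\<^bsub>A\<^esub> x\<in>S. F x) = (\<Oplus>\<^bsub>A\<^esub> x\<in>S. diff A (F x))"
proof (cases "finite S")
  case True
  then show ?thesis using assms
  proof induction
    case (insert x S)
    then have "F \<in> S \<rightarrow> carrier A" "F x \<in> carrier A" by auto
    then show ?case using insert
      by (simp add: A.finsum_insert diff_add diff_closed Pi_def)
  qed simp
qed (simp add: A.finsum_infinite)

lemma hcomp_diff:
  assumes x: "x \<in> carrier A"
  shows "hcomp (diff A x) (p + 1) = diff A (hcomp x p)"
proof -
  let ?S = "{p. hcomp x p \<noteq> \<zero>\<^bsub>A\<^esub>}" and ?c = "\<lambda>q. diff A (hcomp x (q - 1))"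
  note h = hcomp[OF x]
  have hc: "hcomp x q \<in> carrier A" for q using h(1) by auto
  have "diff A x = (\<Oplus>\<^bsub>A\<^esub> p\<in>?S. diff A (hcomp x p))"
    using diff_finsum[of "hcomp x" ?S] hc h(3) by auto
  also have "\<dots> = (\<Oplus>\<^bsub>A\<^esub> p\<in>?S. ?c (p + 1))" by simp
  also have "\<dots> = (\<Oplus>\<^bsub>A\<^esub> q\<in>(\<lambda>p. p + 1) ` ?S. ?c q)"
    using hc diff_closed by (subst A.finsum_reindex) auto
  finally have eq: "diff A x = (\<Oplus>\<^bsub>A\<^esub> q\<in>(\<lambda>p. p + 1) ` ?S. ?c q)" .
  have "hcomp (diff A x) = ?c"
  proof (rule hcomp_unique[OF _ _ _ eq])
    show "?c q \<in> grade A q" for q using diff_grade[OF h(1)[of "q - 1"]] by simp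
    show "?c q = \<zero>\<^bsub>A\<^esub>" if "q \<notin> (\<lambda>p. p + 1) ` ?S" for q
    proof -
      have "q - 1 \<notin> ?S" using that by (metis (no_types, lifting) diff_add_cancel image_eqI)
      then show ?thesis by simp
    qed
  qed (use h(2) in simp)
  then show ?thesis by simp
qed

text \<open>The differential commutes with taking components, so the component of \<open>y\<close>
  in degree \<open>t - 1\<close> is already a primitive.\<close>

lemma exact_homogeneous:
  assumes "y \<in> carrier A" "diff A y \<in> grade A t"
  shows "\<exists>y' \<in> grade A (t - 1). diff A y' = diff A y"
  using hcomp_diff[OF assms(1), of "t - 1"] hcomp_homogeneous[OF assms(2)] hcomp(1)[OF assms(1), of "t - 1"]
  by auto

lemma cocycle_hcomp:
  assumes "z \<in> cocycles A" shows "hcomp z p \<in> cocycles A"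
proof -
  have "hcomp \<zero>\<^bsub>A\<^esub> = (\<lambda>p. \<zero>\<^bsub>A\<^esub>)" by (subst hcomp_homogeneous[of _ 0]) (auto simp: grade_closed)
  then show ?thesis
    using assms hcomp_diff[of z p] hcomp(1)[of z p] by (auto simp: cocycles_def)
qed

lemma diff_idem: "diff A (idem i) = \<zero>\<^bsub>A\<^esub>"
  unfolding idem_def by (simp add: diff_iota)

lemma diff_idem_mult: "y \<in> carrier A \<Longrightarrow> diff A (idem i \<otimes>\<^bsub>A\<^esub> y) = idem i \<otimes>\<^bsub>A\<^esub> diff A y"
  using diff_mult[OF idem_grade[of i]] by (simp add: diff_idem diff_closed)

lemma cocyclesD: "x \<in> cocycles A \<Longrightarrow> x \<in> carrier A" "x \<in> cocycles A \<Longrightarrow> diff A x = \<zero>\<^bsub>A\<^esub>"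
  by (auto simp: cocycles_def)

lemma coboundary_cocycle: "x \<in> coboundaries A \<Longrightarrow> x \<in> cocycles A"
  by (auto simp: coboundaries_def cocycles_def diff_closed diff_diff)

lemma cocycles_closed:
  "\<zero>\<^bsub>A\<^esub> \<in> cocycles A" "x \<in> cocycles A \<Longrightarrow> y \<in> cocycles A \<Longrightarrow> x \<oplus>\<^bsub>A\<^esub> y \<in> cocycles A"
  "x \<in> cocycles A \<Longrightarrow> \<ominus>\<^bsub>A\<^esub> x \<in> cocycles A"
  "x \<in> cocycles A \<Longrightarrow> y \<in> cocycles A \<Longrightarrow> x \<ominus>\<^bsub>A\<^esub> y \<in> cocycles A"
  "c \<in> carrier K \<Longrightarrow> x \<in> cocycles A \<Longrightarrow> c \<odot>\<^bsub>A\<^esub> x \<in> cocycles A"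
  "\<one>\<^bsub>A\<^esub> \<in> cocycles A"
  "r \<in> carrier (power_algebra K m) \<Longrightarrow> iota A r \<in> cocycles A"
proof -
  show "\<zero>\<^bsub>A\<^esub> \<in> cocycles A" by (simp add: cocycles_def)
  show "x \<in> cocycles A \<Longrightarrow> y \<in> cocycles A \<Longrightarrow> x \<oplus>\<^bsub>A\<^esub> y \<in> cocycles A" by (simp add: cocycles_def diff_add)
  show *: "x \<in> cocycles A \<Longrightarrow> y \<in> cocycles A \<Longrightarrow> x \<ominus>\<^bsub>A\<^esub> y \<in> cocycles A" for x y
    unfolding cocycles_def by (simp add: diff_minus minus_zero_zero)
  show "\<ominus>\<^bsub>A\<^esub> x \<in> cocycles A" if "x \<in> cocycles A"
    using *[of "\<zero>\<^bsub>A\<^esub>" x] that by (simp add: cocycles_def a_minus_def)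
  show "c \<in> carrier K \<Longrightarrow> x \<in> cocycles A \<Longrightarrow> c \<odot>\<^bsub>A\<^esub> x \<in> cocycles A" by (simp add: cocycles_def diff_smult)
  show i: "r \<in> carrier (power_algebra K m) \<Longrightarrow> iota A r \<in> cocycles A" for r
    by (simp add: cocycles_def diff_iota iota_props)
  have "\<one>\<^bsub>power_algebra K m\<^esub> \<in> carrier (power_algebra K m)" by (auto simp: power_algebra_def)
  from i[OF this] iota_props(5)[OF this] show "\<one>\<^bsub>A\<^esub> \<in> cocycles A" by simp
qed

lemma coboundaries_closed:
  "\<zero>\<^bsub>A\<^esub> \<in> coboundaries A" "x \<in> coboundaries A \<Longrightarrow> y \<in> coboundaries A \<Longrightarrow> x \<oplus>\<^bsub>A\<^esub> y \<in> coboundaries A"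
  "x \<in> coboundaries A \<Longrightarrow> \<ominus>\<^bsub>A\<^esub> x \<in> coboundaries A"
  "x \<in> coboundaries A \<Longrightarrow> y \<in> coboundaries A \<Longrightarrow> x \<ominus>\<^bsub>A\<^esub> y \<in> coboundaries A"
  "c \<in> carrier K \<Longrightarrow> x \<in> coboundaries A \<Longrightarrow> c \<odot>\<^bsub>A\<^esub> x \<in> coboundaries A"
proof -
  show "\<zero>\<^bsub>A\<^esub> \<in> coboundaries A" unfolding coboundaries_def using diff_zero by (metis A.zero_closed image_eqI)
  show "x \<in> coboundaries A \<Longrightarrow> y \<in> coboundaries A \<Longrightarrow> x \<oplus>\<^bsub>A\<^esub> y \<in> coboundaries A"
    unfolding coboundaries_def by (auto simp: diff_add[symmetric])
  show *: "x \<in> coboundaries A \<Longrightarrow> y \<in> coboundaries A \<Longrightarrow> x \<ominus>\<^bsub>A\<^esub> y \<in> coboundaries A" for x y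
    unfolding coboundaries_def by (auto simp: diff_minus[symmetric])
  show "c \<in> carrier K \<Longrightarrow> x \<in> coboundaries A \<Longrightarrow> c \<odot>\<^bsub>A\<^esub> x \<in> coboundaries A"
    unfolding coboundaries_def by (auto simp: diff_smult[symmetric])
  show "\<ominus>\<^bsub>A\<^esub> x \<in> coboundaries A" if "x \<in> coboundaries A"
    using *[of "\<zero>\<^bsub>A\<^esub>" x] that \<open>\<zero>\<^bsub>A\<^esub> \<in> coboundaries A\<close> cocyclesD(1)[OF coboundary_cocycle[OF that]]
    by (simp add: a_minus_def)
qed

text \<open>The Leibniz rule is available only for a homogeneous left factor. Splitting that factor
  extends its consequences to arbitrary cocycles.\<close>

lemma diff_mult_split:
  assumes "x \<in> carrier A" "y \<in> carrier A"
  shows "diff A (x \<otimes>\<^bsub>A\<^esub> y) = (\<Oplus>\<^bsub>A\<^esub> p\<in>{p. hcomp x p \<noteq> \<zero>\<^bsub>A\<^esub>}. diff A (hcomp x p \<otimes>\<^bsub>A\<^esub> y))"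
proof -
  note h = hcomp[OF assms(1)]
  have hc: "hcomp x q \<in> carrier A" for q using h(1) by auto
  have "x \<otimes>\<^bsub>A\<^esub> y = (\<Oplus>\<^bsub>A\<^esub> p\<in>{p. hcomp x p \<noteq> \<zero>\<^bsub>A\<^esub>}. hcomp x p \<otimes>\<^bsub>A\<^esub> y)"
    using h(2) hc assms(2) by (subst A.finsum_ldistr[symmetric]) (auto simp: h(3)[symmetric])
  then show ?thesis using hc assms(2) by (simp add: diff_finsum Pi_def)
qed

lemma finsum_coboundary: "(\<And>x. x \<in> S \<Longrightarrow> F x \<in> coboundaries A) \<Longrightarrow> (\<Oplus>\<^bsub>A\<^esub> x\<in>S. F x) \<in> coboundaries A"
proof (induction S rule: infinite_finite_induct)
  case (insert x S)
  then have "F y \<in> carrier A" if "y \<in> insert x S" for y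
    using coboundary_cocycle cocyclesD(1) that by blast
  then show ?case using insert by (subst A.finsum_insert) (auto intro!: coboundaries_closed)
qed (simp_all add: coboundaries_closed A.finsum_infinite)

lemma cocycles_mult:
  assumes x: "x \<in> cocycles A" and y: "y \<in> cocycles A"
  shows "x \<otimes>\<^bsub>A\<^esub> y \<in> cocycles A"
proof -
  have c: "x \<in> carrier A" "y \<in> carrier A" "diff A y = \<zero>\<^bsub>A\<^esub>" using x y by (auto simp: cocycles_def)
  have "diff A (hcomp x p \<otimes>\<^bsub>A\<^esub> y) = \<zero>\<^bsub>A\<^esub>" for p
    using diff_mult[OF hcomp(1)[OF c(1)] c(2), of p] cocyclesD[OF cocycle_hcomp[OF x, of p]] c
    by (simp add: minus_zero_zero)
  then show ?thesis using diff_mult_split[OF c(1,2)] c by (simp add: cocycles_def)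
qed

lemma coboundaries_ideal:
  assumes x: "x \<in> coboundaries A" and y: "y \<in> cocycles A"
  shows "x \<otimes>\<^bsub>A\<^esub> y \<in> coboundaries A" "y \<otimes>\<^bsub>A\<^esub> x \<in> coboundaries A"
proof -
  obtain a where a: "a \<in> carrier A" "x = diff A a" using x by (auto simp: coboundaries_def)
  have c: "y \<in> carrier A" "diff A y = \<zero>\<^bsub>A\<^esub>" using y by (auto simp: cocycles_def)
  note ha = hcomp[OF a(1)] and hy = hcomp[OF c(1)]
  have hac: "hcomp a q \<in> carrier A" and hyc: "hcomp y q \<in> carrier A" for q using ha(1) hy(1) by auto
  have "diff A (a \<otimes>\<^bsub>A\<^esub> y) = (\<Oplus>\<^bsub>A\<^esub> p\<in>{p. hcomp a p \<noteq> \<zero>\<^bsub>A\<^esub>}. diff A (hcomp a p) \<otimes>\<^bsub>A\<^esub> y)"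
    unfolding diff_mult_split[OF a(1) c(1)]
    using diff_mult[OF ha(1) c(1)] hac c diff_closed by (intro A.finsum_cong') (auto simp: a_minus_def)
  also have "\<dots> = diff A (\<Oplus>\<^bsub>A\<^esub> p\<in>{p. hcomp a p \<noteq> \<zero>\<^bsub>A\<^esub>}. hcomp a p) \<otimes>\<^bsub>A\<^esub> y"
    using hac c ha(2) diff_closed by (subst diff_finsum, simp) (subst A.finsum_ldistr, auto)
  finally show "x \<otimes>\<^bsub>A\<^esub> y \<in> coboundaries A"
    using ha(3) a c unfolding coboundaries_def by (metis A.m_closed image_eqI)
  \<comment> \<open>Left multiplication by a homogeneous cocycle commutes with the differential up
    to sign, and coboundaries are closed under negation.\<close>
  have "hcomp y p \<otimes>\<^bsub>A\<^esub> x \<in> coboundaries A" for p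
  proof -
    have "diff A (hcomp y p) = \<zero>\<^bsub>A\<^esub>" using cocycle_hcomp[OF y] by (simp add: cocycles_def)
    then have "diff A (hcomp y p \<otimes>\<^bsub>A\<^esub> a) = hcomp y p \<otimes>\<^bsub>A\<^esub> x \<or> diff A (hcomp y p \<otimes>\<^bsub>A\<^esub> a) = \<ominus>\<^bsub>A\<^esub> (hcomp y p \<otimes>\<^bsub>A\<^esub> x)"
      using diff_mult[OF hy(1) a(1), of p] hyc a diff_closed by (auto simp: a_minus_def)
    moreover have "diff A (hcomp y p \<otimes>\<^bsub>A\<^esub> a) \<in> coboundaries A" unfolding coboundaries_def using hyc a by simp
    ultimately show ?thesis using coboundaries_closed(3)[of "\<ominus>\<^bsub>A\<^esub> (hcomp y p \<otimes>\<^bsub>A\<^esub> x)"] hyc a diff_closed by auto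
  qed
  moreover have "y \<otimes>\<^bsub>A\<^esub> x = (\<Oplus>\<^bsub>A\<^esub> p\<in>{p. hcomp y p \<noteq> \<zero>\<^bsub>A\<^esub>}. hcomp y p \<otimes>\<^bsub>A\<^esub> x)"
    using hy(2) hyc a diff_closed by (subst A.finsum_ldistr[symmetric]) (auto simp: hy(3)[symmetric])
  ultimately show "y \<otimes>\<^bsub>A\<^esub> x \<in> coboundaries A" by (auto intro: finsum_coboundary)
qed

text \<open>The record whose quotient defines \<open>cohomology\<close>. Once it is a ring with the
  coboundaries as an ideal, the calculus of cosets applies.\<close>

abbreviation "Zalg \<equiv> A\<lparr>carrier := cocycles A, grade := (\<lambda>p. grade A p \<inter> cocycles A)\<rparr>"

definition cls :: "'a \<Rightarrow> 'a set" where "cls x = coboundaries A +>\<^bsub>A\<^esub> x"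

lemma cls_eq: "cls x = (\<lambda>b. b \<oplus>\<^bsub>A\<^esub> x) ` coboundaries A"
  by (auto simp: cls_def a_r_coset_def r_coset_def)

lemma ring_Zalg: "ring Zalg"
proof (rule ringI)
  show "abelian_group Zalg"
  proof (rule abelian_groupI)
    fix x assume "x \<in> carrier Zalg"
    then have "\<ominus>\<^bsub>A\<^esub> x \<in> carrier Zalg \<and> \<ominus>\<^bsub>A\<^esub> x \<oplus>\<^bsub>Zalg\<^esub> x = \<zero>\<^bsub>Zalg\<^esub>" by (simp add: cocycles_closed cocyclesD A.l_neg)
    then show "\<exists>y\<in>carrier Zalg. y \<oplus>\<^bsub>Zalg\<^esub> x = \<zero>\<^bsub>Zalg\<^esub>" by blast
  qed (auto simp: cocycles_closed cocyclesD A.a_ac)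
qed (auto intro!: monoidI simp: cocycles_closed cocycles_mult cocyclesD A.m_assoc A.l_distr A.r_distr)

lemma ideal_Zalg: "ideal (coboundaries A) Zalg"
proof (rule idealI[OF ring_Zalg])
  interpret Z: ring Zalg by (rule ring_Zalg)
  show "subgroup (coboundaries A) (add_monoid Zalg)"
  proof (rule Z.add.subgroupI)
    fix a assume a: "a \<in> coboundaries A"
    then have ac: "a \<in> cocycles A" by (rule coboundary_cocycle)
    have "\<ominus>\<^bsub>Zalg\<^esub> a = \<ominus>\<^bsub>A\<^esub> a"
      using Z.minus_equality[of "\<ominus>\<^bsub>A\<^esub> a" a] ac by (simp add: cocycles_closed cocyclesD A.l_neg)
    then show "\<ominus>\<^bsub>Zalg\<^esub> a \<in> coboundaries A" using a by (simp add: coboundaries_closed)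
  qed (use coboundaries_closed in \<open>auto simp: coboundary_cocycle\<close>)
qed (use coboundaries_ideal in auto)

lemma coset_Zalg: "coboundaries A +>\<^bsub>Zalg\<^esub> x = cls x"
  by (simp add: cls_def a_r_coset_def r_coset_def)

lemma cohomology_carrier: "carrier (cohomology A) = cls ` cocycles A"
proof -
  have "carrier (cohomology A) = a_rcosets\<^bsub>Zalg\<^esub> (coboundaries A)"
    by (simp add: cohomology_def galg_quot_def FactRing_def)
  also have "\<dots> = cls ` cocycles A"
    unfolding A_RCOSETS_def RCOSETS_def using coset_Zalg by (auto simp: a_r_coset_def)
  finally show ?thesis .
qed

text \<open>The added coboundaries matter for \<open>c = \<zero>\<close>, where the image of the
  coset is a single element and not a coset.\<close>

lemma cls_coset_smult:
  assumes c: "c \<in> carrier K" and x: "x \<in> cocycles A"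
  shows "coboundaries A <+>\<^bsub>A\<^esub> ((\<lambda>x. c \<odot>\<^bsub>A\<^esub> x) ` cls x) = cls (c \<odot>\<^bsub>A\<^esub> x)"
proof (rule Set.set_eqI, rule iffI)
  note D = cocyclesD(1)[OF coboundary_cocycle]
  have xc: "x \<in> carrier A" using x by (rule cocyclesD)
  fix y
  {
    assume "y \<in> coboundaries A <+>\<^bsub>A\<^esub> ((\<lambda>x. c \<odot>\<^bsub>A\<^esub> x) ` cls x)"
    then obtain b b' where b: "b \<in> coboundaries A" "b' \<in> coboundaries A" "y = b \<oplus>\<^bsub>A\<^esub> c \<odot>\<^bsub>A\<^esub> (b' \<oplus>\<^bsub>A\<^esub> x)"
      by (auto simp: set_add_def set_mult_def cls_eq)
    then have "y = (b \<oplus>\<^bsub>A\<^esub> c \<odot>\<^bsub>A\<^esub> b') \<oplus>\<^bsub>A\<^esub> c \<odot>\<^bsub>A\<^esub> x"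
      using c xc D by (simp add: smult_r_distr A.a_assoc)
    moreover have "b \<oplus>\<^bsub>A\<^esub> c \<odot>\<^bsub>A\<^esub> b' \<in> coboundaries A" using b c by (simp add: coboundaries_closed)
    ultimately show "y \<in> cls (c \<odot>\<^bsub>A\<^esub> x)" by (auto simp: cls_eq)
  next
    assume "y \<in> cls (c \<odot>\<^bsub>A\<^esub> x)"
    then obtain b where b: "b \<in> coboundaries A" "y = b \<oplus>\<^bsub>A\<^esub> c \<odot>\<^bsub>A\<^esub> x" by (auto simp: cls_eq)
    have "x \<in> cls x" unfolding cls_eq using coboundaries_closed(1) xc by (force simp: image_iff)
    then show "y \<in> coboundaries A <+>\<^bsub>A\<^esub> ((\<lambda>x. c \<odot>\<^bsub>A\<^esub> x) ` cls x)"
      using b by (auto simp: set_add_def set_mult_def)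
  }
qed

lemma cohomology_ops:
  assumes x: "x \<in> cocycles A" and y: "y \<in> cocycles A"
  shows "cls x \<otimes>\<^bsub>cohomology A\<^esub> cls y = cls (x \<otimes>\<^bsub>A\<^esub> y)"
    and "cls x \<oplus>\<^bsub>cohomology A\<^esub> cls y = cls (x \<oplus>\<^bsub>A\<^esub> y)"
    and "cls x = cls y \<longleftrightarrow> x \<ominus>\<^bsub>A\<^esub> y \<in> coboundaries A"
proof -
  interpret I: ideal "coboundaries A" Zalg by (rule ideal_Zalg)
  have c: "x \<in> carrier A" "y \<in> carrier A" using x y by (auto simp: cocyclesD)
  show "cls x \<otimes>\<^bsub>cohomology A\<^esub> cls y = cls (x \<otimes>\<^bsub>A\<^esub> y)"
    using I.rcoset_mult_add[of x y] x y
    by (simp add: cohomology_def galg_quot_def FactRing_def coset_Zalg)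
  show "cls x \<oplus>\<^bsub>cohomology A\<^esub> cls y = cls (x \<oplus>\<^bsub>A\<^esub> y)"
    using I.a_rcos_sum[of x y] x y
    by (simp add: cohomology_def galg_quot_def FactRing_def coset_Zalg)
  show "cls x = cls y \<longleftrightarrow> x \<ominus>\<^bsub>A\<^esub> y \<in> coboundaries A"
  proof
    assume "cls x = cls y"
    moreover have "x \<in> cls x" unfolding cls_eq using coboundaries_closed(1) c by (force simp: image_iff)
    ultimately obtain b where b: "b \<in> coboundaries A" "x = b \<oplus>\<^bsub>A\<^esub> y" by (auto simp: cls_eq)
    then have "x \<ominus>\<^bsub>A\<^esub> y = b" using c cocyclesD(1)[OF coboundary_cocycle[OF b(1)]]
      by (simp add: a_minus_def A.a_assoc A.r_neg)
    then show "x \<ominus>\<^bsub>A\<^esub> y \<in> coboundaries A" using b by simp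
  next
    assume a: "x \<ominus>\<^bsub>A\<^esub> y \<in> coboundaries A"
    have "cls x = cls y" if a: "x \<ominus>\<^bsub>A\<^esub> y \<in> coboundaries A" and x: "x \<in> carrier A" and y: "y \<in> carrier A" for x y
    proof -
      have xy: "x = (x \<ominus>\<^bsub>A\<^esub> y) \<oplus>\<^bsub>A\<^esub> y" using x y by (simp add: a_minus_def A.a_assoc A.l_neg)
      note D = cocyclesD(1)[OF coboundary_cocycle]
      show ?thesis unfolding cls_eq
      proof (rule Set.set_eqI, rule iffI)
        fix z assume "z \<in> (\<lambda>b. b \<oplus>\<^bsub>A\<^esub> x) ` coboundaries A"
        then obtain b where b: "b \<in> coboundaries A" "z = b \<oplus>\<^bsub>A\<^esub> x" by auto
        then have "z = (b \<oplus>\<^bsub>A\<^esub> (x \<ominus>\<^bsub>A\<^esub> y)) \<oplus>\<^bsub>A\<^esub> y" using xy D a x y by (metis A.a_assoc)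
        then show "z \<in> (\<lambda>b. b \<oplus>\<^bsub>A\<^esub> y) ` coboundaries A" using b a coboundaries_closed(2) by blast
      next
        fix z assume "z \<in> (\<lambda>b. b \<oplus>\<^bsub>A\<^esub> y) ` coboundaries A"
        then obtain b where b: "b \<in> coboundaries A" "z = b \<oplus>\<^bsub>A\<^esub> y" by auto
        have "(b \<ominus>\<^bsub>A\<^esub> (x \<ominus>\<^bsub>A\<^esub> y)) \<oplus>\<^bsub>A\<^esub> x = b \<oplus>\<^bsub>A\<^esub> y"
          using D[OF b(1)] x y
          by (simp add: a_minus_def A.minus_add A.a_ac A.r_neg) (metis A.a_comm A.a_inv_closed A.a_lcomm A.r_neg A.r_zero)
        then show "z \<in> (\<lambda>b. b \<oplus>\<^bsub>A\<^esub> x) ` coboundaries A" using b a coboundaries_closed(4) by (metis image_eqI)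
      qed
    qed
    then show "cls x = cls y" using a c by blast
  qed
qed

lemma cohomology_smult:
  "c \<in> carrier K \<Longrightarrow> x \<in> cocycles A \<Longrightarrow> c \<odot>\<^bsub>cohomology A\<^esub> cls x = cls (c \<odot>\<^bsub>A\<^esub> x)"
  using cls_coset_smult[of c x]
  by (simp add: cohomology_def galg_quot_def set_add_def set_mult_def)

lemma cohomology_consts:
  "\<one>\<^bsub>cohomology A\<^esub> = cls \<one>\<^bsub>A\<^esub>" "\<zero>\<^bsub>cohomology A\<^esub> = cls \<zero>\<^bsub>A\<^esub>"
  "grade (cohomology A) p = cls ` (grade A p \<inter> cocycles A)" "iota (cohomology A) r = cls (iota A r)"
proof -
  have "cls \<zero>\<^bsub>A\<^esub> = coboundaries A"
  proof -
    have "(\<lambda>b. b \<oplus>\<^bsub>A\<^esub> \<zero>\<^bsub>A\<^esub>) ` coboundaries A = (\<lambda>b. b) ` coboundaries A"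
      using cocyclesD(1)[OF coboundary_cocycle] by (intro image_cong) auto
    then show ?thesis by (simp add: cls_eq)
  qed
  then show "\<zero>\<^bsub>cohomology A\<^esub> = cls \<zero>\<^bsub>A\<^esub>" by (simp add: cohomology_def galg_quot_def FactRing_def)
qed (simp_all add: cohomology_def galg_quot_def FactRing_def coset_Zalg)

lemma cls_zero_iff: "x \<in> cocycles A \<Longrightarrow> cls x = cls \<zero>\<^bsub>A\<^esub> \<longleftrightarrow> x \<in> coboundaries A"
  using cohomology_ops(3)[OF _ cocycles_closed(1), of x] cocyclesD(1)[of x] by (simp add: a_minus_def)

end

section \<open>Dga morphisms and a criterion for quasi-isomorphisms\<close>

locale dga_morphism = A: diff_graded_algebra K m A + B: diff_graded_algebra K m B
  for K :: "('k, 'e) ring_scheme" and m A B +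
  fixes f
  assumes f_hom: "f \<in> dga_hom K m A B"
begin

lemma f_props:
  shows "x \<in> carrier A \<Longrightarrow> f x \<in> carrier B"
    and "x \<in> carrier A \<Longrightarrow> y \<in> carrier A \<Longrightarrow> f (x \<otimes>\<^bsub>A\<^esub> y) = f x \<otimes>\<^bsub>B\<^esub> f y"
    and "x \<in> carrier A \<Longrightarrow> y \<in> carrier A \<Longrightarrow> f (x \<oplus>\<^bsub>A\<^esub> y) = f x \<oplus>\<^bsub>B\<^esub> f y"
    and "c \<in> carrier K \<Longrightarrow> x \<in> carrier A \<Longrightarrow> f (c \<odot>\<^bsub>A\<^esub> x) = c \<odot>\<^bsub>B\<^esub> f x"
    and "f \<one>\<^bsub>A\<^esub> = \<one>\<^bsub>B\<^esub>"
    and "x \<in> grade A p \<Longrightarrow> f x \<in> grade B p"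
    and "r \<in> carrier (power_algebra K m) \<Longrightarrow> f (iota A r) = iota B r"
    and "x \<in> carrier A \<Longrightarrow> f (diff A x) = diff B (f x)"
proof -
  show "x \<in> grade A p \<Longrightarrow> f x \<in> grade B p"
    using f_hom unfolding dga_hom_def galg_hom_def by blast
qed (use f_hom in \<open>auto simp: dga_hom_def galg_hom_def alg_hom_def ring_hom_def\<close>)

lemma f_zero: "f \<zero>\<^bsub>A\<^esub> = \<zero>\<^bsub>B\<^esub>"
  using f_props(4)[of "\<zero>\<^bsub>K\<^esub>" "\<zero>\<^bsub>A\<^esub>"] f_props(1)[of "\<zero>\<^bsub>A\<^esub>"] by simp

lemma f_minus: "x \<in> carrier A \<Longrightarrow> y \<in> carrier A \<Longrightarrow> f (x \<ominus>\<^bsub>A\<^esub> y) = f x \<ominus>\<^bsub>B\<^esub> f y"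
proof -
  assume x: "x \<in> carrier A" and y: "y \<in> carrier A"
  have "f (\<ominus>\<^bsub>A\<^esub> y) \<oplus>\<^bsub>B\<^esub> f y = \<zero>\<^bsub>B\<^esub>"
    using f_props(3)[of "\<ominus>\<^bsub>A\<^esub> y" y] y f_zero by (simp add: A.A.l_neg)
  then have "f (\<ominus>\<^bsub>A\<^esub> y) = \<ominus>\<^bsub>B\<^esub> f y" using y f_props(1) by (metis A.A.a_inv_closed B.A.minus_equality)
  then show ?thesis using x y by (simp add: a_minus_def f_props)
qed

lemma f_cocycle: "x \<in> cocycles A \<Longrightarrow> f x \<in> cocycles B"
  using f_props(1,8)[of x] f_zero by (auto simp: cocycles_def)

lemma f_coboundary: "x \<in> coboundaries A \<Longrightarrow> f x \<in> coboundaries B"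
  using f_props(1,8) by (auto simp: coboundaries_def)

lemma cohomology_map_cls:
  assumes x: "x \<in> cocycles A"
  shows "cohomology_map B f (A.cls x) = B.cls (f x)"
proof -
  have xc: "x \<in> carrier A" and fx: "f x \<in> carrier B" using A.cocyclesD[OF x] f_props(1) by auto
  note DA = A.cocyclesD(1)[OF A.coboundary_cocycle] and DB = B.cocyclesD(1)[OF B.coboundary_cocycle]
  show ?thesis
  proof (rule Set.set_eqI, rule iffI)
    fix y assume "y \<in> cohomology_map B f (A.cls x)"
    then obtain b a where b: "b \<in> coboundaries B" "a \<in> coboundaries A" "y = b \<oplus>\<^bsub>B\<^esub> f (a \<oplus>\<^bsub>A\<^esub> x)"
      by (auto simp: cohomology_map_def set_add_def set_mult_def A.cls_eq)
    then have "y = (b \<oplus>\<^bsub>B\<^esub> f a) \<oplus>\<^bsub>B\<^esub> f x" using f_props(1)[OF DA[OF b(2)]] DB[OF b(1)] DA[OF b(2)] xc fx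
      by (simp add: f_props(3) B.A.a_assoc)
    then show "y \<in> B.cls (f x)"
      using b f_coboundary[OF b(2)] B.coboundaries_closed(2) by (auto simp: B.cls_eq)
  next
    fix y assume "y \<in> B.cls (f x)"
    then obtain b where b: "b \<in> coboundaries B" "y = b \<oplus>\<^bsub>B\<^esub> f x" by (auto simp: B.cls_eq)
    have "x \<in> A.cls x" unfolding A.cls_eq using A.coboundaries_closed(1) xc by (force simp: image_iff)
    then show "y \<in> cohomology_map B f (A.cls x)"
      using b by (auto simp: cohomology_map_def set_add_def set_mult_def)
  qed
qed

text \<open>The form in which \<open>Q\<close> is later compared with \<open>B\<close>. The
  algebraic structure on classes is inherited from \<open>f\<close>, so only bijectivity is left,
  and that is tested on representatives.\<close>

lemma quasi_iso_criterion:
  assumes inj: "\<And>z. z \<in> cocycles A \<Longrightarrow> f z \<in> coboundaries B \<Longrightarrow> z \<in> coboundaries A"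
    and surj: "\<And>z. z \<in> cocycles B \<Longrightarrow> \<exists>y \<in> cocycles A. z \<ominus>\<^bsub>B\<^esub> f y \<in> coboundaries B"
  shows "f \<in> quasi_isos K m A B"
proof -
  let ?g = "cohomology_map B f"
  have carr: "?g X \<in> carrier (cohomology B)" if "X \<in> carrier (cohomology A)" for X
    using that by (auto simp: A.cohomology_carrier B.cohomology_carrier cohomology_map_cls f_cocycle)
  have hom: "?g \<in> galg_hom K m (cohomology A) (cohomology B)"
    unfolding galg_hom_def alg_hom_def ring_hom_def
    by (auto simp: A.cohomology_carrier B.cohomology_carrier cohomology_map_cls f_cocycle
      A.cohomology_ops(1,2) B.cohomology_ops(1,2) A.cohomology_smult B.cohomology_smult A.cohomology_consts B.cohomology_consts A.cocycles_closed A.cocycles_mult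
      A.cocyclesD f_props intro!: imageI)
  have "inj_on ?g (carrier (cohomology A))"
  proof (rule inj_onI)
    fix X Y assume "X \<in> carrier (cohomology A)" "Y \<in> carrier (cohomology A)" and eq: "?g X = ?g Y"
    then obtain x y where x: "X = A.cls x" "x \<in> cocycles A" and y: "Y = A.cls y" "y \<in> cocycles A"
      by (auto simp: A.cohomology_carrier)
    have "f x \<ominus>\<^bsub>B\<^esub> f y \<in> coboundaries B"
      using eq x y by (simp add: cohomology_map_cls B.cohomology_ops(3) f_cocycle)
    then have "x \<ominus>\<^bsub>A\<^esub> y \<in> coboundaries A"
      using x y by (intro inj) (simp_all add: A.cocycles_closed f_minus A.cocyclesD)
    then show "X = Y" using x y by (simp add: A.cohomology_ops(3))
  qed
  moreover have "?g ` carrier (cohomology A) = carrier (cohomology B)"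
  proof
    show "carrier (cohomology B) \<subseteq> ?g ` carrier (cohomology A)"
    proof
      fix Z assume "Z \<in> carrier (cohomology B)"
      then obtain z where z: "Z = B.cls z" "z \<in> cocycles B" by (auto simp: B.cohomology_carrier)
      obtain y where y: "y \<in> cocycles A" "z \<ominus>\<^bsub>B\<^esub> f y \<in> coboundaries B" using surj z by blast
      then have "Z = ?g (A.cls y)"
        using z by (simp add: cohomology_map_cls B.cohomology_ops(3) f_cocycle)
      then show "Z \<in> ?g ` carrier (cohomology A)" using y by (auto simp: A.cohomology_carrier)
    qed
  qed (use carr in auto)
  ultimately show ?thesis
    using hom f_hom by (simp add: quasi_isos_def galg_iso_def bij_betw_def)
qed

end

section \<open>The cobar differential on words\<close>

lemma frag_cmul_diff_distrib2: "frag_cmul c (a - b) = frag_cmul c a - frag_cmul c b"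
  by (rule poly_mapping_eqI) (simp add: lookup_minus right_diff_distrib)

text \<open>Signs are computed in the free abelian group on words, where linear arithmetic is
  automatic; \<open>ev\<close> carries the results to \<open>K\<close> afterwards.\<close>

abbreviation fkeys :: "('a \<Rightarrow>\<^sub>0 int) \<Rightarrow> 'a set" where "fkeys \<equiv> Poly_Mapping.keys"

lemma fkeys_intros:
  "fkeys (0 :: 'a \<Rightarrow>\<^sub>0 int) \<subseteq> S"
  "fkeys a \<subseteq> S \<Longrightarrow> fkeys b \<subseteq> S \<Longrightarrow> fkeys (a + b) \<subseteq> S"
  "fkeys a \<subseteq> S \<Longrightarrow> fkeys b \<subseteq> S \<Longrightarrow> fkeys (a - b) \<subseteq> S"
  "fkeys a \<subseteq> S \<Longrightarrow> fkeys (frag_cmul c a) \<subseteq> S"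
  "w \<in> S \<Longrightarrow> fkeys (frag_of w) \<subseteq> S"
  using Poly_Mapping.keys_add[of a b] keys_diff[of a b] by (auto dest: subsetD)

lemma fkeys_extend: "(\<And>w. w \<in> fkeys a \<Longrightarrow> fkeys (f w) \<subseteq> S) \<Longrightarrow> fkeys (frag_extend f a) \<subseteq> S"
  using keys_frag_extend[of f a] by blast

definition adj :: "nat \<Rightarrow> nat \<Rightarrow> bool" where "adj i j \<longleftrightarrow> j = Suc i \<or> i = Suc j"

definition letter_degree :: "nat \<Rightarrow> nat \<Rightarrow> nat \<Rightarrow> int" where
  "letter_degree n i j = (if i = j then int n else edge_degree n i j)"

lemma adj_sym: "adj i j \<longleftrightarrow> adj j i" and adj_irrefl [simp]: "\<not> adj i i"
  by (auto simp: adj_def)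

lemma letter_degree_adj: "adj i j \<Longrightarrow> letter_degree n i j + letter_degree n j i = letter_degree n i i"
  by (auto simp: adj_def letter_degree_def edge_degree_def)

text \<open>
  The letter \<open>nd i s\<close> is the vertex \<open>i\<close>, marked as a product sign if \<open>s\<close> holds and as a bar
  otherwise.  Words begin and end with product signs, so that they multiply like paths.
\<close>

locale letters =
  fixes nd :: "nat \<Rightarrow> bool \<Rightarrow> 'x" and ver :: "'x \<Rightarrow> nat" and sp :: "'x \<Rightarrow> bool" and m n :: nat
  assumes ver_nd [simp]: "ver (nd i s) = i" and sp_nd [simp]: "sp (nd i s) = s"
begin

abbreviation "ld x y \<equiv> letter_degree n (ver x) (ver y)"

abbreviation "spl y \<equiv> nd (ver y) True"
abbreviation "joi y \<equiv> nd (ver y) False"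

text \<open>The Koszul sign for moving an operator of degree one past the letter from
  \<open>x\<close> to \<open>y\<close>. In \<open>sgs\<close> a bar at \<open>y\<close> shifts the
  degree of the letter by one and so reverses the sign.\<close>

definition sg :: "'x \<Rightarrow> 'x \<Rightarrow> int" where "sg x y = (if even (ld x y) then 1 else -1)"

abbreviation "sgs x y \<equiv> sg x y * (if sp y then 1 else -1)"

text \<open>An arrow followed by its reverse: among basis elements other than idempotents, these are
  the only pairs with nonzero product.\<close>

definition tn :: "'x \<Rightarrow> 'x \<Rightarrow> 'x \<Rightarrow> bool" where "tn x y z \<longleftrightarrow> ver x = ver z \<and> adj (ver x) (ver y)"

abbreviation pre :: "'x \<Rightarrow> ('x list \<Rightarrow>\<^sub>0 int) \<Rightarrow> 'x list \<Rightarrow>\<^sub>0 int" where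
  "pre x \<equiv> frag_extend (\<lambda>w. frag_of (x # w))"

text \<open>
  A bar at \<open>y\<close> becomes a product sign, or else the two basis elements of \<open>A\<close> which meet at \<open>y\<close>
  are multiplied.  Their product is nonzero only if they are an arrow and its reverse; it is then
  the loop at \<open>x\<close>, which is encoded by removing \<open>y\<close> from the list.
\<close>

fun F :: "'x \<Rightarrow> 'x list \<Rightarrow> 'x list \<Rightarrow>\<^sub>0 int" where
  "F x (y # z # ws) = (if sp y then 0 else
     frag_cmul (sg x y) (frag_of (x # spl y # z # ws) - (if tn x y z then frag_of (x # z # ws) else 0)))"
| "F x _ = 0"

text \<open>Either the vertex \<open>y\<close> is acted upon, or the first letter is passed with its
  Koszul sign. The first vertex itself is never touched.\<close>

fun D :: "'x list \<Rightarrow> 'x list \<Rightarrow>\<^sub>0 int" where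
  "D (x # y # v) = F x (y # v) + frag_cmul (sgs x y) (pre x (D (y # v)))"
| "D _ = 0"

text \<open>A block with letters of degrees \<open>a_1, ..., a_k\<close> is a desuspended element of
  the bar construction, of degree \<open>a_1 + ... + a_k - (k - 1)\<close>: each of its
  \<open>k - 1\<close> bars costs one.\<close>

fun wdeg :: "'x list \<Rightarrow> int" where
  "wdeg (x # y # v) = ld x y - (if sp y then 0 else 1) + wdeg (y # v)"
| "wdeg _ = 0"

text \<open>The sign is chosen so that opening the new bar again, with the sign in \<open>F\<close>,
  returns the word itself.\<close>

fun H :: "'x list \<Rightarrow> 'x list \<Rightarrow>\<^sub>0 int" where
  "H (x # y # z # ws) = (if sp y then frag_cmul (sg x y) (frag_of (x # joi y # z # ws)) else 0)"
| "H _ = 0"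

lemma sg_ver: "ver x = ver x' \<Longrightarrow> ver y = ver y' \<Longrightarrow> sg x y = sg x' y'"
  by (simp add: sg_def)

lemma sg_cases: "sg x y = 1 \<or> sg x y = -1" by (simp add: sg_def)

lemma sg_sq [simp]: "sg x y * sg x y = 1" "sg x y * (sg x y * c) = c"
  by (simp_all add: sg_def)

lemma sg_tn: "tn x y z \<Longrightarrow> sg x z = sg x y * sg y z"
proof -
  assume t: "tn x y z"
  then have "ld x z = ld x y + ld y z" using letter_degree_adj[of "ver x" "ver y" n] by (simp add: tn_def) metis
  then show ?thesis by (simp add: sg_def)
qed

lemma D_keys: "fkeys (D (y # v)) \<subseteq> {w. \<exists>u. w = y # u \<and> u \<noteq> []}"
proof (induction v arbitrary: y)
  case (Cons z ws)
  have "fkeys (F y (z # ws)) \<subseteq> {w. \<exists>u. w = y # u \<and> u \<noteq> []}"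
  proof (cases ws)
    case (Cons a ws')
    then show ?thesis
      by (auto dest!: subsetD[OF keys_diff])
  qed simp
  moreover have "fkeys (frag_cmul (sgs y z) (pre y (D (z # ws)))) \<subseteq> {w. \<exists>u. w = y # u \<and> u \<noteq> []}"
    using Cons.IH[of z] by (intro fkeys_intros fkeys_extend) auto
  ultimately show ?case unfolding D.simps by (rule fkeys_intros)
qed simp

text \<open>The mark of the first vertex never enters \<open>D\<close>. This lets the tails of a
  word before and after \<open>H\<close> be compared.\<close>

lemma D_head: "ver y = ver y' \<Longrightarrow> D (y # v) = frag_extend (\<lambda>w. frag_of (y # tl w)) (D (y' # v))"
proof (cases v)
  case (Cons z ws)
  assume e: "ver y = ver y'"
  have "F y (z # ws) = frag_extend (\<lambda>w. frag_of (y # tl w)) (F y' (z # ws))"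
    using e sg_ver[OF e, of z z]
    by (cases ws) (auto simp: frag_extend_cmul frag_extend_diff tn_def)
  moreover have "pre y a = frag_extend (\<lambda>w. frag_of (y # tl w)) (pre y' a)" for a :: "'x list \<Rightarrow>\<^sub>0 int"
    using frag_extend_compose[of "\<lambda>w. frag_of (y # tl w)" "\<lambda>w. y' # w" a] by (simp add: comp_def)
  ultimately show ?thesis
    using Cons e sg_ver[OF e, of z z] by (simp add: frag_extend_add frag_extend_cmul)
qed simp

lemma ext_D_pre:
  assumes "fkeys a \<subseteq> {w. \<exists>u. w = y # u \<and> u \<noteq> []}"
  shows "frag_extend D (pre x a) = frag_extend (F x) a + frag_cmul (sgs x y) (pre x (frag_extend D a))"
  using assms
proof (induction a rule: frag_induction)
  case (one w)
  then show ?case by (auto simp: frag_extend_of)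
next
  case (diff a b)
  then show ?case by (simp add: frag_extend_diff frag_cmul_diff_distrib2)
qed simp

lemma ext_F_pre:
  assumes "fkeys a \<subseteq> {w. \<exists>u. w = z # u \<and> u \<noteq> []}" "\<not> sp y"
  shows "frag_extend (F x) (pre y a) =
    frag_cmul (sg x y) (pre x (pre (spl y) a) - (if tn x y z then pre x a else 0))"
  using assms(1)
proof (induction a rule: frag_induction)
  case (one w)
  then show ?case using assms(2) by (auto simp: frag_extend_of)
next
  case (diff a b)
  then show ?case by (simp add: frag_extend_diff frag_cmul_diff_distrib2)
qed simp

text \<open>Collects the terms in which the neighbouring vertices \<open>y\<close> and
  \<open>z\<close> are both treated, in either order. Three basis elements other than idempotents
  have product zero, which is the content of \<open>na\<close>; so no associativity terms arise, and
  the rest cancels by \<open>sg_tn\<close>.\<close>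

lemma F_rest:
  assumes "\<not> sp y"
  shows "pre x (F (spl y) (z # ws)) - (if tn x y z then frag_cmul (sg x y) (F x (z # ws)) else 0)
     - frag_cmul (sg x y) (frag_extend (F x) (F y (z # ws))) = 0"
proof (cases "ws = [] \<or> sp z")
  case True
  then show ?thesis by (cases ws) auto
next
  case False
  then obtain a ws' where ws: "ws = a # ws'" and z: "\<not> sp z" by (cases ws) auto
  have s: "sg (spl y) z = sg y z" "sg x (spl y) = sg x y" by (simp_all add: sg_def)
  have t: "tn (spl y) z a = tn y z a" "tn x y (spl z) = tn x y z" by (simp_all add: tn_def)
  have na: "\<not> (tn x y a \<and> tn y z a)" "\<not> (tn x y z \<and> tn x z a)" by (auto simp: tn_def)
  show ?thesis
    using ws z assms s t na sg_tn[of x y z] sg_cases[of x y] sg_cases[of y z]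
    by (auto simp: frag_extend_cmul frag_extend_diff frag_cmul_diff_distrib2)
qed

text \<open>These are the terms of the square of \<open>D\<close> on \<open>x # y # z # ws\<close>
  in which \<open>y\<close> is treated at least once. The remaining ones vanish by induction in
  \<open>D_D\<close>.\<close>

lemma D_F:
  assumes y: "\<not> sp y"
  shows "frag_extend D (F x (y # z # ws)) + frag_cmul (sgs x y) (frag_extend (F x) (D (y # z # ws))) = 0"
proof -
  let ?B = "D (z # ws)" and ?s = "sg x y"
  note kB = D_keys[of z ws]
  have D1: "D (x # spl y # z # ws) = frag_cmul ?s (pre x (F (spl y) (z # ws) + frag_cmul (sgs y z) (pre (spl y) ?B)))"
    using sg_ver[of "spl y" y z z] sg_ver[of x x "spl y" y] by simp
  have D2: "D (x # z # ws) = F x (z # ws) + frag_cmul (sgs x z) (pre x ?B)" by simp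
  have D3: "frag_extend (F x) (D (y # z # ws)) = frag_extend (F x) (F y (z # ws)) +
     frag_cmul (sgs y z) (frag_cmul ?s (pre x (pre (spl y) ?B) - (if tn x y z then pre x ?B else 0)))"
    using ext_F_pre[OF kB y, of x] by (simp add: frag_extend_add frag_extend_cmul)
  show ?thesis
    unfolding D3 F.simps(1) using y F_rest[OF y, of x z ws] sg_tn[of x y z] sg_cases[of x y] sg_cases[of y z]
    apply (cases "tn x y z"; elim disjE)
    apply (simp_all only: D1 D2 if_True if_False frag_extend_cmul frag_extend_diff frag_extend_add frag_extend_of
         frag_cmul_one frag_cmul_minus_one frag_extend_minus frag_extend_0 frag_cmul_diff_distrib2 frag_cmul_distrib2)
    apply (simp_all add: algebra_simps frag_extend_minus frag_extend_add del: D.simps F.simps)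
    done
qed

lemma D_D: "frag_extend D (D w) = 0"
proof (induction w rule: D.induct)
  case (1 x y v)
  have "frag_extend D (F x (y # v)) + frag_cmul (sgs x y) (frag_extend (F x) (D (y # v))) = 0"
  proof (cases "v = [] \<or> sp y")
    case True
    then have "F x (y # v) = 0" by (cases v) auto
    moreover have "frag_extend (F x) (D (y # v)) = 0"
    proof (rule frag_extend_eq_0)
      fix w assume "w \<in> fkeys (D (y # v))"
      then obtain b u where "w = y # b # u" "v \<noteq> []" using D_keys[of y v]
        by (cases v) (auto simp: neq_Nil_conv)
      then show "F x w = 0" using True by auto
    qed
    ultimately show ?thesis by simp
  next
    case False
    then show ?thesis using D_F[of y x] by (cases v) (auto simp del: D.simps F.simps)
  qed
  then show ?case
    using 1 ext_D_pre[OF D_keys[of y v], of x] by (simp add: frag_extend_add frag_extend_cmul frag_cmul_distrib2)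
qed simp_all


lemma wdeg_append: "wdeg (us @ y # v) = wdeg (us @ [y]) + wdeg (y # v)"
  by (induction us rule: wdeg.induct) (cases v; auto)+

lemma F_append: "us \<noteq> [] \<Longrightarrow> F x (y # us @ v) = frag_extend (\<lambda>w. frag_of (w @ v)) (F x (y # us))"
  by (cases us) (auto simp: frag_extend_cmul frag_extend_diff)

text \<open>The graded Leibniz rule. A product sign is never acted upon, so no term straddles
  \<open>y\<close>.\<close>

lemma D_append:
  assumes "sp y"
  shows "D (us @ y # v) = frag_extend (\<lambda>w. frag_of (w @ v)) (D (us @ [y]))
    + frag_cmul (if even (wdeg (us @ [y])) then 1 else -1) (frag_extend (\<lambda>w. frag_of (us @ w)) (D (y # v)))"
proof (induction us rule: wdeg.induct)
  case (1 x x2 us)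
  let ?post = "frag_extend (\<lambda>w. frag_of (w @ v)) :: _ \<Rightarrow> 'x list \<Rightarrow>\<^sub>0 int"
  have pp: "pre x (?post a) = ?post (pre x a)" for a :: "'x list \<Rightarrow>\<^sub>0 int"
    using frag_extend_compose[of "\<lambda>w. frag_of (w @ v)" "\<lambda>w. x # w" a]
      frag_extend_compose[of "\<lambda>w. frag_of (x # w)" "\<lambda>w. w @ v" a] by (simp add: comp_def)
  have pl: "pre x (frag_extend (\<lambda>w. frag_of ((x2 # us) @ w)) a) = frag_extend (\<lambda>w. frag_of ((x # x2 # us) @ w)) a"
    for a :: "'x list \<Rightarrow>\<^sub>0 int"
    using frag_extend_compose[of "\<lambda>w. frag_of (x # w)" "\<lambda>w. (x2 # us) @ w" a] by (simp add: comp_def)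
  have F: "F x (x2 # us @ y # v) = ?post (F x (x2 # us @ [y]))"
    using F_append[of "us @ [y]" x x2 v] by simp
  have sign: "sgs x x2 * (if even (wdeg ((x2 # us) @ [y])) then 1 else -1) =
     (if even (wdeg ((x # x2 # us) @ [y])) then 1 else - 1)"
    by (simp add: sg_def)
  have "D ((x # x2 # us) @ y # v) = F x (x2 # us @ y # v) + frag_cmul (sgs x x2) (pre x (D ((x2 # us) @ y # v)))"
    by simp
  also have "\<dots> = ?post (F x (x2 # us @ [y])) + frag_cmul (sgs x x2) (?post (pre x (D ((x2 # us) @ [y])))
     + frag_cmul (if even (wdeg ((x2 # us) @ [y])) then 1 else -1) (frag_extend (\<lambda>w. frag_of ((x # x2 # us) @ w)) (D (y # v))))"
    unfolding 1 F pl[symmetric] pp[symmetric] by (simp only: frag_extend_add frag_extend_cmul)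
  also have "\<dots> = ?post (D ((x # x2 # us) @ [y])) + frag_cmul (sgs x x2 * (if even (wdeg ((x2 # us) @ [y])) then 1 else -1))
      (frag_extend (\<lambda>w. frag_of ((x # x2 # us) @ w)) (D (y # v)))"
    by (simp only: append_Cons D.simps frag_extend_add frag_extend_cmul frag_cmul_distrib2 frag_cmul_cmul add.assoc)
  finally show ?case unfolding sign .
next
  case "2_1"
  then show ?case using frag_expansion[of "D (y # v)"] by simp
next
  case ("2_2" x)
  have F: "F x (y # v) = 0" using assms by (cases v) auto
  show ?case using assms by (simp add: F sg_def)
qed

text \<open>\<open>H\<close> creates a bar at \<open>y\<close>. Opening it returns the word,
  multiplying at it gives the shorter word, and the terms acting beyond \<open>y\<close> cancel
  between the two composites because \<open>H\<close> is moved past them with opposite sign.\<close>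

lemma homotopy_split:
  assumes "sp y" "nd (ver y) (sp y) = y"
  shows "frag_extend D (H (x # y # z # ws)) + frag_extend H (D (x # y # z # ws))
    = frag_of (x # y # z # ws) - (if tn x y z then frag_of (x # z # ws) else 0)"
proof -
  have y: "nd (ver y) True = y" using assms by simp
  have s: "sg x (joi y) = sg x y" "tn x (joi y) z = tn x y z" by (simp_all add: sg_def tn_def)
  have "frag_extend H (pre x a) = frag_cmul (sg x y) (pre x (frag_extend (\<lambda>w. frag_of (joi y # tl w)) a))"
    if "fkeys a \<subseteq> {w. \<exists>u. w = y # u \<and> u \<noteq> []}" for a
    using that
  proof (induction a rule: frag_induction)
    case (one w)
    then show ?case using assms(1) by (auto simp: neq_Nil_conv)
  next
    case (diff a b)
    then show ?case by (simp add: frag_extend_diff frag_cmul_diff_distrib2)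
  qed simp
  from this[OF D_keys] have h2: "frag_extend H (pre x (D (y # z # ws))) = frag_cmul (sg x y) (pre x (D (joi y # z # ws)))"
    using D_head[of "joi y" y "z # ws"] by (simp del: D.simps)
  have "frag_extend H (D (x # y # z # ws)) = frag_cmul (sg x y) (frag_extend H (pre x (D (y # z # ws))))"
    using assms(1) by (simp add: frag_extend_cmul frag_extend_add)
  also have "\<dots> = pre x (D (joi y # z # ws))" unfolding h2 by simp
  finally have 1: "frag_extend H (D (x # y # z # ws)) = pre x (D (joi y # z # ws))" .
  have "frag_extend D (H (x # y # z # ws)) = frag_cmul (sg x y) (D (x # joi y # z # ws))"
    using assms(1) by (simp add: frag_extend_cmul del: D.simps)
  also have "D (x # joi y # z # ws) = frag_cmul (sg x y) (frag_of (x # y # z # ws) - (if tn x y z then frag_of (x # z # ws) else 0))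
     + frag_cmul (- sg x y) (pre x (D (joi y # z # ws)))"
    unfolding D.simps(1)[of x] F.simps(1) by (simp add: s y del: D.simps)
  finally show ?thesis unfolding 1
    by (simp only: frag_cmul_distrib2 frag_cmul_cmul sg_sq mult_minus_right) simp
qed

text \<open>Here \<open>H\<close> kills the word itself, and after \<open>D\<close> it sees only the
  two terms that treat the bar at \<open>y\<close>. Opening that bar and closing it again returns
  the word.\<close>

lemma homotopy_join:
  assumes "\<not> sp y" "nd (ver y) (sp y) = y"
  shows "frag_extend D (H (x # y # z # ws)) + frag_extend H (D (x # y # z # ws))
    = frag_of (x # y # z # ws) - (if tn x y z then frag_cmul (sg x y) (H (x # z # ws)) else 0)"
proof -
  have y: "nd (ver y) False = y" using assms by simp
  have s: "sg x (spl y) = sg x y" by (simp add: sg_def)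
  have "frag_extend H (pre x a) = 0" if "fkeys a \<subseteq> {w. \<exists>u. w = y # u \<and> u \<noteq> []}" for a
    using that
  proof (induction a rule: frag_induction)
    case (one w)
    then show ?case using assms(1) by (auto simp: neq_Nil_conv)
  next
    case (diff a b)
    then show ?case by (simp add: frag_extend_diff)
  qed simp
  from this[OF D_keys] have h2: "frag_extend H (pre x (D (y # z # ws))) = 0" .
  have "frag_extend H (D (x # y # z # ws)) = frag_extend H (F x (y # z # ws))"
    unfolding D.simps(1)[of x] by (simp add: frag_extend_add frag_extend_cmul h2 del: D.simps F.simps)
  also have "\<dots> = frag_of (x # y # z # ws) - (if tn x y z then frag_cmul (sg x y) (H (x # z # ws)) else 0)"
    using assms(1) by (simp add: frag_extend_cmul frag_extend_diff frag_cmul_diff_distrib2 s y)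
  finally show ?thesis using assms(1) by simp
qed

section \<open>Admissible words and their reduction by the homotopy\<close>

definition letter :: "'x \<Rightarrow> bool" where "letter x \<longleftrightarrow> nd (ver x) (sp x) = x \<and> ver x \<in> {1..m}"

definition link :: "'x \<Rightarrow> 'x \<Rightarrow> bool" where "link x y \<longleftrightarrow> ver x = ver y \<or> adj (ver x) (ver y)"

text \<open>The first letter may be a bar, because the recursion for \<open>D\<close> passes to
  tails of words; \<open>wordsQ\<close> demands a product sign there too.\<close>

definition val :: "'x list \<Rightarrow> bool" where
  "val w \<longleftrightarrow> w \<noteq> [] \<and> (\<forall>x\<in>set w. letter x) \<and> successively link w \<and> sp (last w)"

definition wordsQ :: "'x list set" where
  "wordsQ = {w. val w \<and> sp (hd w)}"

lemma val_Cons: "val (x # y # v) \<longleftrightarrow> letter x \<and> link x y \<and> val (y # v)"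
  by (auto simp: val_def)

lemma letter_spl: "letter y \<Longrightarrow> letter (nd (ver y) b)" by (simp add: letter_def)

lemma link_ver: "ver x = ver x' \<Longrightarrow> ver y = ver y' \<Longrightarrow> link x y = link x' y'" by (simp add: link_def)

abbreviation "Dset y w \<equiv> {w'. \<exists>u. w' = y # u \<and> u \<noteq> [] \<and> val w' \<and> last w' = last w \<and> wdeg w' = wdeg w + 1 \<and> length w' \<le> length w}"

lemma pre_Dset:
  assumes "a \<in> Dset y (y # v)" "letter x" "link x y"
  shows "x # a \<in> Dset x (x # y # v)"
  using assms by (auto simp: val_Cons)

lemma D_val: "val (y # v) \<Longrightarrow> fkeys (D (y # v)) \<subseteq> Dset y (y # v)"
proof (induction v arbitrary: y)
  case (Cons z v)
  then have v: "letter y" "link y z" "val (z # v)" by (auto simp: val_Cons)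
  have "fkeys (F y (z # v)) \<subseteq> Dset y (y # z # v)"
  proof (cases "v = [] \<or> sp z")
    case True
    then show ?thesis by (cases v) auto
  next
    case False
    then obtain a v' where a: "v = a # v'" "\<not> sp z" by (cases v) auto
    have v2: "letter z" "link z a" "val (a # v')" using v(3) a by (auto simp: val_Cons)
    have "y # spl z # a # v' \<in> Dset y (y # z # v)"
      using v v2 a link_ver[of y y "spl z" z] link_ver[of "spl z" z a a] by (auto simp: val_Cons letter_spl)
    moreover have "y # a # v' \<in> Dset y (y # z # v)" if t: "tn y z a"
    proof -
      have "ld y a = ld y z + ld z a"
        using t letter_degree_adj[of "ver y" "ver z" n] by (simp add: tn_def) metis
      moreover have "link y a" using t by (simp add: link_def tn_def)
      ultimately show ?thesis using v v2 a by (auto simp: val_Cons)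
    qed
    ultimately show ?thesis
      unfolding a(1)
      by (cases "tn y z a"; simp only: a(2) F.simps if_True if_False diff_zero; intro fkeys_intros; assumption?; simp only: simp_thms)
  qed
  moreover have "fkeys (frag_cmul (sgs y z) (pre y (D (z # v)))) \<subseteq> Dset y (y # z # v)"
    using Cons.IH[OF v(3)] pre_Dset[OF _ v(1,2)]
    by (intro fkeys_intros fkeys_extend) blast
  ultimately show ?case unfolding D.simps by (rule fkeys_intros)
qed simp

lemma wordsQ_cases:
  assumes "w \<in> wordsQ" obtains x v where "w = x # v" "val (x # v)" "sp x"
  using assms by (cases w) (auto simp: wordsQ_def val_def)

lemma D_wordsQ:
  assumes "w \<in> wordsQ"
  shows "fkeys (D w) \<subseteq> {w' \<in> wordsQ. hd w' = hd w \<and> last w' = last w \<and> wdeg w' = wdeg w + 1 \<and> length w' \<le> length w}"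
proof -
  obtain x v where w: "w = x # v" "val (x # v)" "sp x" using assms by (rule wordsQ_cases)
  show ?thesis using D_val[OF w(2)] w(1,3) by (auto simp: wordsQ_def)
qed

lemma H_wordsQ:
  assumes "w \<in> wordsQ" shows "fkeys (H w) \<subseteq> wordsQ"
proof -
  obtain x v where w: "w = x # v" "val (x # v)" "sp x" using assms by (rule wordsQ_cases)
  show ?thesis
  proof (cases "length v \<ge> 2")
    case True
    then obtain y z u where v: "v = y # z # u" by (cases v; cases "tl v") auto
    have "x # joi y # z # u \<in> wordsQ"
      using w v link_ver[of x x "joi y" y] link_ver[of "joi y" y z z] by (auto simp: wordsQ_def val_Cons letter_spl)
    then show ?thesis by (auto simp: w(1) v)
  next
    case False
    then have "H w = 0" using w(1) by (cases v; cases "tl v") auto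
    then show ?thesis by simp
  qed
qed

text \<open>The part of a word that survives the homotopy. Words with at most one letter are fixed
  and all others become shorter, so iteration retracts \<open>Q\<close> onto the basis words of
  \<open>A\<close>.\<close>

definition reduce :: "'x list \<Rightarrow> 'x list \<Rightarrow>\<^sub>0 int" where
  "reduce w = frag_of w - (frag_extend D (H w) + frag_extend H (D w))"

lemma reduce_short: "length w \<le> 2 \<Longrightarrow> reduce w = frag_of w"
  by (cases w; cases "tl w"; cases "tl (tl w)") (auto simp: reduce_def)

lemma reduce_long:
  assumes w: "w \<in> wordsQ" and l: "length w \<ge> 3"
  shows "fkeys (reduce w) \<subseteq> {w' \<in> wordsQ. length w' < length w}"
proof -
  obtain x v where "w = x # v" "val (x # v)" "sp x" using w by (rule wordsQ_cases)
  with l obtain y z u where v: "w = x # y # z # u" "val (x # y # z # u)" "sp x"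
    by (cases v; cases "tl v") auto
  have y: "nd (ver y) (sp y) = y" using v(2) by (simp add: val_Cons letter_def)
  have xz: "x # z # u \<in> wordsQ" if "tn x y z"
    using v that by (auto simp: wordsQ_def val_Cons link_def tn_def)
  show ?thesis
  proof (cases "sp y")
    case True
    then show ?thesis using xz unfolding reduce_def v(1) homotopy_split[OF True y]
      by (auto simp: v(1))
  next
    case False
    have "fkeys (H (x # z # u)) \<subseteq> {w' \<in> wordsQ. length w' < length w}" if "tn x y z"
      using H_wordsQ[OF xz[OF that]] v(1) by (cases u) (auto split: if_splits)
    then show ?thesis unfolding reduce_def v(1) homotopy_join[OF False y] by (auto simp: v(1))
  qed
qed

end

section \<open>The cobar construction as a differential graded algebra\<close>

lemma (in abelian_group) minus_minus_cancel:
  "x \<in> carrier G \<Longrightarrow> y \<in> carrier G \<Longrightarrow> x \<ominus> (x \<ominus> y) = y"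
  by (simp add: a_minus_def minus_add r_neg2)

lemma (in abelian_group) minus_telescope:
  "x \<in> carrier G \<Longrightarrow> y \<in> carrier G \<Longrightarrow> z \<in> carrier G \<Longrightarrow> (x \<ominus> y) \<oplus> (y \<ominus> z) = x \<ominus> z"
  by (simp add: a_minus_def a_assoc r_neg1)

lemma (in graded_algebra) grade_finsum:
  "(\<And>x. x \<in> S \<Longrightarrow> F x \<in> grade A p) \<Longrightarrow> (\<Oplus>\<^bsub>A\<^esub> x\<in>S. F x) \<in> grade A p"
proof (induction S rule: infinite_finite_induct)
  case (insert x S)
  then have "F y \<in> carrier A" if "y \<in> insert x S" for y using grade_carrier that by blast
  then show ?case using insert by (subst A.finsum_insert) (auto intro!: grade_closed)
qed (simp_all add: grade_closed A.finsum_infinite)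

lemma klinear_zero:
  assumes "klinear K A B T" "module K A" "module K B" shows "T \<zero>\<^bsub>A\<^esub> = \<zero>\<^bsub>B\<^esub>"
proof -
  interpret A: module K A by fact
  interpret B: module K B by fact
  show ?thesis using klinearD(3)[OF assms(1), of "\<zero>\<^bsub>K\<^esub>" "\<zero>\<^bsub>A\<^esub>"] klinearD(1)[OF assms(1), of "\<zero>\<^bsub>A\<^esub>"] by simp
qed

lemma klinear_uminus:
  assumes T: "klinear K A B T" "module K A" "module K B" and x: "x \<in> carrier A"
  shows "T (\<ominus>\<^bsub>A\<^esub> x) = \<ominus>\<^bsub>B\<^esub> T x"
proof -
  interpret A: module K A by fact
  interpret B: module K B by fact
  have "T (\<ominus>\<^bsub>A\<^esub> x) \<oplus>\<^bsub>B\<^esub> T x = \<zero>\<^bsub>B\<^esub>"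
    using klinearD(2)[OF T(1), of "\<ominus>\<^bsub>A\<^esub> x" x] klinear_zero[OF T] x by (simp add: A.M.l_neg)
  then show ?thesis using x klinearD(1)[OF T(1)] by (metis A.M.a_inv_closed B.M.minus_equality)
qed

lemma klinear_minus:
  assumes T: "klinear K A B T" "module K A" "module K B" and x: "x \<in> carrier A" and y: "y \<in> carrier A"
  shows "T (x \<ominus>\<^bsub>A\<^esub> y) = T x \<ominus>\<^bsub>B\<^esub> T y"
proof -
  interpret A: module K A by fact
  show ?thesis using x y klinear_uminus[OF T y] klinearD(2)[OF T(1), of x "\<ominus>\<^bsub>A\<^esub> y"] by (simp add: a_minus_def)
qed

lemma klinear_add:
  assumes S: "klinear K A B S" and T: "klinear K A B T" and B: "module K B"
  shows "klinear K A B (\<lambda>x. S x \<oplus>\<^bsub>B\<^esub> T x)"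
proof -
  interpret B: module K B by fact
  show ?thesis
    using klinearD[OF S] klinearD[OF T] by (intro klinearI) (auto simp: B.smult_r_distr B.M.a_ac)
qed

lemma klinear_id: "klinear K A A (\<lambda>x. x)"
  by (intro klinearI) auto

lemma (in graded_algebra) klinear_mult:
  "y \<in> carrier A \<Longrightarrow> klinear K A A (\<lambda>x. x \<otimes>\<^bsub>A\<^esub> y)" "y \<in> carrier A \<Longrightarrow> klinear K A A (\<lambda>x. y \<otimes>\<^bsub>A\<^esub> x)"
  by (auto intro!: klinearI simp: smult_mult_left smult_mult_right A.l_distr A.r_distr)

locale bar_cobar = letters nd ver sp m n + field K
  for K :: "('k, 'e) ring_scheme" (structure)
    and nd :: "nat \<Rightarrow> bool \<Rightarrow> 'x" and ver :: "'x \<Rightarrow> nat" and sp :: "'x \<Rightarrow> bool" and m n :: nat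
begin

lemma wordsQ_word_category: "word_category K m (\<lambda>i. nd i True) ver wordsQ wdeg"
proof (intro word_category.intro word_category_axioms.intro)
  show "field K" by (rule field_axioms)
  fix w assume w: "w \<in> wordsQ"
  show "w \<noteq> []" using w by (auto simp: wordsQ_def val_def)
  have "letter x" if "x \<in> set w" for x using w that by (auto simp: wordsQ_def val_def)
  then have "x \<in> (\<lambda>i. nd i True) ` {1..m}" if "x \<in> set w" "sp x" for x
    using that by (intro image_eqI[of _ _ "ver x"]) (force simp: letter_def)+
  then show "hd w \<in> (\<lambda>i. nd i True) ` {1..m} \<and> last w \<in> (\<lambda>i. nd i True) ` {1..m}"
    using w by (auto simp: wordsQ_def val_def)
next
  fix p q assume p: "p \<in> wordsQ" and q: "q \<in> wordsQ" and pq: "last p = hd q"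
  obtain p' y where p': "p = p' @ [y]" using p by (cases p rule: rev_cases) (auto simp: wordsQ_def val_def)
  obtain q' where q': "q = y # q'" using q pq p' by (cases q) (auto simp: wordsQ_def val_def)
  have "successively link (p' @ y # q')"
  proof -
    have "successively link (p' @ [y])" "successively link (y # q')"
      using p q by (simp_all add: p' q' wordsQ_def val_def)
    then show ?thesis
      using successively_append_iff[of link p' "[y]"] successively_append_iff[of link p' "y # q'"] by simp
  qed
  then show "p @ tl q \<in> wordsQ"
    using p q unfolding p' q' wordsQ_def val_def
    by (cases p') (auto split: if_splits)
  show "wdeg (p @ tl q) = wdeg p + wdeg q"
    using wdeg_append[of p' y q'] by (simp add: p' q')
qed (auto simp: wordsQ_def val_def letter_def)

sublocale word_category K m "\<lambda>i. nd i True" ver wordsQ wdeg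
  by (rule wordsQ_word_category)

sublocale WG: graded_algebra K m A
  by (rule graded)

text \<open>Integral coefficients are mapped to multiples of the unit of \<open>K\<close>, so
  identities between integral combinations hold in every characteristic.\<close>

definition ev :: "('x list \<Rightarrow>\<^sub>0 int) \<Rightarrow> 'x list \<Rightarrow> 'k" where
  "ev a = (\<lambda>r. [Poly_Mapping.lookup a r] \<cdot> \<one>)"

lemma zero_int: "[(0::int)] \<cdot> \<one> = \<zero>"
  by (simp add: add_pow_def)

lemma ev_zero [simp]: "ev 0 = \<zero>\<^bsub>A\<^esub>"
  by (simp add: ev_def word_algebra_simps(4) fun_eq_iff zero_int)

lemma ev_of [simp]: "ev (frag_of w) = single K w"
  by (auto simp: ev_def single_def fun_eq_iff zero_int)

lemma ev_add: "ev (a + b) = ev a \<oplus>\<^bsub>A\<^esub> ev b"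
  by (simp add: ev_def word_algebra_simps(5) fun_eq_iff lookup_add add.int_pow_mult)

lemma ev_in: "fkeys a \<subseteq> wordsQ \<Longrightarrow> ev a \<in> carrier A"
proof (rule carrierI)
  assume a: "fkeys a \<subseteq> wordsQ"
  have "r \<in> fkeys a" if "ev a r \<noteq> \<zero>" for r using that by (auto simp: ev_def zero_int in_keys_iff)
  then show "\<And>w. ev a w \<noteq> \<zero> \<Longrightarrow> w \<in> wordsQ" "finite {w. ev a w \<noteq> \<zero>}"
    using a by (auto intro: finite_subset[of _ "fkeys a"])
qed (simp add: ev_def)

lemma ev_uminus: "fkeys a \<subseteq> wordsQ \<Longrightarrow> ev (- a) = \<ominus>\<^bsub>A\<^esub> ev a"
  using ev_add[of "- a" a] ev_in[of a] ev_in[of "- a"] WA.minus_equality[of "ev (- a)" "ev a"]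
  by (simp add: eq_commute)

lemma ev_diff: "fkeys a \<subseteq> wordsQ \<Longrightarrow> fkeys b \<subseteq> wordsQ \<Longrightarrow> ev (a - b) = ev a \<ominus>\<^bsub>A\<^esub> ev b"
  using ev_add[of a "- b"] by (simp add: ev_uminus a_minus_def)

lemma ev_grade:
  assumes "fkeys a \<subseteq> {w \<in> wordsQ. wdeg w = t}" shows "ev a \<in> grade A t"
proof -
  have "r \<in> fkeys a" if "ev a r \<noteq> \<zero>" for r using that by (auto simp: ev_def zero_int in_keys_iff)
  then show ?thesis using assms ev_in[of a] unfolding word_algebra_simps(7) by blast
qed

abbreviation op :: "('x list \<Rightarrow> 'x list \<Rightarrow>\<^sub>0 int) \<Rightarrow> ('x list \<Rightarrow> 'k) \<Rightarrow> 'x list \<Rightarrow> 'k" where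
  "op \<phi> \<equiv> lin K A (\<lambda>w. ev (\<phi> w))"

abbreviation wmap :: "('x list \<Rightarrow> 'x list \<Rightarrow>\<^sub>0 int) \<Rightarrow> bool" where
  "wmap \<phi> \<equiv> \<forall>w\<in>wordsQ. fkeys (\<phi> w) \<subseteq> wordsQ"

lemma op_klinear: "wmap \<phi> \<Longrightarrow> klinear K A A (op \<phi>)"
  by (rule lin_klinear[OF module_A]) (simp add: ev_in)

lemma op_single: "wmap \<phi> \<Longrightarrow> w \<in> wordsQ \<Longrightarrow> op \<phi> (single K w) = ev (\<phi> w)"
  by (rule lin_single[OF module_A]) (simp_all add: ev_in)

text \<open>Compares a linear map after \<open>ev\<close> with an additive map on integral
  combinations. The restriction to words in \<open>S\<close> matters for products, where a uniform
  formula exists only for words with a common end point.\<close>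

lemma lin_ev_induct:
  assumes T: "klinear K A B T" and T': "\<And>a b. fkeys a \<subseteq> S \<Longrightarrow> fkeys b \<subseteq> S \<Longrightarrow> T' a \<in> carrier B \<and> T' (a - b) = T' a \<ominus>\<^bsub>B\<^esub> T' b"
    and B: "module K B" and S: "S \<subseteq> wordsQ"
    and eq: "\<And>w. w \<in> S \<Longrightarrow> T (single K w) = T' (frag_of w)" and a: "fkeys a \<subseteq> S"
  shows "T (ev a) = T' a"
proof -
  have "fkeys a \<subseteq> S \<and> T (ev a) = T' a"
    using a
  proof (induction a rule: frag_induction)
    case zero
    interpret B: module K B by (rule B)
    have "T' 0 = \<zero>\<^bsub>B\<^esub>" using T'[of 0 0] by (simp add: a_minus_def) (metis B.M.r_neg)
    then show ?case using klinear_zero[OF T module_A B] by simp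
  next
    case (diff a b)
    then have ab: "fkeys a \<subseteq> wordsQ" "fkeys b \<subseteq> wordsQ" "fkeys (a - b) \<subseteq> S"
      using S keys_diff[of a b] by auto
    then show ?case
      using diff T'[of a b] klinear_minus[OF T module_A B ev_in ev_in, OF ab(1,2)] by (simp add: ev_diff)
  qed (simp add: eq)
  then show ?thesis by simp
qed

lemma frag_extend_words: "wmap \<phi> \<Longrightarrow> fkeys a \<subseteq> wordsQ \<Longrightarrow> fkeys (frag_extend \<phi> a) \<subseteq> wordsQ"
  by (rule fkeys_extend) auto

lemma op_ev:
  assumes \<phi>: "wmap \<phi>" and a: "fkeys a \<subseteq> wordsQ"
  shows "op \<phi> (ev a) = ev (frag_extend \<phi> a)"
  by (rule lin_ev_induct[OF op_klinear[OF \<phi>] _ module_A _ _ a])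
    (use \<phi> in \<open>auto simp: op_single frag_extend_diff ev_diff frag_extend_words intro!: ev_in fkeys_extend\<close>)

lemma op_op:
  assumes \<phi>: "wmap \<phi>" and \<psi>: "wmap \<psi>" and f: "f \<in> carrier A"
  shows "op \<phi> (op \<psi> f) = op (\<lambda>w. frag_extend \<phi> (\<psi> w)) f"
proof (rule klinear_ext[OF _ _ module_A _ f])
  show "klinear K A A (\<lambda>f. op \<phi> (op \<psi> f))" by (rule klinear_comp[OF op_klinear[OF \<psi>] op_klinear[OF \<phi>]])
  have w: "wmap (\<lambda>w. frag_extend \<phi> (\<psi> w))" using \<phi> \<psi> frag_extend_words by auto
  show "klinear K A A (op (\<lambda>w. frag_extend \<phi> (\<psi> w)))" by (rule op_klinear[OF w])
  show "op \<phi> (op \<psi> (single K x)) = op (\<lambda>w. frag_extend \<phi> (\<psi> w)) (single K x)" if "x \<in> wordsQ" for x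
    using that \<phi> \<psi> w by (simp add: op_single op_ev)
qed

lemma wmap_D: "wmap D" and wmap_H: "wmap H"
  using D_wordsQ H_wordsQ by blast+

abbreviation "d \<equiv> op D"
abbreviation "h \<equiv> op H"
text \<open>Multiplication by the parity sign of the degree. It turns the Leibniz rule into an
  identity that is linear in both factors, so that checking basis words suffices.\<close>

definition "\<sigma> = op (\<lambda>w. frag_cmul (if even (wdeg w) then 1 else -1) (frag_of w))"

lemmas d_klinear = op_klinear[OF wmap_D] and h_klinear = op_klinear[OF wmap_H]
lemmas d_single = op_single[OF wmap_D]

lemma \<sigma>_klinear: "klinear K A A \<sigma>"
  unfolding \<sigma>_def by (rule op_klinear) auto

lemma \<sigma>_single: "w \<in> wordsQ \<Longrightarrow> \<sigma> (single K w) = (if even (wdeg w) then single K w else \<ominus>\<^bsub>A\<^esub> single K w)"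
  unfolding \<sigma>_def by (subst op_single) (auto simp: ev_uminus)

lemma \<sigma>_grade: "f \<in> grade A p \<Longrightarrow> \<sigma> f = (if even p then f else \<ominus>\<^bsub>A\<^esub> f)"
proof -
  assume f: "f \<in> grade A p"
  then have fc: "f \<in> carrier A" by auto
  have W: "w \<in> wordsQ" "wdeg w = p" if "f w \<noteq> \<zero>" for w
    using that f carrier_out[OF fc] unfolding word_algebra_simps(7) by auto
  have "\<sigma> f = (\<Oplus>\<^bsub>A\<^esub> w\<in>{w. f w \<noteq> \<zero>}. if even p then f w \<odot>\<^bsub>A\<^esub> single K w else \<ominus>\<^bsub>A\<^esub> (f w \<odot>\<^bsub>A\<^esub> single K w))"
    unfolding \<sigma>_def lin_def using W fc smult_closed
    by (intro WA.finsum_cong') (auto simp: ev_uminus WM.smult_r_minus)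
  also have "\<dots> = (if even p then f else \<ominus>\<^bsub>A\<^esub> f)"
  proof (cases "even p")
    case True then show ?thesis using expand[OF fc] by simp
  next
    case False
    have "(\<Oplus>\<^bsub>A\<^esub> w\<in>{w. f w \<noteq> \<zero>}. \<ominus>\<^bsub>A\<^esub> (f w \<odot>\<^bsub>A\<^esub> single K w)) = (\<Oplus>\<^bsub>A\<^esub> w\<in>{w. f w \<noteq> \<zero>}. (\<ominus> \<one>) \<odot>\<^bsub>A\<^esub> (f w \<odot>\<^bsub>A\<^esub> single K w))"
      using W fc smult_closed by (intro WA.finsum_cong') (auto simp: WM.smult_l_minus)
    also have "\<dots> = (\<ominus> \<one>) \<odot>\<^bsub>A\<^esub> (\<Oplus>\<^bsub>A\<^esub> w\<in>{w. f w \<noteq> \<zero>}. f w \<odot>\<^bsub>A\<^esub> single K w)"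
      using W fc carrier_supp[OF fc] smult_closed by (intro WM.finsum_smult_ldistr[symmetric]) auto
    finally show ?thesis using False expand[OF fc] fc by (simp add: WM.smult_l_minus)
  qed
  finally show ?thesis .
qed

lemma ev_mult_single:
  assumes a: "fkeys a \<subseteq> {w' \<in> wordsQ. last w' = y}" and w: "w \<in> wordsQ"
  shows "ev a \<otimes>\<^bsub>A\<^esub> single K w = (if y = hd w then ev (frag_extend (\<lambda>w'. frag_of (w' @ tl w)) a) else \<zero>\<^bsub>A\<^esub>)"
proof (rule lin_ev_induct[OF WG.klinear_mult(1)[OF single_in[OF w]] _ module_A _ _ a])
  let ?T = "\<lambda>a. if y = hd w then ev (frag_extend (\<lambda>w'. frag_of (w' @ tl w)) a) else \<zero>\<^bsub>A\<^esub>"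
  fix a b assume "fkeys a \<subseteq> {w' \<in> wordsQ. last w' = y}" "fkeys b \<subseteq> {w' \<in> wordsQ. last w' = y}"
  then have "fkeys (frag_extend (\<lambda>w'. frag_of (w' @ tl w)) a) \<subseteq> wordsQ"
    "fkeys (frag_extend (\<lambda>w'. frag_of (w' @ tl w)) b) \<subseteq> wordsQ" if "y = hd w"
    using that W_comp w by (auto intro!: fkeys_extend)
  then show "?T a \<in> carrier A \<and> ?T (a - b) = ?T a \<ominus>\<^bsub>A\<^esub> ?T b"
    by (auto simp: ev_in ev_diff frag_extend_diff a_minus_def)
qed (use w in \<open>auto simp: mult_single\<close>)

lemma single_mult_ev:
  assumes a: "fkeys a \<subseteq> {w' \<in> wordsQ. hd w' = y}" and w: "w \<in> wordsQ"
  shows "single K w \<otimes>\<^bsub>A\<^esub> ev a = (if last w = y then ev (frag_extend (\<lambda>w'. frag_of (w @ tl w')) a) else \<zero>\<^bsub>A\<^esub>)"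
proof (rule lin_ev_induct[OF WG.klinear_mult(2)[OF single_in[OF w]] _ module_A _ _ a])
  let ?T = "\<lambda>a. if last w = y then ev (frag_extend (\<lambda>w'. frag_of (w @ tl w')) a) else \<zero>\<^bsub>A\<^esub>"
  fix a b assume "fkeys a \<subseteq> {w' \<in> wordsQ. hd w' = y}" "fkeys b \<subseteq> {w' \<in> wordsQ. hd w' = y}"
  then have "fkeys (frag_extend (\<lambda>w'. frag_of (w @ tl w')) a) \<subseteq> wordsQ"
    "fkeys (frag_extend (\<lambda>w'. frag_of (w @ tl w')) b) \<subseteq> wordsQ" if "last w = y"
    using that W_comp w by (auto intro!: fkeys_extend)
  then show "?T a \<in> carrier A \<and> ?T (a - b) = ?T a \<ominus>\<^bsub>A\<^esub> ?T b"
    by (auto simp: ev_in ev_diff frag_extend_diff a_minus_def)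
qed (use w in \<open>auto simp: mult_single\<close>)

lemma leibniz_single:
  assumes u: "u \<in> wordsQ" and w: "w \<in> wordsQ"
  shows "d (single K u \<otimes>\<^bsub>A\<^esub> single K w) =
    d (single K u) \<otimes>\<^bsub>A\<^esub> single K w \<oplus>\<^bsub>A\<^esub> \<sigma> (single K u) \<otimes>\<^bsub>A\<^esub> d (single K w)"
proof -
  have kD: "fkeys (D u) \<subseteq> {w' \<in> wordsQ. last w' = last u}" "fkeys (D w) \<subseteq> {w' \<in> wordsQ. hd w' = hd w}"
    using D_wordsQ[OF u] D_wordsQ[OF w] by auto
  note ms = ev_mult_single[OF kD(1) w] single_mult_ev[OF kD(2) u]
  have c: "single K u \<in> carrier A" "ev (D w) \<in> carrier A" using u kD(2) by (auto intro!: ev_in)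
  have sm: "\<sigma> (single K u) \<otimes>\<^bsub>A\<^esub> ev (D w) = (if even (wdeg u) then single K u \<otimes>\<^bsub>A\<^esub> ev (D w) else \<ominus>\<^bsub>A\<^esub> (single K u \<otimes>\<^bsub>A\<^esub> ev (D w)))"
    using c by (simp add: \<sigma>_single[OF u] WA.l_minus)
  show ?thesis
  proof (cases "last u = hd w")
    case False
    then show ?thesis
      using u w by (auto simp: mult_single d_single ms sm klinear_zero[OF d_klinear module_A module_A])
  next
    case True
    obtain us y where us: "u = us @ [y]" using W_nonempty[OF u] by (metis append_butlast_last_id)
    obtain v where v: "w = y # v" using True us W_nonempty[OF w] by (cases w) auto
    have sy: "sp y" using u by (auto simp: us wordsQ_def val_def)
    have post: "frag_extend (\<lambda>w'. frag_of (w' @ tl w)) (D u) = frag_extend (\<lambda>w. frag_of (w @ v)) (D (us @ [y]))"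
      by (simp add: us v)
    \<comment> \<open>\<open>D\<close> keeps the head of \<open>w\<close>, which is the last vertex
      of \<open>u\<close>; dropping it and appending to \<open>u\<close> is the same as prepending
      \<open>us\<close>.\<close>
    have pr: "frag_extend (\<lambda>w'. frag_of (u @ tl w')) (D w) = frag_extend (\<lambda>w. frag_of (us @ w)) (D (y # v))"
      unfolding v using D_keys[of y v] by (intro frag_extend_eq) (auto simp: us)
    have k1: "fkeys (frag_extend (\<lambda>w'. frag_of (w' @ tl w)) (D u)) \<subseteq> wordsQ"
      using kD(1) True W_comp w by (auto intro!: fkeys_extend)
    have k2: "fkeys (frag_extend (\<lambda>w'. frag_of (u @ tl w')) (D w)) \<subseteq> wordsQ"
      using kD(2) True W_comp u by (auto intro!: fkeys_extend)
    have "D (u @ tl w) = frag_extend (\<lambda>w'. frag_of (w' @ tl w)) (D u)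
      + frag_cmul (if even (wdeg u) then 1 else -1) (frag_extend (\<lambda>w'. frag_of (u @ tl w')) (D w))"
      using D_append[OF sy, of us v] unfolding post pr by (simp add: us v)
    then have "ev (D (u @ tl w)) = ev (frag_extend (\<lambda>w'. frag_of (w' @ tl w)) (D u)) \<oplus>\<^bsub>A\<^esub>
       (if even (wdeg u) then ev (frag_extend (\<lambda>w'. frag_of (u @ tl w')) (D w))
        else \<ominus>\<^bsub>A\<^esub> ev (frag_extend (\<lambda>w'. frag_of (u @ tl w')) (D w)))"
      using k2 by (simp add: ev_add ev_uminus)
    then show ?thesis
      using True u w W_comp[OF u w True] by (simp add: mult_single d_single ms sm)
  qed
qed

lemma leibniz:
  assumes x: "x \<in> carrier A" and y: "y \<in> carrier A"
  shows "d (x \<otimes>\<^bsub>A\<^esub> y) = d x \<otimes>\<^bsub>A\<^esub> y \<oplus>\<^bsub>A\<^esub> \<sigma> x \<otimes>\<^bsub>A\<^esub> d y"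
proof (rule klinear_ext[OF _ _ module_A _ x])
  note kd = klinearD(1)[OF d_klinear] and ks = klinearD(1)[OF \<sigma>_klinear]
  show "klinear K A A (\<lambda>x. d (x \<otimes>\<^bsub>A\<^esub> y))"
    by (rule klinear_comp[OF WG.klinear_mult(1)[OF y] d_klinear])
  show "klinear K A A (\<lambda>x. d x \<otimes>\<^bsub>A\<^esub> y \<oplus>\<^bsub>A\<^esub> \<sigma> x \<otimes>\<^bsub>A\<^esub> d y)"
    by (intro klinear_add module_A klinear_comp[OF d_klinear WG.klinear_mult(1)[OF y]]
        klinear_comp[OF \<sigma>_klinear WG.klinear_mult(1)[OF kd[OF y]]])
  fix u assume u: "u \<in> wordsQ"
  show "d (single K u \<otimes>\<^bsub>A\<^esub> y) = d (single K u) \<otimes>\<^bsub>A\<^esub> y \<oplus>\<^bsub>A\<^esub> \<sigma> (single K u) \<otimes>\<^bsub>A\<^esub> d y"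
  proof (rule klinear_ext[OF _ _ module_A _ y])
    show "klinear K A A (\<lambda>y. d (single K u \<otimes>\<^bsub>A\<^esub> y))"
      by (rule klinear_comp[OF WG.klinear_mult(2)[OF single_in[OF u]] d_klinear])
    show "klinear K A A (\<lambda>y. d (single K u) \<otimes>\<^bsub>A\<^esub> y \<oplus>\<^bsub>A\<^esub> \<sigma> (single K u) \<otimes>\<^bsub>A\<^esub> d y)"
      using u by (intro klinear_add module_A WG.klinear_mult klinear_comp[OF d_klinear WG.klinear_mult(2)] kd ks) auto
  qed (rule leibniz_single[OF u])
qed

lemma d_d: "x \<in> carrier A \<Longrightarrow> d (d x) = \<zero>\<^bsub>A\<^esub>"
  unfolding op_op[OF wmap_D wmap_D]
  by (simp add: D_D lin_def)

lemma d_grade: "f \<in> grade A p \<Longrightarrow> d f \<in> grade A (p + 1)"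
proof -
  assume f: "f \<in> grade A p"
  then have fc: "f \<in> carrier A" by auto
  have W: "w \<in> wordsQ" "wdeg w = p" if "f w \<noteq> \<zero>" for w
    using that f carrier_out[OF fc] unfolding word_algebra_simps(7) by auto
  show ?thesis unfolding lin_def
  proof (rule WG.grade_finsum)
    fix w assume "w \<in> {w. f w \<noteq> \<zero>}"
    then have w: "w \<in> wordsQ" "wdeg w = p" using W by auto
    then show "f w \<odot>\<^bsub>A\<^esub> ev (D w) \<in> grade A (p + 1)"
      using D_wordsQ[OF w(1)] fc by (intro WG.grade_closed ev_grade) auto
  qed
qed

definition Q :: "('k, 'x list \<Rightarrow> 'k) dga" where
  "Q = galg.extend A (dga.fields d)"

lemma Q_simps [simp]:
  "carrier Q = carrier A" "monoid.mult Q = monoid.mult A" "monoid.one Q = monoid.one A"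
  "ring.zero Q = ring.zero A" "ring.add Q = ring.add A" "smult Q = smult A" "grade Q = grade A"
  "iota Q = iota A" "diff Q = d"
  by (simp_all add: Q_def galg.extend_def dga.fields_def)

lemma Q_graded: "graded_algebra K m Q"
  by (rule graded_algebra_cong[OF graded]) simp_all

lemma Q_uminus: "x \<in> carrier A \<Longrightarrow> \<ominus>\<^bsub>Q\<^esub> x = \<ominus>\<^bsub>A\<^esub> x"
proof -
  assume x: "x \<in> carrier A"
  interpret Q: graded_algebra K m Q by (rule Q_graded)
  show ?thesis using Q.A.minus_equality[of "\<ominus>\<^bsub>A\<^esub> x" x] x by (simp add: WA.l_neg)
qed

lemma Q_minus: "x \<in> carrier A \<Longrightarrow> y \<in> carrier A \<Longrightarrow> x \<ominus>\<^bsub>Q\<^esub> y = x \<ominus>\<^bsub>A\<^esub> y"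
  by (simp add: a_minus_def Q_uminus)

lemma Q_dga: "diff_graded_algebra K m Q"
proof -
  interpret Q: graded_algebra K m Q by (rule Q_graded)
  show ?thesis
  proof (intro diff_graded_algebra.intro Q_graded diff_graded_algebra_axioms.intro)
    fix x y p assume x: "x \<in> grade Q p" and y: "y \<in> carrier Q"
    then have xc: "x \<in> carrier A" by auto
    have dc: "d y \<in> carrier A" using y klinearD(1)[OF d_klinear] by simp
    show "diff Q (x \<otimes>\<^bsub>Q\<^esub> y) = (if even p then diff Q x \<otimes>\<^bsub>Q\<^esub> y \<oplus>\<^bsub>Q\<^esub> x \<otimes>\<^bsub>Q\<^esub> diff Q y
         else diff Q x \<otimes>\<^bsub>Q\<^esub> y \<ominus>\<^bsub>Q\<^esub> x \<otimes>\<^bsub>Q\<^esub> diff Q y)"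
      using leibniz[OF xc, of y] x y xc dc by (simp add: \<sigma>_grade a_minus_def Q_uminus WA.l_minus)
  next
    fix r assume r: "r \<in> carrier (power_algebra K m)"
    have "D w = 0" if "iota A r w \<noteq> \<zero>" for w
    proof -
      have "length w = 1" using that iota_length by blast
      then show ?thesis by (cases w) auto
    qed
    then have "d (iota A r) = \<zero>\<^bsub>A\<^esub>"
      unfolding lin_def using iota_in[OF r] by (intro WA.add.finprod_one_eqI) auto
    then show "diff Q (iota Q r) = \<zero>\<^bsub>Q\<^esub>" by simp
  qed (use klinearD[OF d_klinear] d_grade d_d in auto)
qed

text \<open>On a cocycle the homotopy formula exhibits the difference to its reduction as
  \<open>d (h z)\<close>. Each reduction shortens the longest words until length two is reached, and
  the finite support bounds the number of steps.\<close>

lemma cocycle_short: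
  assumes "z \<in> cocycles Q"
  shows "\<exists>z' \<in> cocycles Q. (\<forall>w. z' w \<noteq> \<zero> \<longrightarrow> length w \<le> 2) \<and> z \<ominus>\<^bsub>Q\<^esub> z' \<in> coboundaries Q"
proof -
  interpret Q: diff_graded_algebra K m Q by (rule Q_dga)
  have wr: "wmap reduce"
  proof
    fix w assume w: "w \<in> wordsQ"
    show "fkeys (reduce w) \<subseteq> wordsQ"
      using reduce_long[OF w] reduce_short[of w] w by (cases "length w \<ge> 3") auto
  qed
  have red: "x \<ominus>\<^bsub>A\<^esub> op reduce x = d (h x) \<oplus>\<^bsub>A\<^esub> h (d x)" if x: "x \<in> carrier A" for x
  proof -
    have "x = op reduce x \<oplus>\<^bsub>A\<^esub> (d (h x) \<oplus>\<^bsub>A\<^esub> h (d x))"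
    proof (rule klinear_ext[OF klinear_id _ module_A _ x])
      show "klinear K A A (\<lambda>x. op reduce x \<oplus>\<^bsub>A\<^esub> (d (h x) \<oplus>\<^bsub>A\<^esub> h (d x)))"
        by (intro klinear_add module_A op_klinear[OF wr] klinear_comp[OF d_klinear h_klinear] klinear_comp[OF h_klinear d_klinear])
      fix w assume w: "w \<in> wordsQ"
      have k: "fkeys (D w) \<subseteq> wordsQ" "fkeys (H w) \<subseteq> wordsQ" using wmap_D wmap_H w by auto
      have "frag_of w = reduce w + (frag_extend D (H w) + frag_extend H (D w))" by (simp add: reduce_def)
      then have "ev (frag_of w) = ev (reduce w) \<oplus>\<^bsub>A\<^esub> (ev (frag_extend D (H w)) \<oplus>\<^bsub>A\<^esub> ev (frag_extend H (D w)))"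
        by (simp only: ev_add)
      moreover have "op reduce (single K w) = ev (reduce w)" "d (h (single K w)) = ev (frag_extend D (H w))"
        "h (d (single K w)) = ev (frag_extend H (D w))"
        using w k by (simp_all add: op_single wr wmap_D wmap_H op_ev)
      ultimately show "single K w = op reduce (single K w) \<oplus>\<^bsub>A\<^esub> (d (h (single K w)) \<oplus>\<^bsub>A\<^esub> h (d (single K w)))"
        by simp
    qed
    moreover have "op reduce x \<in> carrier A" "d (h x) \<in> carrier A" "h (d x) \<in> carrier A"
      using x klinearD(1)[OF d_klinear] klinearD(1)[OF h_klinear] klinearD(1)[OF op_klinear[OF wr]] by auto
    ultimately show ?thesis
      by (metis WA.a_comm WA.add.inv_solve_right' WA.add.m_closed a_minus_def)
  qed
  have "\<exists>z' \<in> cocycles Q. (\<forall>w. z' w \<noteq> \<zero> \<longrightarrow> length w \<le> 2) \<and> z \<ominus>\<^bsub>Q\<^esub> z' \<in> coboundaries Q"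
    if "z \<in> cocycles Q" "\<forall>w. z w \<noteq> \<zero> \<longrightarrow> length w \<le> N + 2" for N z
    using that
  proof (induction N arbitrary: z)
    case 0
    then show ?case using Q.cocyclesD(1)[of z] Q.coboundaries_closed(1)
      by (intro bexI[of _ z]) (auto simp: a_minus_def Q_uminus WA.r_neg)
  next
    case (Suc N)
    let ?z = "op reduce z"
    have zc: "z \<in> carrier A" "d z = \<zero>\<^bsub>A\<^esub>" using Suc.prems(1) by (auto simp: cocycles_def)
    have zr: "?z \<in> carrier A" using klinearD(1)[OF op_klinear[OF wr] zc(1)] .
    have hz: "h z \<in> carrier A" "h (d z) = \<zero>\<^bsub>A\<^esub>"
      using klinearD(1)[OF h_klinear zc(1)] zc(2) klinear_zero[OF h_klinear module_A module_A] by auto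
    have "z \<ominus>\<^bsub>A\<^esub> ?z = d (h z)" using red[OF zc(1)] hz klinearD(1)[OF d_klinear hz(1)] by simp
    then have cob: "z \<ominus>\<^bsub>Q\<^esub> ?z \<in> coboundaries Q" using zc zr hz by (auto simp: Q_minus coboundaries_def)
    have "?z = z \<ominus>\<^bsub>Q\<^esub> (z \<ominus>\<^bsub>Q\<^esub> ?z)"
      using zc zr Q.A.minus_minus_cancel[of z ?z] by simp
    then have zcc: "?z \<in> cocycles Q"
      using Suc.prems(1) Q.coboundary_cocycle[OF cob] Q.cocycles_closed(4) by metis
    have len: "length w \<le> N + 2" if nz: "?z w \<noteq> \<zero>" for w
    proof (rule ccontr)
      assume l: "\<not> length w \<le> N + 2"
      have "z v \<otimes> ev (reduce v) w = \<zero>" if v: "v \<in> {v. z v \<noteq> \<zero>}" for v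
      proof -
        have vW: "v \<in> wordsQ" "length v \<le> N + 3" using v carrier_out[OF zc(1)] Suc.prems(2) by auto
        have "w \<notin> fkeys (reduce v)"
        proof (cases "length v \<ge> 3")
          case True
          then show ?thesis using reduce_long[OF vW(1) True] vW(2) l by auto
        next
          case False
          then show ?thesis using reduce_short[of v] l by auto
        qed
        then show ?thesis using zc(1) by (simp add: ev_def zero_int in_keys_iff)
      qed
      then have "(\<Oplus>v\<in>{v. z v \<noteq> \<zero>}. z v \<otimes> ev (reduce v) w) = \<zero>" by (intro add.finprod_one_eqI) auto
      moreover have "?z w = (\<Oplus>v\<in>{v. z v \<noteq> \<zero>}. z v \<otimes> ev (reduce v) w)"
      proof -
        have "z v \<odot>\<^bsub>A\<^esub> ev (reduce v) \<in> carrier A" if "z v \<noteq> \<zero>" for v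
          using that wr carrier_out[OF zc(1)] zc(1) by (intro smult_closed ev_in) auto
        then have "?z w = (\<Oplus>v\<in>{v. z v \<noteq> \<zero>}. (z v \<odot>\<^bsub>A\<^esub> ev (reduce v)) w)"
          unfolding lin_def by (intro finsum_apply) auto
        then show ?thesis by (simp add: word_algebra_simps(6))
      qed
      ultimately show False using nz by simp
    qed
    obtain z' where z': "z' \<in> cocycles Q" "\<forall>w. z' w \<noteq> \<zero> \<longrightarrow> length w \<le> 2" "?z \<ominus>\<^bsub>Q\<^esub> z' \<in> coboundaries Q"
      using Suc.IH[OF zcc] len by blast
    have "z \<ominus>\<^bsub>Q\<^esub> z' = (z \<ominus>\<^bsub>Q\<^esub> ?z) \<oplus>\<^bsub>Q\<^esub> (?z \<ominus>\<^bsub>Q\<^esub> z')"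
      using zc zr Q.cocyclesD(1)[OF z'(1)] Q.A.minus_telescope[of z ?z z'] by simp
    then show ?case using z' cob Q.coboundaries_closed(2) by metis
  qed
  moreover have "\<exists>N. \<forall>w. z w \<noteq> \<zero> \<longrightarrow> length w \<le> N + 2"
  proof -
    have "finite {w. z w \<noteq> \<zero>}" using assms carrier_supp by (auto simp: cocycles_def)
    then have "length w \<le> Max (length ` {w. z w \<noteq> \<zero>})" if "z w \<noteq> \<zero>" for w using that by (intro Max_ge) auto
    then show ?thesis using trans_le_add1 by blast
  qed
  ultimately show ?thesis using assms by blast
qed

end

section \<open>Coordinates on the zigzag algebra\<close>

lemma paths_successively: "paths m = {p. p \<noteq> [] \<and> set p \<subseteq> {1..m} \<and> successively adj p}"
  by (auto simp: paths_def successively_conv_nth adj_def less_diff_conv)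

lemma path_degree_Cons: "path_degree n (x # y # r) = edge_degree n x y + path_degree n (y # r)"
  by (simp add: path_degree_def sum.lessThan_Suc_shift del: sum.lessThan_Suc)

lemma path_degree_single [simp]: "path_degree n [x] = 0"
  by (simp add: path_degree_def)

lemma path_degree_append: "path_degree n (p @ y # q) = path_degree n (p @ [y]) + path_degree n (y # q)"
proof (induction p)
  case (Cons x p)
  then show ?case by (cases p) (simp_all add: path_degree_Cons path_degree_single)
qed (simp add: path_degree_single)

lemma adj_neq: "adj i j \<Longrightarrow> i \<noteq> j"
  by auto

text \<open>\<open>[i, i]\<close> stands for the loop at \<open>i\<close>.\<close>

definition basis :: "nat \<Rightarrow> nat list set" where
  "basis m = {[i] | i. i \<in> {1..m}} \<union> {[i, j] | i j. i \<in> {1..m} \<and> j \<in> {1..m} \<and> (i = j \<or> adj i j)}"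

fun basis_degree :: "nat \<Rightarrow> nat list \<Rightarrow> int" where
  "basis_degree n [i, j] = letter_degree n i j"
| "basis_degree n _ = 0"

locale zigzag = field K for K :: "('k, 'e) ring_scheme" (structure) +
  fixes m n :: nat
  assumes m2: "m \<ge> 2"
begin

lemma paths_word_category: "word_category K m (\<lambda>i. i) (\<lambda>i. i) (paths m) (path_degree n)"
proof (intro word_category.intro word_category_axioms.intro)
  show "field K" by (rule field_axioms)
  fix p q assume p: "p \<in> paths m" and q: "q \<in> paths m" and pq: "last p = hd q"
  obtain p' y where p': "p = p' @ [y]" using p by (cases p rule: rev_cases) (auto simp: paths_def)
  obtain q' where q': "q = y # q'" using q pq p' by (cases q) (auto simp: paths_def)
  have "successively adj (p' @ [y])" "successively adj (y # q')"
    using p q by (simp_all add: p' q' paths_successively)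
  then have "successively adj (p' @ y # q')"
    using successively_append_iff[of adj p' "[y]"] successively_append_iff[of adj p' "y # q'"] by simp
  then show "p @ tl q \<in> paths m" using p q by (simp add: p' q' paths_successively)
  show "path_degree n (p @ tl q) = path_degree n p + path_degree n q"
    using path_degree_append[of n p' y q'] by (simp add: p' q')
qed (auto simp: paths_successively path_degree_def subset_iff)

sublocale P: word_category K m "\<lambda>i. i" "\<lambda>i. i" "paths m" "path_degree n"
  by (rule paths_word_category)

sublocale PG: graded_algebra K m P.A by (rule P.graded)

text \<open>The two cycles of length two at \<open>i\<close> agree modulo \<open>J\<close>, hence
  the sum of their coefficients. At an end of the quiver one of the two lists is not a path, and its
  coefficient is zero.\<close>

fun co :: "(nat list \<Rightarrow> 'k) \<Rightarrow> nat list \<Rightarrow> 'k" where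
  "co f [i] = f [i]"
| "co f [i, j] = (if i = j then f [i, i - 1, i] \<oplus> f [i, i + 1, i] else f [i, j])"
| "co f _ = \<zero>"

lemma co_closed [simp]: "f \<in> carrier P.A \<Longrightarrow> co f w \<in> carrier K"
  by (induction f w rule: co.induct) auto

lemma co_out: "f \<in> carrier P.A \<Longrightarrow> w \<notin> basis m \<Longrightarrow> co f w = \<zero>"
proof (induction f w rule: co.induct)
  case (2 f i j)
  have o: "f p = \<zero>" if "p \<notin> paths m" for p using P.carrier_out 2(1) that by blast
  have "[i, i - 1, i] \<notin> paths m" "[i, i + 1, i] \<notin> paths m" if "i \<notin> {1..m}"
    using that by (auto simp: paths_successively)
  then show ?case using 2 o[of "[i,j]"] o[of "[i, i - 1, i]"] o[of "[i, i + 1, i]"]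
    by (auto simp: basis_def paths_successively)
qed (auto simp: basis_def paths_successively intro!: P.carrier_out)

lemma co_add: "f \<in> carrier P.A \<Longrightarrow> g \<in> carrier P.A \<Longrightarrow> co (f \<oplus>\<^bsub>P.A\<^esub> g) w = co f w \<oplus> co g w"
  by (induction f w rule: co.induct) (auto simp: P.word_algebra_simps(5) a_ac)

lemma co_smult: "c \<in> carrier K \<Longrightarrow> f \<in> carrier P.A \<Longrightarrow> co (c \<odot>\<^bsub>P.A\<^esub> f) w = c \<otimes> co f w"
  by (induction f w rule: co.induct) (auto simp: P.word_algebra_simps(6) r_distr)

lemma co_uminus: "f \<in> carrier P.A \<Longrightarrow> co (\<ominus>\<^bsub>P.A\<^esub> f) w = \<ominus> co f w"
  using co_smult[of "\<ominus> \<one>" f w] P.WM.smult_l_minus[of \<one> f] by (simp add: l_minus)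

lemma co_minus: "f \<in> carrier P.A \<Longrightarrow> g \<in> carrier P.A \<Longrightarrow> co (f \<ominus>\<^bsub>P.A\<^esub> g) w = co f w \<ominus> co g w"
  by (simp add: a_minus_def co_add co_uminus)

lemma co_zero: "co \<zero>\<^bsub>P.A\<^esub> w = \<zero>"
  by (induction "\<zero>\<^bsub>P.A\<^esub>" w rule: co.induct) (auto simp: P.word_algebra_simps(4))

lemma mult_expand:
  assumes "f \<in> carrier P.A" "g \<in> carrier P.A"
  shows "(f \<otimes>\<^bsub>P.A\<^esub> g) [a] = f [a] \<otimes> g [a]"
    and "(f \<otimes>\<^bsub>P.A\<^esub> g) [a, b] = f [a] \<otimes> g [a, b] \<oplus> f [a, b] \<otimes> g [b]"
    and "(f \<otimes>\<^bsub>P.A\<^esub> g) [a, b, c] = f [a] \<otimes> g [a, b, c] \<oplus> (f [a, b] \<otimes> g [b, c] \<oplus> f [a, b, c] \<otimes> g [c])"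
  using assms by (simp_all add: P.mult_conv lessThan_Suc a_ac)

text \<open>The structure constants of the zigzag algebra. In the last formula
  \<open>i \<ge> 1\<close> keeps the truncated \<open>i - 1\<close> different from
  \<open>i\<close>.\<close>

lemma co_mult:
  assumes f: "f \<in> carrier P.A" and g: "g \<in> carrier P.A"
  shows "co (f \<otimes>\<^bsub>P.A\<^esub> g) [i] = co f [i] \<otimes> co g [i]"
    and "i \<noteq> j \<Longrightarrow> co (f \<otimes>\<^bsub>P.A\<^esub> g) [i, j] = co f [i] \<otimes> co g [i, j] \<oplus> co f [i, j] \<otimes> co g [j]"
    and "i \<ge> 1 \<Longrightarrow> co (f \<otimes>\<^bsub>P.A\<^esub> g) [i, i] = co f [i] \<otimes> co g [i, i] \<oplus> co f [i, i] \<otimes> co g [i] \<oplus>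
       (co f [i, i - 1] \<otimes> co g [i - 1, i] \<oplus> co f [i, i + 1] \<otimes> co g [i + 1, i])"
proof -
  assume "i \<ge> 1"
  then have i: "i - 1 \<noteq> i" by simp
  show "co (f \<otimes>\<^bsub>P.A\<^esub> g) [i, i] = co f [i] \<otimes> co g [i, i] \<oplus> co f [i, i] \<otimes> co g [i] \<oplus>
       (co f [i, i - 1] \<otimes> co g [i - 1, i] \<oplus> co f [i, i + 1] \<otimes> co g [i + 1, i])"
    using f g i by (simp add: mult_expand r_distr l_distr a_ac del: One_nat_def)
qed (use f g in \<open>simp_all add: mult_expand r_distr l_distr a_ac\<close>)

definition J :: "(nat list \<Rightarrow> 'k) set" where "J = Idl\<^bsub>P.A\<^esub> (J_generators K m n)"

lemma gen_straight:
  assumes "m \<ge> 3" "i \<in> {2..m-1}"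
  shows "single K [i - 1, i, i + 1] \<in> J_generators K m n" "single K [i + 1, i, i - 1] \<in> J_generators K m n"
    "single K [i, i - 1, i] \<ominus>\<^bsub>P.A\<^esub> single K [i, i + 1, i] \<in> J_generators K m n"
  using assms unfolding J_generators_def path_elem_single path_algebra_word_algebra by auto

lemma paths2: "a \<in> {1..m} \<Longrightarrow> b \<in> {1..m} \<Longrightarrow> adj a b \<Longrightarrow> [a, b] \<in> paths m"
  and paths1: "a \<in> {1..m} \<Longrightarrow> [a] \<in> paths m"
  by (auto simp: paths_successively)

lemma gens_closed: "J_generators K m n \<subseteq> carrier P.A"
proof (cases "m \<ge> 3")
  case True
  have "[i, i - 1, i] \<in> paths m \<and> [i, i + 1, i] \<in> paths m \<and> [i - 1, i, i + 1] \<in> paths m \<and> [i + 1, i, i - 1] \<in> paths m"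
    if "i \<in> {2..m-1}" for i using that by (auto simp: paths_successively adj_def)
  then show ?thesis
    using True unfolding J_generators_def path_elem_single path_algebra_word_algebra by auto
next
  case False
  then have "[1, 2, 1, 2] \<in> paths m" "[2, 1, 2, 1] \<in> paths m" using m2 by (auto simp: paths_successively adj_def)
  then show ?thesis using False unfolding J_generators_def path_elem_single by auto
qed

lemma J_ideal: "ideal J P.A"
  unfolding J_def by (rule P.WA.genideal_ideal[OF gens_closed])

sublocale JI: ideal J P.A by (rule J_ideal)

lemma gens_J: "J_generators K m n \<subseteq> J"
  unfolding J_def by (rule P.WA.genideal_self[OF gens_closed])

lemma co_single: "co (single K p) w = (case w of
    [i] \<Rightarrow> if p = [i] then \<one> else \<zero>
  | [i, j] \<Rightarrow> if i = j then (if p = [i, i - 1, i] \<or> p = [i, i + 1, i] then \<one> else \<zero>) else if p = [i, j] then \<one> else \<zero>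
  | _ \<Rightarrow> \<zero>)"
  by (induction "single K p" w rule: co.induct) (auto simp: single_def)

text \<open>By \<open>co_mult\<close> the common kernel of all coordinates is an ideal, and it
  contains the generators.\<close>

lemma J_ker: "f \<in> J \<Longrightarrow> co f w = \<zero>"
proof -
  let ?K = "{f \<in> carrier P.A. \<forall>w. co f w = \<zero>}"
  have mult: "co (f \<otimes>\<^bsub>P.A\<^esub> g) w = \<zero>"
    if f: "f \<in> carrier P.A" and g: "g \<in> carrier P.A" and z: "(\<forall>w. co f w = \<zero>) \<or> (\<forall>w. co g w = \<zero>)" for f g w
  proof (cases "w \<in> basis m")
    case True
    then show ?thesis using z f g co_mult[OF f g] by (auto simp: basis_def dest: adj_neq simp del: co.simps)
  next
    case False
    then show ?thesis using co_out P.mult_closed[OF f g] by blast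
  qed
  have "ideal ?K P.A"
  proof (rule idealI[OF P.ring_A])
    show "subgroup ?K (add_monoid P.A)"
    proof (rule P.WA.add.subgroupI)
      show "?K \<noteq> {}" using co_zero P.zero_in by blast
    qed (auto simp: co_uminus co_add)
  qed (use mult P.mult_closed in auto)
  moreover have "J_generators K m n \<subseteq> ?K"
  proof (cases "m \<ge> 3")
    case True
    have mm: "\<one> \<ominus> \<one> = \<zero>" "\<zero> \<ominus> \<zero> = \<zero>" by (simp_all add: a_minus_def r_neg)
    have "co g w = \<zero>" if g: "g \<in> J_generators K m n" for g w
    proof -
      obtain i where i: "i \<in> {2..m-1}" and "g = single K [i, i - 1, i] \<ominus>\<^bsub>P.A\<^esub> single K [i, i + 1, i] \<or>
         g = single K [i - 1, i, i + 1] \<or> g = single K [i + 1, i, i - 1]"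
        using g True unfolding J_generators_def path_elem_single path_algebra_word_algebra by auto
      moreover have "[i, i - 1, i] \<in> paths m" "[i, i + 1, i] \<in> paths m"
        using i by (auto simp: paths_successively adj_def)
      ultimately show ?thesis using i
        by (auto simp: co_minus co_single mm split: list.splits)
    qed
    then show ?thesis using gens_closed by blast
  next
    case False
    then show ?thesis using gens_closed
      unfolding J_generators_def path_elem_single by (auto simp: co_single split: list.splits)
  qed
  ultimately have "J \<subseteq> ?K" unfolding J_def by (rule P.WA.genideal_minimal)
  then show "f \<in> J \<Longrightarrow> co f w = \<zero>" by blast
qed

lemma J_left: "p \<in> paths m \<Longrightarrow> f \<in> J \<Longrightarrow> single K p \<otimes>\<^bsub>P.A\<^esub> f \<in> J"
  and J_right: "p \<in> paths m \<Longrightarrow> f \<in> J \<Longrightarrow> f \<otimes>\<^bsub>P.A\<^esub> single K p \<in> J"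
  using JI.I_l_closed JI.I_r_closed P.single_in by auto

lemma J_carrier: "f \<in> J \<Longrightarrow> f \<in> carrier P.A"
  by (rule JI.Icarr)

lemma J_arith: "f \<in> J \<Longrightarrow> g \<in> J \<Longrightarrow> f \<oplus>\<^bsub>P.A\<^esub> g \<in> J" "f \<in> J \<Longrightarrow> \<ominus>\<^bsub>P.A\<^esub> f \<in> J" "\<zero>\<^bsub>P.A\<^esub> \<in> J"
  by (auto intro: JI.a_closed JI.a_inv_closed)

lemma J_smult: "c \<in> carrier K \<Longrightarrow> f \<in> J \<Longrightarrow> c \<odot>\<^bsub>P.A\<^esub> f \<in> J"
proof -
  assume c: "c \<in> carrier K" and f: "f \<in> J"
  have "(c \<odot>\<^bsub>P.A\<^esub> \<one>\<^bsub>P.A\<^esub>) \<otimes>\<^bsub>P.A\<^esub> f = c \<odot>\<^bsub>P.A\<^esub> f"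
    using c J_carrier[OF f] by (simp add: P.smult_mult P.one_in)
  then show ?thesis using JI.I_l_closed[OF f, of "c \<odot>\<^bsub>P.A\<^esub> \<one>\<^bsub>P.A\<^esub>"] c P.smult_closed[OF c P.one_in] by simp
qed

lemma J_cong: "f \<ominus>\<^bsub>P.A\<^esub> g \<in> J \<Longrightarrow> g \<in> J \<Longrightarrow> f \<in> carrier P.A \<Longrightarrow> f \<in> J"
proof -
  assume a: "f \<ominus>\<^bsub>P.A\<^esub> g \<in> J" "g \<in> J" "f \<in> carrier P.A"
  have "f = (f \<ominus>\<^bsub>P.A\<^esub> g) \<oplus>\<^bsub>P.A\<^esub> g"
    using a J_carrier[OF a(2)] by (simp add: a_minus_def P.WA.a_assoc P.WA.l_neg)
  then show ?thesis using J_arith(1)[OF a(1,2)] by simp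
qed

lemma straight_J:
  assumes "[x, y, z] \<in> paths m" "x \<noteq> z" shows "single K [x, y, z] \<in> J"
proof -
  have "(z = y + 1 \<and> x = y - 1 \<or> z = y - 1 \<and> x = y + 1)" "y \<in> {2..m-1}" "m \<ge> 3"
    using assms by (auto simp: paths_successively adj_def)
  then show ?thesis using gen_straight(1,2)[of y] gens_J by auto
qed

lemma turn_J:
  assumes "adj i x" "adj i y" "x \<noteq> y" "x \<in> {1..m}" "y \<in> {1..m}"
  shows "single K [i, x, i] \<ominus>\<^bsub>P.A\<^esub> single K [i, y, i] \<in> J"
proof -
  have i: "i \<in> {2..m-1}" "m \<ge> 3" "x = i - 1 \<and> y = i + 1 \<or> x = i + 1 \<and> y = i - 1"
    using assms by (auto simp: adj_def)
  have p: "[i, i - 1, i] \<in> paths m" "[i, i + 1, i] \<in> paths m"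
    using i by (auto simp: paths_successively adj_def)
  have "\<ominus>\<^bsub>P.A\<^esub> (single K [i, i - 1, i] \<ominus>\<^bsub>P.A\<^esub> single K [i, i + 1, i]) = single K [i, i + 1, i] \<ominus>\<^bsub>P.A\<^esub> single K [i, i - 1, i]"
    using p by (simp add: a_minus_def P.WA.minus_add P.WA.a_comm)
  moreover have "single K [i, i - 1, i] \<ominus>\<^bsub>P.A\<^esub> single K [i, i + 1, i] \<in> J"
    using gen_straight(3)[OF i(2,1)] gens_J by blast
  ultimately show ?thesis using i(3) J_arith(2) by fastforce
qed

text \<open>A path with a straight part is a multiple of a straight path. If it only goes back and
  forth and \<open>m \<ge> 3\<close>, one of its two vertices has a further neighbour
  \<open>b\<close>; exchanging a turn for the turn through \<open>b\<close> produces a straight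
  part.\<close>

lemma four_J:
  assumes p: "[x, y, z, t] \<in> paths m" shows "single K [x, y, z, t] \<in> J"
proof -
  have v: "x \<in> {1..m}" "y \<in> {1..m}" "z \<in> {1..m}" "t \<in> {1..m}" and a: "adj x y" "adj y z" "adj z t"
    using p by (auto simp: paths_successively)
  have p3: "[x, y, z] \<in> paths m" "[y, z, t] \<in> paths m" and p2: "[x, y] \<in> paths m" "[z, t] \<in> paths m"
    using p by (auto simp: paths_successively)
  have s4: "single K [x, y, z, t] = single K [x, y, z] \<otimes>\<^bsub>P.A\<^esub> single K [z, t]"
    "single K [x, y, z, t] = single K [x, y] \<otimes>\<^bsub>P.A\<^esub> single K [y, z, t]"
    using p3 p2 by (simp_all add: P.mult_single)
  consider "m = 2" | "x \<noteq> z" | "y \<noteq> t" | "m \<ge> 3" "x = z" "y = t" using m2 by (cases "m = 2") auto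
  then show ?thesis
  proof cases
    case 1
    have 12: "i = 1 \<or> i = 2" if "i \<in> {1..m}" for i using that 1 by auto
    have "[x, y, z, t] = [1, 2, 1, 2] \<or> [x, y, z, t] = [2, 1, 2, 1]"
      using 12[OF v(1)] 12[OF v(2)] 12[OF v(3)] 12[OF v(4)] a unfolding adj_def by (elim disjE) simp_all
    then show ?thesis using gens_J 1 unfolding J_generators_def path_elem_single by auto
  next
    case 2
    then show ?thesis using s4(1) J_right[OF p2(2) straight_J[OF p3(1)]] by simp
  next
    case 3
    then show ?thesis using s4(2) J_left[OF p2(1) straight_J[OF p3(2)]] by simp
  next
    case 4
    \<comment> \<open>The vertex \<open>b\<close> lies one step outside the edge: below its lower
      end if there is room, otherwise above its upper end, where \<open>m \<ge> 3\<close> provides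
      room.\<close>
    have "\<exists>b \<in> {1..m}. adj y b \<and> b \<noteq> x \<or> adj x b \<and> b \<noteq> y"
      using v a(1) 4 by (intro bexI[of _ "if y = Suc x then if x = 1 then y + 1 else x - 1 else if y = 1 then x + 1 else y - 1"])
        (auto simp: adj_def)
    then obtain b where b: "b \<in> {1..m}" "adj y b \<and> b \<noteq> x \<or> adj x b \<and> b \<noteq> y" by blast
    from b(2) show ?thesis
    proof
      assume yb: "adj y b \<and> b \<noteq> x"
      have q: "[x, y, b] \<in> paths m" "[b, y] \<in> paths m" "[y, b, y] \<in> paths m" "[y, x, y] \<in> paths m" "[x, y, x, y] \<in> paths m"
        using v a b(1) yb 4 p by (auto simp: paths_successively adj_sym)
      have eq: "single K [x, y] \<otimes>\<^bsub>P.A\<^esub> (single K [y, x, y] \<ominus>\<^bsub>P.A\<^esub> single K [y, b, y])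
         = single K [x, y, x, y] \<ominus>\<^bsub>P.A\<^esub> single K [x, y, b, y]"
        using q p2 4 by (simp add: a_minus_def P.WA.r_distr P.WA.r_minus P.mult_single)
      have "single K [x, y, x, y] \<ominus>\<^bsub>P.A\<^esub> single K [x, y, b, y] \<in> J"
        unfolding eq[symmetric]
        using v a b(1) yb by (intro J_left[OF p2(1)] turn_J) (auto simp: adj_sym)
      moreover have "single K [x, y, b, y] \<in> J"
        using J_right[OF q(2) straight_J[OF q(1)]] yb q by (simp add: P.mult_single)
      ultimately have "single K [x, y, x, y] \<in> J" by (rule J_cong) (use q(5) in auto)
      then show ?thesis using 4(2,3) by simp
    next
      assume xb: "adj x b \<and> b \<noteq> y"
      have q: "[b, x, y] \<in> paths m" "[x, b] \<in> paths m" "[x, b, x] \<in> paths m" "[x, y, x] \<in> paths m" "[x, y, x, y] \<in> paths m"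
        using v a b(1) xb 4 p by (auto simp: paths_successively adj_sym)
      have eq: "(single K [x, y, x] \<ominus>\<^bsub>P.A\<^esub> single K [x, b, x]) \<otimes>\<^bsub>P.A\<^esub> single K [x, y]
         = single K [x, y, x, y] \<ominus>\<^bsub>P.A\<^esub> single K [x, b, x, y]"
        using q p2 4 by (simp add: a_minus_def P.WA.l_distr P.WA.l_minus P.mult_single)
      have "single K [x, y, x, y] \<ominus>\<^bsub>P.A\<^esub> single K [x, b, x, y] \<in> J"
        unfolding eq[symmetric]
        using v a b(1) xb by (intro J_right[OF p2(1)] turn_J) (auto simp: adj_sym)
      moreover have "single K [x, b, x, y] \<in> J"
        using J_left[OF q(2) straight_J[OF q(1)]] xb q by (simp add: P.mult_single)
      ultimately have "single K [x, y, x, y] \<in> J" by (rule J_cong) (use q(5) in auto)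
      then show ?thesis using 4(2,3) by simp
    qed
  qed
qed

text \<open>The loop at \<open>1\<close> has to go through \<open>2\<close>, the only neighbour; it
  exists because \<open>m \<ge> 2\<close>.\<close>

fun rep :: "nat list \<Rightarrow> nat list" where
  "rep [i, j] = (if i = j then [i, if i = 1 then 2 else i - 1, i] else [i, j])"
| "rep w = w"

lemma rep_path: "w \<in> basis m \<Longrightarrow> rep w \<in> paths m"
proof -
  have "[i, if i = 1 then 2 else i - 1, i] \<in> paths m" if i: "i \<in> {1..m}" for i
  proof (cases "i = 1")
    case False
    with i have "i \<noteq> 0" "i \<noteq> Suc 0" by auto
    then obtain i' where "i = Suc (Suc i')" by (metis not0_implies_Suc)
    then show ?thesis using i by (auto simp: paths_successively adj_def)
  qed (use m2 in \<open>auto simp: paths_successively adj_def\<close>)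
  note loop = this
  assume "w \<in> basis m"
  then consider i where "w = [i]" "i \<in> {1..m}" | i where "w = [i, i]" "i \<in> {1..m}"
    | i j where "w = [i, j]" "i \<in> {1..m}" "j \<in> {1..m}" "adj i j"
    unfolding basis_def by blast
  then show "rep w \<in> paths m"
  proof cases
    case 2
    then show ?thesis using loop[of i] by (simp only: rep.simps refl if_True simp_thms)
  next
    case 3
    then show ?thesis using adj_neq[OF 3(4)] by (simp add: paths2)
  qed (simp add: paths1)
qed

lemma finite_basis: "finite (basis m)"
proof (rule finite_subset)
  show "basis m \<subseteq> {w. set w \<subseteq> {1..m} \<and> length w \<le> 2}" by (auto simp: basis_def)
qed (rule finite_lists_length_le, simp)

definition nf :: "(nat list \<Rightarrow> 'k) \<Rightarrow> nat list \<Rightarrow> 'k" where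
  "nf f = (\<Oplus>\<^bsub>P.A\<^esub> w\<in>basis m. co f w \<odot>\<^bsub>P.A\<^esub> single K (rep w))"

lemma nf_klinear: "klinear K P.A P.A nf"
proof (rule klinearI)
  have c: "c \<odot>\<^bsub>P.A\<^esub> single K (rep w) \<in> carrier P.A" if "w \<in> basis m" "c \<in> carrier K" for w c
    using that rep_path by (intro P.smult_closed) auto
  show "nf f \<in> carrier P.A" if "f \<in> carrier P.A" for f
    unfolding nf_def using that c by (intro P.WA.finsum_closed) auto
  show "nf (f \<oplus>\<^bsub>P.A\<^esub> g) = nf f \<oplus>\<^bsub>P.A\<^esub> nf g" if f: "f \<in> carrier P.A" and g: "g \<in> carrier P.A" for f g
  proof -
    have "nf (f \<oplus>\<^bsub>P.A\<^esub> g) = (\<Oplus>\<^bsub>P.A\<^esub> w\<in>basis m. co f w \<odot>\<^bsub>P.A\<^esub> single K (rep w) \<oplus>\<^bsub>P.A\<^esub> co g w \<odot>\<^bsub>P.A\<^esub> single K (rep w))"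
      unfolding nf_def using that c rep_path by (intro P.WA.finsum_cong') (auto simp: co_add P.WM.smult_l_distr)
    then show ?thesis unfolding nf_def using f g c by (simp add: P.WA.finsum_addf Pi_def)
  qed
  show "nf (a \<odot>\<^bsub>P.A\<^esub> f) = a \<odot>\<^bsub>P.A\<^esub> nf f" if f: "f \<in> carrier P.A" and a: "a \<in> carrier K" for f a
  proof -
    have "nf (a \<odot>\<^bsub>P.A\<^esub> f) = (\<Oplus>\<^bsub>P.A\<^esub> w\<in>basis m. a \<odot>\<^bsub>P.A\<^esub> (co f w \<odot>\<^bsub>P.A\<^esub> single K (rep w)))"
      unfolding nf_def using that c rep_path by (intro P.WA.finsum_cong') (auto simp: co_smult P.WM.smult_assoc1)
    then show ?thesis unfolding nf_def using f a c finite_basis by (simp add: P.WM.finsum_smult_ldistr Pi_def)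
  qed
qed

lemma nf_basis:
  assumes w: "w \<in> basis m" and c: "\<And>x. x \<in> basis m \<Longrightarrow> co f x = (if x = w then \<one> else \<zero>)"
  shows "nf f = single K (rep w)"
proof -
  have "nf f = (\<Oplus>\<^bsub>P.A\<^esub> x\<in>basis m. if w = x then single K (rep x) else \<zero>\<^bsub>P.A\<^esub>)"
    unfolding nf_def using c rep_path by (intro P.WA.finsum_cong') auto
  also have "\<dots> = single K (rep w)"
    using P.WA.add.finprod_singleton[OF w finite_basis, of "\<lambda>x. single K (rep x)"] rep_path by auto
  finally show ?thesis .
qed

lemma nf_null: "(\<And>x. x \<in> basis m \<Longrightarrow> co f x = \<zero>) \<Longrightarrow> nf f = \<zero>\<^bsub>P.A\<^esub>"
  unfolding nf_def using rep_path by (intro P.WA.add.finprod_one_eqI) auto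

text \<open>Checked on single paths. With at most one edge the path represents itself; with two
  edges it is straight, hence in \<open>J\<close>, or a turn, hence congruent to the chosen one;
  with three or more edges \<open>four_J\<close> puts it into \<open>J\<close>.\<close>

lemma nf_cong: "f \<in> carrier P.A \<Longrightarrow> f \<ominus>\<^bsub>P.A\<^esub> nf f \<in> J"
proof (induction f rule: P.word_induct)
  case zero
  then show ?case using klinear_zero[OF nf_klinear P.module_A P.module_A] J_arith(3) by (simp add: a_minus_def)
next
  case (add f g)
  have "f \<oplus>\<^bsub>P.A\<^esub> g \<ominus>\<^bsub>P.A\<^esub> nf (f \<oplus>\<^bsub>P.A\<^esub> g) = (f \<ominus>\<^bsub>P.A\<^esub> nf f) \<oplus>\<^bsub>P.A\<^esub> (g \<ominus>\<^bsub>P.A\<^esub> nf g)"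
    using add klinearD[OF nf_klinear] by (simp add: a_minus_def P.WA.minus_add P.WA.a_ac)
  then show ?case using add J_arith(1) by simp
next
  case (smult c f)
  have "c \<odot>\<^bsub>P.A\<^esub> f \<ominus>\<^bsub>P.A\<^esub> nf (c \<odot>\<^bsub>P.A\<^esub> f) = c \<odot>\<^bsub>P.A\<^esub> (f \<ominus>\<^bsub>P.A\<^esub> nf f)"
    using smult klinearD[OF nf_klinear] by (simp add: a_minus_def P.WM.smult_r_distr P.WM.smult_r_minus)
  then show ?case using smult J_smult by simp
next
  case (single p)
  have self: "single K p \<ominus>\<^bsub>P.A\<^esub> single K p \<in> J"
    using single J_arith(3) by (simp add: a_minus_def P.WA.r_neg)
  have null: "single K p \<ominus>\<^bsub>P.A\<^esub> nf (single K p) \<in> J"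
    if "single K p \<in> J"
    using that single nf_null[of "single K p"] J_ker[OF that] by (simp add: a_minus_def)
  from single obtain x q where p: "p = x # q" by (cases p) (auto simp: paths_def)
  show ?case
  proof (cases q)
    case Nil
    have "nf (single K p) = single K (rep p)"
      using single p Nil by (intro nf_basis) (auto simp: basis_def paths_successively co_single split: if_splits)
    then show ?thesis using self p Nil by simp
  next
    case q: (Cons y r)
    show ?thesis
    proof (cases r)
      case Nil
      have xy: "x \<noteq> y" using single by (auto simp: p q paths_successively)
      have "nf (single K p) = single K (rep p)"
        using single p q Nil by (intro nf_basis) (auto simp: basis_def paths_successively co_single split: if_splits)
      then show ?thesis using self p q Nil xy by simp
    next
      case r: (Cons z s)
      have xyz: "adj x y" "adj y z" "x \<in> {1..m}" "y \<in> {1..m}" "z \<in> {1..m}" "[x, y, z] \<in> paths m"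
        using single by (auto simp: p q r paths_successively)
      show ?thesis
      proof (cases s)
        case Nil
        show ?thesis
        proof (cases "x = z")
          case True
          have "nf (single K p) = single K (rep [x, x])"
            using xyz True by (intro nf_basis) (auto simp: p q r Nil basis_def co_single adj_def split: if_splits)
          moreover have "single K [x, y, x] \<ominus>\<^bsub>P.A\<^esub> single K (rep [x, x]) \<in> J"
          proof (cases "rep [x, x] = [x, y, x]")
            case True
            then show ?thesis using self \<open>x = z\<close> by (simp add: p q r Nil)
          next
            case False
            then show ?thesis using xyz m2 by (auto intro!: turn_J simp: adj_def split: if_splits)
          qed
          ultimately show ?thesis using True by (simp add: p q r Nil)
        next
          case False
          show ?thesis
            using False xyz straight_J by (intro null) (simp add: p q r Nil)
        qed
      next
        case (Cons t s')
        have f: "[x, y, z, t] \<in> paths m" "t # s' \<in> paths m"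
          using single by (auto simp: p q r Cons paths_successively)
        have "single K p = single K [x, y, z, t] \<otimes>\<^bsub>P.A\<^esub> single K (t # s')"
          using P.mult_single[OF f] by (simp add: p q r Cons)
        then show ?thesis
          using J_right[OF f(2) four_J[OF f(1)]]
          by (intro null) simp
      qed
    qed
  qed
qed

lemma J_iff: "f \<in> carrier P.A \<Longrightarrow> f \<in> J \<longleftrightarrow> (\<forall>w. co f w = \<zero>)"
  using J_ker nf_cong[of f] nf_null[of f] by (auto simp: a_minus_def)

end

section \<open>The quotient algebra in coordinates\<close>

context zigzag
begin

abbreviation "AA \<equiv> A_alg K m n"

definition coset :: "(nat list \<Rightarrow> 'k) \<Rightarrow> (nat list \<Rightarrow> 'k) set" where
  "coset f = J +>\<^bsub>P.A\<^esub> f"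

lemma AA_def': "AA = galg_quot P.A J"
  by (simp add: A_alg_def J_def path_algebra_word_algebra)

lemma AA_carrier: "carrier AA = coset ` carrier P.A"
  by (auto simp: AA_def' galg_quot_def FactRing_def A_RCOSETS_def' coset_def)

lemma AA_ops:
  assumes "f \<in> carrier P.A" "g \<in> carrier P.A"
  shows "coset f \<otimes>\<^bsub>AA\<^esub> coset g = coset (f \<otimes>\<^bsub>P.A\<^esub> g)" "coset f \<oplus>\<^bsub>AA\<^esub> coset g = coset (f \<oplus>\<^bsub>P.A\<^esub> g)"
  using JI.rcoset_mult_add[OF assms] JI.a_rcos_sum[OF assms]
  by (simp_all add: AA_def' galg_quot_def FactRing_def coset_def)

lemma coset_eq: "coset f = (\<lambda>j. j \<oplus>\<^bsub>P.A\<^esub> f) ` J"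
  by (auto simp: coset_def a_r_coset_def r_coset_def)

lemma coset_self: "f \<in> carrier P.A \<Longrightarrow> f \<in> coset f"
  using J_arith(3) by (force simp: coset_eq image_iff)

lemma AA_smult:
  assumes c: "c \<in> carrier K" and f: "f \<in> carrier P.A"
  shows "c \<odot>\<^bsub>AA\<^esub> coset f = coset (c \<odot>\<^bsub>P.A\<^esub> f)"
proof -
  have "c \<odot>\<^bsub>AA\<^esub> coset f = J <+>\<^bsub>P.A\<^esub> ((\<lambda>x. c \<odot>\<^bsub>P.A\<^esub> x) ` coset f)"
    by (simp add: AA_def' galg_quot_def)
  also have "\<dots> = coset (c \<odot>\<^bsub>P.A\<^esub> f)"
  proof (rule Set.set_eqI, rule iffI)
    fix y assume "y \<in> J <+>\<^bsub>P.A\<^esub> ((\<lambda>x. c \<odot>\<^bsub>P.A\<^esub> x) ` coset f)"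
    then obtain b b' where b: "b \<in> J" "b' \<in> J" "y = b \<oplus>\<^bsub>P.A\<^esub> c \<odot>\<^bsub>P.A\<^esub> (b' \<oplus>\<^bsub>P.A\<^esub> f)"
      by (auto simp: set_add_def set_mult_def coset_eq)
    then have "y = (b \<oplus>\<^bsub>P.A\<^esub> c \<odot>\<^bsub>P.A\<^esub> b') \<oplus>\<^bsub>P.A\<^esub> c \<odot>\<^bsub>P.A\<^esub> f"
      using c f J_carrier by (simp add: P.WM.smult_r_distr P.WA.a_assoc)
    then show "y \<in> coset (c \<odot>\<^bsub>P.A\<^esub> f)" using b c by (auto simp: coset_eq intro!: J_arith J_smult)
  next
    fix y assume "y \<in> coset (c \<odot>\<^bsub>P.A\<^esub> f)"
    then obtain b where "b \<in> J" "y = b \<oplus>\<^bsub>P.A\<^esub> c \<odot>\<^bsub>P.A\<^esub> f" by (auto simp: coset_eq)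
    then show "y \<in> J <+>\<^bsub>P.A\<^esub> ((\<lambda>x. c \<odot>\<^bsub>P.A\<^esub> x) ` coset f)"
      using coset_self[OF f] by (auto simp: set_add_def set_mult_def)
  qed
  finally show ?thesis .
qed

lemma AA_grade: "grade AA t = coset ` grade P.A t"
  and AA_iota: "iota AA r = coset (iota P.A r)"
  by (simp_all add: AA_def' galg_quot_def coset_def)

text \<open>The choice of the representative is immaterial because \<open>co\<close> vanishes on
  \<open>J\<close>.\<close>

definition coords :: "(nat list \<Rightarrow> 'k) set \<Rightarrow> nat list \<Rightarrow> 'k" where
  "coords X = co (SOME f. f \<in> X)"

lemma coords_coset: "f \<in> carrier P.A \<Longrightarrow> coords (coset f) w = co f w"
proof -
  assume f: "f \<in> carrier P.A"
  have "(SOME g. g \<in> coset f) \<in> coset f" using coset_self[OF f] someI[of "\<lambda>g. g \<in> coset f" f] by blast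
  then obtain j where "j \<in> J" "(SOME g. g \<in> coset f) = j \<oplus>\<^bsub>P.A\<^esub> f" by (auto simp: coset_eq)
  then show ?thesis using f J_carrier[of j] J_ker[of j] by (simp add: coords_def co_add)
qed

lemma coset_eq_iff: "f \<in> carrier P.A \<Longrightarrow> g \<in> carrier P.A \<Longrightarrow> coset f = coset g \<longleftrightarrow> (\<forall>w. co f w = co g w)"
proof
  assume f: "f \<in> carrier P.A" and g: "g \<in> carrier P.A"
  show "coset f = coset g \<Longrightarrow> \<forall>w. co f w = co g w" using coords_coset[OF f] coords_coset[OF g] by metis
  assume eq: "\<forall>w. co f w = co g w"
  then have "f \<ominus>\<^bsub>P.A\<^esub> g \<in> J" using f g by (simp add: J_iff co_minus) (simp add: a_minus_def r_neg)
  then have fg: "f \<ominus>\<^bsub>P.A\<^esub> g \<in> J" .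
  have "f = (f \<ominus>\<^bsub>P.A\<^esub> g) \<oplus>\<^bsub>P.A\<^esub> g" using f g by (simp add: a_minus_def P.WA.a_assoc P.WA.l_neg)
  then have "f \<in> coset g" unfolding coset_eq using fg by blast
  then show "coset f = coset g" using JI.a_repr_independence'[of f g] g by (simp add: coset_def)
qed

lemma co_grade:
  assumes f: "f \<in> grade P.A t" and w: "co f w \<noteq> \<zero>"
  shows "basis_degree n w = t"
proof -
  have fc: "f \<in> carrier P.A" using f by auto
  have d: "path_degree n p = t" if "f p \<noteq> \<zero>" for p using f that unfolding P.word_algebra_simps(7) by blast
  have "w \<in> basis m" using w co_out[OF fc] by blast
  then consider i where "w = [i]" | i j where "w = [i, j]" "adj i j" | i where "w = [i, i]" "i \<in> {1..m}"
    by (auto simp: basis_def)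
  then show ?thesis
  proof cases
    case 1
    then show ?thesis using d[of w] w by simp
  next
    case 2
    then show ?thesis using d[of w] w adj_neq[OF 2(2)] by (simp add: path_degree_Cons letter_degree_def)
  next
    case 3
    then have "f [i, i - 1, i] \<noteq> \<zero> \<or> f [i, i + 1, i] \<noteq> \<zero>" using w by auto
    then have "path_degree n [i, i - 1, i] = t \<or> path_degree n [i, i + 1, i] = t" using d by blast
    then show ?thesis using 3 by (auto simp: path_degree_Cons letter_degree_def edge_degree_def)
  qed
qed

end

section \<open>Coordinates of cocycles in a dga with the given cohomology\<close>

locale zigzag_cohomology = zigzag K m n + B: diff_graded_algebra K m B
  for K :: "('k, 'e) ring_scheme" (structure) and m n :: nat and B :: "('k, 'b) dga" +
  fixes \<theta>
  assumes iso: "\<theta> \<in> galg_iso K m (cohomology B) (A_alg K m n)"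
begin

text \<open>Transports the coordinates along the isomorphism, so that from here on scalars attached
  to cocycles replace cosets on both sides.\<close>

definition \<chi> :: "'b \<Rightarrow> nat list \<Rightarrow> 'k" where "\<chi> z = coords (\<theta> (B.cls z))"

lemma \<theta>_props:
  shows "X \<in> carrier (cohomology B) \<Longrightarrow> \<theta> X \<in> carrier AA"
    and "X \<in> carrier (cohomology B) \<Longrightarrow> Y \<in> carrier (cohomology B) \<Longrightarrow> \<theta> (X \<otimes>\<^bsub>cohomology B\<^esub> Y) = \<theta> X \<otimes>\<^bsub>AA\<^esub> \<theta> Y"
    and "X \<in> carrier (cohomology B) \<Longrightarrow> Y \<in> carrier (cohomology B) \<Longrightarrow> \<theta> (X \<oplus>\<^bsub>cohomology B\<^esub> Y) = \<theta> X \<oplus>\<^bsub>AA\<^esub> \<theta> Y"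
    and "c \<in> carrier K \<Longrightarrow> X \<in> carrier (cohomology B) \<Longrightarrow> \<theta> (c \<odot>\<^bsub>cohomology B\<^esub> X) = c \<odot>\<^bsub>AA\<^esub> \<theta> X"
    and "X \<in> grade (cohomology B) t \<Longrightarrow> \<theta> X \<in> grade AA t"
    and "r \<in> carrier (power_algebra K m) \<Longrightarrow> \<theta> (iota (cohomology B) r) = iota AA r"
    and "bij_betw \<theta> (carrier (cohomology B)) (carrier AA)"
proof -
  show "X \<in> grade (cohomology B) t \<Longrightarrow> \<theta> X \<in> grade AA t"
    using iso unfolding galg_iso_def galg_hom_def by blast
qed (use iso in \<open>auto simp: galg_iso_def galg_hom_def alg_hom_def ring_hom_def\<close>)

lemma cls_in: "z \<in> cocycles B \<Longrightarrow> B.cls z \<in> carrier (cohomology B)"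
  by (simp add: B.cohomology_carrier)

lemma \<theta>_rep:
  assumes "z \<in> cocycles B"
  obtains f where "f \<in> carrier P.A" "\<theta> (B.cls z) = coset f" "\<chi> z = co f"
  using \<theta>_props(1)[OF cls_in[OF assms]] coords_coset by (auto simp: AA_carrier \<chi>_def fun_eq_iff)

lemma \<chi>_closed [simp]: "z \<in> cocycles B \<Longrightarrow> \<chi> z w \<in> carrier K"
  by (metis \<theta>_rep co_closed)

lemma \<chi>_out: "z \<in> cocycles B \<Longrightarrow> w \<notin> basis m \<Longrightarrow> \<chi> z w = \<zero>"
  by (metis \<theta>_rep co_out)

lemma \<chi>_add: "z \<in> cocycles B \<Longrightarrow> z' \<in> cocycles B \<Longrightarrow> \<chi> (z \<oplus>\<^bsub>B\<^esub> z') w = \<chi> z w \<oplus> \<chi> z' w"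
proof -
  assume z: "z \<in> cocycles B" and z': "z' \<in> cocycles B"
  obtain f where f: "f \<in> carrier P.A" "\<theta> (B.cls z) = coset f" "\<chi> z = co f" using \<theta>_rep[OF z] by blast
  obtain g where g: "g \<in> carrier P.A" "\<theta> (B.cls z') = coset g" "\<chi> z' = co g" using \<theta>_rep[OF z'] by blast
  have "\<theta> (B.cls (z \<oplus>\<^bsub>B\<^esub> z')) = coset (f \<oplus>\<^bsub>P.A\<^esub> g)"
    using \<theta>_props(3)[OF cls_in[OF z] cls_in[OF z']] f g z z' by (simp add: B.cohomology_ops AA_ops)
  then show ?thesis using f g by (simp add: \<chi>_def coords_coset co_add P.add_closed)
qed

lemma \<chi>_smult: "c \<in> carrier K \<Longrightarrow> z \<in> cocycles B \<Longrightarrow> \<chi> (c \<odot>\<^bsub>B\<^esub> z) w = c \<otimes> \<chi> z w"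
proof -
  assume z: "z \<in> cocycles B" and c: "c \<in> carrier K"
  obtain f where f: "f \<in> carrier P.A" "\<theta> (B.cls z) = coset f" "\<chi> z = co f" using \<theta>_rep[OF z] by blast
  have "\<theta> (B.cls (c \<odot>\<^bsub>B\<^esub> z)) = coset (c \<odot>\<^bsub>P.A\<^esub> f)"
    using \<theta>_props(4)[OF c cls_in[OF z]] f z c by (simp add: B.cohomology_smult AA_smult)
  then show ?thesis using f c by (simp add: \<chi>_def coords_coset co_smult P.smult_closed)
qed

lemma \<chi>_mult:
  assumes z: "z \<in> cocycles B" and z': "z' \<in> cocycles B"
  shows "\<chi> (z \<otimes>\<^bsub>B\<^esub> z') [i] = \<chi> z [i] \<otimes> \<chi> z' [i]"
    and "i \<noteq> j \<Longrightarrow> \<chi> (z \<otimes>\<^bsub>B\<^esub> z') [i, j] = \<chi> z [i] \<otimes> \<chi> z' [i, j] \<oplus> \<chi> z [i, j] \<otimes> \<chi> z' [j]"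
    and "i \<ge> 1 \<Longrightarrow> \<chi> (z \<otimes>\<^bsub>B\<^esub> z') [i, i] = \<chi> z [i] \<otimes> \<chi> z' [i, i] \<oplus> \<chi> z [i, i] \<otimes> \<chi> z' [i] \<oplus>
       (\<chi> z [i, i - 1] \<otimes> \<chi> z' [i - 1, i] \<oplus> \<chi> z [i, i + 1] \<otimes> \<chi> z' [i + 1, i])"
proof -
  obtain f where f: "f \<in> carrier P.A" "\<theta> (B.cls z) = coset f" "\<chi> z = co f" using \<theta>_rep[OF z] by blast
  obtain g where g: "g \<in> carrier P.A" "\<theta> (B.cls z') = coset g" "\<chi> z' = co g" using \<theta>_rep[OF z'] by blast
  have "\<theta> (B.cls (z \<otimes>\<^bsub>B\<^esub> z')) = coset (f \<otimes>\<^bsub>P.A\<^esub> g)"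
    using \<theta>_props(2)[OF cls_in[OF z] cls_in[OF z']] f g z z' by (simp add: B.cohomology_ops AA_ops)
  then have "\<chi> (z \<otimes>\<^bsub>B\<^esub> z') w = co (f \<otimes>\<^bsub>P.A\<^esub> g) w" for w
    using f g by (simp add: \<chi>_def coords_coset P.mult_closed del: co.simps)
  note this co_mult[OF f(1) g(1), folded f(3) g(3)]
  then show "\<chi> (z \<otimes>\<^bsub>B\<^esub> z') [i] = \<chi> z [i] \<otimes> \<chi> z' [i]"
    "i \<noteq> j \<Longrightarrow> \<chi> (z \<otimes>\<^bsub>B\<^esub> z') [i, j] = \<chi> z [i] \<otimes> \<chi> z' [i, j] \<oplus> \<chi> z [i, j] \<otimes> \<chi> z' [j]"
    "i \<ge> 1 \<Longrightarrow> \<chi> (z \<otimes>\<^bsub>B\<^esub> z') [i, i] = \<chi> z [i] \<otimes> \<chi> z' [i, i] \<oplus> \<chi> z [i, i] \<otimes> \<chi> z' [i] \<oplus>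
       (\<chi> z [i, i - 1] \<otimes> \<chi> z' [i - 1, i] \<oplus> \<chi> z [i, i + 1] \<otimes> \<chi> z' [i + 1, i])"
    by (simp_all only:)
qed

text \<open>Injectivity of \<open>\<theta>\<close> combined with \<open>coset_eq_iff\<close>. Every
  obstruction is tested through this criterion.\<close>

lemma \<chi>_zero_iff: "z \<in> cocycles B \<Longrightarrow> z \<in> coboundaries B \<longleftrightarrow> (\<forall>w. \<chi> z w = \<zero>)"
proof -
  assume z: "z \<in> cocycles B"
  obtain f where f: "f \<in> carrier P.A" "\<theta> (B.cls z) = coset f" "\<chi> z = co f" using \<theta>_rep[OF z] by blast
  obtain g where g: "g \<in> carrier P.A" "\<theta> (B.cls \<zero>\<^bsub>B\<^esub>) = coset g" "\<chi> \<zero>\<^bsub>B\<^esub> = co g"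
    using \<theta>_rep[OF B.cocycles_closed(1)] by blast
  have z0: "\<chi> \<zero>\<^bsub>B\<^esub> w = \<zero>" for w
    using \<chi>_smult[OF zero_closed B.cocycles_closed(1), of w] B.cocycles_closed(1) by simp
  have "z \<in> coboundaries B \<longleftrightarrow> B.cls z = B.cls \<zero>\<^bsub>B\<^esub>" using B.cls_zero_iff[OF z] by simp
  also have "\<dots> \<longleftrightarrow> \<theta> (B.cls z) = \<theta> (B.cls \<zero>\<^bsub>B\<^esub>)"
    using inj_on_eq_iff[OF bij_betw_imp_inj_on[OF \<theta>_props(7)] cls_in[OF z] cls_in[OF B.cocycles_closed(1)]] by simp
  also have "\<dots> \<longleftrightarrow> (\<forall>w. co f w = co g w)" unfolding f g using coset_eq_iff[OF f(1) g(1)] .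
  also have "\<dots> \<longleftrightarrow> (\<forall>w. \<chi> z w = \<zero>)" using f(3) g(3) z0 by simp
  finally show ?thesis .
qed

lemma \<chi>_grade: "z \<in> cocycles B \<Longrightarrow> z \<in> grade B t \<Longrightarrow> \<chi> z w \<noteq> \<zero> \<Longrightarrow> basis_degree n w = t"
proof -
  assume z: "z \<in> cocycles B" and t: "z \<in> grade B t" and nz: "\<chi> z w \<noteq> \<zero>"
  have "B.cls z \<in> grade (cohomology B) t" using z t by (auto simp: B.cohomology_consts)
  then have "\<theta> (B.cls z) \<in> coset ` grade P.A t" using \<theta>_props(5) by (simp add: AA_grade)
  then obtain f where f: "f \<in> grade P.A t" "\<theta> (B.cls z) = coset f" by blast
  then show ?thesis using nz co_grade[OF f(1)] coords_coset[of f] by (auto simp: \<chi>_def)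
qed

lemma \<chi>_iota:
  assumes r: "r \<in> carrier (power_algebra K m)"
  shows "\<chi> (iota B r) w = (if \<exists>i\<in>{1..m}. w = [i] then r (hd w) else \<zero>)"
proof -
  have "\<theta> (B.cls (iota B r)) = coset (iota P.A r)"
    using \<theta>_props(6)[OF r] by (simp add: B.cohomology_consts AA_iota)
  then have "\<chi> (iota B r) w = co (iota P.A r) w" using P.iota_in[OF r] by (simp add: \<chi>_def coords_coset)
  also have "\<dots> = (if \<exists>i\<in>{1..m}. w = [i] then r (hd w) else \<zero>)"
    by (induction "iota P.A r" w rule: co.induct) (auto simp: P.word_algebra_simps(8))
  finally show ?thesis .
qed

lemma \<chi>_idem: "i \<in> {1..m} \<Longrightarrow> \<chi> (B.idem i) w = (if w = [i] then \<one> else \<zero>)"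
  unfolding B.idem_def \<chi>_iota[OF B.base_unit_in] by (auto simp: B.base_unit_def)

lemma idem_cocycle: "B.idem i \<in> cocycles B"
  unfolding B.idem_def by (simp add: B.cocycles_closed)

lemma co_rep:
  assumes "w \<in> basis m" shows "co (single K (rep w)) x = (if x = w then \<one> else \<zero>)"
proof (cases "x \<in> basis m")
  case True
  then show ?thesis using assms by (auto simp: basis_def co_single dest: adj_neq split: if_splits)
next
  case False
  then show ?thesis using assms co_out[OF P.single_in[OF rep_path[OF assms]], of x] by auto
qed

lemma \<chi>_surj:
  assumes w: "w \<in> basis m" shows "\<exists>z \<in> cocycles B. \<forall>x. \<chi> z x = (if x = w then \<one> else \<zero>)"
proof -
  have s: "single K (rep w) \<in> carrier P.A" using rep_path[OF w] by auto
  then have "coset (single K (rep w)) \<in> carrier AA" by (auto simp: AA_carrier)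
  then obtain X where "X \<in> carrier (cohomology B)" "\<theta> X = coset (single K (rep w))"
    using \<theta>_props(7) unfolding bij_betw_def by (metis imageE)
  then obtain z where "z \<in> cocycles B" "\<theta> (B.cls z) = coset (single K (rep w))"
    by (auto simp: B.cohomology_carrier)
  then show ?thesis using coords_coset[OF s] co_rep[OF w] by (intro bexI[of _ z]) (simp_all add: \<chi>_def)
qed

lemma \<chi>_minus: "z \<in> cocycles B \<Longrightarrow> z' \<in> cocycles B \<Longrightarrow> \<chi> (z \<ominus>\<^bsub>B\<^esub> z') w = \<chi> z w \<ominus> \<chi> z' w"
proof -
  assume z: "z \<in> cocycles B" and z': "z' \<in> cocycles B"
  have "\<ominus>\<^bsub>B\<^esub> z' = (\<ominus> \<one>) \<odot>\<^bsub>B\<^esub> z'" using B.smult_l_minus[of \<one> z'] B.cocyclesD(1)[OF z'] by simp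
  then show ?thesis using z z' by (simp add: a_minus_def \<chi>_add \<chi>_smult B.cocycles_closed l_minus)
qed

lemma \<chi>_finsum:
  "finite S \<Longrightarrow> (\<And>x. x \<in> S \<Longrightarrow> F x \<in> cocycles B) \<Longrightarrow> (\<Oplus>\<^bsub>B\<^esub> x\<in>S. F x) \<in> cocycles B \<and> \<chi> (\<Oplus>\<^bsub>B\<^esub> x\<in>S. F x) w = (\<Oplus>x\<in>S. \<chi> (F x) w)"
proof (induction S rule: finite_induct)
  case empty
  then show ?case using \<chi>_zero_iff[OF B.cocycles_closed(1)] B.coboundaries_closed(1) B.cocycles_closed(1) by auto
next
  case (insert x S)
  then have F: "F \<in> insert x S \<rightarrow> carrier B" using B.cocyclesD(1) by auto
  then show ?case using insert
    by (simp add: B.A.finsum_insert finsum_insert Pi_def B.cocycles_closed \<chi>_add)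
qed

lemma \<chi>_hcomp:
  assumes z: "z \<in> cocycles B"
  shows "\<chi> (B.hcomp z t) w = (if basis_degree n w = t then \<chi> z w else \<zero>)"
proof -
  let ?S = "{p. B.hcomp z p \<noteq> \<zero>\<^bsub>B\<^esub>}"
  note h = B.hcomp[OF B.cocyclesD(1)[OF z]] and hc = B.cocycle_hcomp[OF z]
  have off: "\<chi> (B.hcomp z p) w = \<zero>" if "basis_degree n w \<noteq> p" for p
    using \<chi>_grade[OF hc h(1)] that by blast
  show ?thesis
  proof (cases "basis_degree n w = t")
    case True
    have "\<chi> z w = (\<Oplus>p\<in>?S. \<chi> (B.hcomp z p) w)"
      using \<chi>_finsum[OF h(2), of "B.hcomp z" w] hc h(3) by simp
    also have "\<dots> = (\<Oplus>p\<in>?S. if t = p then \<chi> (B.hcomp z p) w else \<zero>)"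
      using off True hc by (intro finsum_cong') auto
    also have "\<dots> = \<chi> (B.hcomp z t) w"
    proof (cases "t \<in> ?S")
      case True
      then show ?thesis using add.finprod_singleton[OF True h(2), of "\<lambda>p. \<chi> (B.hcomp z p) w"] hc by auto
    next
      case False
      then have 0: "B.hcomp z t = \<zero>\<^bsub>B\<^esub>" by simp
      have "(\<Oplus>p\<in>?S. if t = p then \<chi> (B.hcomp z p) w else \<zero>) = \<zero>"
        using False by (intro add.finprod_one_eqI) auto
      then show ?thesis
        using 0 \<chi>_zero_iff[OF B.cocycles_closed(1)] B.coboundaries_closed(1) by simp
    qed
    finally show ?thesis using True by simp
  qed (simp add: off)
qed

text \<open>The morphism space between two vertices in degree \<open>t\<close>, where the values on
  words from \<open>i\<close> to \<open>j\<close> have to lie.\<close>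

definition hm :: "nat \<Rightarrow> nat \<Rightarrow> int \<Rightarrow> 'b set" where
  "hm i j t = {x \<in> grade B t. B.idem i \<otimes>\<^bsub>B\<^esub> x = x \<and> x \<otimes>\<^bsub>B\<^esub> B.idem j = x}"

lemma hm_carrier: "x \<in> hm i j t \<Longrightarrow> x \<in> carrier B" and hm_grade: "x \<in> hm i j t \<Longrightarrow> x \<in> grade B t"
  by (auto simp: hm_def)

lemma hm_closed:
  "\<zero>\<^bsub>B\<^esub> \<in> hm i j t"
  "x \<in> hm i j t \<Longrightarrow> y \<in> hm i j t \<Longrightarrow> x \<oplus>\<^bsub>B\<^esub> y \<in> hm i j t"
  "c \<in> carrier K \<Longrightarrow> x \<in> hm i j t \<Longrightarrow> c \<odot>\<^bsub>B\<^esub> x \<in> hm i j t"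
  "x \<in> hm i j t \<Longrightarrow> y \<in> hm j l s \<Longrightarrow> x \<otimes>\<^bsub>B\<^esub> y \<in> hm i l (t + s)"
  "x \<in> hm i j t \<Longrightarrow> diff B x \<in> hm i j (t + 1)"
proof -
  show "x \<in> hm i j t \<Longrightarrow> y \<in> hm i j t \<Longrightarrow> x \<oplus>\<^bsub>B\<^esub> y \<in> hm i j t"
    using hm_carrier[of x] hm_carrier[of y] by (auto simp: hm_def B.grade_closed B.A.r_distr B.A.l_distr)
  show "c \<in> carrier K \<Longrightarrow> x \<in> hm i j t \<Longrightarrow> c \<odot>\<^bsub>B\<^esub> x \<in> hm i j t"
    using hm_carrier[of x] by (auto simp: hm_def B.grade_closed B.smult_mult_left B.smult_mult_right)
  show "x \<otimes>\<^bsub>B\<^esub> y \<in> hm i l (t + s)" if x: "x \<in> hm i j t" and y: "y \<in> hm j l s"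
  proof -
    have c: "x \<in> carrier B" "y \<in> carrier B" using x y hm_carrier by auto
    have "B.idem i \<otimes>\<^bsub>B\<^esub> (x \<otimes>\<^bsub>B\<^esub> y) = x \<otimes>\<^bsub>B\<^esub> y"
      using x c B.A.m_assoc[of "B.idem i" x y] by (simp add: hm_def)
    moreover have "(x \<otimes>\<^bsub>B\<^esub> y) \<otimes>\<^bsub>B\<^esub> B.idem l = x \<otimes>\<^bsub>B\<^esub> y"
      using y c B.A.m_assoc[of x y "B.idem l"] by (simp add: hm_def)
    ultimately show ?thesis using x y B.grade_mult[of x t y s] by (simp add: hm_def)
  qed
  show "diff B x \<in> hm i j (t + 1)" if x: "x \<in> hm i j t"
  proof -
    have xc: "x \<in> carrier B" and xg: "x \<in> grade B t" using x hm_carrier hm_grade by auto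
    have "B.idem i \<otimes>\<^bsub>B\<^esub> diff B x = diff B x"
      using x B.diff_idem_mult[OF xc, of i] by (simp add: hm_def)
    moreover have "diff B x \<otimes>\<^bsub>B\<^esub> B.idem j = diff B x"
      using x B.diff_mult[OF xg, of "B.idem j"] xc by (auto simp: hm_def B.diff_idem B.diff_closed a_minus_def split: if_splits)
    ultimately show ?thesis using B.diff_grade[OF xg] by (simp add: hm_def)
  qed
qed (simp add: hm_def B.grade_closed)

lemma hm_sandwich:
  "x \<in> grade B t \<Longrightarrow> B.idem i \<otimes>\<^bsub>B\<^esub> x \<otimes>\<^bsub>B\<^esub> B.idem j \<in> hm i j t"
proof -
  assume x: "x \<in> grade B t"
  then have xc: "x \<in> carrier B" by auto
  have e: "B.idem i \<otimes>\<^bsub>B\<^esub> (B.idem i \<otimes>\<^bsub>B\<^esub> y) = B.idem i \<otimes>\<^bsub>B\<^esub> y" if "y \<in> carrier B" for y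
    using B.idem_mult[of i i] that by (simp flip: B.A.m_assoc)
  have "B.idem i \<otimes>\<^bsub>B\<^esub> x \<otimes>\<^bsub>B\<^esub> B.idem j \<in> grade B t"
    using B.grade_mult[OF B.grade_mult[OF B.idem_grade x] B.idem_grade, of i j] by simp
  then show ?thesis using xc e B.idem_mult[of j j] by (simp add: hm_def B.A.m_assoc)
qed

text \<open>Multiplication with the idempotents fixes \<open>z\<close> but kills every coordinate
  with other end points.\<close>

lemma \<chi>_hm:
  assumes i: "i \<in> {1..m}" "j \<in> {1..m}" and z: "z \<in> cocycles B" "z \<in> hm i j t" and nz: "\<chi> z w \<noteq> \<zero>"
  shows "w \<in> basis m" "hd w = i" "last w = j" "basis_degree n w = t"
proof -
  have zi: "B.idem i \<otimes>\<^bsub>B\<^esub> z = z" "z \<otimes>\<^bsub>B\<^esub> B.idem j = z" using z(2) by (auto simp: hm_def)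
  show "basis_degree n w = t" using \<chi>_grade[OF z(1) hm_grade[OF z(2)] nz] .
  show w: "w \<in> basis m" using \<chi>_out[OF z(1)] nz by blast
  note ml = \<chi>_mult[OF idem_cocycle[of i] z(1)] and mr = \<chi>_mult[OF z(1) idem_cocycle[of j]]
  from w consider a where "w = [a]" "a \<in> {1..m}" | a b where "w = [a, b]" "a \<noteq> b" "a \<in> {1..m}" | a where "w = [a, a]" "a \<in> {1..m}"
    by (auto simp: basis_def dest: adj_neq)
  then have "hd w = i \<and> last w = j"
  proof cases
    case 1
    then show ?thesis
      using ml(1)[of a] mr(1)[of a] nz z i unfolding zi by (auto simp: \<chi>_idem split: if_splits)
  next
    case 2
    then show ?thesis
      using ml(2)[OF 2(2)] mr(2)[OF 2(2)] nz z i unfolding zi by (auto simp: \<chi>_idem split: if_splits)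
  next
    case 3
    then show ?thesis
      using ml(3)[of a] mr(3)[of a] nz z i unfolding zi by (auto simp: \<chi>_idem split: if_splits)
  qed
  then show "hd w = i" "last w = j" by auto
qed

text \<open>A homogeneous primitive is multiplied by \<open>idem i\<close> and
  \<open>idem j\<close>. These are cocycles of degree zero, so its differential is multiplied in the
  same way, which leaves \<open>z\<close> unchanged.\<close>

lemma hm_exact:
  assumes z: "z \<in> coboundaries B" "z \<in> hm i j t"
  shows "\<exists>y \<in> hm i j (t - 1). diff B y = z"
proof -
  obtain y0 where "y0 \<in> carrier B" "z = diff B y0" using z by (auto simp: coboundaries_def)
  then obtain y where y: "y \<in> grade B (t - 1)" "diff B y = z"
    using B.exact_homogeneous[of y0 t] hm_grade[OF z(2)] by auto
  have yc: "y \<in> carrier B" using y by auto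
  have iy: "B.idem i \<otimes>\<^bsub>B\<^esub> y \<in> grade B (t - 1)" using B.grade_mult[OF B.idem_grade y(1)] by simp
  have "diff B (B.idem i \<otimes>\<^bsub>B\<^esub> y \<otimes>\<^bsub>B\<^esub> B.idem j) = z"
    using B.diff_mult[OF iy, of "B.idem j"] z(2) y yc hm_carrier[OF z(2)]
    by (auto simp: B.diff_idem B.diff_idem_mult hm_def a_minus_def split: if_splits)
  then show ?thesis using hm_sandwich[OF y(1)] by blast
qed

text \<open>Any cocycle in the right class is cut down to the right degree and then to the right end
  points; neither step changes its coordinates.\<close>

lemma eta_exists:
  assumes "[i, j] \<in> basis m"
  shows "\<exists>z \<in> cocycles B. z \<in> hm i j (letter_degree n i j) \<and> (\<forall>w. \<chi> z w = (if w = [i, j] then \<one> else \<zero>))"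
proof -
  have ij: "i \<in> {1..m}" "j \<in> {1..m}" using assms by (auto simp: basis_def)
  obtain z0 where z0: "z0 \<in> cocycles B" "\<And>x. \<chi> z0 x = (if x = [i, j] then \<one> else \<zero>)" using \<chi>_surj[OF assms] by blast
  define z1 where "z1 = B.hcomp z0 (letter_degree n i j)"
  have z1: "z1 \<in> cocycles B" "z1 \<in> grade B (letter_degree n i j)" "\<And>x. \<chi> z1 x = (if x = [i, j] then \<one> else \<zero>)"
    using B.cocycle_hcomp[OF z0(1)] B.hcomp(1)[OF B.cocyclesD(1)[OF z0(1)]] \<chi>_hcomp[OF z0(1)] z0(2)
    by (auto simp: z1_def)
  define z2 where "z2 = B.idem i \<otimes>\<^bsub>B\<^esub> z1"
  define z where "z = z2 \<otimes>\<^bsub>B\<^esub> B.idem j"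
  have z2: "z2 \<in> cocycles B" unfolding z2_def using z1 idem_cocycle by (intro B.cocycles_mult)
  have z: "z \<in> cocycles B" unfolding z_def using z2 idem_cocycle by (intro B.cocycles_mult)
  have c: "\<chi> z w = (if w = [i, j] then \<one> else \<zero>)" if "w \<in> basis m" for w
  proof -
    note ml = \<chi>_mult[OF idem_cocycle[of i] z1(1), folded z2_def] and mr = \<chi>_mult[OF z2 idem_cocycle[of j], folded z_def]
    have b: "\<chi> z2 w = (if w = [i, j] then \<one> else \<zero>)" if "w \<in> basis m" for w
    proof -
      from that consider a where "w = [a]" "a \<in> {1..m}" | a b where "w = [a, b]" "a \<noteq> b" "a \<in> {1..m}" | a where "w = [a, a]" "a \<in> {1..m}"
        by (auto simp: basis_def dest: adj_neq)
      then show ?thesis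
      proof cases
        case 1
        then show ?thesis using ml(1)[of a] ij z1(3) by (simp add: \<chi>_idem)
      next
        case 2
        then show ?thesis using ml(2)[OF 2(2)] ij z1(3) by (simp add: \<chi>_idem)
      next
        case 3
        then show ?thesis using ml(3)[of a] ij z1(3) by (simp add: \<chi>_idem)
      qed
    qed
    from that consider a where "w = [a]" "a \<in> {1..m}" | a b where "w = [a, b]" "a \<noteq> b" "a \<in> {1..m}" | a where "w = [a, a]" "a \<in> {1..m}"
      by (auto simp: basis_def dest: adj_neq)
    then show ?thesis
    proof cases
      case 1
      then show ?thesis using b[of w] that mr(1)[of a] ij by (auto simp: \<chi>_idem)
    next
      case 2
      have "\<chi> z2 [a] \<in> carrier K" using z2 by simp
      then show ?thesis using 2 b[of w] that mr(2)[of a b] ij by (auto simp: \<chi>_idem)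
    next
      case 3
      have "\<chi> z2 w \<in> carrier K" for w using z2 by simp
      then show ?thesis using 3 b[of w] that mr(3)[of a] ij by (auto simp: \<chi>_idem)
    qed
  qed
  then have "\<chi> z w = (if w = [i, j] then \<one> else \<zero>)" for w
    using \<chi>_out[OF z, of w] assms by (cases "w \<in> basis m") auto
  moreover have "z \<in> hm i j (letter_degree n i j)" unfolding z_def z2_def by (rule hm_sandwich[OF z1(2)])
  ultimately show ?thesis using z by blast
qed

definition eta :: "nat \<Rightarrow> nat \<Rightarrow> 'b" where
  "eta i j = (SOME z. z \<in> cocycles B \<and> z \<in> hm i j (letter_degree n i j) \<and> (\<forall>w. \<chi> z w = (if w = [i, j] then \<one> else \<zero>)))"

lemma eta:
  assumes "[i, j] \<in> basis m"
  shows "eta i j \<in> cocycles B" "eta i j \<in> hm i j (letter_degree n i j)" "\<chi> (eta i j) w = (if w = [i, j] then \<one> else \<zero>)"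
  using someI_ex[OF eta_exists[OF assms, unfolded Bex_def]] unfolding eta_def[symmetric] by auto

end

section \<open>Maps out of the cobar construction\<close>

context letters
begin

fun tb :: "nat list \<Rightarrow> 'x list" where
  "tb [] = []"
| "tb [j] = [nd j True]"
| "tb (j # k # vs) = nd j False # tb (k # vs)"

text \<open>The word whose inner vertices are all bars. These words generate \<open>Q\<close> freely
  over the idempotents.\<close>

definition bw :: "nat list \<Rightarrow> 'x list" where "bw vs = nd (hd vs) True # tb (tl vs)"

definition chains :: "nat list set" where
  "chains = {vs. length vs \<ge> 2 \<and> set vs \<subseteq> {1..m} \<and> successively (\<lambda>i j. i = j \<or> adj i j) vs}"

definition bdeg :: "nat list \<Rightarrow> int" where "bdeg vs = wdeg (bw vs)"

text \<open>\<open>vs\<close> accumulates the current block. A product sign closes it and opens the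
  next one, so neighbouring blocks share a vertex.\<close>

fun bl :: "nat list \<Rightarrow> 'x list \<Rightarrow> nat list list" where
  "bl vs [] = []"
| "bl vs (y # ys) = (if sp y then (vs @ [ver y]) # bl [ver y] ys else bl (vs @ [ver y]) ys)"

definition blocks :: "'x list \<Rightarrow> nat list list" where "blocks w = bl [ver (hd w)] (tl w)"

text \<open>The number of bars. \<open>D\<close> lowers it by exactly one, which bounds the blocks
  that occur in the differential of a block.\<close>

definition ns :: "'x list \<Rightarrow> nat" where "ns w = length (filter (\<lambda>x. \<not> sp x) w)"

lemma tb_val:
  "vs \<noteq> [] \<Longrightarrow> set vs \<subseteq> {1..m} \<Longrightarrow> successively (\<lambda>i j. i = j \<or> adj i j) vs \<Longrightarrow>
    val (tb vs) \<and> ver (hd (tb vs)) = hd vs \<and> last (tb vs) = nd (last vs) True"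
proof (induction vs rule: tb.induct)
  case (3 j k vs)
  then have "val (tb (k # vs))" "ver (hd (tb (k # vs))) = k" by simp_all
  then obtain z v where "tb (k # vs) = z # v" "ver z = k" by (cases "tb (k # vs)") (auto simp: val_def)
  then show ?case using 3 by (auto simp: val_Cons letter_def link_def)
qed (auto simp: val_def letter_def)

lemma chain_cases:
  assumes "vs \<in> chains" obtains i us where "vs = i # us" "us \<noteq> []"
  using assms by (cases vs; cases "tl vs") (auto simp: chains_def)

lemma bw_props:
  assumes "vs \<in> chains"
  shows "bw vs \<in> wordsQ" "hd (bw vs) = nd (hd vs) True" "last (bw vs) = nd (last vs) True"
    "length (bw vs) = length vs" "ns (bw vs) + 2 = length vs"
proof -
  obtain i us where vs: "vs = i # us" "us \<noteq> []" using assms by (rule chain_cases)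
  have u: "set us \<subseteq> {1..m}" "successively (\<lambda>i j. i = j \<or> adj i j) us" "i \<in> {1..m}" "i = hd us \<or> adj i (hd us)"
    using assms vs by (auto simp: chains_def successively_Cons)
  note t = tb_val[OF vs(2) u(1,2)]
  then obtain z v where z: "tb us = z # v" "ver z = hd us" by (cases "tb us") (auto simp: val_def)
  show "bw vs \<in> wordsQ" using t z u vs by (auto simp: wordsQ_def bw_def val_Cons letter_def link_def)
  show "hd (bw vs) = nd (hd vs) True" "last (bw vs) = nd (last vs) True"
    using t z vs by (auto simp: bw_def)
  have "length (tb us) = length us \<and> (us \<noteq> [] \<longrightarrow> ns (tb us) + 1 = length us)" for us
    by (induction us rule: tb.induct) (auto simp: ns_def)
  then show "length (bw vs) = length vs" "ns (bw vs) + 2 = length vs"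
    using vs by (auto simp: bw_def ns_def)
qed

lemma bl_tb: "us \<noteq> [] \<Longrightarrow> bl vs (tb us @ zs) = (vs @ us) # bl [last us] zs"
  by (induction us arbitrary: vs rule: tb.induct) auto

lemma blocks_bw: "vs \<in> chains \<Longrightarrow> blocks (bw vs @ zs) = vs # bl [last vs] zs"
proof -
  assume "vs \<in> chains"
  then obtain i us where "vs = i # us" "us \<noteq> []" by (rule chain_cases)
  then show ?thesis using bl_tb[of us "[i]" zs] by (simp add: blocks_def bw_def)
qed

lemma tb_letters:
  "(\<forall>u\<in>set us. \<not> sp u \<and> letter u) \<Longrightarrow> sp y \<Longrightarrow> letter y \<Longrightarrow> us @ [y] = tb (map ver us @ [ver y])"
proof (induction us)
  case (Cons a us)
  then have "tb (ver a # (map ver us @ [ver y])) = nd (ver a) False # tb (map ver us @ [ver y])"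
    by (cases "map ver us @ [ver y]") auto
  moreover have "us @ [y] = tb (map ver us @ [ver y])" using Cons by simp
  moreover have "nd (ver a) False = a" using Cons.prems(1) by (auto simp: letter_def)
  ultimately show ?case by simp
qed (auto simp: letter_def)

lemma successively_link_map: "successively link w \<Longrightarrow> successively (\<lambda>i j. i = j \<or> adj i j) (map ver w)"
  by (simp add: successively_map link_def)

lemma words_decompose:
  assumes w: "w \<in> wordsQ" and l: "length w \<ge> 2"
  obtains vs w' where "vs \<in> chains" "w' \<in> wordsQ" "w = bw vs @ tl w'" "last vs = ver (hd w')"
    "blocks w = vs # blocks w'" "length w' < length w"
proof -
  obtain x v where x: "w = x # v" using l by (cases w) auto
  then have v: "v \<noteq> []" "sp (last v)" using w l by (cases v; auto simp: wordsQ_def val_def)+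
  then have "\<exists>y\<in>set v. sp y" by (meson last_in_set)
  then obtain us y zs where s: "v = us @ y # zs" "sp y" "\<forall>u\<in>set us. \<not> sp u"
    by (auto dest!: split_list_first_prop)
  have let1: "letter a" if "a \<in> set w" for a using w that by (auto simp: wordsQ_def val_def)
  let ?vs = "ver x # map ver us @ [ver y]"
  have tbu: "us @ [y] = tb (map ver us @ [ver y])"
    using s let1 by (intro tb_letters) (auto simp: x)
  have xx: "nd (ver x) True = x" using let1[of x] w by (auto simp: x letter_def wordsQ_def)
  have wd: "w = bw ?vs @ tl (y # zs)" using x s xx tbu[symmetric] by (simp add: bw_def)
  have suc: "successively link (x # us @ y # zs)" using w x s by (simp add: wordsQ_def val_def)
  have suc1: "successively link (x # us @ [y])" and suc2: "successively link (y # zs)"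
    using suc successively_append_iff[of link "x # us @ [y]" zs] successively_append_iff[of link "x # us" "y # zs"]
    by simp_all
  have vs: "?vs \<in> chains"
  proof -
    have "set w = insert x (set us \<union> insert y (set zs))" using x s(1) by auto
    moreover have "ver ` set w \<subseteq> {1..m}" using let1 unfolding letter_def by blast
    ultimately have "set ?vs \<subseteq> {1..m}" by (simp add: image_Un)
    then show ?thesis using successively_link_map[OF suc1] by (simp add: chains_def)
  qed
  have w': "y # zs \<in> wordsQ"
    using w suc2 s let1 by (auto simp: wordsQ_def val_def x)
  have "blocks w = ?vs # blocks (y # zs)"
    unfolding wd blocks_bw[OF vs] by (simp add: blocks_def)
  then show ?thesis using that[OF vs w' wd] by (simp add: x s)
qed

lemma wordsQ_induct [consumes 1, case_names unit block]:
  assumes w: "w \<in> wordsQ"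
    and u: "\<And>i. i \<in> {1..m} \<Longrightarrow> P [nd i True]"
    and b: "\<And>vs w'. vs \<in> chains \<Longrightarrow> w' \<in> wordsQ \<Longrightarrow> last vs = ver (hd w') \<Longrightarrow> P w' \<Longrightarrow>
        blocks (bw vs @ tl w') = vs # blocks w' \<Longrightarrow> P (bw vs @ tl w')"
  shows "P w"
  using w
proof (induction "length w" arbitrary: w rule: less_induct)
  case less
  show ?case
  proof (cases "length w \<ge> 2")
    case True
    show ?thesis using words_decompose[OF less.prems True] b less.hyps by metis
  next
    case False
    then obtain x where "w = [x]" using less.prems by (cases w; cases "tl w") (auto simp: wordsQ_def val_def)
    then have "w = [nd (ver x) True]" "ver x \<in> {1..m}" using less.prems by (auto simp: wordsQ_def val_def letter_def)
    then show ?thesis using u by metis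
  qed
qed

lemma words_hd_last: "w \<in> wordsQ \<Longrightarrow> hd w = nd (ver (hd w)) True \<and> last w = nd (ver (last w)) True
    \<and> ver (hd w) \<in> {1..m} \<and> ver (last w) \<in> {1..m}"
  by (auto simp: wordsQ_def val_def letter_def) (metis hd_in_set last_in_set letter_def atLeastAtMost_iff One_nat_def)+

lemma D_ns: "fkeys (D w) \<subseteq> {w'. ns w' + 1 = ns w}"
proof (induction w rule: D.induct)
  case (1 x y v)
  have "fkeys (F x (y # v)) \<subseteq> {w'. ns w' + 1 = ns (x # y # v)}"
  proof (cases "v = [] \<or> sp y")
    case True
    then show ?thesis by (cases v) auto
  next
    case False
    then obtain z u where v: "v = z # u" and y: "\<not> sp y" by (cases v) auto
    show ?thesis
      unfolding v by (cases "tn x y z"; simp only: y F.simps if_True if_False diff_zero; intro fkeys_intros)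
        (auto simp: ns_def y)
  qed
  moreover have "fkeys (frag_cmul (sgs x y) (pre x (D (y # v)))) \<subseteq> {w'. ns w' + 1 = ns (x # y # v)}"
  proof (intro fkeys_intros fkeys_extend)
    fix w assume "w \<in> fkeys (D (y # v))"
    then have "ns w + 1 = ns (y # v)" using 1 by blast
    then show "x # w \<in> {w'. ns w' + 1 = ns (x # y # v)}" by (simp add: ns_def)
  qed
  ultimately show ?case unfolding D.simps by (rule fkeys_intros)
qed simp_all

lemma bl_length: "b \<in> set (bl vs ys) \<Longrightarrow> vs \<noteq> [] \<Longrightarrow> length b \<le> length vs + ns ys + 1"
proof (induction vs ys rule: bl.induct)
  case (2 vs y ys)
  show ?case
  proof (cases "sp y")
    case True
    have "length vs \<ge> 1" using 2 by (cases vs) auto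
    then show ?thesis using 2 True by (auto simp: ns_def)
  qed (use 2 in \<open>auto simp: ns_def\<close>)
qed simp

text \<open>Opening a bar and multiplying at a bar both remove it, and a block is at most two
  vertices longer than its number of bars. So the equation for \<open>f vs\<close> involves only
  values on shorter chains.\<close>

lemma blocks_D:
  assumes vs: "vs \<in> chains" and w: "w \<in> fkeys (D (bw vs))" and b: "b \<in> set (blocks w)"
  shows "length b < length vs"
proof -
  have "ns w + 1 = ns (bw vs)" using D_ns w by blast
  moreover have "w \<in> wordsQ" using D_wordsQ[OF bw_props(1)[OF vs]] w by blast
  then have "ns (tl w) = ns w" by (cases w) (auto simp: ns_def wordsQ_def)
  ultimately show ?thesis
    using bl_length[of b "[ver (hd w)]" "tl w"] b bw_props(5)[OF vs] by (simp add: blocks_def)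
qed

lemma blocks_chains: "w \<in> wordsQ \<Longrightarrow> b \<in> set (blocks w) \<Longrightarrow> b \<in> chains"
  by (induction w rule: wordsQ_induct) (auto simp: blocks_def)

end

section \<open>Multiplicative extension and obstructions\<close>

locale formality = zigzag_cohomology K m n B \<theta> + bar_cobar K nd ver sp m n
  for K :: "('k, 'e) ring_scheme" (structure) and m n :: nat and B :: "('k, 'b) dga" and \<theta>
    and nd :: "nat \<Rightarrow> bool \<Rightarrow> 'x" and ver :: "'x \<Rightarrow> nat" and sp :: "'x \<Rightarrow> bool"
begin

definition typed :: "(nat list \<Rightarrow> 'b) \<Rightarrow> bool" where
  "typed f \<longleftrightarrow> (\<forall>vs\<in>chains. f vs \<in> hm (hd vs) (last vs) (bdeg vs))"

text \<open>Blocks are free generators, so arbitrary values extend multiplicatively. The final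
  idempotent is the value on a unit word and is absorbed on all other words.\<close>

definition G :: "(nat list \<Rightarrow> 'b) \<Rightarrow> 'x list \<Rightarrow> 'b" where
  "G f w = foldr (\<lambda>b y. f b \<otimes>\<^bsub>B\<^esub> y) (blocks w) (B.idem (ver (last w)))"

abbreviation "g f \<equiv> lin K B (G f)"

text \<open>The differential that \<open>f vs\<close> must have for \<open>g f\<close> to be a chain
  map. By \<open>blocks_D\<close> it is known before \<open>f vs\<close> is chosen.\<close>

definition Ob :: "(nat list \<Rightarrow> 'b) \<Rightarrow> nat list \<Rightarrow> 'b" where
  "Ob f vs = g f (ev (D (bw vs)))"

lemma module_B: "module K B" by (rule B.module_axioms)

lemma idem_hm: "B.idem i \<in> hm i i 0"
  using B.idem_mult[of i i] by (simp add: hm_def B.idem_grade)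

lemma hm_unit: "x \<in> hm i j t \<Longrightarrow> B.idem i \<otimes>\<^bsub>B\<^esub> x = x" "x \<in> hm i j t \<Longrightarrow> x \<otimes>\<^bsub>B\<^esub> B.idem j = x"
  by (auto simp: hm_def)

lemma hm_orthogonal:
  assumes x: "x \<in> hm i j t" and y: "y \<in> hm k l s" and jk: "j \<noteq> k"
  shows "x \<otimes>\<^bsub>B\<^esub> y = \<zero>\<^bsub>B\<^esub>"
proof -
  have c: "x \<in> carrier B" "y \<in> carrier B" using x y hm_carrier by auto
  have "x \<otimes>\<^bsub>B\<^esub> y = (x \<otimes>\<^bsub>B\<^esub> B.idem j) \<otimes>\<^bsub>B\<^esub> (B.idem k \<otimes>\<^bsub>B\<^esub> y)" using hm_unit[OF x] hm_unit[OF y] by simp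
  also have "\<dots> = x \<otimes>\<^bsub>B\<^esub> (B.idem j \<otimes>\<^bsub>B\<^esub> B.idem k) \<otimes>\<^bsub>B\<^esub> y" using c by (simp add: B.A.m_assoc)
  also have "\<dots> = \<zero>\<^bsub>B\<^esub>" using c jk by (simp add: B.idem_mult)
  finally show ?thesis .
qed

lemma G_unit: "G f [nd i True] = B.idem i"
  by (simp add: G_def blocks_def)

lemma G_block:
  assumes "vs \<in> chains" "w' \<in> wordsQ" "last vs = ver (hd w')"
  shows "G f (bw vs @ tl w') = f vs \<otimes>\<^bsub>B\<^esub> G f w'"
proof -
  have "last (bw vs) = hd w'" using bw_props(3)[OF assms(1)] words_hd_last[OF assms(2)] assms(3) by simp
  then have "last (bw vs @ tl w') = last w'"
    using assms(2) by (cases w') (auto simp: wordsQ_def val_def)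
  then show ?thesis
    using blocks_bw[OF assms(1), of "tl w'"] assms(3) by (simp add: G_def blocks_def)
qed

lemma block_join:
  assumes "vs \<in> chains" "w' \<in> wordsQ" "last vs = ver (hd w')"
  shows "last (bw vs) = hd w'" "bw vs @ tl w' \<in> wordsQ" "wdeg (bw vs @ tl w') = bdeg vs + wdeg w'"
    "hd (bw vs @ tl w') = nd (hd vs) True" "last (bw vs @ tl w') = last w'"
proof -
  show l: "last (bw vs) = hd w'" using bw_props(3)[OF assms(1)] words_hd_last[OF assms(2)] assms(3) by simp
  show "bw vs @ tl w' \<in> wordsQ" "wdeg (bw vs @ tl w') = bdeg vs + wdeg w'"
    using W_comp[OF bw_props(1)[OF assms(1)] assms(2) l] dg_comp[OF bw_props(1)[OF assms(1)] assms(2) l]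
    by (simp_all add: bdeg_def)
  show "hd (bw vs @ tl w') = nd (hd vs) True" by (simp add: bw_def)
  show "last (bw vs @ tl w') = last w'"
    using l assms(2) by (cases w') (auto simp: wordsQ_def val_def)
qed

lemma G_typed:
  assumes f: "typed f" and w: "w \<in> wordsQ"
  shows "G f w \<in> hm (ver (hd w)) (ver (last w)) (wdeg w)"
  using w
proof (induction w rule: wordsQ_induct)
  case (unit i)
  then show ?case using idem_hm by (simp add: G_unit)
next
  case (block vs w')
  have "f vs \<in> hm (hd vs) (ver (hd w')) (bdeg vs)" using f block by (auto simp: typed_def)
  then show ?case
    using hm_closed(4)[OF _ block.IH] block_join[OF block(1-3)] by (simp add: G_block[OF block(1-3)])
qed

lemma G_carrier: "typed f \<Longrightarrow> w \<in> wordsQ \<Longrightarrow> G f w \<in> carrier B"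
  using G_typed hm_carrier by blast

lemma G_append:
  assumes f: "typed f" and u: "u \<in> wordsQ" and w: "w \<in> wordsQ" and uw: "last u = hd w"
  shows "G f (u @ tl w) = G f u \<otimes>\<^bsub>B\<^esub> G f w"
  using u uw
proof (induction u rule: wordsQ_induct)
  case (unit i)
  then have "[nd i True] @ tl w = w" using w by (cases w) (auto simp: wordsQ_def val_def)
  moreover have "ver (hd w) = i" using unit(2)[symmetric] by simp
  ultimately show ?case using hm_unit(1)[OF G_typed[OF f w]] by (simp add: G_unit)
next
  case (block vs w')
  have l: "last w' = hd w" using block_join(5)[OF block(1-3)] block.prems by simp
  have j: "w' @ tl w \<in> wordsQ" using W_comp[OF block(2) w l] .
  have ne: "w' \<noteq> []" using block(2) W_nonempty by auto
  have "(bw vs @ tl w') @ tl w = bw vs @ tl (w' @ tl w)" using ne by simp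
  moreover have "last vs = ver (hd (w' @ tl w))" using block(3) ne by simp
  ultimately have "G f ((bw vs @ tl w') @ tl w) = f vs \<otimes>\<^bsub>B\<^esub> (G f w' \<otimes>\<^bsub>B\<^esub> G f w)"
    using G_block[OF block(1) j] block.IH l by simp
  moreover have "f vs \<in> carrier B" using f block(1) hm_carrier by (auto simp: typed_def)
  ultimately show ?case
    using G_carrier[OF f] block(2) w by (simp add: G_block[OF block(1-3)] B.A.m_assoc)
qed

lemma G_bw: "typed f \<Longrightarrow> vs \<in> chains \<Longrightarrow> G f (bw vs) = f vs"
proof -
  assume f: "typed f" and vs: "vs \<in> chains"
  have l: "last vs \<in> {1..m}" using vs by (cases vs rule: rev_cases) (auto simp: chains_def)
  then have "[nd (last vs) True] \<in> wordsQ" by (rule W_unit)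
  then have "G f (bw vs) = f vs \<otimes>\<^bsub>B\<^esub> B.idem (last vs)"
    using G_block[OF vs, of "[nd (last vs) True]" f] by (simp add: G_unit)
  then show ?thesis using f vs hm_unit(2) by (auto simp: typed_def)
qed

lemma g_klinear: "typed f \<Longrightarrow> klinear K A B (g f)"
  by (rule lin_klinear[OF module_B]) (rule G_carrier)

lemma g_single: "typed f \<Longrightarrow> w \<in> wordsQ \<Longrightarrow> g f (single K w) = G f w"
  by (rule lin_single[OF module_B]) (rule G_carrier)

lemma g_mult:
  assumes f: "typed f" and x: "x \<in> carrier A" and y: "y \<in> carrier A"
  shows "g f (x \<otimes>\<^bsub>A\<^esub> y) = g f x \<otimes>\<^bsub>B\<^esub> g f y"
proof (rule klinear_ext[OF _ _ module_B _ x])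
  note k = g_klinear[OF f]
  show "klinear K A B (\<lambda>x. g f (x \<otimes>\<^bsub>A\<^esub> y))" by (rule klinear_comp[OF WG.klinear_mult(1)[OF y] k])
  show "klinear K A B (\<lambda>x. g f x \<otimes>\<^bsub>B\<^esub> g f y)"
    by (rule klinear_comp[OF k B.klinear_mult(1)[OF klinearD(1)[OF k y]]])
  fix u assume u: "u \<in> wordsQ"
  have gu: "g f (single K u) \<in> carrier B" using u klinearD(1)[OF k] by auto
  show "g f (single K u \<otimes>\<^bsub>A\<^esub> y) = g f (single K u) \<otimes>\<^bsub>B\<^esub> g f y"
  proof (rule klinear_ext[OF _ _ module_B _ y])
    show "klinear K A B (\<lambda>y. g f (single K u \<otimes>\<^bsub>A\<^esub> y))" using u by (intro klinear_comp[OF WG.klinear_mult(2) k]) auto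
    show "klinear K A B (\<lambda>y. g f (single K u) \<otimes>\<^bsub>B\<^esub> g f y)" by (rule klinear_comp[OF k B.klinear_mult(2)[OF gu]])
    fix w assume w: "w \<in> wordsQ"
    show "g f (single K u \<otimes>\<^bsub>A\<^esub> single K w) = g f (single K u) \<otimes>\<^bsub>B\<^esub> g f (single K w)"
    proof (cases "last u = hd w")
      case True
      then show ?thesis using u w W_comp[OF u w True] by (simp add: mult_single g_single f G_append)
    next
      case False
      then have "ver (last u) \<noteq> ver (hd w)" using words_hd_last[OF u] words_hd_last[OF w] by metis
      then have "G f u \<otimes>\<^bsub>B\<^esub> G f w = \<zero>\<^bsub>B\<^esub>"
        using hm_orthogonal[OF G_typed[OF f u] G_typed[OF f w]] by simp
      then show ?thesis
        using False u w klinear_zero[OF k module_A module_B] by (simp add: mult_single g_single f)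
    qed
  qed
qed

lemma Ob_hm:
  assumes f: "typed f" and vs: "vs \<in> chains"
  shows "Ob f vs \<in> hm (hd vs) (last vs) (bdeg vs + 1)"
proof -
  let ?S = "{w \<in> wordsQ. hd w = nd (hd vs) True \<and> last w = nd (last vs) True \<and> wdeg w = bdeg vs + 1}"
  have "fkeys (D (bw vs)) \<subseteq> ?S"
    using D_wordsQ[OF bw_props(1)[OF vs]] bw_props[OF vs] by (auto simp: bdeg_def)
  moreover have "g f (ev a) \<in> hm (hd vs) (last vs) (bdeg vs + 1) \<and> fkeys a \<subseteq> ?S" if "fkeys a \<subseteq> ?S" for a
    using that
  proof (induction a rule: frag_induction)
    case zero
    then show ?case using klinear_zero[OF g_klinear[OF f] module_A module_B] hm_closed(1) by simp
  next
    case (one w)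
    then show ?case using G_typed[OF f, of w] by (auto simp: g_single f)
  next
    case (diff a b)
    then have k: "fkeys a \<subseteq> wordsQ" "fkeys b \<subseteq> wordsQ" "fkeys (a - b) \<subseteq> ?S"
      using keys_diff[of a b] by auto
    have "x \<ominus>\<^bsub>B\<^esub> y \<in> hm i j t" if "x \<in> hm i j t" "y \<in> hm i j t" for x y i j t
    proof -
      have "\<ominus>\<^bsub>B\<^esub> y = (\<ominus> \<one>) \<odot>\<^bsub>B\<^esub> y" using B.smult_l_minus[of \<one> y] hm_carrier[OF that(2)] by simp
      then show ?thesis using hm_closed(2)[OF that(1) hm_closed(3)[OF _ that(2), of "\<ominus> \<one>"]] by (simp add: a_minus_def)
    qed
    then show ?case
      using diff k klinear_minus[OF g_klinear[OF f] module_A module_B ev_in ev_in, OF k(1,2)] by (simp add: ev_diff)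
  qed
  ultimately have "g f (ev (D (bw vs))) \<in> hm (hd vs) (last vs) (bdeg vs + 1)" by blast
  then show ?thesis by (simp add: Ob_def)
qed

lemma lin_cong:
  assumes "\<And>w. f w \<noteq> \<zero> \<Longrightarrow> \<phi> w = \<psi> w" "\<And>w. w \<in> wordsQ \<Longrightarrow> \<psi> w \<in> carrier B" "f \<in> carrier A"
  shows "lin K B \<phi> f = lin K B \<psi> f"
  unfolding lin_def using assms carrier_out[OF assms(3)] by (intro B.A.finsum_cong') auto

text \<open>A consequence of \<open>blocks_D\<close>: changing \<open>f\<close> at one length leaves
  the right-hand sides of the equations up to that length unchanged.\<close>

lemma Ob_cong:
  assumes f: "typed f'" and vs: "vs \<in> chains" and eq: "\<And>b. b \<in> chains \<Longrightarrow> length b < length vs \<Longrightarrow> f b = f' b"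
  shows "Ob f vs = Ob f' vs"
  unfolding Ob_def
proof (rule lin_cong)
  have k: "fkeys (D (bw vs)) \<subseteq> wordsQ" using D_wordsQ[OF bw_props(1)[OF vs]] by blast
  then show "ev (D (bw vs)) \<in> carrier A" by (rule ev_in)
  fix w assume "ev (D (bw vs)) w \<noteq> \<zero>"
  then have w: "w \<in> fkeys (D (bw vs))" by (auto simp: ev_def zero_int in_keys_iff)
  have "f b = f' b" if "b \<in> set (blocks w)" for b
    using eq blocks_D[OF vs w that] blocks_chains[OF _ that] k w by blast
  then show "G f w = G f' w" unfolding G_def by (intro foldr_cong) auto
qed (rule G_carrier[OF f])

definition solved :: "(nat list \<Rightarrow> 'b) \<Rightarrow> nat list \<Rightarrow> bool" where
  "solved f b \<longleftrightarrow> diff B (f b) = Ob f b"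

text \<open>The Leibniz rules in \<open>Q\<close> and in \<open>B\<close> reduce the claim to the
  first block and the remaining word.\<close>

lemma G_diff:
  assumes f: "typed f" and w: "w \<in> wordsQ" and s: "\<forall>b\<in>set (blocks w). solved f b"
  shows "diff B (G f w) = g f (ev (D w))"
  using w s
proof (induction w rule: wordsQ_induct)
  case (unit i)
  then show ?case using klinear_zero[OF g_klinear[OF f] module_A module_B] by (simp add: G_unit B.diff_idem)
next
  case (block vs w')
  note j = block_join[OF block(1-3)] and bw = bw_props(1)[OF block(1)]
  have IH: "diff B (G f w') = g f (ev (D w'))" and sv: "diff B (f vs) = g f (ev (D (bw vs)))"
    using block by (simp_all add: solved_def Ob_def)
  have fv: "f vs \<in> grade B (bdeg vs)" using f block(1) hm_grade by (auto simp: typed_def)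
  have k: "ev (D (bw vs)) \<in> carrier A" "ev (D w') \<in> carrier A"
    using wmap_D bw block(2) by (auto intro: ev_in)
  have s: "single K (bw vs) \<in> carrier A" "single K w' \<in> carrier A" "\<sigma> (single K (bw vs)) \<in> carrier A"
    using bw block(2) klinearD(1)[OF \<sigma>_klinear] by auto
  have "ev (D (bw vs @ tl w')) = d (single K (bw vs) \<otimes>\<^bsub>A\<^esub> single K w')"
    using j bw block(2) by (simp add: mult_single d_single)
  also have "\<dots> = ev (D (bw vs)) \<otimes>\<^bsub>A\<^esub> single K w' \<oplus>\<^bsub>A\<^esub> \<sigma> (single K (bw vs)) \<otimes>\<^bsub>A\<^esub> ev (D w')"
    using leibniz_single[OF bw block(2)] bw block(2) by (simp add: d_single)
  finally have "g f (ev (D (bw vs @ tl w'))) =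
      g f (ev (D (bw vs)) \<otimes>\<^bsub>A\<^esub> single K w' \<oplus>\<^bsub>A\<^esub> \<sigma> (single K (bw vs)) \<otimes>\<^bsub>A\<^esub> ev (D w'))" by simp
  also have "\<dots> = g f (ev (D (bw vs)) \<otimes>\<^bsub>A\<^esub> single K w') \<oplus>\<^bsub>B\<^esub> g f (\<sigma> (single K (bw vs)) \<otimes>\<^bsub>A\<^esub> ev (D w'))"
    by (rule klinearD(2)[OF g_klinear[OF f]]) (use k s in auto)
  also have "\<dots> = g f (ev (D (bw vs))) \<otimes>\<^bsub>B\<^esub> G f w' \<oplus>\<^bsub>B\<^esub> g f (\<sigma> (single K (bw vs))) \<otimes>\<^bsub>B\<^esub> g f (ev (D w'))"
    unfolding g_mult[OF f k(1) s(2)] g_mult[OF f s(3) k(2)] g_single[OF f block(2)] ..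
  also have "g f (\<sigma> (single K (bw vs))) = (if even (bdeg vs) then f vs else \<ominus>\<^bsub>B\<^esub> f vs)"
    using bw klinear_uminus[OF g_klinear[OF f] module_A module_B single_in[OF bw]]
    by (simp add: \<sigma>_single bdeg_def g_single f G_bw block(1))
  finally have "g f (ev (D (bw vs @ tl w'))) = diff B (f vs) \<otimes>\<^bsub>B\<^esub> G f w' \<oplus>\<^bsub>B\<^esub>
      (if even (bdeg vs) then f vs else \<ominus>\<^bsub>B\<^esub> f vs) \<otimes>\<^bsub>B\<^esub> diff B (G f w')"
    by (simp only: sv IH)
  also have "\<dots> = diff B (f vs \<otimes>\<^bsub>B\<^esub> G f w')"
    using B.diff_mult[OF fv G_carrier[OF f block(2)]] fv B.diff_closed G_carrier[OF f block(2)]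
    by (simp add: B.A.l_minus a_minus_def B.grade_carrier)
  finally show ?case by (simp add: G_block[OF block(1-3)])
qed

text \<open>All blocks that occur in \<open>D (bw vs)\<close> are solved already, so the
  differential of the obstruction is the image of the square of \<open>D\<close>.\<close>

lemma Ob_cocycle:
  assumes f: "typed f" and vs: "vs \<in> chains"
    and s: "\<And>b. b \<in> chains \<Longrightarrow> length b < length vs \<Longrightarrow> solved f b"
  shows "Ob f vs \<in> cocycles B"
proof -
  let ?S = "fkeys (D (bw vs))"
  have k: "?S \<subseteq> wordsQ" using D_wordsQ[OF bw_props(1)[OF vs]] by blast
  have gd: "diff B (G f w) = g f (ev (D w))" if "w \<in> ?S" for w
  proof (rule G_diff[OF f])
    show "w \<in> wordsQ" using that k by blast
    then show "\<forall>b\<in>set (blocks w). solved f b" using blocks_D[OF vs that] blocks_chains s by blast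
  qed
  have "diff B (g f (ev (D (bw vs)))) = g f (ev (frag_extend D (D (bw vs))))"
  proof (rule lin_ev_induct[OF klinear_comp[OF g_klinear[OF f] B.diff_klinear] _ module_B k _ subset_refl])
    fix a b assume "fkeys a \<subseteq> ?S" "fkeys b \<subseteq> ?S"
    then have "fkeys (frag_extend D a) \<subseteq> wordsQ" "fkeys (frag_extend D b) \<subseteq> wordsQ"
      using frag_extend_words[OF wmap_D] k by (meson order_trans)+
    then show "g f (ev (frag_extend D a)) \<in> carrier B \<and> g f (ev (frag_extend D (a - b))) =
        g f (ev (frag_extend D a)) \<ominus>\<^bsub>B\<^esub> g f (ev (frag_extend D b))"
      using klinear_minus[OF g_klinear[OF f] module_A module_B] klinearD(1)[OF g_klinear[OF f]]
      by (simp add: frag_extend_diff ev_diff ev_in)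
  qed (use gd k in \<open>auto simp: g_single f\<close>)
  then show ?thesis
    using hm_carrier[OF Ob_hm[OF f vs]] klinear_zero[OF g_klinear[OF f] module_A module_B]
    by (simp add: D_D cocycles_def Ob_def)
qed

end

section \<open>Degrees and the obstructions for \<open>n = 2\<close>\<close>

lemma quiver_d_Suc: "quiver_d n i + quiver_d n (Suc i) = int n"
proof (cases "even n")
  case False
  then have "odd (int n)" by simp
  then obtain k where k: "int n = 2 * k + 1" by (rule oddE)
  show ?thesis using False by (cases "even i") (auto simp: quiver_d_def k)
qed (simp add: quiver_d_def)

text \<open>By \<open>quiver_d_Suc\<close> the two directions obey the same formula: the degree of
  an arrow depends on its source only.\<close>

lemma letter_degree_quiver: "adj i j \<Longrightarrow> letter_degree n i j = quiver_d n i"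
  using quiver_d_Suc[of n j] by (auto simp: adj_def letter_degree_def edge_degree_def)

lemma adj_parity: "adj i j \<Longrightarrow> odd (i + j)"
  by (auto simp: adj_def)

text \<open>The length of the path obtained when each loop is replaced by an arrow and its
  reverse.\<close>

fun plen :: "nat list \<Rightarrow> nat" where
  "plen (i # j # r) = (if i = j then 2 else 1) + plen (j # r)"
| "plen _ = 0"

fun ldsum :: "nat \<Rightarrow> nat list \<Rightarrow> int" where
  "ldsum n (i # j # r) = letter_degree n i j + ldsum n (j # r)"
| "ldsum n _ = 0"

text \<open>Two successive arrows have total degree \<open>n\<close>, and so does a loop. For odd
  path length the unpaired arrow contributes the value at the first vertex, because
  \<open>quiver_d\<close> depends only on the parity of the vertex.\<close>

lemma ldsum_plen:
  "vs \<noteq> [] \<Longrightarrow> successively (\<lambda>i j. i = j \<or> adj i j) vs \<Longrightarrow>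
   ldsum n vs = int n * int (plen vs div 2) + (if odd (plen vs) then quiver_d n (hd vs) else 0)
   \<and> (even (hd vs + last vs) \<longleftrightarrow> even (plen vs))"
proof (induction vs rule: plen.induct)
  case (1 i j r)
  then have IH: "ldsum n (j # r) = int n * int (plen (j # r) div 2) + (if odd (plen (j # r)) then quiver_d n j else 0)"
    "even (j + last (j # r)) \<longleftrightarrow> even (plen (j # r))" by simp_all
  show ?case
  proof (cases "i = j")
    case True
    then show ?thesis using IH by (simp add: letter_degree_def algebra_simps)
  next
    case False
    then have a: "adj i j" using 1 by simp
    have p: "plen (i # j # r) = Suc (plen (j # r))" using False by simp
    have q: "quiver_d n i + quiver_d n j = int n"
      using a quiver_d_Suc[of n i] quiver_d_Suc[of n j] by (auto simp: adj_def)
    have e: "even (hd (i # j # r) + last (i # j # r)) \<longleftrightarrow> even (plen (i # j # r))"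
      using adj_parity[OF a] IH(2) p by (simp, presburger)
    show ?thesis
    proof (cases "even (plen (j # r))")
      case True
      then show ?thesis using e p IH(1) letter_degree_quiver[OF a, of n] by (simp add: False)
    next
      case odd: False
      then have "Suc (plen (j # r)) div 2 = plen (j # r) div 2 + 1" by presburger
      then show ?thesis using e p q odd IH(1) letter_degree_quiver[OF a, of n] by (simp add: False algebra_simps)
    qed
  qed
qed simp_all

lemma plen_ge: "plen vs \<ge> length vs - 1"
  by (induction vs rule: plen.induct) auto

lemma plen_arrows: "successively (\<lambda>i j. i = j \<or> adj i j) vs \<Longrightarrow> plen vs = length vs - 1 \<Longrightarrow> successively adj vs"
proof (induction vs rule: plen.induct)
  case (1 i j r)
  then show ?case using plen_ge[of "j # r"] by (auto split: if_splits)
qed simp_all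

lemma arrows_plen: "successively adj vs \<Longrightarrow> plen vs = length vs - 1"
  by (induction vs rule: plen.induct) auto

context letters
begin

lemma wdeg_tb: "vs \<noteq> [] \<Longrightarrow> wdeg (nd i s # tb vs) = ldsum n (i # vs) - int (length vs) + 1"
  by (induction vs arbitrary: i s rule: tb.induct) auto

lemma bdeg_eq: "vs \<in> chains \<Longrightarrow> bdeg vs = ldsum n vs - int (length vs) + 2"
proof -
  assume "vs \<in> chains"
  then obtain i us where "vs = i # us" "us \<noteq> []" by (rule chain_cases)
  then show ?thesis using wdeg_tb[of us i True] by (simp add: bdeg_def bw_def)
qed

text \<open>Let \<open>p\<close> be the path length and \<open>L\<close> the number of vertices, so
  \<open>p \<ge> L - 1\<close>. A unit or an arrow would require
  \<open>n * (p div 2) = L - 3\<close>, but the left side is at least \<open>p - 1\<close>. A loop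
  requires \<open>n * (p div 2 - 1) = L - 3\<close>, which forces \<open>n = 2\<close> and
  \<open>p = L - 1\<close>, that is, no loop among the letters.\<close>

lemma obstruction_degree:
  assumes vs: "vs \<in> chains" and l: "length vs \<ge> 4" and n: "n \<ge> 2"
    and w: "w \<in> basis m" "hd w = hd vs" "last w = last vs" "basis_degree n w = bdeg vs + 1"
  shows "n = 2 \<and> successively adj vs \<and> hd vs = last vs \<and> w = [hd vs, hd vs]"
proof -
  have ss: "vs \<noteq> []" "successively (\<lambda>i j. i = j \<or> adj i j) vs" using vs by (auto simp: chains_def)
  let ?p = "plen vs" and ?L = "length vs"
  note ld = ldsum_plen[OF ss, of n]
  have pl: "?p \<ge> ?L - 1" by (rule plen_ge)
  have deg: "basis_degree n w = ldsum n vs - int ?L + 3" using bdeg_eq[OF vs] w(4) by simp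
  have nk: "int n * int k \<ge> 2 * int k" for k using n by (simp add: mult_right_mono)
  from w(1) consider (unit) i where "w = [i]" | (loop) i where "w = [i, i]" | (arrow) i j where "w = [i, j]" "adj i j"
    unfolding basis_def by blast
  then show ?thesis
  proof cases
    case unit
    then have ev: "even ?p" using ld w(2,3) by auto
    have "2 * (?p div 2) = ?p" using ev by simp
    then have "int n * int (?p div 2) \<ge> int ?p" using nk[of "?p div 2"] by linarith
    then have False using deg ld ev unit pl l by simp
    then show ?thesis ..
  next
    case arrow
    then have od: "odd ?p" using ld w(2,3) adj_parity[OF arrow(2)] by auto
    have "2 * (?p div 2) + 1 = ?p" using od by presburger
    then have "int n * int (?p div 2) \<ge> int ?p - 1" using nk[of "?p div 2"] by linarith
    moreover have "hd vs = i" using w(2) arrow by simp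
    ultimately have False
      using deg ld od arrow pl l letter_degree_quiver[OF arrow(2), of n] by simp
    then show ?thesis ..
  next
    case loop
    then have ev: "even ?p" using ld w(2,3) by auto
    then obtain k where k: "?p = 2 * k" by (rule evenE)
    have eq: "int n * int k - int ?L + 3 = int n" using deg ld ev loop k by (simp add: letter_degree_def)
    have k2: "k \<ge> 2" using pl l k by linarith
    have f: "int n * (int k - 1) = int ?L - 3" using eq by (simp add: algebra_simps)
    have n2: "n = 2"
    proof (rule ccontr)
      assume "n \<noteq> 2"
      \<comment> \<open>Together with \<open>L \<le> 2 * k + 1\<close> this would give
        \<open>3 * (k - 1) \<le> 2 * (k - 1)\<close>, impossible for \<open>k \<ge> 2\<close>. The
        bound on \<open>k\<close> comes from \<open>L \<ge> 4\<close> and the parity of the path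
        length.\<close>
      then have "int n * (int k - 1) \<ge> 3 * (int k - 1)" using n k2 by (intro mult_right_mono) auto
      then have "3 * (int k - 1) \<le> int ?L - 3" unfolding f .
      moreover have "int ?L \<le> 2 * int k + 1" "int k \<ge> 2" using pl k k2 l by linarith+
      ultimately show False by (simp add: algebra_simps)
    qed
    then have "?p = ?L - 1" using f k pl k2 by simp
    then show ?thesis using plen_arrows[OF ss(2)] n2 loop w(2,3) by auto
  qed
qed

end

section \<open>Functions on closed paths of arrows\<close>

definition del_at :: "nat \<Rightarrow> 'a list \<Rightarrow> 'a list" where
  "del_at j vs = take j vs @ drop (Suc j) vs"

text \<open>At such a position an arrow meets its reverse. Deleting the vertex leaves two equal
  neighbours, that is, the loop which is their product.\<close>

definition turn :: "nat \<Rightarrow> nat list \<Rightarrow> bool" where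
  "turn j p \<longleftrightarrow> p ! (j - 1) = p ! Suc j"

lemma del_at_nth: "0 < length p \<Longrightarrow> j < length p \<Longrightarrow> t < length p - 1 \<Longrightarrow> del_at j p ! t = (if t < j then p ! t else p ! Suc t)"
  by (auto simp: del_at_def nth_append min_def)

lemma del_at_length: "j < length p \<Longrightarrow> length (del_at j p) = length p - 1"
  by (auto simp: del_at_def)

text \<open>\<open>N\<close> counts vertices, so the closed paths below have \<open>N - 1\<close>
  arrows.\<close>

locale closed_paths = field K for K :: "('k, 'e) ring_scheme" (structure) +
  fixes m N :: nat
  assumes N3: "N \<ge> 3"
begin

definition closed :: "nat list set" where
  "closed = {p. length p = N \<and> successively adj p \<and> set p \<subseteq> {1..m} \<and> hd p = last p}"

text \<open>
  \<open>dk \<kappa>\<close> is the change of the obstructions on closed paths when the solution is changed by the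
  cocycles with coefficients \<open>\<kappa>\<close> on words of length \<open>N - 1\<close>; \<open>adm\<close> says that these cocycles have
  the right degree.
\<close>

definition adm :: "(nat list \<Rightarrow> 'k) \<Rightarrow> bool" where
  "adm \<kappa> \<longleftrightarrow> (\<forall>x. \<kappa> x \<in> carrier K) \<and> (\<forall>x. \<kappa> x \<noteq> \<zero> \<longrightarrow> length x = N - 1 \<and> set x \<subseteq> {1..m} \<and>
     successively (\<lambda>i j. i = j \<or> adj i j) x \<and>
     (hd x = last x \<and> plen x = N - 1 \<or> adj (hd x) (last x) \<and> plen x = N - 2))"

definition dk :: "(nat list \<Rightarrow> 'k) \<Rightarrow> nat list \<Rightarrow> 'k" where
  "dk \<kappa> p = (\<ominus> \<kappa> (tl p) \<oplus> \<ominus> \<kappa> (butlast p)) \<oplus> (\<Oplus>j\<in>{1..<N-1}. if turn j p then \<kappa> (del_at j p) else \<zero>)"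

text \<open>The functions hit by an admissible correction. They form a subspace, so it is enough to
  reach the indicator functions of single paths.\<close>

definition achv :: "(nat list \<Rightarrow> 'k) \<Rightarrow> bool" where
  "achv \<phi> \<longleftrightarrow> (\<exists>\<kappa>. adm \<kappa> \<and> (\<forall>q\<in>closed. dk \<kappa> q = \<phi> q))"

abbreviation ind :: "nat list \<Rightarrow> nat list \<Rightarrow> 'k" where "ind p \<equiv> single K p"

lemma adm_closed: "adm \<kappa> \<Longrightarrow> \<kappa> x \<in> carrier K"
  by (simp add: adm_def)

lemma achv_add:
  assumes "achv \<phi>" "achv \<psi>" shows "achv (\<lambda>q. \<phi> q \<oplus> \<psi> q)"
proof -
  obtain \<kappa> \<kappa>' where k: "adm \<kappa>" "\<forall>q\<in>closed. dk \<kappa> q = \<phi> q" "adm \<kappa>'" "\<forall>q\<in>closed. dk \<kappa>' q = \<psi> q"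
    using assms unfolding achv_def by blast
  have c: "\<kappa> x \<in> carrier K" "\<kappa>' x \<in> carrier K" for x using k adm_closed by auto
  have "\<kappa> x \<noteq> \<zero> \<or> \<kappa>' x \<noteq> \<zero>" if "\<kappa> x \<oplus> \<kappa>' x \<noteq> \<zero>" for x using that by auto
  then have "adm (\<lambda>x. \<kappa> x \<oplus> \<kappa>' x)" using k(1,3) c unfolding adm_def by (meson add.m_closed)
  moreover have "dk (\<lambda>x. \<kappa> x \<oplus> \<kappa>' x) q = dk \<kappa> q \<oplus> dk \<kappa>' q" for q
  proof -
    have "(\<Oplus>j\<in>{1..<N-1}. if turn j q then \<kappa> (del_at j q) \<oplus> \<kappa>' (del_at j q) else \<zero>) =
      (\<Oplus>j\<in>{1..<N-1}. (if turn j q then \<kappa> (del_at j q) else \<zero>) \<oplus> (if turn j q then \<kappa>' (del_at j q) else \<zero>))"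
      using c by (intro finsum_cong') auto
    also have "\<dots> = (\<Oplus>j\<in>{1..<N-1}. if turn j q then \<kappa> (del_at j q) else \<zero>) \<oplus> (\<Oplus>j\<in>{1..<N-1}. if turn j q then \<kappa>' (del_at j q) else \<zero>)"
      using c by (intro finsum_addf) auto
    finally have *: "(\<Oplus>j\<in>{1..<N-1}. if turn j q then \<kappa> (del_at j q) \<oplus> \<kappa>' (del_at j q) else \<zero>) = \<dots>" .
    have "(\<Oplus>j\<in>{1..<N-1}. if turn j q then \<kappa> (del_at j q) else \<zero>) \<in> carrier K" "(\<Oplus>j\<in>{1..<N-1}. if turn j q then \<kappa>' (del_at j q) else \<zero>) \<in> carrier K"
      using c by (auto intro!: finsum_closed)
    then show ?thesis unfolding dk_def * using c by (simp add: minus_add a_ac)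
  qed
  ultimately show ?thesis unfolding achv_def using k by (intro exI[of _ "\<lambda>x. \<kappa> x \<oplus> \<kappa>' x"]) simp
qed

lemma achv_smult:
  assumes "achv \<phi>" "c \<in> carrier K" shows "achv (\<lambda>q. c \<otimes> \<phi> q)"
proof -
  obtain \<kappa> where k: "adm \<kappa>" "\<forall>q\<in>closed. dk \<kappa> q = \<phi> q" using assms unfolding achv_def by blast
  have kc: "\<kappa> x \<in> carrier K" for x using k adm_closed by auto
  have "\<kappa> x \<noteq> \<zero>" if "c \<otimes> \<kappa> x \<noteq> \<zero>" for x using that assms(2) by auto
  then have "adm (\<lambda>x. c \<otimes> \<kappa> x)" using k(1) kc assms(2) unfolding adm_def by (meson m_closed)
  moreover have "dk (\<lambda>x. c \<otimes> \<kappa> x) q = c \<otimes> dk \<kappa> q" for q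
  proof -
    have "(\<Oplus>j\<in>{1..<N-1}. if turn j q then c \<otimes> \<kappa> (del_at j q) else \<zero>) =
      (\<Oplus>j\<in>{1..<N-1}. c \<otimes> (if turn j q then \<kappa> (del_at j q) else \<zero>))"
      using kc assms(2) by (intro finsum_cong') auto
    also have "\<dots> = c \<otimes> (\<Oplus>j\<in>{1..<N-1}. if turn j q then \<kappa> (del_at j q) else \<zero>)"
      using kc assms(2) by (intro finsum_rdistr[symmetric]) auto
    finally have *: "(\<Oplus>j\<in>{1..<N-1}. if turn j q then c \<otimes> \<kappa> (del_at j q) else \<zero>) = \<dots>" .
    have "(\<Oplus>j\<in>{1..<N-1}. if turn j q then \<kappa> (del_at j q) else \<zero>) \<in> carrier K"
      using kc by (auto intro!: finsum_closed)
    then show ?thesis unfolding dk_def * using kc assms(2) by (simp add: r_distr r_minus)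
  qed
  ultimately show ?thesis unfolding achv_def using k by (intro exI[of _ "\<lambda>x. c \<otimes> \<kappa> x"]) simp
qed

lemma achv_cong: "achv \<phi> \<Longrightarrow> (\<And>q. q \<in> closed \<Longrightarrow> \<phi> q = \<psi> q) \<Longrightarrow> achv \<psi>"
  unfolding achv_def by metis

lemma achv_cancel:
  assumes "achv (\<lambda>q. ind p q \<oplus> ind p' q)" "achv (ind p')" shows "achv (ind p)"
proof -
  have "achv (\<lambda>q. (ind p q \<oplus> ind p' q) \<oplus> (\<ominus> \<one>) \<otimes> ind p' q)"
    using achv_add[OF assms(1) achv_smult[OF assms(2), of "\<ominus> \<one>"]] by simp
  then show ?thesis
    by (rule achv_cong) (auto simp: single_def a_assoc r_neg l_minus)
qed

lemma closed_nth_adj: "p \<in> closed \<Longrightarrow> Suc t < N \<Longrightarrow> adj (p ! t) (p ! Suc t)"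
  by (auto simp: closed_def successively_conv_nth)

lemma closed_range: "p \<in> closed \<Longrightarrow> t < N \<Longrightarrow> p ! t \<in> {1..m}"
  unfolding closed_def by (metis (mono_tags, lifting) mem_Collect_eq nth_mem subsetD)

text \<open>A path of arrows has no equal neighbours, so the deletion creates exactly one loop, and
  its position recovers \<open>j\<close>.\<close>

lemma del_loops:
  assumes p: "p \<in> closed" and j: "0 < j" "j < N - 1" "turn j p" and t: "0 < t" "t < N - 1"
  shows "del_at j p ! (t - 1) = del_at j p ! t \<longleftrightarrow> t = j"
proof -
  have l: "length p = N" using p by (simp add: closed_def)
  have d: "del_at j p ! s = (if s < j then p ! s else p ! Suc s)" if "s < N - 1" for s
    using that j l by (intro del_at_nth) auto
  have a: "p ! s \<noteq> p ! Suc s" if "Suc s < N" for s using adj_neq[OF closed_nth_adj[OF p that]] .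
  obtain t' where t': "t = Suc t'" using t(1) by (cases t) auto
  consider "t < j" | "t = j" | "t > j" by linarith
  then show ?thesis
  proof cases
    case 1
    then show ?thesis using d[of t] d[of t'] a[of t'] t j t' by simp
  next
    case 2
    with t' have jt: "j = Suc t'" by simp
    show ?thesis using d[of t] d[of t'] t j(2,3) unfolding t' jt turn_def by simp
  next
    case 3
    then show ?thesis using d[of t] d[of t'] a[of t] t j t' by simp
  qed
qed

lemma plen_app: "plen (us @ x # vs) = plen (us @ [x]) + plen (x # vs)"
  by (induction us rule: plen.induct) (cases vs; auto)+

lemma del_split:
  assumes p: "p \<in> closed" and j: "0 < j" "j < N - 1" "turn j p"
  obtains us v c ws where "p = us @ v # c # v # ws" "j = Suc (length us)" "del_at j p = us @ v # v # ws"
proof -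
  have l: "length p = N" using p by (simp add: closed_def)
  have "p = take (j - 1) p @ p ! (j - 1) # p ! j # p ! Suc j # drop (Suc (Suc j)) p"
    using l j by (metis Cons_nth_drop_Suc Suc_diff_1 Suc_lessD Suc_less_eq2 append_take_drop_id less_diff_conv diff_Suc_1 add.commute plus_1_eq_Suc)
  moreover have "p ! Suc j = p ! (j - 1)" using j by (simp add: turn_def)
  ultimately have eq: "p = take (j - 1) p @ p ! (j - 1) # p ! j # p ! (j - 1) # drop (Suc (Suc j)) p" by simp
  have lt: "length (take (j - 1) p) = j - 1" using l j by simp
  have "del_at j (take (j - 1) p @ p ! (j - 1) # p ! j # p ! (j - 1) # drop (Suc (Suc j)) p) =
      take (j - 1) p @ p ! (j - 1) # p ! (j - 1) # drop (Suc (Suc j)) p"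
    using lt j(1) by (cases j) (simp_all add: del_at_def)
  then show ?thesis using that[OF eq] lt j(1) eq by simp
qed

text \<open>Two arrows are traded for one loop, which preserves the path length, and the end points
  stay equal.\<close>

lemma ind_del_adm:
  assumes p: "p \<in> closed" and j: "0 < j" "j < N - 1" "turn j p"
  shows "adm (ind (del_at j p))"
proof -
  obtain us v c ws where s: "p = us @ v # c # v # ws" "j = Suc (length us)" "del_at j p = us @ v # v # ws"
    using del_split[OF p j] .
  have cl: "length p = N" "successively adj p" "set p \<subseteq> {1..m}" "hd p = last p" using p by (auto simp: closed_def)
  have "successively adj (us @ [v])" "successively adj (v # ws)"
    using cl(2) successively_append_iff[of adj "us @ [v]" "c # v # ws"] successively_append_iff[of adj "us @ [v, c]" "v # ws"]
    unfolding s(1) by simp_all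
  then have sa: "successively adj (us @ [v])" "successively adj (v # ws)" .
  then have sl: "successively (\<lambda>i j. i = j \<or> adj i j) (us @ [v])" "successively (\<lambda>i j. i = j \<or> adj i j) (v # ws)"
    by (auto elim: successively_mono)
  have "successively (\<lambda>i j. i = j \<or> adj i j) ((us @ [v]) @ v # ws)"
    using sl by (subst successively_append_iff) simp
  moreover have "plen (us @ v # v # ws) = N - 1"
    using plen_app[of us v "v # ws"] arrows_plen[OF sa(1)] arrows_plen[OF sa(2)] cl(1) s(1) by simp
  moreover have "hd (us @ v # v # ws) = last (us @ v # v # ws)" using cl(4) s(1) by (cases us) auto
  ultimately show ?thesis
    using cl(1,3) s(1) unfolding adm_def s(3) by (auto simp: single_def)
qed

text \<open>The two end terms vanish because \<open>tl q\<close> and \<open>butlast q\<close>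
  contain no loop. By \<open>del_loops\<close> only a deletion at \<open>j\<close> itself can
  reproduce the list.\<close>

lemma dk_ind_del:
  assumes p: "p \<in> closed" and j: "0 < j" "j < N - 1" "turn j p" and q: "q \<in> closed"
  shows "dk (ind (del_at j p)) q = (if turn j q \<and> del_at j q = del_at j p then \<one> else \<zero>)"
proof -
  let ?x = "del_at j p"
  have lq: "length q = N" "successively adj q" and lp: "length p = N" using q p by (auto simp: closed_def)
  have loop: "?x ! (j - 1) = ?x ! j" using del_loops[OF p j j(1,2)] by simp
  have ne: "y \<noteq> ?x" if "successively adj y" "length y = N - 1" for y
  proof
    assume "y = ?x"
    moreover have "adj (y ! (j - 1)) (y ! j)"
      using that j by (auto simp: successively_conv_nth dest: spec[of _ "j - 1"])
    ultimately show False using loop by simp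
  qed
  have "successively adj (tl q)" "successively adj (butlast q)"
    using lq N3 by (auto simp: successively_conv_nth nth_tl nth_butlast)
  then have t: "tl q \<noteq> ?x" "butlast q \<noteq> ?x" using ne lq by auto
  have tm: "(if turn i q then ind ?x (del_at i q) else \<zero>) = (if j = i then (if turn j q \<and> del_at j q = ?x then \<one> else \<zero>) else \<zero>)"
    if i: "i \<in> {1..<N-1}" for i
  proof (cases "turn i q \<and> del_at i q = ?x")
    case True
    have "?x ! (i - 1) = ?x ! i"
      using del_loops[OF q _ _ _, of i i] True i by auto
    then have "i = j" using del_loops[OF p j, of i] i by auto
    then show ?thesis using True by (simp add: single_def)
  qed (auto simp: single_def)
  have "(\<Oplus>i\<in>{1..<N-1}. if turn i q then ind ?x (del_at i q) else \<zero>) =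
     (\<Oplus>i\<in>{1..<N-1}. if j = i then (if turn j q \<and> del_at j q = ?x then \<one> else \<zero>) else \<zero>)"
    using tm by (intro finsum_cong') auto
  also have "\<dots> = (if turn j q \<and> del_at j q = ?x then \<one> else \<zero>)"
    using add.finprod_singleton[of j "{1..<N-1}" "\<lambda>_. if turn j q \<and> del_at j q = ?x then \<one> else \<zero>"] j by auto
  finally show ?thesis unfolding dk_def using t by (simp only: single_def if_False) simp
qed

lemma del_eq_update:
  assumes p: "p \<in> closed" and q: "q \<in> closed" and j: "0 < j" "j < N - 1"
    and e: "del_at j q = del_at j p"
  shows "q = p[j := q ! j]"
proof (rule nth_equalityI)
  have l: "length p = N" "length q = N" using p q by (auto simp: closed_def)
  then show "length q = length (p[j := q ! j])" by simp
  fix t assume t: "t < length q"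
  have d: "q ! s = p ! s" if "s < j" for s
    using arg_cong[OF e, of "\<lambda>x. x ! s"] that j l del_at_nth[of q j s] del_at_nth[of p j s] by simp
  have d': "q ! Suc s = p ! Suc s" if "j \<le> s" "s < N - 1" for s
    using arg_cong[OF e, of "\<lambda>x. x ! s"] that j l del_at_nth[of q j s] del_at_nth[of p j s] by simp
  consider "t < j" | "t = j" | "j < t" by linarith
  then show "q ! t = p[j := q ! j] ! t"
  proof cases
    case 3
    then show ?thesis using d'[of "t - 1"] t l j by simp
  qed (use d t l j in simp_all)
qed

text \<open>Closed paths with the same deletion at \<open>j\<close> differ only in the vertex there,
  which is a neighbour of \<open>h\<close>. Peaks are reflected downwards, so the recursion has a
  bottom: for \<open>h = 1\<close> the second neighbour lies outside the quiver and the indicator is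
  reached directly.\<close>

lemma flip:
  assumes p: "p \<in> closed" and j: "0 < j" "j < N - 1" and pj: "p ! (j - 1) = h" "p ! j = Suc h" "p ! Suc j = h"
    and low: "h \<ge> 2 \<Longrightarrow> p[j := h - 1] \<in> closed \<Longrightarrow> achv (ind (p[j := h - 1]))"
  shows "achv (ind p)"
proof -
  have l: "length p = N" using p by (simp add: closed_def)
  have tp: "turn j p" using pj by (simp add: turn_def)
  let ?p' = "p[j := h - 1]"
  have h1: "h \<ge> 1" using closed_range[OF p, of "j - 1"] pj j by auto
  have only: "q = p \<or> (h \<ge> 2 \<and> q = ?p')" if q: "q \<in> closed" "turn j q" "del_at j q = del_at j p" for q
  proof -
    have qp: "q = p[j := q ! j]" by (rule del_eq_update[OF p q(1) j q(3)])
    then have "q ! (j - 1) = h" using pj(1) j l by (metis diff_less less_numeral_extra(1) nat_neq_iff nth_list_update_neq)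
    then have "adj h (q ! j)" using closed_nth_adj[OF q(1), of "j - 1"] j by simp
    then have "q ! j = Suc h \<or> q ! j = h - 1 \<and> h \<ge> 1" by (auto simp: adj_def)
    moreover have "q ! j \<ge> 1" using closed_range[OF q(1), of j] j by auto
    ultimately consider "q ! j = p ! j" | "q ! j = h - 1" "h \<ge> 2" using pj(2) by fastforce
    then show ?thesis
    proof cases
      case 1
      then show ?thesis using qp by simp
    next
      case 2
      then show ?thesis using qp by simp
    qed
  qed
  have del': "del_at j ?p' = del_at j p" using l j by (simp add: del_at_def)
  have turn': "turn j ?p'" using tp l j by (simp add: turn_def)
  have a: "achv (\<lambda>q. if turn j q \<and> del_at j q = del_at j p then \<one> else \<zero>)"
    unfolding achv_def using ind_del_adm[OF p j tp] dk_ind_del[OF p j tp] by blast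
  show ?thesis
  proof (cases "h \<ge> 2")
    case False
    show ?thesis by (rule achv_cong[OF a]) (use only tp False in \<open>auto simp: single_def\<close>)
  next
    case True
    have p': "?p' \<in> closed"
    proof -
      have "j - 1 < N" using j by simp
      from closed_range[OF p this] have r: "h - 1 \<in> {1..m}" using True pj(1) by auto
      have "adj (?p' ! t) (?p' ! Suc t)" if t: "Suc t < N" for t
      proof -
        consider "t = j" | "Suc t = j" | "t \<noteq> j" "Suc t \<noteq> j" by blast
        then show ?thesis
        proof cases
          case 1
          then show ?thesis using pj(3) l j t True by (auto simp: adj_def)
        next
          case 2
          then show ?thesis using pj(1) l j t True by (auto simp: adj_def)
        next
          case 3
          then show ?thesis using closed_nth_adj[OF p t] by simp
        qed
      qed
      then have "successively adj ?p'" using l by (simp add: successively_conv_nth)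
      moreover have "hd ?p' = hd p" using j l by (cases p; cases j) auto
      moreover have "last ?p' = last p" using j l by (subst last_list_update) auto
      moreover have "set ?p' \<subseteq> {1..m}" using r p set_update_subset_insert[of p j "h - 1"] by (auto simp: closed_def)
      ultimately show ?thesis using p l by (auto simp: closed_def)
    qed
    have ne: "p \<noteq> ?p'"
    proof
      assume "p = ?p'"
      then have "p ! j = ?p' ! j" by (rule arg_cong)
      then show False using pj(2) l j by simp
    qed
    have "achv (\<lambda>q. ind p q \<oplus> ind ?p' q)"
      by (rule achv_cong[OF a]) (use only tp turn' del' ne in \<open>auto simp: single_def\<close>)
    then show ?thesis using low[OF True p'] by (rule achv_cancel)
  qed
qed

text \<open>A correction on the list \<open>tl p\<close>, which contains no loop, is seen by two
  closed paths only: the one extending it at the front and the one extending it at the back.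
  Deletion terms are absent because deletions contain a loop.\<close>

lemma rotate:
  assumes p: "p \<in> closed" and a: "achv (ind (tl p @ [hd (tl p)]))"
  shows "achv (ind p)"
proof -
  let ?x = "tl p" and ?p' = "tl p @ [hd (tl p)]"
  have l: "length p = N" "successively adj p" "set p \<subseteq> {1..m}" "hd p = last p" using p by (auto simp: closed_def)
  obtain t s y where pt: "p = t # s # y" using l(1) N3 by (cases p; cases "tl p") auto
  have ne: "y \<noteq> []" using pt l(1) N3 by auto
  have ts: "adj t s" "last p = t" "last ?x = t" using l pt by auto
  have sx: "successively adj ?x" using l(2) pt by simp
  have adm: "adm (ind ?x)"
    using l sx ts arrows_plen[OF sx] pt unfolding adm_def
    by (auto simp: single_def adj_sym elim!: successively_mono)
  have dk: "dk (ind ?x) q = (\<ominus> ind p q) \<oplus> \<ominus> ind ?p' q" if q: "q \<in> closed" for q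
  proof -
    have lq: "length q = N" "successively adj q" "hd q = last q" using q by (auto simp: closed_def)
    have qne: "q \<noteq> []" "tl q \<noteq> []" "butlast q \<noteq> []" using lq(1) N3 by (cases q; auto)+
    have "del_at j q \<noteq> ?x" if j: "j \<in> {1..<N-1}" "turn j q" for j
    proof
      assume e: "del_at j q = ?x"
      have "?x ! (j - 1) = ?x ! j" using del_loops[OF q, of j j] j unfolding e[symmetric] by auto
      moreover have "adj (?x ! (j - 1)) (?x ! j)"
        using sx j l(1) by (auto simp: successively_conv_nth dest: spec[of _ "j - 1"])
      ultimately show False by simp
    qed
    then have sum0: "(\<Oplus>j\<in>{1..<N-1}. if turn j q then ind ?x (del_at j q) else \<zero>) = \<zero>"
      by (intro add.finprod_one_eqI) (auto simp: single_def)
    have "tl q = ?x \<longleftrightarrow> q = p"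
    proof
      assume e: "tl q = ?x"
      have "last q = last (tl q)" using qne by (cases q) auto
      then have "hd q = hd p" using e ts lq(3) pt by simp
      then show "q = p" using e qne(1) pt by (metis list.collapse list.distinct(1))
    qed simp
    moreover have "butlast q = ?x \<longleftrightarrow> q = ?p'"
    proof
      assume e: "butlast q = ?x"
      have "hd q = hd (butlast q)" using qne by (cases q) (auto split: if_splits)
      then show "q = ?p'" using e qne(1) lq(3) by (metis append_butlast_last_id)
    qed simp
    ultimately show ?thesis unfolding dk_def sum0 by (simp add: single_def)
  qed
  have "achv (\<lambda>q. \<ominus> ind p q \<oplus> \<ominus> ind ?p' q)" unfolding achv_def using adm dk by blast
  from achv_smult[OF this, of "\<ominus> \<one>"] have "achv (\<lambda>q. (\<ominus> \<one>) \<otimes> (\<ominus> ind p q \<oplus> \<ominus> ind ?p' q))" by simp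
  then have "achv (\<lambda>q. ind p q \<oplus> ind ?p' q)"
    by (rule achv_cong) (auto simp: single_def l_minus r_minus minus_add)
  then show ?thesis using a by (rule achv_cancel)
qed

text \<open>The head of a closed path repeats its last vertex, so the sum over \<open>tl p\<close>
  counts the cycle once and is invariant under rotation. A vertex of maximal height is a peak; if it
  is the base point, one rotation moves it inside. Reflecting it lowers the sum by two.\<close>

lemma achv_ind: "p \<in> closed \<Longrightarrow> achv (ind p)"
proof (induction "sum_list (tl p)" arbitrary: p rule: less_induct)
  case less
  have interior: "achv (ind r)"
    if r: "r \<in> closed" "sum_list (tl r) = sum_list (tl p)" and j: "0 < j" "j < N - 1" "\<forall>x\<in>set r. x \<le> r ! j" for r j
  proof -
    have l: "length r = N" using r by (simp add: closed_def)
    have n: "r ! (j - 1) \<le> r ! j" "r ! Suc j \<le> r ! j" using j l by auto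
    have "adj (r ! (j - 1)) (r ! j)" "adj (r ! j) (r ! Suc j)"
      using closed_nth_adj[OF r(1), of "j - 1"] closed_nth_adj[OF r(1), of j] j by auto
    then obtain h where h: "r ! (j - 1) = h" "r ! j = Suc h" "r ! Suc j = h" using n by (auto simp: adj_def)
    show ?thesis
    proof (rule flip[OF r(1) j(1,2) h])
      assume c: "h \<ge> 2" "r[j := h - 1] \<in> closed"
      have t: "tl (r[j := h - 1]) = (tl r)[j - 1 := h - 1]" using j(1) by (cases r; cases j) auto
      have "tl r ! (j - 1) = Suc h" "j - 1 < length (tl r)" using h(2) j l by (auto simp: nth_tl)
      then have "sum_list ((tl r)[j - 1 := h - 1]) = sum_list (tl r) + (h - 1) - Suc h"
        using sum_list_update[of "j - 1" "tl r" "h - 1"] by simp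
      moreover have "Suc h \<in> set (tl r)"
        using \<open>tl r ! (j - 1) = Suc h\<close> \<open>j - 1 < length (tl r)\<close> by (metis nth_mem)
      then have "Suc h \<le> sum_list (tl r)" by (rule member_le_sum_list) simp
      ultimately have "sum_list ((tl r)[j - 1 := h - 1]) < sum_list (tl r)" using c(1) by linarith
      then show "achv (ind (r[j := h - 1]))" using less.hyps[OF _ c(2)] r(2) t by simp
    qed
  qed
  have l: "length p = N" "hd p = last p" using less.prems by (auto simp: closed_def)
  have pne: "p \<noteq> []" using l N3 by auto
  obtain k where k: "k < N" "\<forall>x\<in>set p. x \<le> p ! k"
  proof -
    have "Max (set p) \<in> set p" using pne by simp
    then obtain k where "k < length p" "p ! k = Max (set p)" by (metis in_set_conv_nth)
    then show ?thesis using that l by simp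
  qed
  show ?case
  proof (cases "0 < k \<and> k < N - 1")
    case True
    then show ?thesis using interior[OF less.prems refl _ _ k(2)] by simp
  next
    case False
    then have "p ! k = last p"
      using k(1) l pne by (cases "k = 0") (auto simp: hd_conv_nth last_conv_nth intro!: arg_cong[of _ _ "(!) p"])
    then have mx: "\<forall>x\<in>set p. x \<le> last p" using k(2) by simp
    let ?r = "tl p @ [hd (tl p)]"
    obtain t s y where pt: "p = t # s # y" using l(1) N3 by (cases p; cases "tl p") auto
    have tl: "last (s # y) = t" using l(2) pt by simp
    have suc: "successively adj (s # y)" "adj t s" using less.prems pt by (auto simp: closed_def)
    have "successively adj ((s # y) @ [s])"
      using suc tl by (subst successively_append_iff) auto
    then have r: "?r \<in> closed" using less.prems pt by (auto simp: closed_def)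
    have set: "set ?r \<subseteq> set p" using pt by auto
    \<comment> \<open>After the rotation the former base point sits just before the new last vertex,
      hence at an inner position.\<close>
    have nth: "?r ! (N - 2) = last p" using l(1) pt by (auto simp: nth_append last_conv_nth)
    have "achv (ind ?r)"
    proof (rule interior[OF r, of "N - 2"])
      show "\<forall>x\<in>set ?r. x \<le> ?r ! (N - 2)" unfolding nth using mx set by blast
    qed (use N3 pt in auto)
    then show ?thesis by (rule rotate[OF less.prems])
  qed
qed

lemma all_achv:
  assumes "\<And>q. q \<in> closed \<Longrightarrow> \<psi> q \<in> carrier K"
  shows "achv \<psi>"
proof -
  have fin: "finite closed"
    by (rule finite_subset[of _ "{p. set p \<subseteq> {1..m} \<and> length p = N}"])
      (auto simp: closed_def intro: finite_lists_length_eq)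
  have "achv (\<lambda>q. if q \<in> S then \<psi> q else \<zero>)" if "finite S" "S \<subseteq> closed" for S
    using that
  proof (induction S rule: finite_induct)
    case empty
    have "adm (\<lambda>_. \<zero>)" by (simp add: adm_def)
    moreover have "dk (\<lambda>_. \<zero>) q = \<zero>" for q by (simp add: dk_def)
    ultimately show ?case by (auto simp: achv_def)
  next
    case (insert p S)
    have "achv (\<lambda>q. \<psi> p \<otimes> ind p q \<oplus> (if q \<in> S then \<psi> q else \<zero>))"
      using insert assms by (intro achv_add achv_smult achv_ind) auto
    then show ?case
      by (rule achv_cong) (use insert assms in \<open>auto simp: single_def\<close>)
  qed
  from achv_cong[OF this[OF fin subset_refl]] show ?thesis by simp
qed

end

section \<open>The differential of a path of arrows for \<open>n = 2\<close>\<close>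

context letters
begin

lemma tb_Cons: "\<exists>s R. tb (z # r) = nd z s # R"
  by (cases r) auto

lemma tb_Cons2: "w \<noteq> [] \<Longrightarrow> tb (y # w) = nd y False # tb w"
  by (cases w) auto

text \<open>For \<open>n = 2\<close> every arrow has degree one, so a letter followed by a bar has
  degree zero and is passed without sign. Hence all cuts carry one sign and all multiplications the
  other.\<close>

lemma D_tb:
  assumes n: "n = 2"
  shows "vs \<noteq> [] \<Longrightarrow> adj (ver x) (hd vs) \<Longrightarrow> successively adj vs \<Longrightarrow> D (x # tb vs) =
    (\<Sum>j<length vs - 1. (if (ver x # vs) ! j = vs ! Suc j then frag_of (x # tb (del_at j vs)) else 0)
       - frag_of (x # tb (take (Suc j) vs) @ tb (drop (Suc j) vs)))"
proof (induction vs arbitrary: x rule: tb.induct)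
  case (3 y z r)
  let ?R = "tb (z # r)" and ?y = "nd y False"
  let ?t = "\<lambda>j. (if (y # z # r) ! j = (z # r) ! Suc j then frag_of (?y # tb (del_at j (z # r))) else 0)
       - frag_of (?y # tb (take (Suc j) (z # r)) @ tb (drop (Suc j) (z # r)))"
  let ?T = "\<lambda>j. (if (ver x # y # z # r) ! j = (y # z # r) ! Suc j then frag_of (x # tb (del_at j (y # z # r))) else 0)
       - frag_of (x # tb (take (Suc j) (y # z # r)) @ tb (drop (Suc j) (y # z # r)))"
  have a: "adj (ver x) y" "adj y z" "successively adj (z # r)" using 3 by auto
  have IH: "D (?y # ?R) = (\<Sum>j<length r. ?t j)" using 3(1)[of ?y] a by simp
  have pt: "pre x (?t j) = ?T (Suc j)" if "j < length r" for j
  proof -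
    have "del_at j (z # r) \<noteq> []" "del_at (Suc j) (y # z # r) = y # del_at j (z # r)"
      using that by (auto simp: del_at_def)
    then show ?thesis by (simp add: frag_extend_diff tb_Cons2)
  qed
  have "pre x (D (?y # ?R)) = (\<Sum>j<length r. pre x (?t j))"
    unfolding IH frag_extend_sum[OF finite_lessThan] comp_def ..
  also have "\<dots> = (\<Sum>j<length r. ?T (Suc j))"
    by (rule sum.cong[OF refl], rule pt) simp
  finally have pD: "pre x (D (?y # ?R)) = (\<Sum>j<length r. ?T (Suc j))" .
  obtain s R where R: "?R = nd z s # R" using tb_Cons by blast
  have sg: "sg x ?y = -1"
  proof -
    have "letter_degree n (ver x) y = 1"
      using letter_degree_quiver[OF a(1), of n] n by (simp add: quiver_d_def)
    then show ?thesis by (simp add: sg_def)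
  qed
  have "D (x # ?y # ?R) = F x (?y # ?R) + pre x (D (?y # ?R))" by (simp add: sg)
  also have "F x (?y # ?R) = ?T 0"
    using a(1) unfolding R by (simp add: sg tn_def del_at_def R)
  finally have "D (x # ?y # ?R) = ?T 0 + (\<Sum>j<length r. ?T (Suc j))" unfolding pD .
  then show ?case by (simp add: sum.lessThan_Suc_shift del: sum.lessThan_Suc)
qed simp_all

lemma D_bw:
  assumes n: "n = 2" and p: "successively adj p" "length p = N" "N \<ge> 3"
  shows "D (bw p) = (\<Sum>j\<in>{1..<N-1}. (if turn j p then frag_of (bw (del_at j p)) else 0)
       - frag_of (bw (take (Suc j) p) @ tl (bw (drop j p))))"
proof -
  obtain i vs where iv: "p = i # vs" "vs \<noteq> []" using p by (cases p; cases "tl p") auto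
  obtain M where M: "length vs = Suc M" using iv(2) by (cases vs) auto
  have a: "adj i (hd vs)" "successively adj vs" using p(1) iv by (auto simp: successively_Cons)
  have "D (bw p) = (\<Sum>j<M. (if (i # vs) ! j = vs ! Suc j then frag_of (nd i True # tb (del_at j vs)) else 0)
       - frag_of (nd i True # tb (take (Suc j) vs) @ tb (drop (Suc j) vs)))"
    using D_tb[OF n iv(2), of "nd i True"] a M by (simp add: bw_def iv)
  also have "\<dots> = (\<Sum>j<M. (if turn (Suc j) p then frag_of (bw (del_at (Suc j) p)) else 0)
       - frag_of (bw (take (Suc (Suc j)) p) @ tl (bw (drop (Suc j) p))))"
  proof (rule sum.cong[OF refl])
    fix j assume "j \<in> {..<M}"
    then have "tl (drop j vs) = drop (Suc j) vs" by (simp add: tl_drop drop_Suc)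
    then show "(if (i # vs) ! j = vs ! Suc j then frag_of (nd i True # tb (del_at j vs)) else 0)
       - frag_of (nd i True # tb (take (Suc j) vs) @ tb (drop (Suc j) vs)) =
      (if turn (Suc j) p then frag_of (bw (del_at (Suc j) p)) else 0)
       - frag_of (bw (take (Suc (Suc j)) p) @ tl (bw (drop (Suc j) p)))"
      by (simp add: turn_def del_at_def iv bw_def)
  qed
  also have "\<dots> = (\<Sum>j\<in>{1..<N-1}. (if turn j p then frag_of (bw (del_at j p)) else 0)
       - frag_of (bw (take (Suc j) p) @ tl (bw (drop j p))))"
  proof -
    have "N - 1 = Suc M" using p(2) iv M by simp
    then show ?thesis by (simp only: One_nat_def sum.atLeast_Suc_lessThan_Suc_shift comp_def lessThan_atLeast0)
  qed
  finally show ?thesis .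
qed

end

section \<open>Obstructions on paths of arrows and their change under perturbation\<close>

context formality
begin

lemma g_ev_sum:
  assumes f: "typed f" and a: "\<And>j. j \<in> S \<Longrightarrow> fkeys (a j) \<subseteq> wordsQ" and S: "finite S"
  shows "fkeys (sum a S) \<subseteq> wordsQ \<and> g f (ev (sum a S)) = (\<Oplus>\<^bsub>B\<^esub> j\<in>S. g f (ev (a j)))"
  using S a
proof (induction S rule: finite_induct)
  case empty
  then show ?case using klinear_zero[OF g_klinear[OF f] module_A module_B] by simp
next
  case (insert x S)
  have c: "g f (ev (a j)) \<in> carrier B" if "j \<in> insert x S" for j
    using klinearD(1)[OF g_klinear[OF f] ev_in] insert.prems that by blast
  have k: "fkeys (a x) \<subseteq> wordsQ" "fkeys (sum a S) \<subseteq> wordsQ" using insert by auto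
  have "g f (ev (a x + sum a S)) = g f (ev (a x)) \<oplus>\<^bsub>B\<^esub> g f (ev (sum a S))"
    unfolding ev_add using k by (intro klinearD(2)[OF g_klinear[OF f]] ev_in)
  moreover have "fkeys (a x + sum a S) \<subseteq> wordsQ" using k by (rule fkeys_intros)
  ultimately show ?case using insert c by (simp add: B.A.finsum_insert Pi_def)
qed

lemma chain_parts:
  assumes p: "p \<in> chains" "length p = N" and j: "j \<in> {1..<N-1}"
  shows "take (Suc j) p \<in> chains" "drop j p \<in> chains" "last (take (Suc j) p) = hd (drop j p)"
proof -
  have s: "successively (\<lambda>i j. i = j \<or> adj i j) p" "set p \<subseteq> {1..m}" using p by (auto simp: chains_def)
  have "successively (\<lambda>i j. i = j \<or> adj i j) (take k p)" "successively (\<lambda>i j. i = j \<or> adj i j) (drop k p)" for k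
    using s(1) successively_append_iff[of "\<lambda>i j. i = j \<or> adj i j" "take k p" "drop k p"] by simp_all
  moreover have "set (take k p) \<subseteq> {1..m}" "set (drop k p) \<subseteq> {1..m}" for k
    using s(2) set_take_subset[of k p] set_drop_subset[of k p] by auto
  ultimately show "take (Suc j) p \<in> chains" "drop j p \<in> chains" using p j by (auto simp: chains_def)
  show "last (take (Suc j) p) = hd (drop j p)"
  proof -
    have "j < length p" using p j by auto
    then show ?thesis by (simp add: take_Suc_conv_app_nth hd_drop_conv_nth)
  qed
qed

lemma arrows_chain: "successively adj p \<Longrightarrow> set p \<subseteq> {1..m} \<Longrightarrow> length p \<ge> 2 \<Longrightarrow> p \<in> chains"
  by (auto simp: chains_def elim: successively_mono)

text \<open>The shape of the equation for an A-infinity morphism: turns are multiplied in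
  \<open>A\<close>, and cuts become products in \<open>B\<close>.\<close>

lemma Ob_arrows:
  assumes n: "n = 2" and f: "typed f" and p: "successively adj p" "set p \<subseteq> {1..m}" "length p = N" "N \<ge> 3"
    and del: "\<And>j. j \<in> {1..<N-1} \<Longrightarrow> turn j p \<Longrightarrow> del_at j p \<in> chains"
  shows "Ob f p = (\<Oplus>\<^bsub>B\<^esub> j\<in>{1..<N-1}. (if turn j p then f (del_at j p) else \<zero>\<^bsub>B\<^esub>)
      \<ominus>\<^bsub>B\<^esub> f (take (Suc j) p) \<otimes>\<^bsub>B\<^esub> f (drop j p))"
proof -
  let ?a = "\<lambda>j. (if turn j p then frag_of (bw (del_at j p)) else 0)
       - frag_of (bw (take (Suc j) p) @ tl (bw (drop j p)))"
  have pc: "p \<in> chains" using arrows_chain p by simp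
  have parts: "g f (ev (?a j)) = (if turn j p then f (del_at j p) else \<zero>\<^bsub>B\<^esub>) \<ominus>\<^bsub>B\<^esub> f (take (Suc j) p) \<otimes>\<^bsub>B\<^esub> f (drop j p)
      \<and> fkeys (?a j) \<subseteq> wordsQ"
    if j: "j \<in> {1..<N-1}" for j
  proof -
    note c = chain_parts[OF pc p(3) j]
    have ld: "last (take (Suc j) p) = ver (hd (bw (drop j p)))" using c bw_props(2)[OF c(2)] by simp
    note G = G_block[OF c(1) bw_props(1)[OF c(2)] ld, of f]
    have w: "bw (take (Suc j) p) @ tl (bw (drop j p)) \<in> wordsQ" using block_join(2)[OF c(1) bw_props(1)[OF c(2)] ld] .
    have k1: "fkeys (if turn j p then frag_of (bw (del_at j p)) else 0) \<subseteq> wordsQ"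
      using del[OF j] bw_props(1) by auto
    have k2: "fkeys (frag_of (bw (take (Suc j) p) @ tl (bw (drop j p)))) \<subseteq> wordsQ" using w by simp
    have "g f (ev (?a j)) = g f (ev (if turn j p then frag_of (bw (del_at j p)) else 0)) \<ominus>\<^bsub>B\<^esub>
        g f (ev (frag_of (bw (take (Suc j) p) @ tl (bw (drop j p)))))"
      unfolding ev_diff[OF k1 k2] by (rule klinear_minus[OF g_klinear[OF f] module_A module_B ev_in[OF k1] ev_in[OF k2]])
    also have "g f (ev (if turn j p then frag_of (bw (del_at j p)) else 0)) = (if turn j p then f (del_at j p) else \<zero>\<^bsub>B\<^esub>)"
      using del[OF j] bw_props(1) klinear_zero[OF g_klinear[OF f] module_A module_B] by (simp add: g_single f G_bw)
    also have "g f (ev (frag_of (bw (take (Suc j) p) @ tl (bw (drop j p))))) = f (take (Suc j) p) \<otimes>\<^bsub>B\<^esub> f (drop j p)"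
      using w c(2) by (simp add: g_single f G G_bw)
    finally show ?thesis using fkeys_intros(3)[OF k1 k2] by simp
  qed
  have fin: "finite {1..<N-1}" by simp
  have "Ob f p = (\<Oplus>\<^bsub>B\<^esub> j\<in>{1..<N-1}. g f (ev (?a j)))"
    unfolding Ob_def D_bw[OF n p(1,3,4)] using g_ev_sum[OF f _ fin, of ?a] parts by blast
  also have "\<dots> = (\<Oplus>\<^bsub>B\<^esub> j\<in>{1..<N-1}. (if turn j p then f (del_at j p) else \<zero>\<^bsub>B\<^esub>)
      \<ominus>\<^bsub>B\<^esub> f (take (Suc j) p) \<otimes>\<^bsub>B\<^esub> f (drop j p))"
  proof (rule B.A.finsum_cong')
    show "(\<lambda>j. (if turn j p then f (del_at j p) else \<zero>\<^bsub>B\<^esub>) \<ominus>\<^bsub>B\<^esub> f (take (Suc j) p) \<otimes>\<^bsub>B\<^esub> f (drop j p))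
        \<in> {1..<N-1} \<rightarrow> carrier B"
    proof
      fix j assume j: "j \<in> {1..<N-1}"
      have fc: "f x \<in> carrier B" if "x \<in> chains" for x using f that hm_carrier by (auto simp: typed_def)
      show "(if turn j p then f (del_at j p) else \<zero>\<^bsub>B\<^esub>) \<ominus>\<^bsub>B\<^esub> f (take (Suc j) p) \<otimes>\<^bsub>B\<^esub> f (drop j p) \<in> carrier B"
        using fc[OF del[OF j]] fc[OF chain_parts(1)[OF pc p(3) j]] fc[OF chain_parts(2)[OF pc p(3) j]] by simp
    qed
  qed (use parts in auto)
  finally show ?thesis .
qed

lemma eta_basis: "[i, j] \<in> basis m \<Longrightarrow> eta i j \<in> carrier B"
  using eta(1) B.cocyclesD(1) by blast

lemma \<chi>_adj_mult:
  assumes z: "z \<in> cocycles B" "z' \<in> cocycles B" and ab: "adj a b" "a \<in> {1..m}"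
    and c: "\<And>w. \<chi> z w = (if w = [a, b] then c else \<zero>)" "\<And>w. \<chi> z' w = (if w = [b, a] then c' else \<zero>)"
    and K: "c \<in> carrier K" "c' \<in> carrier K"
  shows "\<chi> (z \<otimes>\<^bsub>B\<^esub> z') [a, a] = c \<otimes> c'"
proof -
  have "b = a - 1 \<and> b \<noteq> a + 1 \<or> b = a + 1 \<and> b \<noteq> a - 1" "a \<noteq> b" using ab by (auto simp: adj_def)
  then show ?thesis using \<chi>_mult(3)[OF z, of a] c K ab by auto
qed

text \<open>The case distinction keeps the value in \<open>B\<close> for every list, since
  \<open>eta\<close> is meaningful only for pairs in \<open>basis m\<close>.\<close>

definition keta :: "(nat list \<Rightarrow> 'k) \<Rightarrow> nat list \<Rightarrow> 'b" where
  "keta \<kappa> x = (if \<kappa> x = \<zero> then \<zero>\<^bsub>B\<^esub> else \<kappa> x \<odot>\<^bsub>B\<^esub> eta (hd x) (last x))"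

definition perturb :: "nat \<Rightarrow> (nat list \<Rightarrow> 'k) \<Rightarrow> (nat list \<Rightarrow> 'b) \<Rightarrow> nat list \<Rightarrow> 'b" where
  "perturb N \<kappa> f x = (if length x = N - 1 then f x \<oplus>\<^bsub>B\<^esub> keta \<kappa> x else f x)"

context
  fixes N :: nat and \<kappa> :: "nat list \<Rightarrow> 'k" and f :: "nat list \<Rightarrow> 'b"
  assumes N5: "N \<ge> 5" and n2: "n = 2" and \<kappa>: "closed_paths.adm K m N \<kappa>" and f: "typed f"
    and f_eta: "\<And>i j. [i, j] \<in> basis m \<Longrightarrow> f [i, j] = eta i j"
begin

interpretation CP: closed_paths K m N
  by unfold_locales (use N5 in simp)

text \<open>The two cases of \<open>adm\<close> are those in which, for \<open>n = 2\<close>, the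
  chain has the degree of the loop or of the arrow between its end points.\<close>

lemma adm_props:
  assumes nz: "\<kappa> x \<noteq> \<zero>"
  shows "x \<in> chains" "[hd x, last x] \<in> basis m" "bdeg x = letter_degree n (hd x) (last x)" "length x = N - 1"
proof -
  have a: "length x = N - 1" "set x \<subseteq> {1..m}" "successively (\<lambda>i j. i = j \<or> adj i j) x"
    "hd x = last x \<and> plen x = N - 1 \<or> adj (hd x) (last x) \<and> plen x = N - 2"
    using \<kappa> nz unfolding CP.adm_def by auto
  show "length x = N - 1" by fact
  show c: "x \<in> chains" using a N5 by (auto simp: chains_def)
  have xne: "x \<noteq> []" using a N5 by auto
  then have "hd x \<in> {1..m}" "last x \<in> {1..m}" using a(2) by (meson hd_in_set last_in_set subsetD)+
  then show "[hd x, last x] \<in> basis m" using a(4) unfolding basis_def by blast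
  note ld = ldsum_plen[OF xne a(3), of n]
  show "bdeg x = letter_degree n (hd x) (last x)"
    using a(4)
  proof
    assume l: "hd x = last x \<and> plen x = N - 1"
    then have ev: "even (plen x)" using ld by simp
    then have "2 * (plen x div 2) = plen x" by simp
    then have "2 * int (plen x div 2) = int N - 1" using l N5 by linarith
    moreover have "ldsum n x = 2 * int (plen x div 2)" using ld ev n2 by simp
    moreover have "letter_degree n (hd x) (last x) = 2" using l n2 by (simp add: letter_degree_def)
    ultimately show ?thesis using a(1) N5 bdeg_eq[OF c] by simp
  next
    assume l: "adj (hd x) (last x) \<and> plen x = N - 2"
    then have o: "odd (plen x)" using ld adj_parity by blast
    then have "2 * (plen x div 2) + 1 = plen x" by presburger
    then have "2 * int (plen x div 2) + 1 = int N - 2" using l N5 by linarith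
    moreover have "letter_degree n (hd x) (last x) = 1"
      using letter_degree_quiver[of "hd x" "last x" n] l n2 by (simp add: quiver_d_def)
    moreover have "ldsum n x = 2 * int (plen x div 2) + 1"
      using ld o n2 by (simp add: quiver_d_def)
    ultimately show ?thesis using a(1) N5 bdeg_eq[OF c] by simp
  qed
qed

lemma \<kappa>_closed: "\<kappa> x \<in> carrier K" using \<kappa> CP.adm_closed by blast

lemma keta_props:
  shows "keta \<kappa> x \<in> cocycles B" "\<chi> (keta \<kappa> x) w = (if w = [hd x, last x] then \<kappa> x else \<zero>)"
    and "keta \<kappa> x \<in> hm (hd x) (last x) (bdeg x)"
proof -
  have z: "\<chi> \<zero>\<^bsub>B\<^esub> w = \<zero>" for w using \<chi>_zero_iff[OF B.cocycles_closed(1)] B.coboundaries_closed(1) by blast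
  note a = adm_props[of x]
  show "keta \<kappa> x \<in> cocycles B" "\<chi> (keta \<kappa> x) w = (if w = [hd x, last x] then \<kappa> x else \<zero>)"
    using a(2) eta[of "hd x" "last x"] \<kappa>_closed
    by (auto simp: keta_def z B.cocycles_closed \<chi>_smult)
  show "keta \<kappa> x \<in> hm (hd x) (last x) (bdeg x)"
    using a(2,3) eta(2)[of "hd x" "last x"] \<kappa>_closed by (auto simp: keta_def hm_closed)
qed

lemma keta_carrier: "keta \<kappa> x \<in> carrier B"
  using keta_props(1) B.cocyclesD(1) by blast

lemma perturb_typed: "typed (perturb N \<kappa> f)"
  using f keta_props(3) by (auto simp: typed_def perturb_def hm_closed)

lemma perturb_diff: "x \<in> chains \<Longrightarrow> diff B (perturb N \<kappa> f x) = diff B (f x)"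
proof -
  assume x: "x \<in> chains"
  then have "f x \<in> carrier B" using f hm_carrier by (auto simp: typed_def)
  then show ?thesis
    using B.cocyclesD[OF keta_props(1)[of x]] by (simp add: perturb_def B.diff_add B.diff_closed)
qed

text \<open>Corrected chains have \<open>N - 1\<close> vertices and arise from \<open>p\<close> by
  deleting a turn or by cutting off the first or last arrow. As \<open>N - 1 > 2\<close>, the other
  factor of such a cut is an uncorrected arrow, so the change is linear in
  \<open>\<kappa>\<close>.\<close>

lemma perturb_Ob:
  assumes p: "p \<in> CP.closed" and oc: "Ob f p \<in> cocycles B" and oc': "Ob (perturb N \<kappa> f) p \<in> cocycles B"
  shows "\<chi> (Ob (perturb N \<kappa> f) p) [hd p, hd p] = \<chi> (Ob f p) [hd p, hd p] \<oplus> CP.dk \<kappa> p"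
proof -
  let ?f = "perturb N \<kappa> f" and ?v = "hd p"
  let ?I = "{1..<N-1}"
  have l: "length p = N" "successively adj p" "set p \<subseteq> {1..m}" "hd p = last p" using p by (auto simp: CP.closed_def)
  have pc: "p \<in> chains" using arrows_chain l N5 by simp
  have del: "del_at j p \<in> chains \<and> hd (del_at j p) = ?v \<and> last (del_at j p) = ?v \<and> length (del_at j p) = N - 1"
    if j: "j \<in> ?I" "turn j p" for j
  proof -
    have "\<kappa>' = single K (del_at j p) \<Longrightarrow> closed_paths.adm K m N \<kappa>'" for \<kappa>'
      using CP.ind_del_adm[OF p _ _ j(2)] j(1) by auto
    then have a: "set (del_at j p) \<subseteq> {1..m}" "successively (\<lambda>i j. i = j \<or> adj i j) (del_at j p)"
      unfolding CP.adm_def by (auto simp: single_def split: if_splits)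
    have j': "0 < j" "j < N - 1" using j(1) by auto
    obtain us v c ws where s: "p = us @ v # c # v # ws" "j = Suc (length us)" "del_at j p = us @ v # v # ws"
      using CP.del_split[OF p j' j(2)] .
    have "hd (del_at j p) = ?v" "last (del_at j p) = ?v" using s l(4) by (cases us; auto)+
    then show ?thesis using a l(1) j N5 by (auto simp: chains_def del_at_length)
  qed
  have l3: "N \<ge> 3" using N5 by simp
  have v: "?v \<in> {1..m}" using l(1,3) N5 by (cases p) auto
  obtain v0 a y where py0: "p = v0 # a # y" using l(1) N5 by (cases p; cases "tl p") auto
  have v0: "v0 = ?v" by (simp add: py0)
  have yne: "y \<noteq> []" using l(1) N5 by (auto simp: py0)
  have va: "adj ?v a" "a \<in> {1..m}" using l(2,3) by (simp_all add: py0)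
  define b where "b = p ! (N - 2)"
  have vb: "adj b ?v" "b \<in> {1..m}"
  proof -
    have "p ! (N - 1) = ?v" using l by (metis last_conv_nth list.size(3) not_numeral_le_zero N5)
    moreover have "adj (p ! (N - 2)) (p ! Suc (N - 2))" using CP.closed_nth_adj[OF p, of "N - 2"] N5 by simp
    moreover have "Suc (N - 2) = N - 1" using N5 by simp
    ultimately show "adj b ?v" by (simp add: b_def)
    show "b \<in> {1..m}" unfolding b_def using CP.closed_range[OF p] N5 by simp
  qed
  let ?tl = "tl p" and ?bl = "butlast p"
  have tlp: "hd ?tl = a" "last ?tl = ?v" "length ?tl = N - 1" "drop 1 p = ?tl" "take (Suc 1) p = [?v, a]"
    using l(1,4) yne by (simp_all add: py0)
  have blp: "hd ?bl = ?v" "last ?bl = b" "length ?bl = N - 1" "take (Suc (N - 2)) p = ?bl" "drop (N - 2) p = [b, ?v]"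
  proof -
    show "hd ?bl = ?v" by (simp add: py0)
    have "?bl \<noteq> []" by (simp add: py0)
    then have "last ?bl = ?bl ! (N - 2)" using l(1) by (simp add: last_conv_nth numeral_2_eq_2)
    then show "last ?bl = b" using l(1) N5 by (simp add: b_def nth_butlast)
    show "length ?bl = N - 1" using l(1) by simp
    have sN: "Suc (N - 2) = N - 1" using N5 by simp
    show "take (Suc (N - 2)) p = ?bl" unfolding sN using l(1) by (simp add: butlast_conv_take)
    have "drop (N - 2) p = p ! (N - 2) # drop (Suc (N - 2)) p" using l(1) N5 by (intro Cons_nth_drop_Suc[symmetric]) simp
    also have "Suc (N - 2) = N - 1" using N5 by simp
    also have "drop (N - 1) p = [p ! (N - 1)]"
    proof -
      have "N - 1 < length p" "Suc (N - 1) = length p" using l(1) N5 by simp_all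
      then show ?thesis using Cons_nth_drop_Suc[of "N - 1" p] by simp
    qed
    also have "p ! (N - 1) = ?v" using l by (metis last_conv_nth list.size(3) not_numeral_le_zero N5)
    finally show "drop (N - 2) p = [b, ?v]" by (simp add: b_def)
  qed
  have eta1: "f [?v, a] = eta ?v a" "f [b, ?v] = eta b ?v" "[?v, a] \<in> basis m" "[b, ?v] \<in> basis m"
    using f_eta va vb v by (auto simp: basis_def)
  \<comment> \<open>\<open>T\<close> is the summand of \<open>Ob_arrows\<close> at \<open>j\<close>
    and \<open>E\<close> its change. The values \<open>j = 1\<close> and \<open>j = N - 2\<close>
    are the cuts after the first and before the last arrow.\<close>
  define E where "E = (\<lambda>j. (if turn j p then keta \<kappa> (del_at j p) else \<zero>\<^bsub>B\<^esub>) \<ominus>\<^bsub>B\<^esub>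
     (if j = 1 then eta ?v a \<otimes>\<^bsub>B\<^esub> keta \<kappa> ?tl else if j = N - 2 then keta \<kappa> ?bl \<otimes>\<^bsub>B\<^esub> eta b ?v else \<zero>\<^bsub>B\<^esub>))"
  define T where "T = (\<lambda>f j. (if turn j p then f (del_at j p) else \<zero>\<^bsub>B\<^esub>) \<ominus>\<^bsub>B\<^esub> f (take (Suc j) p) \<otimes>\<^bsub>B\<^esub> f (drop j p))"
  have fc: "f x \<in> carrier B" if "x \<in> chains" for x using f that hm_carrier by (auto simp: typed_def)
  note et = eta[OF eta1(3)] eta[OF eta1(4)]
  have ec: "eta ?v a \<in> carrier B" "eta b ?v \<in> carrier B" using eta_basis eta1 by auto
  \<comment> \<open>\<open>keta\<close> on \<open>tl p\<close> is a multiple of the arrow back to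
    the base point, so its product with the first arrow has that multiple as its loop coordinate;
    \<open>m2\<close> is the mirror image.\<close>
  have m1: "eta ?v a \<otimes>\<^bsub>B\<^esub> keta \<kappa> ?tl \<in> cocycles B" "\<chi> (eta ?v a \<otimes>\<^bsub>B\<^esub> keta \<kappa> ?tl) [?v, ?v] = \<kappa> ?tl"
    using B.cocycles_mult[OF et(1) keta_props(1)] \<chi>_adj_mult[OF et(1) keta_props(1)[of ?tl] va(1) v et(3), where c' = "\<kappa> ?tl"]
      keta_props(2)[of ?tl] \<kappa>_closed[of ?tl] tlp by auto
  have m2: "keta \<kappa> ?bl \<otimes>\<^bsub>B\<^esub> eta b ?v \<in> cocycles B" "\<chi> (keta \<kappa> ?bl \<otimes>\<^bsub>B\<^esub> eta b ?v) [?v, ?v] = \<kappa> ?bl"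
    using B.cocycles_mult[OF keta_props(1) et(4)]
      \<chi>_adj_mult[OF keta_props(1)[of ?bl] et(4) _ v, where b = b and c = "\<kappa> ?bl" and c' = \<one>]
      keta_props(2)[of ?bl] \<kappa>_closed[of ?bl] blp et(6) vb(1) by (auto simp: adj_sym)
  have z: "\<chi> \<zero>\<^bsub>B\<^esub> w = \<zero>" for w using \<chi>_zero_iff[OF B.cocycles_closed(1)] B.coboundaries_closed(1) by blast
  have Ec: "E j \<in> cocycles B" for j
    unfolding E_def using m1 m2 keta_props(1) by (auto intro!: B.cocycles_closed)
  have Ex: "\<chi> (E j) [?v, ?v] = (if turn j p then \<kappa> (del_at j p) else \<zero>) \<oplus>
      ((if 1 = j then \<ominus> \<kappa> ?tl else \<zero>) \<oplus> (if N - 2 = j then \<ominus> \<kappa> ?bl else \<zero>))" if j: "j \<in> ?I" for j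
  proof -
    have "N - 2 \<noteq> 1" using N5 by simp
    then show ?thesis
      unfolding E_def using m1 m2 keta_props del[OF j] \<kappa>_closed
      by (subst \<chi>_minus) (auto simp: z B.cocycles_closed a_minus_def)
  qed
  have TE: "T ?f j = T f j \<oplus>\<^bsub>B\<^esub> E j" if j: "j \<in> ?I" for j
  proof -
    note c = chain_parts[OF pc l(1) j]
    have fd: "f (take (Suc j) p) \<in> carrier B" "f (drop j p) \<in> carrier B" using c fc by auto
    have len: "length (take (Suc j) p) = Suc j" "length (drop j p) = N - j" using l(1) j by auto
    have d1: "(if turn j p then ?f (del_at j p) else \<zero>\<^bsub>B\<^esub>) =
        (if turn j p then f (del_at j p) else \<zero>\<^bsub>B\<^esub>) \<oplus>\<^bsub>B\<^esub> (if turn j p then keta \<kappa> (del_at j p) else \<zero>\<^bsub>B\<^esub>)"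
      using del[OF j] by (simp add: perturb_def)
    have d2: "?f (take (Suc j) p) \<otimes>\<^bsub>B\<^esub> ?f (drop j p) = f (take (Suc j) p) \<otimes>\<^bsub>B\<^esub> f (drop j p) \<oplus>\<^bsub>B\<^esub>
       (if j = 1 then eta ?v a \<otimes>\<^bsub>B\<^esub> keta \<kappa> ?tl else if j = N - 2 then keta \<kappa> ?bl \<otimes>\<^bsub>B\<^esub> eta b ?v else \<zero>\<^bsub>B\<^esub>)"
    proof -
      consider "j = 1" | "j = N - 2" "j \<noteq> 1" | "j \<noteq> 1" "j \<noteq> N - 2" by blast
      then show ?thesis
      proof cases
        case 1
        then have t: "take (Suc j) p = [?v, a]" "drop j p = ?tl" using tlp by simp_all
        have n: "N - 1 \<noteq> 2" using N5 by simp
        have "?f [?v, a] = eta ?v a" using n eta1 by (simp add: perturb_def)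
        moreover have "?f ?tl = f ?tl \<oplus>\<^bsub>B\<^esub> keta \<kappa> ?tl" using tlp by (simp add: perturb_def)
        ultimately show ?thesis
          using 1 t eta1 ec fd keta_carrier by (simp add: B.A.r_distr)
      next
        case 2
        then have t: "take (Suc j) p = ?bl" "drop j p = [b, ?v]" using blp by simp_all
        have n: "N - 1 \<noteq> 2" using N5 by simp
        have "?f [b, ?v] = eta b ?v" using n eta1 by (simp add: perturb_def)
        moreover have "?f ?bl = f ?bl \<oplus>\<^bsub>B\<^esub> keta \<kappa> ?bl" using blp by (simp add: perturb_def)
        ultimately show ?thesis
          using 2 t eta1 ec fd keta_carrier by (simp add: B.A.l_distr)
      next
        case 3
        then have "Suc j \<noteq> N - 1" "N - j \<noteq> N - 1" using j by auto
        then show ?thesis using 3 len fd by (simp add: perturb_def)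
      qed
    qed
    let ?e1 = "if turn j p then f (del_at j p) else \<zero>\<^bsub>B\<^esub>" and ?e2 = "if turn j p then keta \<kappa> (del_at j p) else \<zero>\<^bsub>B\<^esub>"
    let ?e3 = "f (take (Suc j) p) \<otimes>\<^bsub>B\<^esub> f (drop j p)"
    let ?e4 = "if j = 1 then eta ?v a \<otimes>\<^bsub>B\<^esub> keta \<kappa> ?tl else if j = N - 2 then keta \<kappa> ?bl \<otimes>\<^bsub>B\<^esub> eta b ?v else \<zero>\<^bsub>B\<^esub>"
    have e: "?e1 \<in> carrier B" "?e2 \<in> carrier B" "?e3 \<in> carrier B" "?e4 \<in> carrier B"
      using del[OF j] fc fd keta_carrier ec by auto
    have "(x \<oplus>\<^bsub>B\<^esub> y) \<ominus>\<^bsub>B\<^esub> (z \<oplus>\<^bsub>B\<^esub> w) = (x \<ominus>\<^bsub>B\<^esub> z) \<oplus>\<^bsub>B\<^esub> (y \<ominus>\<^bsub>B\<^esub> w)"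
      if "x \<in> carrier B" "y \<in> carrier B" "z \<in> carrier B" "w \<in> carrier B" for x y z w
      using that by (simp add: a_minus_def B.A.minus_add B.A.a_ac)
    from this[OF e] show ?thesis unfolding T_def E_def d1 d2 .
  qed
  have Tc: "T f j \<in> carrier B" if "j \<in> ?I" for j
    unfolding T_def using del[OF that] fc chain_parts[OF pc l(1) that] by auto
  have "Ob ?f p = (\<Oplus>\<^bsub>B\<^esub> j\<in>?I. T ?f j)"
    unfolding T_def using Ob_arrows[OF n2 perturb_typed l(2,3,1) l3] del by blast
  also have "\<dots> = (\<Oplus>\<^bsub>B\<^esub> j\<in>?I. T f j \<oplus>\<^bsub>B\<^esub> E j)"
    using TE Tc Ec B.cocyclesD(1) by (intro B.A.finsum_cong') auto
  also have "\<dots> = (\<Oplus>\<^bsub>B\<^esub> j\<in>?I. T f j) \<oplus>\<^bsub>B\<^esub> (\<Oplus>\<^bsub>B\<^esub> j\<in>?I. E j)"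
    using Tc Ec B.cocyclesD(1) by (intro B.A.finsum_addf) auto
  also have "(\<Oplus>\<^bsub>B\<^esub> j\<in>?I. T f j) = Ob f p"
    unfolding T_def using Ob_arrows[OF n2 f l(2,3,1) l3] del by simp
  finally have O: "Ob ?f p = Ob f p \<oplus>\<^bsub>B\<^esub> (\<Oplus>\<^bsub>B\<^esub> j\<in>?I. E j)" .
  have fin: "finite ?I" by simp
  note cE = \<chi>_finsum[OF fin Ec, where w = "[?v, ?v]"]
  have kd: "(\<lambda>j. if turn j p then \<kappa> (del_at j p) else \<zero>) \<in> ?I \<rightarrow> carrier K" using \<kappa>_closed by auto
  have k1: "(\<lambda>j. if 1 = j then \<ominus> \<kappa> ?tl else \<zero>) \<in> ?I \<rightarrow> carrier K" "(\<lambda>j. if N - 2 = j then \<ominus> \<kappa> ?bl else \<zero>) \<in> ?I \<rightarrow> carrier K"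
    using \<kappa>_closed by auto
  have in1: "1 \<in> ?I" "N - 2 \<in> ?I" using N5 by auto
  have "(\<Oplus>j\<in>?I. \<chi> (E j) [?v, ?v]) = (\<Oplus>j\<in>?I. (if turn j p then \<kappa> (del_at j p) else \<zero>) \<oplus>
      ((if 1 = j then \<ominus> \<kappa> ?tl else \<zero>) \<oplus> (if N - 2 = j then \<ominus> \<kappa> ?bl else \<zero>)))"
    using Ex \<kappa>_closed by (intro finsum_cong') auto
  also have "\<dots> = (\<Oplus>j\<in>?I. if turn j p then \<kappa> (del_at j p) else \<zero>) \<oplus>
      ((\<Oplus>j\<in>?I. if 1 = j then \<ominus> \<kappa> ?tl else \<zero>) \<oplus> (\<Oplus>j\<in>?I. if N - 2 = j then \<ominus> \<kappa> ?bl else \<zero>))"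
    using kd k1 \<kappa>_closed by (simp add: finsum_addf Pi_def)
  also have "\<dots> = (\<Oplus>j\<in>?I. if turn j p then \<kappa> (del_at j p) else \<zero>) \<oplus> (\<ominus> \<kappa> ?tl \<oplus> \<ominus> \<kappa> ?bl)"
    using add.finprod_singleton[OF in1(1) fin, of "\<lambda>_. \<ominus> \<kappa> ?tl"] add.finprod_singleton[OF in1(2) fin, of "\<lambda>_. \<ominus> \<kappa> ?bl"] \<kappa>_closed
    by simp
  also have "\<dots> = CP.dk \<kappa> p"
    unfolding CP.dk_def using \<kappa>_closed finsum_closed[OF kd] by (intro a_comm) auto
  finally show ?thesis unfolding O using \<chi>_add[OF oc, of "\<Oplus>\<^bsub>B\<^esub> j\<in>?I. E j" "[?v, ?v]"] cE by simp
qed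

end

end

section \<open>The inductive construction of the morphism\<close>

context formality
begin

text \<open>Exactness one length ahead is part of the invariant, because achieving it may change
  \<open>f\<close> at length \<open>q\<close>. Afterwards the values up to length \<open>q\<close>
  are final.\<close>

definition stage :: "nat \<Rightarrow> (nat list \<Rightarrow> 'b) \<Rightarrow> bool" where
  "stage q f \<longleftrightarrow> typed f \<and> (\<forall>i j. [i, j] \<in> basis m \<longrightarrow> f [i, j] = eta i j) \<and>
     (\<forall>b\<in>chains. length b \<le> q \<longrightarrow> solved f b) \<and>
     (\<forall>b\<in>chains. length b = Suc q \<longrightarrow> Ob f b \<in> coboundaries B)"

lemma chain2: "[i, j] \<in> chains \<longleftrightarrow> [i, j] \<in> basis m"
  by (auto simp: chains_def basis_def)

lemma bdeg2: "bdeg [i, j] = letter_degree n i j"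
  by (simp add: bdeg_def bw_def)

lemma \<chi>_zero: "\<chi> \<zero>\<^bsub>B\<^esub> w = \<zero>"
  using \<chi>_zero_iff[OF B.cocycles_closed(1)] B.coboundaries_closed(1) by blast

text \<open>The multiplicativity of the isomorphism enters here: the coordinates of the product are
  given by the structure constants of the zigzag algebra.\<close>

lemma eta_mult:
  assumes ij: "[i, j] \<in> basis m" and jk: "[j, k] \<in> basis m"
  shows "eta i j \<otimes>\<^bsub>B\<^esub> eta j k \<ominus>\<^bsub>B\<^esub> (if i = k \<and> adj i j then eta i i else \<zero>\<^bsub>B\<^esub>) \<in> coboundaries B"
proof -
  let ?z = "eta i j \<otimes>\<^bsub>B\<^esub> eta j k"
  let ?e = "if i = k \<and> adj i j then eta i i else \<zero>\<^bsub>B\<^esub>"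
  have r: "i \<in> {1..m}" "j \<in> {1..m}" "k \<in> {1..m}" using ij jk by (auto simp: basis_def)
  then have ii: "[i, i] \<in> basis m" by (auto simp: basis_def)
  have z: "?z \<in> cocycles B" using eta(1) ij jk B.cocycles_mult by blast
  have zh: "?z \<in> hm i k (letter_degree n i j + letter_degree n j k)"
    using hm_closed(4)[OF eta(2)[OF ij] eta(2)[OF jk]] .
  have e: "?e \<in> cocycles B" using eta(1)[OF ii] B.cocycles_closed by auto
  note m = \<chi>_mult[OF eta(1)[OF ij] eta(1)[OF jk]] and ex = eta(3)[OF ij] eta(3)[OF jk]
  have "\<chi> ?z w = \<chi> ?e w" for w
  proof (cases "w = [i, i] \<and> i = k")
    case True
    then show ?thesis
    proof (cases "adj i j")
      case True
      then show ?thesis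
        using \<chi>_adj_mult[OF eta(1)[OF ij] eta(1)[OF jk] True r(1), of \<one> \<one>] ex \<open>w = [i, i] \<and> i = k\<close> eta(3)[OF ii] by auto
    next
      case False
      then have "i = j" using ij by (auto simp: basis_def)
      then show ?thesis using m(3)[of i] r ex \<open>w = [i, i] \<and> i = k\<close> False by (auto simp: \<chi>_zero)
    qed
  next
    case False
    have "\<chi> ?e w = \<zero>" using False eta(3)[OF ii] by (auto simp: \<chi>_zero)
    moreover have "\<chi> ?z w = \<zero>"
    proof (rule ccontr)
      assume nz: "\<chi> ?z w \<noteq> \<zero>"
      have w: "w \<in> basis m" "hd w = i" "last w = k" using \<chi>_hm[OF r(1,3) z zh nz] by auto
      then consider "w = [i]" | "w = [i, k]" "i \<noteq> k" using False by (auto simp: basis_def dest: adj_neq)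
      then show False
      proof cases
        case 1
        then show False using nz m(1)[of i] ex by simp
      next
        case 2
        then show False using nz m(2)[OF 2(2)] ex by simp
      qed
    qed
    ultimately show ?thesis by simp
  qed
  then have "\<chi> (?z \<ominus>\<^bsub>B\<^esub> ?e) w = \<zero>" for w using \<chi>_minus[OF z e] e by (simp add: a_minus_def r_neg)
  then show ?thesis using \<chi>_zero_iff[OF B.cocycles_closed(4)[OF z e]] by blast
qed

text \<open>On single letters \<open>f\<close> is \<open>eta\<close>, which is closed. For two
  letters the obstruction is, up to sign, the difference treated in \<open>eta_mult\<close>.\<close>

lemma stage_initial: "\<exists>f. stage 2 f"
proof -
  define f where "f = (\<lambda>vs :: nat list. if length vs = 2 then eta (vs ! 0) (vs ! 1) else \<zero>\<^bsub>B\<^esub>)"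
  have two: "\<exists>i j. vs = [i, j]" if "length vs = 2" for vs :: "nat list"
    using that by (cases vs; cases "tl vs"; cases "tl (tl vs)") auto
  have t: "typed f"
    unfolding typed_def
  proof
    fix vs assume vs: "vs \<in> chains"
    show "f vs \<in> hm (hd vs) (last vs) (bdeg vs)"
    proof (cases "length vs = 2")
      case True
      then obtain i j where "vs = [i, j]" using two by blast
      then show ?thesis using vs eta(2)[of i j] chain2 by (simp add: f_def bdeg2)
    qed (simp add: f_def hm_closed)
  qed
  have z: "g f \<zero>\<^bsub>A\<^esub> = \<zero>\<^bsub>B\<^esub>" by (rule klinear_zero[OF g_klinear[OF t] module_A module_B])
  have fe: "f [i, j] = eta i j" for i j by (simp add: f_def)
  have s: "solved f b" if b: "b \<in> chains" "length b \<le> 2" for b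
  proof -
    have "length b = 2" using b by (simp add: chains_def)
    then obtain i j where ij: "b = [i, j]" using two by blast
    then have "diff B (eta i j) = \<zero>\<^bsub>B\<^esub>" using eta(1)[of i j] b chain2 B.cocyclesD(2) by simp
    then show ?thesis using z by (simp add: solved_def Ob_def ij fe bw_def)
  qed
  have o: "Ob f b \<in> coboundaries B" if b: "b \<in> chains" "length b = Suc 2" for b
  proof -
    obtain i j k where ijk: "b = [i, j, k]" using b(2) by (cases b; cases "tl b"; cases "tl (tl b)") auto
    have ij: "[i, j] \<in> basis m" "[j, k] \<in> basis m" using b by (auto simp: ijk chains_def basis_def)
    let ?w = "[nd i True, nd j True, nd k True]" and ?u = "[nd i True, nd k True]"
    let ?t = "i = k \<and> adj i j"
    let ?s = "sg (nd i True) (nd j False)"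
    have D: "D (bw b) = frag_cmul ?s (frag_of ?w - (if ?t then frag_of ?u else 0))"
      by (auto simp: ijk bw_def tn_def)
    have c: "[j, k] \<in> chains" "[i, j] \<in> chains" using ij chain2 by auto
    have ld: "last [i, j] = ver (hd (bw [j, k]))" by (simp add: bw_def)
    have w: "?w \<in> wordsQ" "G f ?w = eta i j \<otimes>\<^bsub>B\<^esub> eta j k"
      using block_join(2)[OF c(2) bw_props(1)[OF c(1)] ld] G_block[OF c(2) bw_props(1)[OF c(1)] ld, of f]
        G_bw[OF t c(1)] by (simp_all add: bw_def fe)
    have u: "?u \<in> wordsQ \<and> G f ?u = eta i i" if ?t
    proof -
      have c: "[i, i] \<in> chains" using ij by (auto simp: chains_def basis_def)
      have "?u = bw [i, i]" using that by (simp add: bw_def)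
      then show ?thesis using bw_props(1)[OF c] G_bw[OF t c] fe by simp
    qed
    have k: "fkeys (frag_of ?w - (if ?t then frag_of ?u else 0)) \<subseteq> wordsQ"
      using w(1) u by (intro fkeys_intros) auto
    have "g f (ev (frag_of ?w - (if ?t then frag_of ?u else 0))) = g f (ev (frag_of ?w)) \<ominus>\<^bsub>B\<^esub> g f (ev (if ?t then frag_of ?u else 0))"
      using w(1) u by (subst ev_diff) (auto intro!: klinear_minus[OF g_klinear[OF t] module_A module_B])
    also have "\<dots> = eta i j \<otimes>\<^bsub>B\<^esub> eta j k \<ominus>\<^bsub>B\<^esub> (if ?t then eta i i else \<zero>\<^bsub>B\<^esub>)"
    proof -
      have "g f (ev (if ?t then frag_of ?u else 0)) = (if ?t then eta i i else \<zero>\<^bsub>B\<^esub>)"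
      proof (cases ?t)
        case True
        have uu: "?u \<in> wordsQ" "G f ?u = eta i i" using u[OF True] by auto
        show ?thesis unfolding if_P[OF True] ev_of using g_single[OF t uu(1)] uu(2) by simp
      next
        case False
        then show ?thesis using z by (simp only: if_False ev_zero)
      qed
      moreover have "g f (ev (frag_of ?w)) = eta i j \<otimes>\<^bsub>B\<^esub> eta j k" using w g_single[OF t w(1)] by simp
      ultimately show ?thesis by simp
    qed
    finally have e: "g f (ev (frag_of ?w - (if ?t then frag_of ?u else 0))) \<in> coboundaries B"
      using eta_mult[OF ij] by simp
    from sg_cases[of "nd i True" "nd j False"] show ?thesis
    proof
      assume "?s = 1"
      then have "Ob f b = g f (ev (frag_of ?w - (if ?t then frag_of ?u else 0)))"
        unfolding Ob_def D by (simp only: frag_cmul_one)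
      then show ?thesis using e by simp
    next
      assume "?s = -1"
      then have "Ob f b = \<ominus>\<^bsub>B\<^esub> g f (ev (frag_of ?w - (if ?t then frag_of ?u else 0)))"
        unfolding Ob_def D using klinear_uminus[OF g_klinear[OF t] module_A module_B ev_in[OF k]]
        by (simp only: frag_cmul_minus_one ev_uminus[OF k])
      then show ?thesis using e B.coboundaries_closed(3) by simp
    qed
  qed
  show ?thesis unfolding stage_def using t fe s o by blast
qed

text \<open>By \<open>obstruction_degree\<close> a single coordinate is left to inspect, and only on
  closed paths of arrows with \<open>n = 2\<close>.\<close>

lemma exceptional_vanish:
  assumes n: "n \<ge> 2" and f: "typed f" and b: "b \<in> chains" "length b \<ge> 4" and c: "Ob f b \<in> cocycles B"
    and ex: "n = 2 \<Longrightarrow> successively adj b \<Longrightarrow> hd b = last b \<Longrightarrow> \<chi> (Ob f b) [hd b, hd b] = \<zero>"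
  shows "Ob f b \<in> coboundaries B"
proof (rule ccontr)
  assume "Ob f b \<notin> coboundaries B"
  then obtain w where nz: "\<chi> (Ob f b) w \<noteq> \<zero>" using \<chi>_zero_iff[OF c] by blast
  have bne: "b \<noteq> []" "set b \<subseteq> {1..m}" using b by (auto simp: chains_def)
  then have r: "hd b \<in> {1..m}" "last b \<in> {1..m}" by (meson hd_in_set last_in_set subsetD)+
  note h = \<chi>_hm[OF r c Ob_hm[OF f b(1)] nz]
  have "n = 2 \<and> successively adj b \<and> hd b = last b \<and> w = [hd b, hd b]"
    by (rule obstruction_degree[OF b n h])
  then show False using ex nz by auto
qed

text \<open>\<open>f1\<close> solves the equations at length \<open>q + 1\<close>. Adding cocycles
  there keeps them solved and, if need be, is used to make the obstructions at length
  \<open>q + 2\<close> exact.\<close>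

lemma stage_step:
  assumes n: "n \<ge> 2" and q: "q \<ge> 2" and f: "stage q f"
  shows "\<exists>f'. stage (Suc q) f' \<and> (\<forall>b. length b \<le> q \<longrightarrow> f' b = f b)"
proof -
  have tf: "typed f" and fe: "\<And>i j. [i, j] \<in> basis m \<Longrightarrow> f [i, j] = eta i j"
    and fs: "\<And>b. b \<in> chains \<Longrightarrow> length b \<le> q \<Longrightarrow> solved f b"
    and fo: "\<And>b. b \<in> chains \<Longrightarrow> length b = Suc q \<Longrightarrow> Ob f b \<in> coboundaries B"
    using f by (auto simp: stage_def)
  have ex: "\<exists>y \<in> hm (hd b) (last b) (bdeg b). diff B y = Ob f b" if "b \<in> chains" "length b = Suc q" for b
    using hm_exact[OF fo[OF that] Ob_hm[OF tf that(1)]] by simp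
  define f1 where "f1 = (\<lambda>b. if b \<in> chains \<and> length b = Suc q
     then (SOME y. y \<in> hm (hd b) (last b) (bdeg b) \<and> diff B y = Ob f b) else f b)"
  have f1: "f1 b \<in> hm (hd b) (last b) (bdeg b) \<and> diff B (f1 b) = Ob f b" if "b \<in> chains" "length b = Suc q" for b
    using someI_ex[OF ex[OF that, unfolded Bex_def]] that by (simp add: f1_def)
  have f1f: "f1 b = f b" if "length b \<le> q" for b using that by (simp add: f1_def)
  have t1: "typed f1"
    using f1 tf by (auto simp: typed_def f1_def)
  have s1: "solved f1 b" if b: "b \<in> chains" "length b \<le> Suc q" for b
  proof -
    have "Ob f1 b = Ob f b" using b f1f by (intro Ob_cong[OF tf]) auto
    then show ?thesis using f1[OF b(1)] fs[OF b(1)] f1f[of b] b(2)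
      by (cases "length b = Suc q") (auto simp: solved_def)
  qed
  have e1: "f1 [i, j] = eta i j" if "[i, j] \<in> basis m" for i j
    using fe[OF that] f1f[of "[i, j]"] q by simp
  have c1: "Ob f1 b \<in> cocycles B" if "b \<in> chains" "length b = Suc (Suc q)" for b
    using that s1 by (intro Ob_cocycle[OF t1]) auto
  show ?thesis
  \<comment> \<open>For \<open>q = 2\<close> the paths in question have three arrows and cannot
    close up, since adjacent vertices differ in parity. So a correction occurs only with
    \<open>N \<ge> 5\<close>, where \<open>perturb_Ob\<close> applies.\<close>
  proof (cases "n = 2 \<and> q \<ge> 3")
    case True
    define N where "N = Suc (Suc q)"
    have N5: "N \<ge> 5" using True by (simp add: N_def)
    have n2: "n = 2" using True by simp
    interpret CP: closed_paths K m N by unfold_locales (use N5 in simp)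
    have cl: "p \<in> chains" "length p = N" if "p \<in> CP.closed" for p
      using that arrows_chain[of p] N5 unfolding CP.closed_def by auto
    have c1': "Ob f1 b \<in> cocycles B" if "b \<in> chains" "length b = N" for b
      using c1 that unfolding N_def by blast
    \<comment> \<open>The correction is to cancel the loop coordinates of the present obstructions;
      every function on closed paths is available for that.\<close>
    have "CP.achv (\<lambda>p. \<ominus> \<chi> (Ob f1 p) [hd p, hd p])"
      using c1' cl by (intro CP.all_achv) auto
    then obtain \<kappa> where \<kappa>: "CP.adm \<kappa>" "\<And>p. p \<in> CP.closed \<Longrightarrow> CP.dk \<kappa> p = \<ominus> \<chi> (Ob f1 p) [hd p, hd p]"
      unfolding CP.achv_def by blast
    define f2 where "f2 = perturb N \<kappa> f1"
    have t2: "typed f2" unfolding f2_def by (rule perturb_typed[OF N5 n2 \<kappa>(1) t1 e1])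
    have f21: "f2 b = f1 b" if "length b \<le> q" for b using that by (simp add: f2_def perturb_def N_def)
    have s2: "solved f2 b" if b: "b \<in> chains" "length b \<le> Suc q" for b
    proof -
      have "Ob f2 b = Ob f1 b" using b f21 by (intro Ob_cong[OF t1]) auto
      then show ?thesis
        using s1[OF b] perturb_diff[OF N5 n2 \<kappa>(1) t1 e1 b(1)] by (auto simp: solved_def f2_def)
    qed
    have c2: "Ob f2 b \<in> cocycles B" if "b \<in> chains" "length b = Suc (Suc q)" for b
      using that s2 by (intro Ob_cocycle[OF t2]) auto
    have o2: "Ob f2 b \<in> coboundaries B" if b: "b \<in> chains" "length b = Suc (Suc q)" for b
    proof (rule exceptional_vanish[OF n t2 b(1) _ c2[OF b]])
      show "length b \<ge> 4" using b q by simp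
      assume a: "successively adj b" "hd b = last b"
      moreover have "length b = N" using b by (simp add: N_def)
      ultimately have bc: "b \<in> CP.closed" using b(1) unfolding CP.closed_def chains_def by blast
      have "\<chi> (Ob f2 b) [hd b, hd b] = \<chi> (Ob f1 b) [hd b, hd b] \<oplus> CP.dk \<kappa> b"
        unfolding f2_def using perturb_Ob[OF N5 n2 \<kappa>(1) t1 e1 bc c1[OF b]] c2[OF b] by (simp add: f2_def)
      also have "\<dots> = \<zero>" using \<kappa>(2)[OF bc] c1[OF b] by (simp add: r_neg)
      finally show "\<chi> (Ob f2 b) [hd b, hd b] = \<zero>" .
    qed
    have "f2 [i, j] = eta i j" if "[i, j] \<in> basis m" for i j
      using e1[OF that] f21[of "[i, j]"] q by simp
    then have "stage (Suc q) f2"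
      unfolding stage_def using t2 s2 o2 by blast
    then show ?thesis using f21 f1f by (intro exI[of _ f2]) auto
  next
    case False
    have o1: "Ob f1 b \<in> coboundaries B" if b: "b \<in> chains" "length b = Suc (Suc q)" for b
    proof (rule exceptional_vanish[OF n t1 b(1) _ c1[OF b]])
      show "length b \<ge> 4" using b q by simp
      assume a: "n = 2" "successively adj b" "hd b = last b"
      then have q2: "q = 2" using False q by simp
      have s: "successively (\<lambda>i j. i = j \<or> adj i j) b" "b \<noteq> []" using b by (auto simp: chains_def)
      have "even (plen b)" using ldsum_plen[OF s(2,1), of n] a(3) by simp
      then show "\<chi> (Ob f1 b) [hd b, hd b] = \<zero>" using arrows_plen[OF a(2)] b(2) q2 by simp
    qed
    have "stage (Suc q) f1"
      unfolding stage_def using t1 e1 s1 o1 by blast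
    then show ?thesis using f1f by blast
  qed
qed

text \<open>Along a sequence of successive stages the value on each chain becomes constant, so the
  limit solves all equations.\<close>

lemma solution_exists:
  assumes n: "n \<ge> 2"
  shows "\<exists>f. typed f \<and> (\<forall>i j. [i, j] \<in> basis m \<longrightarrow> f [i, j] = eta i j) \<and> (\<forall>b\<in>chains. solved f b)"
proof -
  have "\<exists>F. \<forall>k. stage (k + 2) (F k) \<and> (\<forall>b. length b \<le> k + 2 \<longrightarrow> F (Suc k) b = F k b)"
  proof (rule dependent_nat_choice[where P = "\<lambda>k. stage (k + 2)" and Q = "\<lambda>k x y. \<forall>b. length b \<le> k + 2 \<longrightarrow> y b = x b"])
    show "\<exists>x. stage (0 + 2) x" unfolding add_0 by (rule stage_initial)
    show "\<exists>y. stage (Suc k + 2) y \<and> (\<forall>b. length b \<le> k + 2 \<longrightarrow> y b = x b)" if "stage (k + 2) x" for x k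
      using stage_step[OF n _ that] by simp
  qed
  then obtain F where F: "\<And>k. stage (k + 2) (F k)" "\<And>k b. length b \<le> k + 2 \<Longrightarrow> F (Suc k) b = F k b" by blast
  \<comment> \<open>The values of \<open>F k\<close> are final up to length \<open>k + 2\<close>, so
    the index \<open>length b\<close> is large enough.\<close>
  define f where "f = (\<lambda>b. F (length b) b)"
  have Fd: "F (k + i) b = F k b" if "length b \<le> k + 2" for k i b
  proof (induction i)
    case (Suc i)
    then show ?case using F(2)[of b "k + i"] that by simp
  qed simp
  have fF: "f b = F k b" if "length b \<le> k" for b k
    using Fd[of b "length b" "k - length b"] that by (simp add: f_def)
  have tF: "typed (F k)" for k using F(1) by (simp add: stage_def)
  have t: "typed f" unfolding typed_def f_def using tF by (auto simp: typed_def)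
  have "solved f b" if b: "b \<in> chains" for b
  proof -
    have "Ob f b = Ob (F (length b)) b" using fF by (intro Ob_cong[OF tF b]) auto
    moreover have "solved (F (length b)) b" using F(1)[of "length b"] b by (auto simp: stage_def)
    ultimately show ?thesis by (simp add: solved_def f_def)
  qed
  moreover have "f [i, j] = eta i j" if "[i, j] \<in> basis m" for i j
    using F(1)[of "length [i, j]"] that unfolding stage_def f_def by blast
  ultimately show ?thesis using t by blast
qed

section \<open>Comparison of \<open>Q\<close> with \<open>B\<close> on cohomology\<close>

lemma short_words:
  "w \<in> wordsQ \<and> length w \<le> 2 \<longleftrightarrow> w \<in> map (\<lambda>i. nd i True) ` basis m"
proof
  assume w: "w \<in> wordsQ \<and> length w \<le> 2"
  then consider x where "w = [x]" | x y where "w = [x, y]"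
    by (cases w; cases "tl w") (auto simp: wordsQ_def val_def)
  then show "w \<in> map (\<lambda>i. nd i True) ` basis m"
  proof cases
    case 1
    then have "w = map (\<lambda>i. nd i True) [ver x]" "[ver x] \<in> basis m"
      using w by (auto simp: wordsQ_def val_def letter_def basis_def)
    then show ?thesis by blast
  next
    case 2
    then have "w = map (\<lambda>i. nd i True) [ver x, ver y]" "[ver x, ver y] \<in> basis m"
      using w by (auto simp: wordsQ_def val_def letter_def basis_def link_def)
    then show ?thesis by blast
  qed
next
  assume "w \<in> map (\<lambda>i. nd i True) ` basis m"
  then show "w \<in> wordsQ \<and> length w \<le> 2"
    by (auto simp: basis_def wordsQ_def val_def letter_def link_def)
qed

lemma map_nd_inj: "map (\<lambda>i. nd i True) u = map (\<lambda>i. nd i True) u' \<longleftrightarrow> u = u'"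
proof
  assume "map (\<lambda>i. nd i True) u = map (\<lambda>i. nd i True) u'"
  then have "map ver (map (\<lambda>i. nd i True) u) = map ver (map (\<lambda>i. nd i True) u')" by simp
  then show "u = u'" by (simp add: comp_def)
qed simp

lemma G_short:
  assumes f: "typed f" and fe: "\<And>i j. [i, j] \<in> basis m \<Longrightarrow> f [i, j] = eta i j" and u: "u \<in> basis m"
  shows "G f (map (\<lambda>i. nd i True) u) \<in> cocycles B \<and> \<chi> (G f (map (\<lambda>i. nd i True) u)) w = (if w = u then \<one> else \<zero>)"
proof -
  consider i where "u = [i]" "i \<in> {1..m}" | i j where "u = [i, j]" using u by (auto simp: basis_def)
  then show ?thesis
  proof cases
    case 1
    then show ?thesis using idem_cocycle \<chi>_idem by (simp add: G_unit)
  next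
    case 2
    then have c: "[i, j] \<in> chains" using u chain2 by simp
    have "map (\<lambda>i. nd i True) u = bw [i, j]" using 2 by (simp add: bw_def)
    then show ?thesis using G_bw[OF f c] fe[of i j] u 2 eta[of i j] by simp
  qed
qed

text \<open>On words with at most one letter, \<open>g f\<close> takes values whose coordinates are
  those of a single basis element, so it reproduces coefficients as coordinates.\<close>

lemma \<chi>_g_short:
  assumes f: "typed f" and fe: "\<And>i j. [i, j] \<in> basis m \<Longrightarrow> f [i, j] = eta i j"
    and y: "y \<in> carrier A" "\<And>w. y w \<noteq> \<zero> \<Longrightarrow> length w \<le> 2"
  shows "g f y \<in> cocycles B" "u \<in> basis m \<Longrightarrow> \<chi> (g f y) u = y (map (\<lambda>i. nd i True) u)"
proof -
  let ?S = "{w. y w \<noteq> \<zero>}" and ?nd = "map (\<lambda>i. nd i True)"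
  have fin: "finite ?S" using carrier_supp[OF y(1)] .
  have S: "\<exists>u\<in>basis m. w = ?nd u" if "w \<in> ?S" for w
    using that y(2)[of w] carrier_out[OF y(1), of w] short_words[of w] by blast
  have c: "y w \<odot>\<^bsub>B\<^esub> G f w \<in> cocycles B \<and> (u \<in> basis m \<longrightarrow> \<chi> (y w \<odot>\<^bsub>B\<^esub> G f w) u = (if ?nd u = w then y w else \<zero>))"
    if w: "w \<in> ?S" for w
  proof -
    obtain u' where u': "u' \<in> basis m" "w = ?nd u'" using S[OF w] by blast
    have G1: "G f w \<in> cocycles B" "\<chi> (G f w) u = (if u = u' then \<one> else \<zero>)"
      using G_short[OF f fe u'(1)] u'(2) by auto
    show ?thesis
      using G1 y(1) u'(2) map_nd_inj[of u u'] by (auto simp: B.cocycles_closed \<chi>_smult)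
  qed
  have fs: "(\<Oplus>\<^bsub>B\<^esub> w\<in>?S. y w \<odot>\<^bsub>B\<^esub> G f w) \<in> cocycles B \<and>
      \<chi> (\<Oplus>\<^bsub>B\<^esub> w\<in>?S. y w \<odot>\<^bsub>B\<^esub> G f w) u = (\<Oplus>w\<in>?S. \<chi> (y w \<odot>\<^bsub>B\<^esub> G f w) u)"
    using c by (intro \<chi>_finsum[OF fin]) auto
  show "g f y \<in> cocycles B" using fs by (simp add: lin_def)
  assume u: "u \<in> basis m"
  have "\<chi> (g f y) u = (\<Oplus>w\<in>?S. \<chi> (y w \<odot>\<^bsub>B\<^esub> G f w) u)" using fs by (simp add: lin_def)
  also have "\<dots> = (\<Oplus>w\<in>?S. if ?nd u = w then y w else \<zero>)"
    using c u y(1) by (intro finsum_cong') auto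
  also have "\<dots> = y (?nd u)"
  proof (cases "?nd u \<in> ?S")
    case True
    then show ?thesis using add.finprod_singleton[OF True fin, of y] y(1) by auto
  next
    case False
    then have "(\<Oplus>w\<in>?S. if ?nd u = w then y w else \<zero>) = \<zero>" by (intro add.finprod_one_eqI) auto
    then show ?thesis using False by simp
  qed
  finally show "\<chi> (g f y) u = y (?nd u)" .
qed

lemma g_hom:
  assumes f: "typed f" and s: "\<And>b. b \<in> chains \<Longrightarrow> solved f b"
  shows "g f \<in> dga_hom K m Q B"
proof -
  note k = g_klinear[OF f]
  have io: "g f (iota A r) = iota B r" if r: "r \<in> carrier (power_algebra K m)" for r
  proof -
    let ?S = "(\<lambda>i. [nd i True]) ` {1..m}"
    have rK: "r i \<in> carrier K" if "i \<in> {1..m}" for i using r that by (auto simp: power_algebra_def)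
    have val: "iota A r [nd i True] = r i" if "i \<in> {1..m}" for i
      using that by (auto simp: word_algebra_simps(8))
    have sup: "{w. iota A r w \<noteq> \<zero>} \<subseteq> ?S" "?S \<subseteq> wordsQ"
      using W_unit by (auto simp: word_algebra_simps(8) split: if_splits)
    have inj: "inj_on (\<lambda>i. [nd i True]) {1..m}" by (intro inj_onI) (metis list.sel(1) ver_nd)
    have "g f (iota A r) = (\<Oplus>\<^bsub>B\<^esub> w\<in>?S. iota A r w \<odot>\<^bsub>B\<^esub> G f w)"
      by (rule lin_superset[OF module_B _ iota_in[OF r] _ sup]) (auto intro: G_carrier[OF f])
    also have "\<dots> = (\<Oplus>\<^bsub>B\<^esub> i\<in>{1..m}. iota A r [nd i True] \<odot>\<^bsub>B\<^esub> G f [nd i True])"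
      using inj rK val by (intro B.A.finsum_reindex) (auto simp: G_unit)
    also have "\<dots> = (\<Oplus>\<^bsub>B\<^esub> i\<in>{1..m}. r i \<odot>\<^bsub>B\<^esub> B.idem i)"
      using rK val by (intro B.A.finsum_cong') (auto simp: G_unit)
    finally show ?thesis using B.iota_expand[OF r] by simp
  qed
  have one: "g f \<one>\<^bsub>A\<^esub> = \<one>\<^bsub>B\<^esub>"
    unfolding one_iota using io[OF power_algebra_one] B.iota_props(5)[OF power_algebra_one] by simp
  have gr: "g f x \<in> grade B t" if x: "x \<in> grade A t" for x t
    unfolding lin_def
  proof (rule B.grade_finsum)
    fix w assume w: "w \<in> {w. x w \<noteq> \<zero>}"
    have xc: "x \<in> carrier A" using x by auto
    have "w \<in> wordsQ" "wdeg w = t"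
      using w x carrier_out[OF xc] unfolding word_algebra_simps(7) by auto
    then show "x w \<odot>\<^bsub>B\<^esub> G f w \<in> grade B t"
      using G_typed[OF f, of w] hm_grade xc by (intro B.grade_closed(3)) auto
  qed
  have df: "g f (d x) = diff B (g f x)" if x: "x \<in> carrier A" for x
  proof (rule klinear_ext[OF klinear_comp[OF d_klinear k] klinear_comp[OF k B.diff_klinear] module_B _ x])
    fix w assume w: "w \<in> wordsQ"
    show "g f (d (single K w)) = diff B (g f (single K w))"
      using G_diff[OF f w] s blocks_chains[OF w] by (simp add: d_single w g_single f)
  qed
  show ?thesis
    unfolding dga_hom_def galg_hom_def alg_hom_def ring_hom_def
    using klinearD[OF k] g_mult[OF f] one gr df io by auto
qed

text \<open>By \<open>cocycle_short\<close> each class of \<open>Q\<close> has a representative on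
  the basis words of \<open>A\<close>, where \<open>g f\<close> is the identity in
  coordinates.\<close>

lemma quasi_iso_exists:
  assumes n: "n \<ge> 2" shows "quasi_isos K m Q B \<noteq> {}"
proof -
  obtain f where f: "typed f" "\<And>i j. [i, j] \<in> basis m \<Longrightarrow> f [i, j] = eta i j" "\<And>b. b \<in> chains \<Longrightarrow> solved f b"
    using solution_exists[OF n] by blast
  interpret Qd: diff_graded_algebra K m Q by (rule Q_dga)
  interpret M: dga_morphism K m Q B "g f"
    by unfold_locales (rule g_hom[OF f(1,3)])
  have "g f \<in> quasi_isos K m Q B"
  proof (rule M.quasi_iso_criterion)
    fix z assume z: "z \<in> cocycles Q" and gz: "g f z \<in> coboundaries B"
    obtain z' where z': "z' \<in> cocycles Q" "\<forall>w. z' w \<noteq> \<zero> \<longrightarrow> length w \<le> 2" "z \<ominus>\<^bsub>Q\<^esub> z' \<in> coboundaries Q"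
      using cocycle_short[OF z] by blast
    have zc: "z \<in> carrier Q" "z' \<in> carrier Q" using Qd.cocyclesD(1)[OF z] Qd.cocyclesD(1)[OF z'(1)] by auto
    have "g f z \<ominus>\<^bsub>B\<^esub> g f z' \<in> coboundaries B"
      using M.f_coboundary[OF z'(3)] M.f_minus[OF zc] by simp
    moreover have "g f z' = g f z \<ominus>\<^bsub>B\<^esub> (g f z \<ominus>\<^bsub>B\<^esub> g f z')"
      using B.A.minus_minus_cancel[OF M.f_props(1)[OF zc(1)] M.f_props(1)[OF zc(2)]] by simp
    ultimately have gz': "g f z' \<in> coboundaries B" using gz B.coboundaries_closed(4) by metis
    have zA: "z' \<in> carrier A" using zc by simp
    note short = \<chi>_g_short[OF f(1,2) zA]
    have "z' w = \<zero>" for w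
    proof (rule ccontr)
      assume nz: "z' w \<noteq> \<zero>"
      then have "w \<in> wordsQ \<and> length w \<le> 2" using z'(2) carrier_out[OF zA] by blast
      then obtain u where u: "u \<in> basis m" "w = map (\<lambda>i. nd i True) u" using short_words by blast
      have "\<chi> (g f z') u = \<zero>" using gz' \<chi>_zero_iff B.coboundary_cocycle by blast
      then show False using short(2)[OF _ _ u(1)] z'(2) nz u(2) by auto
    qed
    then have "z' = \<zero>\<^bsub>Q\<^esub>" by (simp add: fun_eq_iff word_algebra_simps(4))
    then show "z \<in> coboundaries Q" using z'(3) zc by (simp add: a_minus_def Q_uminus)
  next
    fix z assume z: "z \<in> cocycles B"
    \<comment> \<open>The coordinates of \<open>z\<close> are read as coefficients on words with at
      most one letter. Such words are closed in \<open>Q\<close>, because they have no inner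
      vertex.\<close>
    define y where "y = (\<lambda>w. if w \<in> wordsQ \<and> length w \<le> 2 then \<chi> z (map ver w) else \<zero>)"
    have y: "y \<in> carrier A"
    proof (rule carrierI)
      show "y w \<in> carrier K" for w using z by (simp add: y_def)
      show "w \<in> wordsQ" if "y w \<noteq> \<zero>" for w using that by (auto simp: y_def split: if_splits)
      have "{w. y w \<noteq> \<zero>} \<subseteq> map (\<lambda>i. nd i True) ` basis m"
        using short_words by (auto simp: y_def split: if_splits)
      then show "finite {w. y w \<noteq> \<zero>}" using finite_basis by (meson finite_imageI finite_subset)
    qed
    have yl: "length w \<le> 2" if "y w \<noteq> \<zero>" for w using that by (auto simp: y_def split: if_splits)
    have "D w = 0" if "length w \<le> 2" for w using that by (cases w; cases "tl w"; cases "tl (tl w)") auto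
    then have "d y = \<zero>\<^bsub>A\<^esub>"
      unfolding lin_def using yl y by (intro WA.add.finprod_one_eqI) auto
    then have yc: "y \<in> cocycles Q" using y by (simp add: cocycles_def)
    note short = \<chi>_g_short[OF f(1,2) y yl]
    have "\<chi> (g f y) u = \<chi> z u" for u
    proof (cases "u \<in> basis m")
      case True
      then have "map (\<lambda>i. nd i True) u \<in> wordsQ \<and> length (map (\<lambda>i. nd i True) u) \<le> 2" using short_words by blast
      then show ?thesis using short(2)[OF _ _ True] True by (simp add: y_def comp_def)
    next
      case False
      then show ?thesis using \<chi>_out[OF z False] \<chi>_out[OF short(1) False] by simp
    qed
    then have "\<chi> (z \<ominus>\<^bsub>B\<^esub> g f y) u = \<zero>" for u
      using z short(1) by (simp add: \<chi>_minus) (simp add: a_minus_def r_neg)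
    then have "z \<ominus>\<^bsub>B\<^esub> g f y \<in> coboundaries B"
      using \<chi>_zero_iff[OF B.cocycles_closed(4)[OF z short(1)]] by blast
    then show "\<exists>y\<in>cocycles Q. z \<ominus>\<^bsub>B\<^esub> g f y \<in> coboundaries B" using yc by blast
  qed
  then show ?thesis by blast
qed

end

theorem lemma4p21:
  fixes K :: "('k, 'e) ring_scheme" and m n :: nat
  assumes "field K" and "m \<ge> 2" and "n \<ge> 2"
  shows "intrinsically_formal TYPE('b) TYPE('c) K m (A_alg K m n)"
proof -
  \<comment> \<open>A vertex and its mark are coded by \<open>2 * i\<close> or
    \<open>2 * i + 1\<close> in the summand \<open>nat\<close>, so that \<open>Q\<close> has exactly
    the carrier type that \<open>quasi_isomorphic\<close> allows for intermediate dgas.\<close>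
  define nd :: "nat \<Rightarrow> bool \<Rightarrow> 'b + 'c + nat" where "nd = (\<lambda>i s. Inr (Inr (2 * i + (if s then 1 else 0))))"
  define code :: "'b + 'c + nat \<Rightarrow> nat" where "code = (\<lambda>x. case x of Inr (Inr k) \<Rightarrow> k | _ \<Rightarrow> 0)"
  define ver where "ver = (\<lambda>x. code x div 2)"
  define sp where "sp = (\<lambda>x. odd (code x))"
  have letters: "letters nd ver sp"
    by (intro letters.intro) (auto simp: nd_def ver_def sp_def code_def)
  have zz: "zigzag K m" using assms by (simp add: zigzag_def zigzag_axioms_def)
  have bc: "bar_cobar K nd ver sp" using letters assms(1) by (simp add: bar_cobar_def)
  let ?Q = "bar_cobar.Q K nd ver sp m n"
  have dq: "diff_graded_algebra K m ?Q" by (rule bar_cobar.Q_dga[OF bc])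
  \<comment> \<open>Stated for an arbitrary carrier type, as it is applied to both \<open>B\<close>
    and \<open>C\<close>.\<close>
  have qis: "quasi_isos K m ?Q B \<noteq> {}"
    if B: "diff_graded_algebra K m B" and iso: "galg_iso K m (cohomology B) (A_alg K m n) \<noteq> {}"
    for B :: "('k, 'd) dga"
  proof -
    obtain \<theta> where "\<theta> \<in> galg_iso K m (cohomology B) (A_alg K m n)" using iso by blast
    then have "formality K m n B \<theta> nd ver sp"
      using zz bc B by (simp add: formality_def zigzag_cohomology_def zigzag_cohomology_axioms_def)
    then show ?thesis using assms(3) by (rule formality.quasi_iso_exists)
  qed
  show ?thesis
    unfolding intrinsically_formal_def quasi_isomorphic_def
  proof (intro allI impI)
    fix B :: "('k, 'b) dga" and C :: "('k, 'c) dga"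
    assume "diff_graded_algebra K m B" "diff_graded_algebra K m C"
      "galg_iso K m (cohomology B) (A_alg K m n) \<noteq> {}" "galg_iso K m (cohomology C) (A_alg K m n) \<noteq> {}"
    then have "qis_step K m B ?Q" "qis_step K m ?Q C"
      using qis dq by (auto simp: qis_step_def)
    \<comment> \<open>Both intermediate dgas are \<open>Q\<close>, with the empty chain between
      them.\<close>
    then show "\<exists>D E :: ('k, ('b + 'c + nat) list \<Rightarrow> 'k) dga.
        qis_step K m B D \<and> (qis_step K m)\<^sup>*\<^sup>* D E \<and> qis_step K m E C"
      by blast
  qed
qed

end
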